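(* Let $X$ be a (reduced, irreducible) smooth projective curve over an algebraically closed field $k$ of characteristic $p \ge 0$. Let $G_1$, $G_2$ and $G_3 \subset \mathrm{Aut}(X)$ be finite subgroups, and let $Q$ be a point of $X$. Then the four conditions (a) $X/G_i \cong \mathbb{P}^1$ for $i=1,2,3$; (b) $G_i \cap G_j=\{1\}$ for any $i, j \in \{1,2,3\}$ with $i \ne j$; (c') there exists a divisor $D$ on $X$ such that $D=\sum_{\sigma \in G_i}\sigma(Q)$ for $i=1,2,3$; and (d') $\dim \Lambda \le 2$, where $\Lambda$ is the smallest linear subsystem of the complete linear system $|D|$ such that $\Lambda_1 \cup \Lambda_2 \cup \Lambda_3 \subset \Lambda$, where $\Lambda_i$ is the base-point-free linear system induced by the covering map $X \rightarrow X/G_i \cong \mathbb{P}^1$ for $i=1,2,3$ are all satisfied if and only if there exist a birational embedding $\varphi: X \rightarrow \mathbb{P}^2$ of degree $|G_1|$ and three (distinct) collinear outer Galois points $P_1, P_2, P_3 \in \mathbb{P}^2$ for $\varphi(X)$ such that $G_{P_i}=G_i$ for $i=1,2,3$, and $\varphi(Q) \in \overline{P_1P_2}$, where $\overline{P_1P_2}$ is the line passing through $P_1$ and $P_2$.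
   Context: A birational embedding $\varphi: X \to \mathbb{P}^2$ means a morphism that is birational onto its image; its degree is the degree of the plane curve $\varphi(X)$. A point $P \in \mathbb{P}^2$ is called a Galois point for $\varphi(X)$ if the extension of function fields $k(\varphi(X))/\pi_P^*k(\mathbb{P}^1)$ induced by the projection $\pi_P: \varphi(X) \dashrightarrow \mathbb{P}^1$ from $P$ is a Galois extension. A Galois point $P$ is outer if $P \in \mathbb{P}^2\setminus \varphi(X)$. For a Galois point $P$, $G_P$ denotes the Galois group of this extension, regarded via $k(X)=k(\varphi(X))$ as a subgroup of $\mathrm{Aut}(X)$. Sums such as $\sum_{\sigma\in G}\sigma(Q)$ are divisors on $X$ (points counted with multiplicity), and equalities in (c') are equalities of divisors. A linear subsystem of $|D|$ is a projective linear subspace of $|D|$. The linear system $\Lambda_i$ consists of the pullbacks to $X$ of the points of $X/G_i\cong\mathbb{P}^1$. Condition (d') refers to the divisor $D$ of (c'); when (a) and (c') hold, $D\in\Lambda_i$ and hence $\Lambda_i\subset|D|$. *)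

theory Defs
  imports
    "HOL-Analysis.Abstract_Topology"
    "HOL-Analysis.Cartesian_Space"
    "HOL-Library.Poly_Mapping"
    "HOL-Library.Extended_Nat"
    "HOL-Computational_Algebra.Polynomial"
    "HOL-Algebra.Bij"
    "HOL-Algebra.QuotRing"
    "HOL-Algebra.Finite_Extensions"
begin

section \<open>Projective space and homogeneous polynomials\<close>

text \<open>
  \<open>('k, 'n) proj\<close> is projective space over \<open>'k\<close> with homogeneous coordinates indexed by
  \<open>'n\<close>, so its dimension is \<open>CARD('n) - 1\<close>.  In particular \<open>('k, 2) proj\<close> is the projective
  line and \<open>('k, 3) proj\<close> the projective plane.
\<close>

definition proportional :: "'k::field ^ 'n::finite \<Rightarrow> 'k ^ 'n \<Rightarrow> bool" where
  "proportional x y \<longleftrightarrow> x \<noteq> 0 \<and> (\<exists>c. c \<noteq> 0 \<and> y = c *s x)"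

lemma part_equivp_proportional: "part_equivp (proportional :: 'k::field ^ 'n::finite \<Rightarrow> _)"
proof (rule part_equivpI)
  have "proportional (vec 1 :: 'k ^ 'n) (vec 1)"
    unfolding proportional_def by (auto simp: vec_eq_iff intro!: exI[of _ 1])
  then show "\<exists>x::'k ^ 'n. proportional x x" ..
  show "symp (proportional :: 'k ^ 'n \<Rightarrow> _)"
  proof (rule sympI)
    fix x y :: "'k ^ 'n"
    assume "proportional x y"
    then obtain c where c: "x \<noteq> 0" "c \<noteq> 0" "y = c *s x"
      unfolding proportional_def by blast
    then have "x = inverse c *s y" and "y \<noteq> 0"
      by (auto simp: vec_eq_iff)
    with c(2) show "proportional y x"
      unfolding proportional_def by (metis nonzero_imp_inverse_nonzero)
  qed
  show "transp (proportional :: 'k ^ 'n \<Rightarrow> _)"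
    unfolding transp_def proportional_def
    by (metis mult_eq_0_iff vector_smult_assoc)
qed

quotient_type (overloaded) ('k, 'n) proj = "'k::field ^ 'n::finite" / partial: proportional
  by (rule part_equivp_proportional)

type_synonym ('k, 'n) mpoly = "('n \<Rightarrow>\<^sub>0 nat) \<Rightarrow>\<^sub>0 'k"

definition eval_mpoly :: "('k::field, 'n::finite) mpoly \<Rightarrow> 'k ^ 'n \<Rightarrow> 'k" where
  "eval_mpoly F x =
     (\<Sum>m\<in>Poly_Mapping.keys F. Poly_Mapping.lookup F m * (\<Prod>i\<in>UNIV. (x $ i) ^ Poly_Mapping.lookup m i))"

text \<open>The zero polynomial is homogeneous of every degree.\<close>

definition homogeneous :: "nat \<Rightarrow> ('k::field, 'n::finite) mpoly \<Rightarrow> bool" where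
  "homogeneous d F \<longleftrightarrow> (\<forall>m\<in>Poly_Mapping.keys F. (\<Sum>i\<in>UNIV. Poly_Mapping.lookup m i) = d)"

text \<open>
  The value of a form at a chosen representative of a point.  By the lemma below, its vanishing
  and the quotients of two such values for forms of equal degree do not depend on the
  representative; only these are used.
\<close>

definition peval :: "('k::field, 'n::finite) mpoly \<Rightarrow> ('k, 'n) proj \<Rightarrow> 'k" where
  "peval F P = eval_mpoly F (rep_proj P)"

lemma eval_mpoly_scale:
  assumes "homogeneous d F"
  shows "eval_mpoly F (c *s x) = c ^ d * eval_mpoly F x"
proof -
  have "(\<Prod>i\<in>UNIV. ((c *s x) $ i) ^ Poly_Mapping.lookup m i) =
      c ^ d * (\<Prod>i\<in>UNIV. (x $ i) ^ Poly_Mapping.lookup m i)" if "m \<in> Poly_Mapping.keys F" for m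
    using assms that
    by (auto simp: homogeneous_def power_mult_distrib prod.distrib power_sum)
  then show ?thesis
    by (simp add: eval_mpoly_def sum_distrib_left mult.left_commute)
qed

definition zero_locus :: "('k::field, 'n::finite) mpoly set \<Rightarrow> ('k, 'n) proj set" where
  "zero_locus T = {P. \<forall>F\<in>T. peval F P = 0}"

section \<open>Zariski topology\<close>

definition zariski_open :: "('k::field, 'n::finite) proj set \<Rightarrow> bool" where
  "zariski_open U \<longleftrightarrow> (\<exists>T. (\<forall>F\<in>T. \<exists>d. homogeneous d F) \<and> U = - zero_locus T)"

definition zariski :: "('k::field, 'n::finite) proj topology" where
  "zariski = topology zariski_open"

lemma eval_mpoly_superset:
  assumes "finite A" "Poly_Mapping.keys F \<subseteq> A"
  shows "eval_mpoly F x =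
     (\<Sum>m\<in>A. Poly_Mapping.lookup F m * (\<Prod>i\<in>UNIV. (x $ i) ^ Poly_Mapping.lookup m i))"
  unfolding eval_mpoly_def
  by (rule sum.mono_neutral_left) (use assms in \<open>auto simp: in_keys_iff\<close>)

lemma eval_mpoly_add: "eval_mpoly (F + G) x = eval_mpoly F x + eval_mpoly G x"
proof -
  let ?A = "Poly_Mapping.keys F \<union> Poly_Mapping.keys G"
  have "Poly_Mapping.keys (F + G) \<subseteq> ?A"
    by (rule Poly_Mapping.keys_add)
  then show ?thesis
    by (simp add: eval_mpoly_superset[of ?A] lookup_add distrib_right sum.distrib)
qed

lemma eval_mpoly_zero [simp]: "eval_mpoly 0 x = 0"
  by (simp add: eval_mpoly_def)

lemma eval_mpoly_sum: "eval_mpoly (\<Sum>a\<in>A. h a) x = (\<Sum>a\<in>A. eval_mpoly (h a) x)"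
  by (induction A rule: infinite_finite_induct) (simp_all add: eval_mpoly_add)

lemma eval_mpoly_single:
  "eval_mpoly (Poly_Mapping.single m a) x = a * (\<Prod>i\<in>UNIV. (x $ i) ^ Poly_Mapping.lookup m i)"
  by (simp add: eval_mpoly_def)

lemma mpoly_eq_sum_single:
  "(F :: ('k::field, 'n::finite) mpoly) =
     (\<Sum>m\<in>Poly_Mapping.keys F. Poly_Mapping.single m (Poly_Mapping.lookup F m))"
  by (rule poly_mapping_eqI) (auto simp: lookup_sum lookup_single when_def in_keys_iff)

lemma eval_mpoly_mult: "eval_mpoly (F * G) x = eval_mpoly F x * eval_mpoly G x"
proof -
  have "F * G = (\<Sum>m\<in>Poly_Mapping.keys F. \<Sum>n\<in>Poly_Mapping.keys G.
      Poly_Mapping.single (m + n) (Poly_Mapping.lookup F m * Poly_Mapping.lookup G n))"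
    by (subst mpoly_eq_sum_single[of F], subst mpoly_eq_sum_single[of G])
       (simp add: sum_product mult_single)
  then show ?thesis
    by (simp add: eval_mpoly_sum eval_mpoly_single eval_mpoly_def[of F] eval_mpoly_def[of G]
        sum_product lookup_add power_add prod.distrib mult_ac)
qed

lemma homogeneous_mult:
  assumes "homogeneous d F" "homogeneous e G"
  shows "homogeneous (d + e) (F * G)"
  unfolding homogeneous_def
proof
  fix m assume "m \<in> Poly_Mapping.keys (F * G)"
  then obtain a b where "m = a + b" "a \<in> Poly_Mapping.keys F" "b \<in> Poly_Mapping.keys G"
    using keys_mult by blast
  with assms show "(\<Sum>i\<in>UNIV. Poly_Mapping.lookup m i) = d + e"
    by (simp add: homogeneous_def lookup_add sum.distrib)
qed

lemma istopology_zariski_open: "istopology zariski_open"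
  unfolding istopology_def
proof (intro conjI allI impI)
  fix U V :: "('k::field, 'n::finite) proj set"
  assume "zariski_open U" "zariski_open V"
  then obtain S T where S: "\<forall>F\<in>S. \<exists>d. homogeneous d F" "U = - zero_locus S"
    and T: "\<forall>F\<in>T. \<exists>d. homogeneous d F" "V = - zero_locus T"
    unfolding zariski_open_def by blast
  let ?ST = "(\<lambda>(F, G). F * G) ` (S \<times> T)"
  have "\<forall>F\<in>?ST. \<exists>d. homogeneous d F"
    using S(1) T(1) by (fast intro: homogeneous_mult)
  moreover have "U \<inter> V = - zero_locus ?ST"
    unfolding S(2) T(2) by (auto simp: zero_locus_def peval_def eval_mpoly_mult)
  ultimately show "zariski_open (U \<inter> V)"
    unfolding zariski_open_def by blast
next
  fix \<U> :: "('k::field, 'n::finite) proj set set"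
  assume "\<forall>U\<in>\<U>. zariski_open U"
  then obtain T where T: "\<And>U. U \<in> \<U> \<Longrightarrow> (\<forall>F\<in>T U. \<exists>d. homogeneous d F) \<and> U = - zero_locus (T U)"
    unfolding zariski_open_def by metis
  have "\<Union>\<U> = - zero_locus (\<Union>U\<in>\<U>. T U)"
    using T by (fastforce simp: zero_locus_def)
  moreover have "\<forall>F\<in>(\<Union>U\<in>\<U>. T U). \<exists>d. homogeneous d F"
    using T by blast
  ultimately show "zariski_open (\<Union>\<U>)"
    unfolding zariski_open_def by blast
qed

lemma openin_zariski [simp]: "openin zariski = zariski_open"
  by (simp add: zariski_def istopology_zariski_open)

definition irreducible_space :: "'a topology \<Rightarrow> bool" where
  "irreducible_space T \<longleftrightarrow> topspace T \<noteq> {} \<and>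
     (\<forall>A B. closedin T A \<and> closedin T B \<and> A \<union> B = topspace T \<longrightarrow>
        A = topspace T \<or> B = topspace T)"

definition krull_dim :: "'a topology \<Rightarrow> enat" where
  "krull_dim T = Sup {enat n | n. \<exists>Z.
     (\<forall>i\<le>n. closedin T (Z i) \<and> irreducible_space (subtopology T (Z i))) \<and>
     (\<forall>i<n. Z i \<subset> Z (Suc i))}"

section \<open>Regular functions and rational functions\<close>

text \<open>
  \<open>regular_fun C f\<close>: the partial function \<open>f\<close> is a regular function on its domain, which is
  an open subset of \<open>C\<close>.
\<close>

definition regular_fun ::
  "('k::field, 'n::finite) proj set \<Rightarrow> (('k, 'n) proj \<rightharpoonup> 'k) \<Rightarrow> bool" where
  "regular_fun C f \<longleftrightarrow> openin (subtopology zariski C) (dom f) \<and>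
     (\<forall>P\<in>dom f. \<exists>U d F G. P \<in> U \<and> U \<subseteq> dom f \<and> openin (subtopology zariski C) U \<and>
        homogeneous d F \<and> homogeneous d G \<and>
        (\<forall>R\<in>U. peval G R \<noteq> 0 \<and> f R = Some (peval F R / peval G R)))"

text \<open>
  A rational function on an irreducible \<open>C\<close> is an equivalence class of regular functions on
  nonempty open subsets, two of them being equivalent if they agree on the intersection of
  their domains.  Every class has a unique representative with the largest domain; these
  representatives are the elements of the function field.
\<close>

definition rational_funs ::
  "('k::field, 'n::finite) proj set \<Rightarrow> (('k, 'n) proj \<rightharpoonup> 'k) set" where
  "rational_funs C = {f. regular_fun C f \<and> dom f \<noteq> {} \<and>
     (\<forall>g. regular_fun C g \<and> f \<subseteq>\<^sub>m g \<longrightarrow> g = f)}"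

definition rational_class ::
  "('k::field, 'n::finite) proj set \<Rightarrow> (('k, 'n) proj \<rightharpoonup> 'k) \<Rightarrow> (('k, 'n) proj \<rightharpoonup> 'k)" where
  "rational_class C f = (THE g. g \<in> rational_funs C \<and> f \<subseteq>\<^sub>m g)"

definition pointwise :: "('b \<Rightarrow> 'b \<Rightarrow> 'b) \<Rightarrow> ('a \<rightharpoonup> 'b) \<Rightarrow> ('a \<rightharpoonup> 'b) \<Rightarrow> ('a \<rightharpoonup> 'b)" where
  "pointwise h f g =
     (\<lambda>R. if R \<in> dom f \<inter> dom g then Some (h (the (f R)) (the (g R))) else None)"

definition const_fun :: "('k::field, 'n::finite) proj set \<Rightarrow> 'k \<Rightarrow> (('k, 'n) proj \<rightharpoonup> 'k)" where
  "const_fun C c = (\<lambda>R. if R \<in> C then Some c else None)"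

definition function_field ::
  "('k::field, 'n::finite) proj set \<Rightarrow> (('k, 'n) proj \<rightharpoonup> 'k) ring" where
  "function_field C =
     \<lparr>carrier = rational_funs C,
      mult = \<lambda>f g. rational_class C (pointwise (*) f g),
      one = const_fun C 1,
      zero = const_fun C 0,
      add = \<lambda>f g. rational_class C (pointwise (+) f g)\<rparr>"

definition constants ::
  "('k::field, 'n::finite) proj set \<Rightarrow> (('k, 'n) proj \<rightharpoonup> 'k) set" where
  "constants C = range (const_fun C)"

text \<open>
  Pullback of rational functions along a dominant rational map \<open>\<psi>\<close>, given as a partial function;
  a morphism \<open>\<phi>\<close> is passed as \<open>Some \<circ> \<phi>\<close>.
\<close>

definition pullback ::
  "('k::field, 'n::finite) proj set \<Rightarrow> (('k, 'n) proj \<rightharpoonup> ('k, 'm::finite) proj) \<Rightarrow>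
    (('k, 'm) proj \<rightharpoonup> 'k) \<Rightarrow> (('k, 'n) proj \<rightharpoonup> 'k)" where
  "pullback C \<psi> f = rational_class C (f \<circ>\<^sub>m (\<psi> |` C))"

section \<open>Local rings, smooth projective curves\<close>

definition local_ring ::
  "('k::field, 'n::finite) proj set \<Rightarrow> ('k, 'n) proj \<Rightarrow> (('k, 'n) proj \<rightharpoonup> 'k) set" where
  "local_ring C P = {f \<in> rational_funs C. P \<in> dom f}"

definition max_ideal ::
  "('k::field, 'n::finite) proj set \<Rightarrow> ('k, 'n) proj \<Rightarrow> (('k, 'n) proj \<rightharpoonup> 'k) set" where
  "max_ideal C P = {f \<in> local_ring C P. f P = Some 0}"

definition uniformizer ::
  "('k::field, 'n::finite) proj set \<Rightarrow> ('k, 'n) proj \<Rightarrow> (('k, 'n) proj \<rightharpoonup> 'k) \<Rightarrow> bool" where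
  "uniformizer C P t \<longleftrightarrow> t \<in> max_ideal C P \<and>
     max_ideal C P = {t \<otimes>\<^bsub>function_field C\<^esub> g | g. g \<in> local_ring C P}"

text \<open>
  Points are nonsingular if the local ring is regular, i.e. if its maximal ideal is generated
  by as many elements as the dimension of the ring, which is one for a curve.
\<close>

definition smooth_projective_curve :: "('k::field, 'n::finite) proj set \<Rightarrow> bool" where
  "smooth_projective_curve C \<longleftrightarrow>
     closedin zariski C \<and> irreducible_space (subtopology zariski C) \<and>
     krull_dim (subtopology zariski C) = 1 \<and>
     (\<forall>P\<in>C. \<exists>t. uniformizer C P t)"

section \<open>Morphisms and automorphisms\<close>

definition morphism ::
  "('k::field, 'n::finite) proj set \<Rightarrow> ('k, 'm::finite) proj set \<Rightarrow>
    (('k, 'n) proj \<Rightarrow> ('k, 'm) proj) \<Rightarrow> bool" where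
  "morphism C Y \<phi> \<longleftrightarrow> \<phi> ` C \<subseteq> Y \<and>
     (\<forall>P\<in>C. \<exists>U d F. P \<in> U \<and> openin (subtopology zariski C) U \<and> (\<forall>j. homogeneous d (F j)) \<and>
        (\<forall>R\<in>U. (\<exists>j. peval (F j) R \<noteq> 0) \<and> \<phi> R = abs_proj (\<chi> j. peval (F j) R)))"

definition automorphisms ::
  "('k::field, 'n::finite) proj set \<Rightarrow> (('k, 'n) proj \<Rightarrow> ('k, 'n) proj) set" where
  "automorphisms C = {\<sigma> \<in> Bij C. morphism C C \<sigma> \<and> morphism C C (restrict (inv_into C \<sigma>) C)}"

definition Aut ::
  "('k::field, 'n::finite) proj set \<Rightarrow> (('k, 'n) proj \<Rightarrow> ('k, 'n) proj) monoid" where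
  "Aut C = BijGroup C\<lparr>carrier := automorphisms C\<rparr>"

text \<open>
  A morphism that restricts to an isomorphism between nonempty open subsets of \<open>C\<close> and of its
  image.
\<close>

definition birational_embedding ::
  "('k::field, 'n::finite) proj set \<Rightarrow> (('k, 'n) proj \<Rightarrow> ('k, 'm::finite) proj) \<Rightarrow> bool" where
  "birational_embedding C \<phi> \<longleftrightarrow> morphism C UNIV \<phi> \<and>
     (\<exists>U V \<psi>. openin (subtopology zariski C) U \<and> U \<noteq> {} \<and>
        openin (subtopology zariski (\<phi> ` C)) V \<and> V \<noteq> {} \<and>
        morphism U V \<phi> \<and> morphism V U \<psi> \<and>
        (\<forall>P\<in>U. \<psi> (\<phi> P) = P) \<and> (\<forall>R\<in>V. \<phi> (\<psi> R) = R))"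

section \<open>Quotients by finite groups\<close>

text \<open>
  \<open>q\<close> exhibits \<open>Y\<close> as the quotient of \<open>C\<close> by \<open>G\<close> in the category of spaces with functions: its
  fibres are the orbits, and the regular functions on an open \<open>V \<subseteq> Y\<close> are exactly the functions
  whose composition with \<open>q\<close> is regular on the preimage of \<open>V\<close>.  Since the domain of a partial
  function is part of the data (consider constant functions), the last clause also says that
  \<open>Y\<close> carries the quotient topology.
\<close>

definition geometric_quotient ::
  "('k::field, 'n::finite) proj set \<Rightarrow> (('k, 'n) proj \<Rightarrow> ('k, 'n) proj) set \<Rightarrow>
    ('k, 'm::finite) proj set \<Rightarrow> (('k, 'n) proj \<Rightarrow> ('k, 'm) proj) \<Rightarrow> bool" where
  "geometric_quotient C G Y q \<longleftrightarrow> q ` C = Y \<and>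
     (\<forall>P\<in>C. \<forall>R\<in>C. q P = q R \<longleftrightarrow> (\<exists>\<sigma>\<in>G. R = \<sigma> P)) \<and>
     (\<forall>f. dom f \<subseteq> Y \<longrightarrow>
        (regular_fun Y f \<longleftrightarrow> regular_fun C (f \<circ>\<^sub>m ((Some \<circ> q) |` C))))"

text \<open>\<open>C / G\<close> is isomorphic to the projective line.\<close>

definition rational_quotient ::
  "('k::field, 'n::finite) proj set \<Rightarrow> (('k, 'n) proj \<Rightarrow> ('k, 'n) proj) set \<Rightarrow> bool" where
  "rational_quotient C G \<longleftrightarrow> (\<exists>q. geometric_quotient C G (UNIV :: ('k, 2) proj set) q)"

section \<open>Divisors and linear systems\<close>

type_synonym ('k, 'n) divisor = "('k, 'n) proj \<Rightarrow>\<^sub>0 int"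

definition is_divisor ::
  "('k::field, 'n::finite) proj set \<Rightarrow> ('k, 'n) divisor \<Rightarrow> bool" where
  "is_divisor C D \<longleftrightarrow> Poly_Mapping.keys D \<subseteq> C"

text \<open>The order of a nonzero rational function at a nonsingular point of a curve.\<close>

definition ord_at ::
  "('k::field, 'n::finite) proj set \<Rightarrow> ('k, 'n) proj \<Rightarrow> (('k, 'n) proj \<rightharpoonup> 'k) \<Rightarrow> int" where
  "ord_at C P f = (THE n. \<exists>t u. uniformizer C P t \<and> u \<in> local_ring C P \<and> u P \<noteq> Some 0 \<and>
     f = t [^]\<^bsub>function_field C\<^esub> n \<otimes>\<^bsub>function_field C\<^esub> u)"

text \<open>\<open>E\<close> is the divisor of the nonzero rational function \<open>f\<close>.\<close>

definition divisor_of ::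
  "('k::field, 'n::finite) proj set \<Rightarrow> (('k, 'n) proj \<rightharpoonup> 'k) \<Rightarrow> ('k, 'n) divisor \<Rightarrow> bool" where
  "divisor_of C f E \<longleftrightarrow> is_divisor C E \<and> (\<forall>P\<in>C. Poly_Mapping.lookup E P = ord_at C P f)"

definition riemann_roch_space ::
  "('k::field, 'n::finite) proj set \<Rightarrow> ('k, 'n) divisor \<Rightarrow> (('k, 'n) proj \<rightharpoonup> 'k) set" where
  "riemann_roch_space C D = {f \<in> rational_funs C. f = \<zero>\<^bsub>function_field C\<^esub> \<or>
     (\<forall>P\<in>C. 0 \<le> ord_at C P f + Poly_Mapping.lookup D P)}"

text \<open>
  The divisors \<open>D + div f\<close> for nonzero \<open>f \<in> V\<close>.  For \<open>V = riemann_roch_space C D\<close> this is the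
  complete linear system \<open>|D|\<close>, which is thereby identified with the projective space of
  lines of \<open>riemann_roch_space C D\<close>.
\<close>

definition linear_system ::
  "('k::field, 'n::finite) proj set \<Rightarrow> ('k, 'n) divisor \<Rightarrow> (('k, 'n) proj \<rightharpoonup> 'k) set \<Rightarrow>
    ('k, 'n) divisor set" where
  "linear_system C D V = {E. \<exists>f \<in> V - {\<zero>\<^bsub>function_field C\<^esub>}. divisor_of C f (E - D)}"

text \<open>The locale \<^locale>\<open>subalgebra\<close> describes linear subspaces over \<open>constants C\<close>.\<close>

definition linear_subsystem ::
  "('k::field, 'n::finite) proj set \<Rightarrow> ('k, 'n) divisor \<Rightarrow> ('k, 'n) divisor set \<Rightarrow> bool" where
  "linear_subsystem C D \<Lambda> \<longleftrightarrow> (\<exists>V. subalgebra (constants C) V (function_field C) \<and>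
     V \<subseteq> riemann_roch_space C D \<and> \<Lambda> = linear_system C D V)"

text \<open>\<open>\<Lambda>\<close> has dimension \<open>m\<close> as a projective space.\<close>

definition has_projective_dim ::
  "('k::field, 'n::finite) proj set \<Rightarrow> ('k, 'n) divisor \<Rightarrow> ('k, 'n) divisor set \<Rightarrow> nat \<Rightarrow> bool" where
  "has_projective_dim C D \<Lambda> m \<longleftrightarrow> (\<exists>V. subalgebra (constants C) V (function_field C) \<and>
     V \<subseteq> riemann_roch_space C D \<and> \<Lambda> = linear_system C D V \<and>
     ring.dimension (function_field C) (Suc m) (constants C) V)"

definition smallest_linear_subsystem ::
  "('k::field, 'n::finite) proj set \<Rightarrow> ('k, 'n) divisor \<Rightarrow> ('k, 'n) divisor set \<Rightarrow>
    ('k, 'n) divisor set \<Rightarrow> bool" where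
  "smallest_linear_subsystem C D S \<Lambda> \<longleftrightarrow> linear_subsystem C D \<Lambda> \<and> S \<subseteq> \<Lambda> \<and>
     (\<forall>\<Lambda>'. linear_subsystem C D \<Lambda>' \<and> S \<subseteq> \<Lambda>' \<longrightarrow> \<Lambda> \<subseteq> \<Lambda>')"

text \<open>
  \<open>E\<close> is the pullback of the point \<open>y\<close> of \<open>Y\<close> along \<open>q\<close>: the multiplicity at a point over \<open>y\<close> is the
  order there of the pullback of a local parameter at \<open>y\<close> (the ramification index).
\<close>

definition pullback_point ::
  "('k::field, 'n::finite) proj set \<Rightarrow> ('k, 'm::finite) proj set \<Rightarrow>
    (('k, 'n) proj \<Rightarrow> ('k, 'm) proj) \<Rightarrow> ('k, 'm) proj \<Rightarrow> ('k, 'n) divisor \<Rightarrow> bool" where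
  "pullback_point C Y q y E \<longleftrightarrow> is_divisor C E \<and>
     (\<exists>t. uniformizer Y y t \<and>
        (\<forall>P\<in>C. Poly_Mapping.lookup E P =
           (if q P = y then ord_at C P (pullback C (Some \<circ> q) t) else 0)))"

text \<open>
  The pullbacks of the points of \<open>C / G\<close>.  The quotient map to the projective line is unique up to
  automorphisms of the latter, so all choices of \<open>q\<close> give the same divisors.
\<close>

definition quotient_system ::
  "('k::field, 'n::finite) proj set \<Rightarrow> (('k, 'n) proj \<Rightarrow> ('k, 'n) proj) set \<Rightarrow>
    ('k, 'n) divisor set" where
  "quotient_system C G = {E. \<exists>q y. geometric_quotient C G (UNIV :: ('k, 2) proj set) q \<and>
     pullback_point C (UNIV :: ('k, 2) proj set) q y E}"

section \<open>Plane curves and Galois points\<close>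

text \<open>The degree of a plane curve is the degree of a generator of its homogeneous ideal.\<close>

definition has_degree :: "('k::field, 3) proj set \<Rightarrow> nat \<Rightarrow> bool" where
  "has_degree C d \<longleftrightarrow> (\<exists>F. F \<noteq> 0 \<and> homogeneous d F \<and> C = zero_locus {F} \<and>
     (\<forall>H e. homogeneous e H \<longrightarrow> (C \<subseteq> zero_locus {H} \<longleftrightarrow> F dvd H)))"

definition is_line :: "('k::field, 3) proj set \<Rightarrow> bool" where
  "is_line L \<longleftrightarrow> (\<exists>F. F \<noteq> 0 \<and> homogeneous 1 F \<and> L = zero_locus {F})"

definition collinear_points :: "('k::field, 3) proj set \<Rightarrow> bool" where
  "collinear_points S \<longleftrightarrow> (\<exists>L. is_line L \<and> S \<subseteq> L)"

text \<open>Meaningful for distinct points only.\<close>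

definition line_through :: "('k::field, 3) proj \<Rightarrow> ('k, 3) proj \<Rightarrow> ('k, 3) proj set" where
  "line_through P R = (THE L. is_line L \<and> P \<in> L \<and> R \<in> L)"

text \<open>
  The projection from \<open>P\<close> is given by a linear map whose kernel is the line represented by \<open>P\<close>;
  it is unique up to automorphisms of the projective line.
\<close>

definition projection_from :: "('k::field, 3) proj \<Rightarrow> (('k, 3) proj \<rightharpoonup> ('k, 2) proj)" where
  "projection_from P =
     (let M = (SOME M :: 'k ^ 3 ^ 2. \<forall>x. M *v x = 0 \<longleftrightarrow> x = 0 \<or> abs_proj x = P)
      in (\<lambda>R. if R = P then None else Some (abs_proj (M *v rep_proj R))))"

text \<open>
  The image of the function field of the projective line under pullback along the projection.
  The condition on the domain always holds if the projection is dominant on \<open>C\<close>, that is, unless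
  \<open>C\<close> is a line through \<open>P\<close>.
\<close>

definition projection_field ::
  "('k::field, 3) proj set \<Rightarrow> ('k, 3) proj \<Rightarrow> (('k, 3) proj \<rightharpoonup> 'k) set" where
  "projection_field C P = {pullback C (projection_from P) f | f.
     f \<in> rational_funs (UNIV :: ('k, 2) proj set) \<and>
     dom (f \<circ>\<^sub>m (projection_from P |` C)) \<noteq> {}}"

definition galois_group :: "('a, 'b) ring_scheme \<Rightarrow> 'a set \<Rightarrow> ('a \<Rightarrow> 'a) set" where
  "galois_group E K = {\<tau> \<in> ring_iso E E. \<forall>x\<in>K. \<tau> x = x}"

text \<open>
  An algebraic field extension whose base field is the fixed field of its automorphism group.
\<close>

definition galois_extension :: "('a, 'b) ring_scheme \<Rightarrow> 'a set \<Rightarrow> bool" where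
  "galois_extension E K \<longleftrightarrow> field E \<and> subfield K E \<and>
     (\<forall>x\<in>carrier E. \<not> (ring.transcendental E over K) x) \<and>
     {x \<in> carrier E. \<forall>\<tau>\<in>galois_group E K. \<tau> x = x} = K"

definition galois_point :: "('k::field, 3) proj set \<Rightarrow> ('k, 3) proj \<Rightarrow> bool" where
  "galois_point C P \<longleftrightarrow> galois_extension (function_field C) (projection_field C P)"

definition outer_galois_point :: "('k::field, 3) proj set \<Rightarrow> ('k, 3) proj \<Rightarrow> bool" where
  "outer_galois_point C P \<longleftrightarrow> galois_point C P \<and> P \<notin> C"

text \<open>
  The Galois group at \<open>P\<close> as a set of automorphisms of \<open>C\<close>: those which under
  \<open>pullback C (Some \<circ> \<phi>)\<close>, the identification of the function fields of \<open>\<phi> ` C\<close> and \<open>C\<close>, induce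
  an element of the Galois group.
\<close>

definition galois_group_at ::
  "('k::field, 'n::finite) proj set \<Rightarrow> (('k, 'n) proj \<Rightarrow> ('k, 3) proj) \<Rightarrow> ('k, 3) proj \<Rightarrow>
    (('k, 'n) proj \<Rightarrow> ('k, 'n) proj) set" where
  "galois_group_at C \<phi> P = {\<sigma> \<in> automorphisms C.
     \<exists>\<tau> \<in> galois_group (function_field (\<phi> ` C)) (projection_field (\<phi> ` C) P).
       \<forall>f \<in> rational_funs (\<phi> ` C).
         pullback C (Some \<circ> \<sigma>) (pullback C (Some \<circ> \<phi>) f) = pullback C (Some \<circ> \<phi>) (\<tau> f)}"

end

theory Submission
  imports Defs 
begin

text \<open>
  Rational functions and rational maps are total functions considered up to equality on a nonempty open set.
  If the quotients are rational, the fibre \<open>D\<close> over the image of \<open>Q\<close> is common to the three quotient maps,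
  and coordinates \<open>x\<^sub>i\<close> on the quotient lines with pole divisor \<open>D\<close> satisfy a linear relation with \<open>1\<close> because
  of the dimension bound.  Then \<open>(1 : x\<^sub>1 : x\<^sub>2)\<close> is the plane model: its equation is the characteristic
  polynomial of \<open>x\<^sub>2\<close> over the first quotient, and the \<open>x\<^sub>i\<close> are projections from points on the line at
  infinity.  If the groups are trivial, a line is used instead.  Conversely, projection from \<open>P\<^sub>i\<close> makes \<open>C\<close> a Galois cover of
  the line, the fibre through \<open>Q\<close> is the divisor cut out by the line of the \<open>P\<^sub>i\<close>, and it equals the orbit
  sum: one estimate comes from norms, the other from counting the functions \<open>u\<^sup>i v\<^sup>j\<close> with bounded poles.
\<close>

text \<open>Divisors need orders of vanishing, whereas smoothness supplies only generators of the
  maximal ideals. That a function is a power of such a generator times a unit is drawn from a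
  covering of the line: every function is algebraic over the coordinate of the line, and the
  relation shows that a regular function divides a power of the pulled back local parameter, which
  itself divides a power of the generator. Hence both directions do their valuation theory inside a
  cover, and a projection has to be recognized as a cover before its fibres are known to be orbits.

  The orbit sum counts stabilizers while a fibre counts ramification indices; equating them is the
  point where the degree of the cover would enter, and each direction has its own substitute for it.

  The third point comes out of the linear relation between \<open>1\<close> and the three
  coordinates. For nontrivial groups its coefficients at the coordinates are all nonzero, since a
  shorter relation would put one group inside another, and their ratios are the coordinates of the
  third point on the line at infinity.\<close>

hide_const (open) up_ring.coeff up_ring.monom

abbreviation evm :: "('k::field, 'n::finite) mpoly => 'k ^ 'n => 'k" where "evm == eval_mpoly"

abbreviation hmg :: "nat => ('k::field, 'n::finite) mpoly => bool" where "hmg == homogeneous"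

abbreviation lkp :: "('a \<Rightarrow>\<^sub>0 'b::zero) => 'a => 'b" where "lkp == Poly_Mapping.lookup"

section \<open>Forms and points\<close>

lemma rep_proj_nonzero: "rep_proj P ~= 0"
 using Quotient3_rep_reflp[OF Quotient3_proj, of P] by (simp add: proportional_def)

lemma abs_rep_proj [simp]: "abs_proj (rep_proj P) = P"
 by (rule Quotient3_abs_rep[OF Quotient3_proj])

lemma proportional_refl: "x ~= 0 ==> proportional x x"
 by (auto simp: proportional_def vec_eq_iff intro!: exI[of _ 1])

lemma abs_proj_eq_iff:
 assumes "x ~= 0" "y ~= 0"
 shows "abs_proj x = abs_proj y \<longleftrightarrow> proportional x y"
 using Quotient3_rel[OF Quotient3_proj, of x y] proportional_refl assms by blast

lemma abs_proj_scale: "c ~= 0 ==> x ~= 0 ==> abs_proj (c *s x) = abs_proj x"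
 by (subst eq_commute, subst abs_proj_eq_iff)
  (auto simp: proportional_def vec_eq_iff)

lemma rep_abs_proj:
 assumes "x ~= 0"
 obtains c where "c ~= 0" "rep_proj (abs_proj x) = c *s x"
proof -
 have "proportional x (rep_proj (abs_proj x))"
  using abs_proj_eq_iff[OF assms rep_proj_nonzero[of "abs_proj x"]] by simp
 then show ?thesis using that unfolding proportional_def by blast
qed

lemma cross_imp_scale:
 fixes x y :: "'k::field ^ 'n::finite"
 assumes "x ~= 0" "y ~= 0" and c: "!!i j. x $ i * y $ j = x $ j * y $ i"
 obtains c where "c ~= 0" "y = c *s x"
proof -
 obtain i where i: "x $ i ~= 0" using assms(1) by (auto simp: vec_eq_iff)
 have y: "y = (y $ i / x $ i) *s x"
  using i c[of i] by (auto simp: vec_eq_iff field_simps)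
 moreover have "y $ i / x $ i ~= 0"
 proof
  assume "y $ i / x $ i = 0"
  with y have "y = 0" by (metis vector_smult_lzero)
  with assms(2) show False by simp
 qed
 ultimately show ?thesis using that by blast
qed

lemma abs_proj_eq_cross:
 fixes x y :: "'k::field ^ 'n::finite"
 assumes "x ~= 0" "y ~= 0"
 shows "abs_proj x = abs_proj y \<longleftrightarrow> (ALL i j. x $ i * y $ j = x $ j * y $ i)"
proof
 assume "abs_proj x = abs_proj y"
 then show "ALL i j. x $ i * y $ j = x $ j * y $ i"
  by (auto simp: abs_proj_eq_iff[OF assms] proportional_def)
next
 assume "ALL i j. x $ i * y $ j = x $ j * y $ i"
 then obtain c where "c ~= 0" "y = c *s x" using cross_imp_scale[OF assms] by blast
 then show "abs_proj x = abs_proj y" using abs_proj_scale[of c x] assms by simp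
qed

definition coordv :: "'n => ('k::field, 'n::finite) mpoly" where
 "coordv j = Poly_Mapping.single (Poly_Mapping.single j 1) 1"

definition cst :: "'k => ('k::field, 'n::finite) mpoly" where
 "cst c = Poly_Mapping.single 0 c"

definition lin :: "'k ^ 'n => ('k::field, 'n::finite) mpoly" where
 "lin a = (\<Sum>j\<in>UNIV. cst (a $ j) * coordv j)"

lemma eval_coordv [simp]: "evm (coordv j) x = x $ j"
proof -
 have "(\<Prod>i\<in>UNIV. (x $ i) ^ (lkp (Poly_Mapping.single j 1) i)) =
  (\<Prod>i\<in>UNIV. if i = j then x $ i else 1)"
  by (rule prod.cong) (auto simp: lookup_single when_def)
 then show ?thesis by (simp add: coordv_def eval_mpoly_single)
qed

lemma eval_cst [simp]: "evm (cst c) x = c"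
 by (simp add: cst_def eval_mpoly_single)

lemma cst_0 [simp]: "cst 0 = 0" by (simp add: cst_def)

lemma cst_1: "cst 1 = 1" by (simp add: cst_def)

lemma eval_mpoly_1 [simp]: "evm 1 x = 1"
 using eval_cst[of 1 x] by (simp add: cst_1)

lemma eval_mpoly_prod: "evm (\<Prod>a\<in>A. h a) x = (\<Prod>a\<in>A. evm (h a) x)"
 by (induction A rule: infinite_finite_induct) (simp_all add: eval_mpoly_mult)

lemma eval_mpoly_power: "evm (F ^ n) x = evm F x ^ n"
 by (induction n) (simp_all add: eval_mpoly_mult)

lemma eval_lin [simp]: "evm (lin a) x = (\<Sum>j\<in>UNIV. a $ j * x $ j)"
 by (simp add: lin_def eval_mpoly_sum eval_mpoly_mult)

lemma eval_mpoly_uminus: "evm (- F) x = - evm F x"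
 using eval_mpoly_add[of F "- F" x] by (simp add: eq_neg_iff_add_eq_0 add.commute)

lemma eval_mpoly_diff: "evm (F - G) x = evm F x - evm G x"
 using eval_mpoly_add[of F "- G" x] by (simp add: eval_mpoly_uminus)

lemmas eval_simps = eval_mpoly_add eval_mpoly_mult eval_mpoly_sum eval_mpoly_prod eval_mpoly_power
 eval_mpoly_uminus eval_mpoly_diff

lemma homogeneous_0 [simp]: "hmg d 0"
 by (simp add: homogeneous_def)

lemma homogeneous_add: "hmg d F ==> hmg d G ==> hmg d (F + G)"
 using Poly_Mapping.keys_add[of F G] unfolding homogeneous_def by blast

lemma homogeneous_uminus: "hmg d F ==> hmg d (- F)"
 by (simp add: homogeneous_def)

lemma homogeneous_diff: "hmg d F ==> hmg d G ==> hmg d (F - G)"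
 using homogeneous_add[OF _ homogeneous_uminus, of d F G] by simp

lemma homogeneous_sum: "(!!a. a \<in> A ==> hmg d (h a)) ==> hmg d (\<Sum>a\<in>A. h a)"
 by (induction A rule: infinite_finite_induct) (simp_all add: homogeneous_add)

lemma homogeneous_cst [simp]: "hmg 0 (cst c)"
 by (simp add: homogeneous_def cst_def)

lemma homogeneous_1 [simp]: "hmg 0 1"
 using homogeneous_cst[of 1] by (simp add: cst_1)

lemma homogeneous_coordv [simp]: "hmg (Suc 0) (coordv j)"
proof -
 have "(\<Sum>i\<in>UNIV. lkp (Poly_Mapping.single j (1::nat)) i) =
  (\<Sum>i\<in>UNIV. if i = j then 1 else 0)"
  by (rule sum.cong) (auto simp: lookup_single when_def)
 then show ?thesis by (simp add: homogeneous_def coordv_def)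
qed

lemma homogeneous_cst_mult: "hmg d F ==> hmg d (cst c * F)"
 using homogeneous_mult[of 0 "cst c" d F] by simp

lemma homogeneous_lin [simp]: "hmg (Suc 0) (lin a)"
 unfolding lin_def by (intro homogeneous_sum homogeneous_cst_mult homogeneous_coordv)

lemma homogeneous_prod:
 "(!!a. a \<in> A ==> hmg (d a) (h a)) ==> hmg (\<Sum>a\<in>A. d a) (\<Prod>a\<in>A. h a)"
 by (induction A rule: infinite_finite_induct) (simp_all add: homogeneous_mult)

lemma homogeneous_power: "hmg d F ==> hmg (n * d) (F ^ n)"
 by (induction n) (simp_all add: homogeneous_mult)

lemmas peval_simps = peval_def eval_simps

lemma peval_abs:
 assumes "hmg d F" "x ~= 0"
 obtains c where "c ~= 0" "!!F d. hmg d F ==> peval F (abs_proj x) = c ^ d * evm F x"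
 using rep_abs_proj[OF assms(2)] by (metis eval_mpoly_scale peval_def)

lemma peval_abs_eq_0_iff:
 "hmg d F ==> x ~= 0 ==> peval F (abs_proj x) = 0 \<longleftrightarrow> evm F x = 0"
 by (metis peval_abs mult_eq_0_iff power_not_zero)

lemma peval_abs_ratio:
 "hmg d F ==> hmg d G ==> x ~= 0 ==>
 peval F (abs_proj x) / peval G (abs_proj x) = evm F x / evm G x"
 by (rule peval_abs[of d F x]) (auto simp: power_not_zero)

lemma ex_var_nonzero: "EX j. peval (coordv j) P ~= 0"
 using rep_proj_nonzero[of P] by (auto simp: peval_def vec_eq_iff)

lemma proj_eq_cross: "P = R \<longleftrightarrow> (ALL i j. rep_proj P $ i * rep_proj R $ j = rep_proj P $ j * rep_proj R $ i)"
 using abs_proj_eq_cross[OF rep_proj_nonzero rep_proj_nonzero, of P R] by simp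

definition subst_mpoly :: "('k::field, 'm::finite) mpoly => ('m => ('k, 'n::finite) mpoly) => ('k, 'n) mpoly" where
 "subst_mpoly F H = (\<Sum>m\<in>Poly_Mapping.keys F. cst (lkp F m) *
  (\<Prod>j\<in>UNIV. H j ^ lkp m j))"

lemma eval_subst: "evm (subst_mpoly F H) x = evm F (\<chi> j. evm (H j) x)"
 by (simp add: subst_mpoly_def eval_simps eval_mpoly_def[of F])

lemma homogeneous_subst:
 assumes "hmg d F" "!!j. hmg e (H j)"
 shows "hmg (d * e) (subst_mpoly F H)"
 unfolding subst_mpoly_def
proof (intro homogeneous_sum homogeneous_cst_mult)
 fix m assume "m \<in> Poly_Mapping.keys F"
 then have "d * e = (\<Sum>j\<in>UNIV. lkp m j * e)"
  using assms(1) by (simp add: homogeneous_def sum_distrib_right[symmetric])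
 then show "hmg (d * e) (\<Prod>j\<in>UNIV. H j ^ lkp m j)"
  using homogeneous_prod[of UNIV "%j. lkp m j * e" "%j. H j ^ lkp m j"]
   homogeneous_power[OF assms(2)] by simp
qed

section \<open>Irreducible sets and generic properties\<close>

text \<open>Irreducibility in terms of forms instead of closed sets. In this shape it says directly
  that the nonempty basic open subsets of \<open>C\<close> form a filter base.\<close>

definition irr :: "('k::field, 'n::finite) proj set => bool" where
 "irr C \<longleftrightarrow> C ~= {} & (ALL F G d e. hmg d F --> hmg e G -->
  (\<exists>P\<in>C. peval F P ~= 0) --> (\<exists>P\<in>C. peval G P ~= 0) --> (\<exists>P\<in>C. peval F P ~= 0 & peval G P ~= 0))"

lemma openin_zariski_sub:
 "openin (subtopology zariski C) U \<longleftrightarrow> U \<subseteq> C &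
  (\<forall>P\<in>U. EX F d. hmg d F & peval F P ~= 0 & (\<forall>R\<in>C. peval F R ~= 0 --> R \<in> U))"
proof
 assume "openin (subtopology zariski C) U"
 then obtain T where T: "\<forall>F\<in>T. EX d. hmg d F" "U = - zero_locus T \<inter> C"
  unfolding openin_subtopology openin_zariski zariski_open_def by blast
 show "U \<subseteq> C &
  (\<forall>P\<in>U. EX F d. hmg d F & peval F P ~= 0 & (\<forall>R\<in>C. peval F R ~= 0 --> R \<in> U))"
  using T(1) unfolding T(2) zero_locus_def by fastforce
next
 assume U: "U \<subseteq> C &
  (\<forall>P\<in>U. EX F d. hmg d F & peval F P ~= 0 & (\<forall>R\<in>C. peval F R ~= 0 --> R \<in> U))"
 let ?T = "{F. (EX d. hmg d F) & (\<forall>R\<in>C. peval F R ~= 0 --> R \<in> U)}"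
 have "zariski_open (- zero_locus ?T)" unfolding zariski_open_def
  by (rule exI[of _ ?T]) simp
 moreover have "U = - zero_locus ?T \<inter> C" using U unfolding zero_locus_def by blast
 ultimately show "openin (subtopology zariski C) U"
  unfolding openin_subtopology openin_zariski by blast
qed

lemma openin_basic: "hmg d F ==> openin (subtopology zariski C) {R\<in>C. peval F R ~= 0}"
 unfolding openin_zariski_sub by blast

lemma topspace_zariski [simp]: "topspace (zariski :: ('k::field, 'n::finite) proj topology) = UNIV"
proof -
 have "zariski_open (UNIV :: ('k, 'n) proj set)" unfolding zariski_open_def zero_locus_def
  by (rule exI[of _ "{1}"]) (auto simp: peval_def intro: exI[of _ 0])
 then show ?thesis by (metis openin_zariski openin_subset top.extremum_unique)
qed

lemma topspace_zariski_sub: "topspace (subtopology zariski C) = C"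
 by simp

lemma irreducible_imp_irr:
 assumes "irreducible_space (subtopology zariski C)"
 shows "irr C"
 unfolding irr_def
proof (intro conjI allI impI)
 show "C ~= {}" using assms by (simp add: irreducible_space_def)
 fix F G d e assume h: "hmg d F" "hmg e G" "\<exists>P\<in>C. peval F P ~= 0" "\<exists>P\<in>C. peval G P ~= 0"
 have cl: "closedin (subtopology zariski C) (C - {R\<in>C. peval H R ~= 0})" if "hmg r H" for r H
  using openin_basic[OF that, of C] by (metis closedin_diff closedin_topspace topspace_zariski_sub)
 show "\<exists>P\<in>C. peval F P ~= 0 & peval G P ~= 0"
 proof (rule ccontr)
  assume "\<not> ?thesis"
  then have "(C - {R\<in>C. peval F R ~= 0}) \<union> (C - {R\<in>C. peval G R ~= 0}) = C" by blast
  with assms cl[OF h(1)] cl[OF h(2)] have "C - {R\<in>C. peval F R ~= 0} = C \<or> C - {R\<in>C. peval G R ~= 0} = C"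
   unfolding irreducible_space_def topspace_zariski_sub by blast
  with h(3,4) show False by blast
 qed
qed

text \<open>Generated by the sets on which some form does not vanish, so that
  \<open>eventually\<close> means truth on a nonempty open subset. Intersecting domains of
  definition becomes an application of \<open>eventually_elim\<close>.\<close>

definition gen :: "('k::field, 'n::finite) proj set => ('k, 'n) proj filter" where
 "gen C = (INF F\<in>{F. (EX d. hmg d F) & (\<exists>P\<in>C. peval F P ~= 0)}. principal {P\<in>C. peval F P ~= 0})"

abbreviation aeg where "aeg C Q == \<forall>\<^sub>F R in gen C. Q R"

lemma eventually_gen:
 assumes "irr C"
 shows "(\<forall>\<^sub>F R in gen C. Q R) \<longleftrightarrow>
  (EX F d. hmg d F & (\<exists>P\<in>C. peval F P ~= 0) & (\<forall>R\<in>C. peval F R ~= 0 --> Q R))"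
proof -
 let ?B = "{F. (EX d. hmg d F) & (\<exists>P\<in>C. peval F P ~= 0)}"
 have "1 \<in> ?B" using assms by (auto simp: irr_def peval_def intro: exI[of _ 0])
 then have ne: "?B ~= {}" by blast
 have "\<exists>x\<in>?B. principal {P\<in>C. peval x P ~= 0} \<le> inf (principal {P\<in>C. peval F P ~= 0}) (principal {P\<in>C. peval G P ~= 0})"
  if F: "F \<in> ?B" and G: "G \<in> ?B" for F G
 proof -
  obtain d e where de: "hmg d F" "hmg e G" using F G by blast
  have "\<exists>P\<in>C. peval F P ~= 0 & peval G P ~= 0" using assms de F G unfolding irr_def by blast
  then have "F * G \<in> ?B" using homogeneous_mult[OF de] by (auto simp: peval_simps)
  moreover have "{P\<in>C. peval (F * G) P ~= 0} = {P\<in>C. peval F P ~= 0} \<inter> {P\<in>C. peval G P ~= 0}"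
   by (auto simp: peval_simps)
  ultimately show ?thesis by (intro bexI[of _ "F * G"]) auto
 qed
 from eventually_INF_base[OF ne this, of Q] show ?thesis unfolding gen_def
  by (simp add: eventually_principal) blast
qed

lemma gen_neq_bot: "irr C ==> gen C ~= bot"
 unfolding trivial_limit_def eventually_gen by blast

lemma gen_basic: "irr C ==> hmg d F ==> P \<in> C ==> peval F P ~= 0 ==> \<forall>\<^sub>F R in gen C. R \<in> C & peval F R ~= 0"
 unfolding eventually_gen by blast

lemma gen_in: "irr C ==> \<forall>\<^sub>F R in gen C. R \<in> C"
proof -
 assume i: "irr C"
 then obtain P where "P \<in> C" unfolding irr_def by blast
 then show ?thesis using gen_basic[OF i homogeneous_1, of P] by (auto simp: peval_def elim: eventually_mono)
qed

lemma gen_ex: "irr C ==> \<forall>\<^sub>F R in gen C. Q R ==> \<exists>R\<in>C. Q R"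
 unfolding eventually_gen by blast

lemma gen_False: "irr C ==> \<forall>\<^sub>F R in gen C. Q R ==> \<forall>\<^sub>F R in gen C. \<not> Q R ==> False"
 using gen_neq_bot eventually_conj[of Q "gen C" "%R. \<not> Q R"] by (auto simp: trivial_limit_def)

lemma gen_const: "irr C ==> (\<forall>\<^sub>F R in gen C. Q) \<longleftrightarrow> Q"
 using gen_neq_bot by (cases Q) (auto simp: trivial_limit_def)

text \<open>A point where the form is nonzero would make it nonzero generically. This is the passage
  from identities on an open set to identities at every point.\<close>

lemma gen_form_zero:
 assumes "irr C" "hmg d F" "aeg C (%R. peval F R = 0)" "P \<in> C"
 shows "peval F P = 0"
 using gen_False[OF assms(1,3)] gen_basic[OF assms(1,2,4)] by (metis (no_types, lifting) eventually_mono)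

lemma gen_open: "irr C ==> openin (subtopology zariski C) U ==> U ~= {} ==> \<forall>\<^sub>F R in gen C. R \<in> U"
 unfolding openin_zariski_sub eventually_gen by blast

lemma gen_form_dich:
 assumes "irr C" "hmg d F"
 shows "(\<forall>R\<in>C. peval F R = 0) \<or> (\<forall>\<^sub>F R in gen C. peval F R ~= 0)"
 using gen_basic[OF assms] by (metis (mono_tags, lifting) eventually_mono)

section \<open>Rational functions up to generic equality\<close>

definition ratl :: "('k::field, 'n::finite) proj set => (('k, 'n) proj => 'k) => bool" where
 "ratl C f \<longleftrightarrow> (EX F G d. hmg d F & hmg d G & (\<exists>P\<in>C. peval G P ~= 0) &
  (\<forall>\<^sub>F R in gen C. f R = peval F R / peval G R))"

text \<open>The value \<open>a\<close> is part of the relation because \<open>f\<close> is total and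
  its own value at \<open>P\<close> is arbitrary; only its generic values count.\<close>

definition reg :: "('k::field, 'n::finite) proj set => ('k, 'n) proj => (('k, 'n) proj => 'k) => 'k => bool" where
 "reg C P f a \<longleftrightarrow> (EX F G d. hmg d F & hmg d G & peval G P ~= 0 &
  a = peval F P / peval G P & (\<forall>\<^sub>F R in gen C. f R = peval F R / peval G R))"

lemma ratlI: "hmg d F ==> hmg d G ==> P \<in> C ==> peval G P ~= 0 ==>
 \<forall>\<^sub>F R in gen C. f R = peval F R / peval G R ==> ratl C f"
 unfolding ratl_def by blast

lemma regI: "hmg d F ==> hmg d G ==> peval G P ~= 0 ==>
 \<forall>\<^sub>F R in gen C. f R = peval F R / peval G R ==> a = peval F P / peval G P ==> reg C P f a"
 unfolding reg_def by blast

lemma reg_imp_ratl: "reg C P f a ==> P \<in> C ==> ratl C f"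
 unfolding reg_def ratl_def by blast

lemma reg_cong:
 assumes "reg C P f a" "aeg C (%R. g R = f R)"
 shows "reg C P g a"
proof -
 obtain F G d where 1: "hmg d F" "hmg d G" "peval G P ~= 0" "a = peval F P / peval G P"
  "aeg C (%R. f R = peval F R / peval G R)" using assms(1) unfolding reg_def by blast
 have "aeg C (%R. g R = peval F R / peval G R)" using assms(2) 1(5) by eventually_elim simp
 from regI[OF 1(1-3) this 1(4)] show ?thesis .
qed

lemma ratl_cong:
 assumes "ratl C f" "aeg C (%R. g R = f R)"
 shows "ratl C g"
proof -
 obtain F G d P where 1: "hmg d F" "hmg d G" "P \<in> C" "peval G P ~= 0"
  "aeg C (%R. f R = peval F R / peval G R)" using assms(1) unfolding ratl_def by blast
 have "aeg C (%R. g R = peval F R / peval G R)" using assms(2) 1(5) by eventually_elim simp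
 from ratlI[OF 1(1-4) this] show ?thesis .
qed

text \<open>Cross-multiplying two presentations gives a form that vanishes generically, hence also
  at \<open>P\<close>.\<close>

lemma reg_unique:
 assumes "irr C" "P \<in> C" "reg C P f a" "reg C P f b"
 shows "a = b"
proof -
 obtain F G d where 1: "hmg d F" "hmg d G" "peval G P ~= 0" "a = peval F P / peval G P"
  "aeg C (%R. f R = peval F R / peval G R)" using assms(3) unfolding reg_def by blast
 obtain F' G' d' where 2: "hmg d' F'" "hmg d' G'" "peval G' P ~= 0" "b = peval F' P / peval G' P"
  "aeg C (%R. f R = peval F' R / peval G' R)" using assms(4) unfolding reg_def by blast
 have h: "hmg (d + d') (F * G' - G * F')"
  by (intro homogeneous_diff homogeneous_mult 1 2)
 have "aeg C (%R. peval (F * G' - G * F') R = 0)"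
  using 1(5) 2(5) gen_basic[OF assms(1) 1(2) assms(2) 1(3)] gen_basic[OF assms(1) 2(2) assms(2) 2(3)]
  by eventually_elim (auto simp: peval_simps field_simps)
 from gen_form_zero[OF assms(1) h this assms(2)]
 have "peval F P * peval G' P = peval G P * peval F' P" by (simp add: peval_simps)
 then show ?thesis unfolding 1(4) 2(4) using 1(3) 2(3) by (simp add: frac_eq_eq mult.commute)
qed

lemma reg_const: "irr C ==> reg C P (%_. c) c"
 by (rule regI[of 0 "cst c" 1]) (auto simp: peval_def)

lemma reg_form: "hmg d F ==> hmg d G ==> peval G P ~= 0 ==>
 reg C P (%R. peval F R / peval G R) (peval F P / peval G P)"
 by (rule regI[of d F G]) auto

lemma reg_add:
 assumes "irr C" "P \<in> C" "reg C P f a" "reg C P g b"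
 shows "reg C P (%R. f R + g R) (a + b)"
proof -
 obtain F G d where 1: "hmg d F" "hmg d G" "peval G P ~= 0" "a = peval F P / peval G P"
  "aeg C (%R. f R = peval F R / peval G R)" using assms(3) unfolding reg_def by blast
 obtain F' G' d' where 2: "hmg d' F'" "hmg d' G'" "peval G' P ~= 0" "b = peval F' P / peval G' P"
  "aeg C (%R. g R = peval F' R / peval G' R)" using assms(4) unfolding reg_def by blast
 show ?thesis
 proof (rule regI[of "d + d'" "F * G' + G * F'" "G * G'"])
  show "hmg (d + d') (F * G' + G * F')" "hmg (d + d') (G * G')"
   by (intro homogeneous_add homogeneous_mult 1 2)+
  show "aeg C (%R. f R + g R = peval (F * G' + G * F') R / peval (G * G') R)"
   using 1(5) 2(5) gen_basic[OF assms(1) 1(2) assms(2) 1(3)] gen_basic[OF assms(1) 2(2) assms(2) 2(3)]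
   by eventually_elim (auto simp: peval_simps field_simps)
  show "a + b = peval (F * G' + G * F') P / peval (G * G') P"
   unfolding 1(4) 2(4) using 1(3) 2(3) by (simp add: peval_simps add_frac_eq mult.commute)
 qed (use 1 2 in \<open>auto simp: peval_simps\<close>)
qed

lemma reg_mult:
 assumes "irr C" "P \<in> C" "reg C P f a" "reg C P g b"
 shows "reg C P (%R. f R * g R) (a * b)"
proof -
 obtain F G d where 1: "hmg d F" "hmg d G" "peval G P ~= 0" "a = peval F P / peval G P"
  "aeg C (%R. f R = peval F R / peval G R)" using assms(3) unfolding reg_def by blast
 obtain F' G' d' where 2: "hmg d' F'" "hmg d' G'" "peval G' P ~= 0" "b = peval F' P / peval G' P"
  "aeg C (%R. g R = peval F' R / peval G' R)" using assms(4) unfolding reg_def by blast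
 show ?thesis
 proof (rule regI[of "d + d'" "F * F'" "G * G'"])
  show "hmg (d + d') (F * F')" "hmg (d + d') (G * G')"
   by (intro homogeneous_mult 1 2)+
  show "aeg C (%R. f R * g R = peval (F * F') R / peval (G * G') R)"
   using 1(5) 2(5) by eventually_elim (auto simp: peval_simps)
 qed (use 1 2 in \<open>auto simp: peval_simps\<close>)
qed

lemma reg_inverse:
 assumes "irr C" "P \<in> C" "reg C P f a" "a ~= 0"
 shows "reg C P (%R. inverse (f R)) (inverse a)"
proof -
 obtain F G d where 1: "hmg d F" "hmg d G" "peval G P ~= 0" "a = peval F P / peval G P"
  "aeg C (%R. f R = peval F R / peval G R)" using assms(3) unfolding reg_def by blast
 show ?thesis
 proof (rule regI[of d G F])
  show "aeg C (%R. inverse (f R) = peval G R / peval F R)"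
   using 1(5) by eventually_elim (auto simp: field_simps)
 qed (use 1 assms(4) in \<open>auto simp: field_simps\<close>)
qed

lemma reg_cmult: "irr C ==> P \<in> C ==> reg C P f a ==> reg C P (%R. c * f R) (c * a)"
 using reg_mult[OF _ _ reg_const] by blast

lemma reg_uminus: "irr C ==> P \<in> C ==> reg C P f a ==> reg C P (%R. - f R) (- a)"
 using reg_cmult[of C P f a "-1"] by simp

lemma reg_diff: "irr C ==> P \<in> C ==> reg C P f a ==> reg C P g b ==> reg C P (%R. f R - g R) (a - b)"
 using reg_add[of C P f a "%R. - g R" "- b"] reg_uminus[of C P g b] by simp

lemma reg_divide: "irr C ==> P \<in> C ==> reg C P f a ==> reg C P g b ==> b ~= 0 ==> reg C P (%R. f R / g R) (a / b)"
 using reg_mult[of C P f a "%R. inverse (g R)" "inverse b"] reg_inverse[of C P g b] by (simp add: field_class.field_divide_inverse)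

lemma reg_power: "irr C ==> P \<in> C ==> reg C P f a ==> reg C P (%R. f R ^ n) (a ^ n)"
 by (induction n) (auto intro: reg_mult reg_const)

lemma reg_sum: "irr C ==> P \<in> C ==> (!!i. i \<in> A ==> reg C P (f i) (a i)) ==>
 reg C P (%R. \<Sum>i\<in>A. f i R) (\<Sum>i\<in>A. a i)"
 by (induction A rule: infinite_finite_induct) (auto intro: reg_add reg_const)

lemma reg_prod: "irr C ==> P \<in> C ==> (!!i. i \<in> A ==> reg C P (f i) (a i)) ==>
 reg C P (%R. \<Prod>i\<in>A. f i R) (\<Prod>i\<in>A. a i)"
 by (induction A rule: infinite_finite_induct) (auto intro: reg_mult reg_const)

lemma reg_poly: "irr C ==> P \<in> C ==> reg C P f a ==> reg C P (%R. poly p (f R)) (poly p a)"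
 unfolding poly_altdef by (intro reg_sum reg_cmult reg_power)

lemma reg_poly2:
 "irr C ==> P \<in> C ==> reg C P f a ==> reg C P g b ==>
 reg C P (%R. poly (poly A [:g R:]) (f R)) (poly (poly A [:b:]) a)"
proof (induction A)
 case 0 then show ?case by (simp add: reg_const)
next
 case (pCons p A)
 then show ?case by (auto intro!: reg_add reg_mult reg_poly)
qed

text \<open>Generically, a rational function is regular, so that the rules above transfer.\<close>

lemma ratl_reg: "irr C ==> ratl C f ==> \<forall>\<^sub>F R in gen C. R \<in> C & reg C R f (f R)"
proof -
 assume i: "irr C" and "ratl C f"
 then obtain F G d P where 1: "hmg d F" "hmg d G" "P \<in> C" "peval G P ~= 0"
  "aeg C (%R. f R = peval F R / peval G R)" unfolding ratl_def by blast
 show ?thesis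
  using 1(5) gen_basic[OF i 1(2,3,4)]
  by eventually_elim (use 1 in \<open>auto intro: regI\<close>)
qed

lemma ratl_lift1:
 assumes "irr C" "ratl C f" and "!!P a. P \<in> C ==> reg C P f a ==> EX b. reg C P (%R. ph (f R)) b"
 shows "ratl C (%R. ph (f R))"
 using gen_ex[OF assms(1) ratl_reg[OF assms(1,2)]] assms(3) reg_imp_ratl by metis

lemma ratl_lift2:
 assumes "irr C" "ratl C f" "ratl C g" and "!!P a b. P \<in> C ==> reg C P f a ==> reg C P g b ==> EX b. reg C P (%R. ph (f R) (g R)) b"
 shows "ratl C (%R. ph (f R) (g R))"
proof -
 have "aeg C (%R. R \<in> C & reg C R f (f R) & reg C R g (g R))"
  using ratl_reg[OF assms(1,2)] ratl_reg[OF assms(1,3)] by eventually_elim auto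
 from gen_ex[OF assms(1) this] show ?thesis using assms(4) reg_imp_ratl by metis
qed

lemma ratl_const: "irr C ==> ratl C (%_. c)"
 using reg_const[of C _ c] reg_imp_ratl unfolding irr_def by blast

lemma ratl_add: "irr C ==> ratl C f ==> ratl C g ==> ratl C (%R. f R + g R)"
 by (rule ratl_lift2) (auto intro: reg_add)

lemma ratl_mult: "irr C ==> ratl C f ==> ratl C g ==> ratl C (%R. f R * g R)"
 by (rule ratl_lift2) (auto intro: reg_mult)

lemma ratl_uminus: "irr C ==> ratl C f ==> ratl C (%R. - f R)"
 by (rule ratl_lift1) (auto intro: reg_uminus)

lemma ratl_diff: "irr C ==> ratl C f ==> ratl C g ==> ratl C (%R. f R - g R)"
 by (rule ratl_lift2) (auto intro: reg_diff)

lemma ratl_dich: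
 assumes "irr C" "ratl C f"
 shows "(\<forall>\<^sub>F R in gen C. f R = 0) \<or> (\<forall>\<^sub>F R in gen C. f R ~= 0)"
proof -
 obtain F G d P where 1: "hmg d F" "hmg d G" "P \<in> C" "peval G P ~= 0"
  "aeg C (%R. f R = peval F R / peval G R)" using assms(2) unfolding ratl_def by blast
 note G = gen_basic[OF assms(1) 1(2,3,4)]
 show ?thesis
 proof (cases "\<forall>R\<in>C. peval F R = 0")
  case True
  have "aeg C (%R. f R = 0)" using 1(5) G gen_in[OF assms(1)]
   by eventually_elim (use True in auto)
  then show ?thesis ..
 next
  case False
  then have "aeg C (%R. peval F R ~= 0)" using gen_form_dich[OF assms(1) 1(1)] by blast
  then have "aeg C (%R. f R ~= 0)" using 1(5) G by eventually_elim auto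
  then show ?thesis ..
 qed
qed

lemma ratl_inverse:
 assumes "irr C" "ratl C f" shows "ratl C (%R. inverse (f R))"
 using ratl_dich[OF assms]
proof
 assume "aeg C (%R. f R = 0)"
 then have "aeg C (%R. inverse (f R) = 0)" by eventually_elim simp
 then show ?thesis using ratl_cong[OF ratl_const[OF assms(1), of 0]] by simp
next
 assume "aeg C (%R. f R ~= 0)"
 then have "aeg C (%R. R \<in> C & f R ~= 0 & reg C R f (f R))"
  using ratl_reg[OF assms] by eventually_elim auto
 from gen_ex[OF assms(1) this] show ?thesis using reg_inverse[OF assms(1)] reg_imp_ratl by blast
qed

lemma ratl_power: "irr C ==> ratl C f ==> ratl C (%R. f R ^ n)"
 by (induction n) (auto intro: ratl_mult ratl_const)

lemma ratl_sum: "irr C ==> (!!i. i \<in> A ==> ratl C (f i)) ==> ratl C (%R. \<Sum>i\<in>A. f i R)"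
 by (induction A rule: infinite_finite_induct) (auto intro: ratl_add ratl_const)

lemma ratl_prod: "irr C ==> (!!i. i \<in> A ==> ratl C (f i)) ==> ratl C (%R. \<Prod>i\<in>A. f i R)"
 by (induction A rule: infinite_finite_induct) (auto intro: ratl_mult ratl_const)

lemma ratl_dich_eq: "irr C ==> ratl C f ==> ratl C g ==> (\<forall>\<^sub>F R in gen C. f R = g R) \<or> (\<forall>\<^sub>F R in gen C. f R ~= g R)"
 using ratl_dich[of C "%R. f R - g R"] ratl_diff[of C f g] by simp

lemma ratl_form: "irr C ==> hmg d F ==> hmg d G ==> ratl C (%R. peval F R / peval G R)"
proof (cases "\<forall>R\<in>C. peval G R = 0")
 case True
 assume i: "irr C"
 have "aeg C (%R. peval F R / peval G R = 0)" using gen_in[OF i] by eventually_elim (use True in auto)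
 then show ?thesis using ratl_cong[OF ratl_const[OF i, of 0]] by simp
next
 case False
 assume "hmg d F" "hmg d G"
 then show ?thesis using False by (auto intro!: ratlI[of d F G])
qed

section \<open>The function field\<close>

lemma map_leI: "(!!x y. f x = Some y ==> g x = Some y) ==> f \<subseteq>\<^sub>m g"
 unfolding map_le_def dom_def by force

text \<open>The representative with the largest domain: it is defined wherever \<open>f\<close>
  extends, with the extended value, whatever \<open>f\<close> itself does there. It translates
  functions up to generic equality into elements of \<open>function_field\<close>.\<close>

definition cls :: "('k::field, 'n::finite) proj set => (('k, 'n) proj => 'k) => (('k, 'n) proj \<rightharpoonup> 'k)" where
 "cls C f = (%R. if R \<in> C & (EX a. reg C R f a) then Some (THE a. reg C R f a) else None)"

lemma cls_eq_Some_iff: "irr C ==> cls C f R = Some a \<longleftrightarrow> R \<in> C & reg C R f a"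
proof -
 assume i: "irr C"
 have "(THE a. reg C R f a) = b" if "R \<in> C" "reg C R f b" for b
  using reg_unique[OF i] that by blast
 then show ?thesis by (auto simp: cls_def)
qed

lemma dom_cls: "dom (cls C f) = {R\<in>C. EX a. reg C R f a}"
 by (auto simp: cls_def dom_def)

lemma cls_cong: "\<forall>\<^sub>F R in gen C. f R = g R ==> cls C f = cls C g"
proof -
 assume e: "aeg C (%R. f R = g R)"
 then have e': "aeg C (%R. g R = f R)" by eventually_elim simp
 have "reg C R f a = reg C R g a" for R a
  using reg_cong[OF _ e] reg_cong[OF _ e'] by blast
 then show ?thesis by (simp add: cls_def cong: if_cong)
qed

lemma cls_generic:
 assumes "irr C" "ratl C f" shows "aeg C (%R. cls C f R = Some (f R))"
 using ratl_reg[OF assms] by eventually_elim (simp add: cls_eq_Some_iff[OF assms(1)])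

lemma cls_eq_iff:
 assumes "irr C" "ratl C f" "ratl C g"
 shows "cls C f = cls C g \<longleftrightarrow> (\<forall>\<^sub>F R in gen C. f R = g R)"
proof
 assume "cls C f = cls C g"
 then show "aeg C (%R. f R = g R)"
  using cls_generic[OF assms(1,2)] cls_generic[OF assms(1,3)] by - (erule (1) eventually_elim2, simp)
qed (rule cls_cong)

lemma regular_fun_cls:
 assumes i: "irr C" shows "regular_fun C (cls C f)"
proof -
 have *: "EX F G d. hmg d F & hmg d G & peval G P ~= 0 &
  (\<forall>R\<in>C. peval G R ~= 0 --> cls C f R = Some (peval F R / peval G R))" if P: "P \<in> dom (cls C f)" for P
 proof -
  obtain a where "reg C P f a" using P unfolding dom_cls by blast
  then obtain F G d where 1: "hmg d F" "hmg d G" "peval G P ~= 0"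
   "aeg C (%R. f R = peval F R / peval G R)" unfolding reg_def by blast
  then have "\<forall>R\<in>C. peval G R ~= 0 --> cls C f R = Some (peval F R / peval G R)"
   by (auto simp: cls_eq_Some_iff[OF i] intro: regI)
  with 1 show ?thesis by blast
 qed
 have sub: "dom (cls C f) \<subseteq> C" by (auto simp: dom_cls)
 have "EX G d. hmg d G & peval G P ~= 0 & (\<forall>R\<in>C. peval G R ~= 0 --> R \<in> dom (cls C f))"
  if "P \<in> dom (cls C f)" for P
  using *[OF that] by blast
 then have o: "openin (subtopology zariski C) (dom (cls C f))"
  unfolding openin_zariski_sub using sub by blast
 show ?thesis unfolding regular_fun_def
 proof (intro conjI ballI o)
  fix P assume P: "P \<in> dom (cls C f)"
  obtain F G d where 1: "hmg d F" "hmg d G" "peval G P ~= 0"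
  "\<forall>R\<in>C. peval G R ~= 0 --> cls C f R = Some (peval F R / peval G R)" using *[OF P] by blast
  show "EX U d F G. P \<in> U & U \<subseteq> dom (cls C f) & openin (subtopology zariski C) U &
   hmg d F & hmg d G &
   (\<forall>R\<in>U. peval G R ~= 0 & cls C f R = Some (peval F R / peval G R))"
   by (rule exI[of _ "{R\<in>C. peval G R ~= 0}"], rule exI[of _ d], rule exI[of _ F], rule exI[of _ G])
   (use 1 P sub openin_basic[OF 1(2)] in auto)
 qed
qed

lemma regular_fun_reg:
 assumes i: "irr C" and f: "regular_fun C f" "P \<in> dom f"
 shows "P \<in> C" "reg C P (%R. the (f R)) (the (f P))"
proof -
 obtain U d F G where 1: "P \<in> U" "U \<subseteq> dom f" "openin (subtopology zariski C) U"
   "hmg d F" "hmg d G" "\<forall>R\<in>U. peval G R ~= 0 & f R = Some (peval F R / peval G R)"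
  using f unfolding regular_fun_def by blast
 have U: "aeg C (%R. R \<in> U)" using gen_open[OF i 1(3)] 1(1) by blast
 then have "aeg C (%R. the (f R) = peval F R / peval G R)" by eventually_elim (use 1(6) in auto)
 then show "reg C P (%R. the (f R)) (the (f P))" using 1 by (intro regI[of d F G]) auto
 show "P \<in> C" using 1(1,3) openin_subset topspace_zariski_sub by blast
qed

lemma regular_fun_dom: "irr C ==> regular_fun C f ==> dom f ~= {} ==> \<forall>\<^sub>F R in gen C. R \<in> dom f"
 by (rule gen_open) (auto simp: regular_fun_def)

lemma regular_fun_le_cls:
 assumes i: "irr C" and f: "regular_fun C f"
 shows "f \<subseteq>\<^sub>m cls C (%R. the (f R))"
proof (rule map_leI)
 fix P a assume "f P = Some a"
 then show "cls C (%R. the (f R)) P = Some a"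
  using regular_fun_reg[OF i f, of P] by (force simp: cls_eq_Some_iff[OF i] dom_def)
qed

lemma regular_fun_le_unique:
 assumes i: "irr C" and g: "regular_fun C g" and f: "f \<subseteq>\<^sub>m g" "aeg C (%R. f R = Some (h R))"
 shows "g \<subseteq>\<^sub>m cls C h"
proof -
 have "aeg C (%R. the (g R) = h R)" using f(2)
  by eventually_elim (use f(1) in \<open>force simp: map_le_def dom_def\<close>)
 then show ?thesis using regular_fun_le_cls[OF i g] cls_cong by fastforce
qed

lemma cls_maximal:
 assumes i: "irr C" and f: "ratl C f" and g: "regular_fun C g" "cls C f \<subseteq>\<^sub>m g"
 shows "g = cls C f"
 using regular_fun_le_unique[OF i g cls_generic[OF i f]] g(2) by (rule map_le_antisym)

lemma cls_in_rational_funs: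
 assumes i: "irr C" and f: "ratl C f"
 shows "cls C f \<in> rational_funs C"
proof -
 have "dom (cls C f) ~= {}" using gen_ex[OF i cls_generic[OF i f]] by auto
 then show ?thesis unfolding rational_funs_def using regular_fun_cls[OF i] cls_maximal[OF i f] by blast
qed

lemma regular_fun_ratl:
 assumes i: "irr C" and f: "regular_fun C f" "dom f ~= {}"
 shows "ratl C (%R. the (f R))"
 using regular_fun_reg[OF i f(1)] f(2) reg_imp_ratl by blast

lemma rational_funs_cls:
 assumes i: "irr C" and f: "f \<in> rational_funs C"
 shows "ratl C (%R. the (f R))" "f = cls C (%R. the (f R))"
proof -
 have 1: "regular_fun C f" "dom f ~= {}" "!!g. regular_fun C g ==> f \<subseteq>\<^sub>m g ==> g = f"
  using f unfolding rational_funs_def by auto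
 show "ratl C (%R. the (f R))" using regular_fun_ratl[OF i 1(1,2)] .
 show "f = cls C (%R. the (f R))"
  using 1(3)[OF regular_fun_cls[OF i] regular_fun_le_cls[OF i 1(1)]] by simp
qed

lemma rational_funs_eq: "irr C ==> rational_funs C = {cls C f | f. ratl C f}"
 using rational_funs_cls cls_in_rational_funs by blast

lemma rational_class_eq:
 assumes i: "irr C" and e: "aeg C (%R. f R = Some (h R))" and r: "ratl C h"
  and sub: "f \<subseteq>\<^sub>m cls C h"
 shows "rational_class C f = cls C h"
 unfolding rational_class_def
proof (rule the_equality)
 show "cls C h \<in> rational_funs C & f \<subseteq>\<^sub>m cls C h" using cls_in_rational_funs[OF i r] sub by blast
 fix g assume g: "g \<in> rational_funs C & f \<subseteq>\<^sub>m g"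
 then have 1: "regular_fun C g" "!!g'. regular_fun C g' ==> g \<subseteq>\<^sub>m g' ==> g' = g"
  unfolding rational_funs_def by auto
 have "g \<subseteq>\<^sub>m cls C h" using regular_fun_le_unique[OF i 1(1) _ e] g by blast
 then show "g = cls C h" using 1(2)[OF regular_fun_cls[OF i]] by blast
qed

abbreviation FF :: "('k::field, 'n::finite) proj set => (('k, 'n) proj \<rightharpoonup> 'k) ring" where
 "FF \<equiv> function_field"

lemma carrier_FF: "irr C ==> carrier (FF C) = {cls C f | f. ratl C f}"
 by (simp add: function_field_def rational_funs_eq)

lemma cls_in_carrier [intro]: "irr C ==> ratl C f ==> cls C f \<in> carrier (FF C)"
 by (auto simp: carrier_FF)

lemma pointwise_cls:
 assumes i: "irr C" and f: "ratl C f" "ratl C g" and h: "ratl C (%R. ph (f R) (g R))"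
  and reg: "!!P a b. P \<in> C ==> reg C P f a ==> reg C P g b ==> reg C P (%R. ph (f R) (g R)) (ph a b)"
 shows "rational_class C (pointwise ph (cls C f) (cls C g)) = cls C (%R. ph (f R) (g R))"
proof (rule rational_class_eq[OF i _ h])
 show "aeg C (%R. pointwise ph (cls C f) (cls C g) R = Some (ph (f R) (g R)))"
  using cls_generic[OF i f(1)] cls_generic[OF i f(2)] by eventually_elim (simp add: pointwise_def domIff)
 show "pointwise ph (cls C f) (cls C g) \<subseteq>\<^sub>m cls C (%R. ph (f R) (g R))"
 proof (rule map_leI)
  fix P c assume c: "pointwise ph (cls C f) (cls C g) P = Some c"
  then obtain a b where ab: "cls C f P = Some a" "cls C g P = Some b"
   by (auto simp: pointwise_def split: if_splits)
  with c have "c = ph a b" by (auto simp: pointwise_def domIff)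
  then show "cls C (%R. ph (f R) (g R)) P = Some c"
   using ab reg by (simp add: cls_eq_Some_iff[OF i])
 qed
qed

lemma FF_mult: "irr C ==> ratl C f ==> ratl C g ==> cls C f \<otimes>\<^bsub>FF C\<^esub> cls C g = cls C (%R. f R * g R)"
 by (simp add: function_field_def pointwise_cls ratl_mult reg_mult)

lemma FF_add: "irr C ==> ratl C f ==> ratl C g ==> cls C f \<oplus>\<^bsub>FF C\<^esub> cls C g = cls C (%R. f R + g R)"
 by (simp add: function_field_def pointwise_cls ratl_add reg_add)

lemma const_fun_cls: "irr C ==> const_fun C c = cls C (%_. c)"
proof
 fix R assume "irr C"
 then show "const_fun C c R = cls C (%_. c) R"
  using cls_eq_Some_iff[of C "%_. c" R c] reg_const[of C R c]
  by (cases "R \<in> C") (simp_all add: const_fun_def, simp add: cls_def)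
qed

lemma FF_one: "irr C ==> \<one>\<^bsub>FF C\<^esub> = cls C (%_. 1)"
 by (simp add: function_field_def const_fun_cls)

lemma FF_zero: "irr C ==> \<zero>\<^bsub>FF C\<^esub> = cls C (%_. 0)"
 by (simp add: function_field_def const_fun_cls)

lemma cls_eq_zero_iff: "irr C ==> ratl C f ==> cls C f = \<zero>\<^bsub>FF C\<^esub> \<longleftrightarrow> (\<forall>\<^sub>F R in gen C. f R = 0)"
 using cls_eq_iff[OF _ _ ratl_const, of C f 0] by (simp add: FF_zero)

lemma FF_cases:
 assumes "irr C" "x \<in> carrier (FF C)"
 obtains f where "ratl C f" "x = cls C f"
 using assms by (auto simp: carrier_FF)

lemma field_FF:
 assumes i: "irr C" shows "field (FF C)"
proof -
 note simps = FF_mult[OF i] FF_add[OF i] FF_one[OF i] FF_zero[OF i]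
 note rs = ratl_mult[OF i] ratl_add[OF i] ratl_const[OF i]
 have cr: "cring (FF C)"
 proof (rule cringI)
  show "abelian_group (FF C)"
  proof (rule abelian_groupI)
   fix x y assume "x \<in> carrier (FF C)" "y \<in> carrier (FF C)"
   then show "x \<oplus>\<^bsub>FF C\<^esub> y \<in> carrier (FF C)" by (elim FF_cases[OF i]) (auto simp: simps rs i)
   show "x \<oplus>\<^bsub>FF C\<^esub> y = y \<oplus>\<^bsub>FF C\<^esub> x" using \<open>x \<in> _\<close> \<open>y \<in> _\<close>
   by (elim FF_cases[OF i]) (auto simp: simps rs add.commute)
  next
   fix x y z assume "x \<in> carrier (FF C)" "y \<in> carrier (FF C)" "z \<in> carrier (FF C)"
   then show "x \<oplus>\<^bsub>FF C\<^esub> y \<oplus>\<^bsub>FF C\<^esub> z = x \<oplus>\<^bsub>FF C\<^esub> (y \<oplus>\<^bsub>FF C\<^esub> z)"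
   by (elim FF_cases[OF i]) (auto simp: simps rs add.assoc)
  next
   fix x assume "x \<in> carrier (FF C)"
   then show "\<zero>\<^bsub>FF C\<^esub> \<oplus>\<^bsub>FF C\<^esub> x = x" by (elim FF_cases[OF i]) (auto simp: simps rs)
   obtain f where f: "ratl C f" "x = cls C f" using \<open>x \<in> _\<close> by (elim FF_cases[OF i]) auto
   show "\<exists>y\<in>carrier (FF C). y \<oplus>\<^bsub>FF C\<^esub> x = \<zero>\<^bsub>FF C\<^esub>"
   by (rule bexI[of _ "cls C (%R. - f R)"]) (auto simp: f simps rs ratl_uminus i)
  qed (auto simp: simps rs i)
  show "Group.comm_monoid (FF C)"
  proof (rule comm_monoidI)
   fix x y assume "x \<in> carrier (FF C)" "y \<in> carrier (FF C)"
   then show "x \<otimes>\<^bsub>FF C\<^esub> y \<in> carrier (FF C)" by (elim FF_cases[OF i]) (auto simp: simps rs i)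
   show "x \<otimes>\<^bsub>FF C\<^esub> y = y \<otimes>\<^bsub>FF C\<^esub> x" using \<open>x \<in> _\<close> \<open>y \<in> _\<close>
   by (elim FF_cases[OF i]) (auto simp: simps rs mult.commute)
  next
   fix x y z assume "x \<in> carrier (FF C)" "y \<in> carrier (FF C)" "z \<in> carrier (FF C)"
   then show "x \<otimes>\<^bsub>FF C\<^esub> y \<otimes>\<^bsub>FF C\<^esub> z = x \<otimes>\<^bsub>FF C\<^esub> (y \<otimes>\<^bsub>FF C\<^esub> z)"
   by (elim FF_cases[OF i]) (auto simp: simps rs mult.assoc)
  next
   fix x assume "x \<in> carrier (FF C)"
   then show "\<one>\<^bsub>FF C\<^esub> \<otimes>\<^bsub>FF C\<^esub> x = x" by (elim FF_cases[OF i]) (auto simp: simps rs)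
  qed (auto simp: simps rs i)
  fix x y z assume "x \<in> carrier (FF C)" "y \<in> carrier (FF C)" "z \<in> carrier (FF C)"
  then show "(x \<oplus>\<^bsub>FF C\<^esub> y) \<otimes>\<^bsub>FF C\<^esub> z = x \<otimes>\<^bsub>FF C\<^esub> z \<oplus>\<^bsub>FF C\<^esub> y \<otimes>\<^bsub>FF C\<^esub> z"
   by (elim FF_cases[OF i]) (auto simp: simps rs distrib_right)
 qed
 then interpret cring "FF C" .
 show ?thesis
 proof (rule cring_fieldI2)
  show "\<zero>\<^bsub>FF C\<^esub> ~= \<one>\<^bsub>FF C\<^esub>"
   using cls_eq_iff[OF i ratl_const[OF i] ratl_const[OF i], of 0 1] gen_const[OF i] by (simp add: simps)
  fix x assume "x \<in> carrier (FF C)" "x ~= \<zero>\<^bsub>FF C\<^esub>"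
  then obtain f where f: "ratl C f" "x = cls C f" by (elim FF_cases[OF i]) auto
  with \<open>x ~= _\<close> have ne: "aeg C (%R. f R ~= 0)" using cls_eq_zero_iff[OF i f(1)] ratl_dich[OF i f(1)] by auto
  show "\<exists>y\<in>carrier (FF C). x \<otimes>\<^bsub>FF C\<^esub> y = \<one>\<^bsub>FF C\<^esub>"
  proof (rule bexI[of _ "cls C (%R. inverse (f R))"])
   show "x \<otimes>\<^bsub>FF C\<^esub> cls C (%R. inverse (f R)) = \<one>\<^bsub>FF C\<^esub>"
   unfolding f(2) FF_mult[OF i f(1) ratl_inverse[OF i f(1)]] FF_one[OF i]
   by (rule cls_cong) (use ne in \<open>eventually_elim, simp\<close>)
  qed (use f ratl_inverse[OF i] i in auto)
 qed
qed

lemma FF_uminus: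
 assumes i: "irr C" and f: "ratl C f" shows "\<ominus>\<^bsub>FF C\<^esub> cls C f = cls C (%R. - f R)"
proof -
 interpret field "FF C" by (rule field_FF[OF i])
 have "cls C (%R. - f R) \<oplus>\<^bsub>FF C\<^esub> cls C f = \<zero>\<^bsub>FF C\<^esub>"
  by (simp add: FF_add[OF i ratl_uminus[OF i f] f] FF_zero[OF i])
 then show ?thesis using minus_equality cls_in_carrier[OF i f] cls_in_carrier[OF i ratl_uminus[OF i f]] by blast
qed

lemma FF_inv:
 assumes i: "irr C" and f: "ratl C f" and ne: "aeg C (%R. f R ~= 0)"
 shows "inv\<^bsub>FF C\<^esub> cls C f = cls C (%R. inverse (f R))"
proof -
 interpret field "FF C" by (rule field_FF[OF i])
 have "cls C f \<otimes>\<^bsub>FF C\<^esub> cls C (%R. inverse (f R)) = \<one>\<^bsub>FF C\<^esub>"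
   unfolding FF_mult[OF i f ratl_inverse[OF i f]] FF_one[OF i]
   by (rule cls_cong) (use ne in \<open>eventually_elim, simp\<close>)
 then show ?thesis using comm_inv_char cls_in_carrier[OF i f] cls_in_carrier[OF i ratl_inverse[OF i f]] by blast
qed

lemma FF_nat_pow:
 assumes i: "irr C" and f: "ratl C f" shows "cls C f [^]\<^bsub>FF C\<^esub> (n::nat) = cls C (%R. f R ^ n)"
proof (induction n)
 case 0 then show ?case by (simp add: FF_one[OF i])
next
 case (Suc n)
 then show ?case by (simp add: FF_mult[OF i ratl_power[OF i f] f] mult.commute)
qed

lemma ratl_power_int:
 assumes i: "irr C" and f: "ratl C f" shows "ratl C (%R. f R powi n)"
 unfolding power_int_def using ratl_power[OF i f] ratl_inverse[OF i ratl_power[OF i f]]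
 by (cases "0 \<le> n") (simp_all add: power_inverse)

lemma FF_int_pow:
 assumes i: "irr C" and f: "ratl C f" and ne: "aeg C (%R. f R ~= 0)"
 shows "cls C f [^]\<^bsub>FF C\<^esub> (n::int) = cls C (%R. f R powi n)"
proof (cases "n \<ge> 0")
 case True
 then have "cls C f [^]\<^bsub>FF C\<^esub> n = cls C f [^]\<^bsub>FF C\<^esub> nat n" by (subst int_pow_def2) simp
 then show ?thesis using True unfolding FF_nat_pow[OF i f] by (simp add: power_int_def)
next
 case False
 have "aeg C (%R. f R ^ nat (- n) ~= 0)" using ne by eventually_elim simp
 note inv = FF_inv[OF i ratl_power[OF i f] this]
 have "cls C f [^]\<^bsub>FF C\<^esub> n = inv\<^bsub>FF C\<^esub> (cls C f [^]\<^bsub>FF C\<^esub> nat (- n))"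
  using False by (subst int_pow_def2) simp
 then show ?thesis using False unfolding FF_nat_pow[OF i f] inv by (simp add: power_int_def power_inverse)
qed

lemma subfield_constants:
 assumes i: "irr C" shows "subfield (constants C) (FF C)"
proof -
 interpret field "FF C" by (rule field_FF[OF i])
 note simps = FF_mult[OF i ratl_const[OF i] ratl_const[OF i]] FF_add[OF i ratl_const[OF i] ratl_const[OF i]] FF_one[OF i] FF_zero[OF i]
  FF_uminus[OF i ratl_const[OF i]]
 have c: "constants C = {cls C (%_. c) | c. True}" by (auto simp: constants_def const_fun_cls[OF i])
 show ?thesis
 proof (rule subfieldI', rule subringI)
  show "constants C \<subseteq> carrier (FF C)" by (auto simp: c i ratl_const)
  fix x assume x: "x \<in> constants C - {\<zero>\<^bsub>FF C\<^esub>}"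
  then obtain a where a: "x = cls C (%_. a)" "a ~= 0" by (auto simp: c simps)
  then have "aeg C (%R. a ~= 0)" by simp
  from FF_inv[OF i ratl_const[OF i] this] show "inv\<^bsub>FF C\<^esub> x \<in> constants C" using a by (auto simp: c)
 qed (auto simp: c simps)
qed

section \<open>Morphisms\<close>

text \<open>The generically defined map \<open>ph\<close> extends to \<open>P\<close> with value \<open>y\<close>.\<close>

definition mor_at :: "('k::field, 'n::finite) proj set => ('k, 'n) proj =>
  (('k, 'n) proj => ('k, 'm::finite) proj) => ('k, 'm) proj => bool" where
 "mor_at C P ph y \<longleftrightarrow> (EX F d. (ALL j. hmg d (F j)) & (EX j. peval (F j) P ~= 0) &
  y = abs_proj (\<chi> j. peval (F j) P) & (\<forall>\<^sub>F R in gen C. ph R = abs_proj (\<chi> j. peval (F j) R)))"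

text \<open>Phrased with filters, dominance is what pulling back generic identities requires:
  nonempty open subsets of \<open>Y\<close> have generic preimages.\<close>

abbreviation dominant :: "('k::field, 'n::finite) proj set => ('k, 'm::finite) proj set =>
  (('k, 'n) proj => ('k, 'm) proj) => bool" where
 "dominant C Y ph \<equiv> filterlim ph (gen Y) (gen C)"

lemma dominantD: "dominant C Y ph ==> \<forall>\<^sub>F y in gen Y. Q y ==> \<forall>\<^sub>F R in gen C. Q (ph R)"
 by (rule eventually_compose_filterlim)

lemma vec_nonzero: "peval (F j) R ~= 0 ==> (\<chi> j. peval (F j) R) ~= 0"
 by (metis vec_lambda_beta zero_index)

lemma mor_atI: "(!!j. hmg d (F j)) ==> peval (F j) P ~= 0 ==> y = abs_proj (\<chi> j. peval (F j) P) ==>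
  \<forall>\<^sub>F R in gen C. ph R = abs_proj (\<chi> j. peval (F j) R) ==> mor_at C P ph y"
 unfolding mor_at_def by blast

lemma mor_atI': "(!!j. hmg d (F j)) ==> (\<chi> j. peval (F j) P) ~= 0 ==> y = abs_proj (\<chi> j. peval (F j) P) ==>
  \<forall>\<^sub>F R in gen C. ph R = abs_proj (\<chi> j. peval (F j) R) ==> mor_at C P ph y"
 using mor_atI[of d F _ P y ph C] by (auto simp: vec_eq_iff)

lemma mor_atE:
 assumes "mor_at C P ph y" "irr C" "P \<in> C"
 obtains F d where "!!j. hmg d (F j)" "(\<chi> j. peval (F j) P) ~= 0"
  "y = abs_proj (\<chi> j. peval (F j) P)"
  "aeg C (%R. R \<in> C & (\<chi> j. peval (F j) R) ~= 0 & ph R = abs_proj (\<chi> j. peval (F j) R))"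
proof -
 obtain F d j where 1: "!!j. hmg d (F j)" "peval (F j) P ~= 0" "y = abs_proj (\<chi> j. peval (F j) P)"
  "aeg C (%R. ph R = abs_proj (\<chi> j. peval (F j) R))"
  using assms(1) unfolding mor_at_def by blast
 have "aeg C (%R. R \<in> C & (\<chi> j. peval (F j) R) ~= 0 & ph R = abs_proj (\<chi> j. peval (F j) R))"
  using 1(4) gen_basic[OF assms(2) 1(1) assms(3) 1(2)] by eventually_elim (metis vec_nonzero)
 then show ?thesis using that[OF 1(1) vec_nonzero[where F = F, OF 1(2)] 1(3)] by blast
qed

text \<open>Different values at \<open>P\<close> differ in some two by two minor, which is a form
  nonzero at \<open>P\<close> and therefore generically. It yields both the uniqueness of extensions
  and the dichotomy that two morphisms agree everywhere or differ generically.\<close>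

lemma mor_at_cross:
 assumes i: "irr C" "P \<in> C" and m: "mor_at C P ph y" "mor_at C P ph' y'" and ne: "y ~= y'"
 shows "aeg C (%R. ph R ~= ph' R)"
proof -
 obtain F d where 1: "!!j. hmg d (F j)" "(\<chi> j. peval (F j) P) ~= 0"
  "y = abs_proj (\<chi> j. peval (F j) P)"
  "aeg C (%R. R \<in> C & (\<chi> j. peval (F j) R) ~= 0 & ph R = abs_proj (\<chi> j. peval (F j) R))"
  by (rule mor_atE[OF m(1) i]) blast
 obtain F' d' where 2: "!!j. hmg d' (F' j)" "(\<chi> j. peval (F' j) P) ~= 0"
  "y' = abs_proj (\<chi> j. peval (F' j) P)"
  "aeg C (%R. R \<in> C & (\<chi> j. peval (F' j) R) ~= 0 & ph' R = abs_proj (\<chi> j. peval (F' j) R))"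
  by (rule mor_atE[OF m(2) i]) blast
 from ne obtain a b where ab: "peval (F a) P * peval (F' b) P ~= peval (F b) P * peval (F' a) P"
  unfolding 1(3) 2(3) abs_proj_eq_cross[OF 1(2) 2(2)] by auto
 have h: "hmg (d + d') (F a * F' b - F b * F' a)"
  by (intro homogeneous_diff homogeneous_mult 1 2)
 have "aeg C (%R. peval (F a * F' b - F b * F' a) R ~= 0)"
  using gen_basic[OF i(1) h i(2)] ab by (auto simp: peval_simps elim: eventually_mono)
 then show ?thesis using 1(4) 2(4)
 proof eventually_elim
  case (elim R)
  then have "ph R = abs_proj (\<chi> j. peval (F j) R)" "ph' R = abs_proj (\<chi> j. peval (F' j) R)" by auto
  moreover have "abs_proj (\<chi> j. peval (F j) R) ~= abs_proj (\<chi> j. peval (F' j) R)"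
   using elim by (subst abs_proj_eq_cross) (auto simp: peval_simps)
  ultimately show ?case by simp
 qed
qed

lemma mor_at_unique:
 "irr C ==> P \<in> C ==> mor_at C P ph y ==> mor_at C P ph' y' ==> \<forall>\<^sub>F R in gen C. ph R = ph' R ==> y = y'"
 using mor_at_cross[of C P ph y ph' y'] gen_False[of C "%R. ph R = ph' R"] by blast

lemma morphism_mor_at:
 assumes i: "irr C" and m: "morphism C Y ph" and P: "P \<in> C"
 shows "mor_at C P ph (ph P)"
proof -
 obtain U d F where 1: "P \<in> U" "openin (subtopology zariski C) U" "ALL j. hmg d (F j)"
   "\<forall>R\<in>U. (EX j. peval (F j) R ~= 0) & ph R = abs_proj (\<chi> j. peval (F j) R)"
  using m P unfolding morphism_def by blast
 have "aeg C (%R. R \<in> U)" using gen_open[OF i 1(2)] 1(1) by blast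
 then have "aeg C (%R. ph R = abs_proj (\<chi> j. peval (F j) R))" by eventually_elim (use 1(4) in auto)
 then show ?thesis unfolding mor_at_def using 1 by blast
qed

text \<open>The generic description \<open>ph'\<close> is kept apart from the total map
  \<open>ph\<close>, so that a map given by formulas on an open set can be extended point by
  point.\<close>

lemma morphismI:
 assumes i: "irr C" and m: "!!P. P \<in> C ==> mor_at C P ph' (ph P)" and Y: "ph ` C \<subseteq> Y"
 shows "morphism C Y ph"
 unfolding morphism_def
proof (intro conjI ballI Y)
 fix P assume P: "P \<in> C"
 obtain F d j where 1: "!!j. hmg d (F j)" "peval (F j) P ~= 0"
  "aeg C (%R. ph' R = abs_proj (\<chi> j. peval (F j) R))"
  using m[OF P] unfolding mor_at_def by blast
 let ?U = "{R\<in>C. peval (F j) R ~= 0}"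
 have "ph R = abs_proj (\<chi> j. peval (F j) R)" if "R \<in> ?U" for R
  using mor_at_unique[OF i _ m mor_atI[OF 1(1) _ refl 1(3)], of R j] that by auto
 then show "EX U d F. P \<in> U & openin (subtopology zariski C) U & (ALL j. hmg d (F j)) &
   (\<forall>R\<in>U. (EX j. peval (F j) R ~= 0) & ph R = abs_proj (\<chi> j. peval (F j) R))"
  using openin_basic[OF 1(1), of C j] 1 P by (intro exI[of _ ?U] exI[of _ d] exI[of _ F]) auto
qed

lemma morphism_eq:
 assumes i: "irr C" and m: "morphism C Y ph" "morphism C Y' ph'" and e: "aeg C (%R. ph R = ph' R)" and P: "P \<in> C"
 shows "ph P = ph' P"
 using mor_at_unique[OF i P morphism_mor_at[OF i m(1) P] morphism_mor_at[OF i m(2) P] e] .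

lemma morphism_dich:
 assumes i: "irr C" and m: "morphism C Y ph" "morphism C Y' ph'"
 shows "(\<forall>R\<in>C. ph R = ph' R) \<or> (\<forall>\<^sub>F R in gen C. ph R ~= ph' R)"
 using mor_at_cross[OF i _ morphism_mor_at[OF i m(1)] morphism_mor_at[OF i m(2)]] by blast

lemma mor_at_form:
 assumes i: "irr C" "P \<in> C" and m: "mor_at C P ph y" and F: "hmg d F" "peval F y ~= 0"
 shows "aeg C (%R. peval F (ph R) ~= 0)"
proof -
 obtain H e where 1: "!!j. hmg e (H j)" "(\<chi> j. peval (H j) P) ~= 0"
  "y = abs_proj (\<chi> j. peval (H j) P)"
  "aeg C (%R. R \<in> C & (\<chi> j. peval (H j) R) ~= 0 & ph R = abs_proj (\<chi> j. peval (H j) R))"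
  by (rule mor_atE[OF m i]) blast
 have s: "peval (subst_mpoly F H) R ~= 0 \<longleftrightarrow> peval F (abs_proj (\<chi> j. peval (H j) R)) ~= 0"
  if "(\<chi> j. peval (H j) R) ~= 0" for R
  using peval_abs_eq_0_iff[OF F(1) that] by (simp add: peval_def eval_subst)
 have "peval (subst_mpoly F H) P ~= 0" using F(2) 1(2,3) s by simp
 from gen_basic[OF i(1) homogeneous_subst[OF F(1) 1(1)] i(2) this] 1(4)
 show ?thesis by eventually_elim (auto simp: s)
qed

lemma dominantI:
 assumes i: "irr C" "irr Y" and m: "!!y. y \<in> Y ==> \<exists>P\<in>C. mor_at C P ph y" and Y: "aeg C (%R. ph R \<in> Y)"
 shows "dominant C Y ph"
 unfolding filterlim_iff
proof (intro allI impI)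
 fix Q assume "aeg Y (%y. Q y)"
 then obtain F d y where F: "hmg d F" "y \<in> Y" "peval F y ~= 0" "\<forall>y\<in>Y. peval F y ~= 0 --> Q y"
  unfolding eventually_gen[OF i(2)] by blast
 obtain P where "P \<in> C" "mor_at C P ph y" using m[OF F(2)] by blast
 from mor_at_form[OF i(1) this F(1,3)] Y show "aeg C (%R. Q (ph R))"
  by eventually_elim (use F(4) in auto)
qed

lemma irr_image:
 assumes i: "irr C" and m: "morphism C Y ph"
 shows "irr (ph ` C)"
 unfolding irr_def
proof (intro conjI allI impI)
 show "ph ` C ~= {}" using i unfolding irr_def by blast
 fix F G d e assume h: "hmg d F" "hmg e G" "\<exists>P\<in>ph ` C. peval F P ~= 0" "\<exists>P\<in>ph ` C. peval G P ~= 0"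
 have "aeg C (%R. peval F (ph R) ~= 0)"
  using h(3) mor_at_form[OF i _ morphism_mor_at[OF i m] h(1)] by blast
 moreover have "aeg C (%R. peval G (ph R) ~= 0)"
  using h(4) mor_at_form[OF i _ morphism_mor_at[OF i m] h(2)] by blast
 ultimately have "aeg C (%R. R \<in> C & peval F (ph R) ~= 0 & peval G (ph R) ~= 0)"
  using gen_in[OF i] by eventually_elim simp
 from gen_ex[OF i this] show "\<exists>P\<in>ph ` C. peval F P ~= 0 & peval G P ~= 0" by blast
qed

lemma dominant_image:
 assumes i: "irr C" and m: "morphism C Y ph" shows "dominant C (ph ` C) ph"
proof (rule dominantI[OF i irr_image[OF i m]])
 show "!!y. y \<in> ph ` C ==> \<exists>P\<in>C. mor_at C P ph y" using morphism_mor_at[OF i m] by blast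
 show "aeg C (%R. ph R \<in> ph ` C)" using gen_in[OF i] by eventually_elim blast
qed

lemma reg_pull:
 assumes i: "irr C" "P \<in> C" and m: "mor_at C P ph y" "dominant C Y ph" and f: "reg Y y f a"
 shows "reg C P (%R. f (ph R)) a"
proof -
 obtain H e where 1: "!!j. hmg e (H j)" "(\<chi> j. peval (H j) P) ~= 0"
  "y = abs_proj (\<chi> j. peval (H j) P)"
  "aeg C (%R. R \<in> C & (\<chi> j. peval (H j) R) ~= 0 & ph R = abs_proj (\<chi> j. peval (H j) R))"
  by (rule mor_atE[OF m(1) i]) blast
 obtain F G d where F: "hmg d F" "hmg d G" "peval G y ~= 0" "a = peval F y / peval G y"
  "aeg Y (%R. f R = peval F R / peval G R)" using f unfolding reg_def by blast
 have s: "peval (subst_mpoly F H) R / peval (subst_mpoly G H) R =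
  peval F (abs_proj (\<chi> j. peval (H j) R)) / peval G (abs_proj (\<chi> j. peval (H j) R))"
  if "(\<chi> j. peval (H j) R) ~= 0" for R
  using peval_abs_ratio[OF F(1,2) that] by (simp add: peval_def eval_subst)
 show ?thesis
 proof (rule regI[OF homogeneous_subst[OF F(1) 1(1)] homogeneous_subst[OF F(2) 1(1)]])
  show "peval (subst_mpoly G H) P ~= 0"
   using peval_abs_eq_0_iff[OF F(2) 1(2)] F(3) 1(3) by (simp add: peval_def eval_subst)
  show "a = peval (subst_mpoly F H) P / peval (subst_mpoly G H) P" using s[OF 1(2)] F(4) 1(3) by simp
  show "aeg C (%R. f (ph R) = peval (subst_mpoly F H) R / peval (subst_mpoly G H) R)"
   using 1(4) dominantD[OF m(2) F(5)] by eventually_elim (auto simp: s)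
 qed
qed

lemma ratl_pull:
 assumes i: "irr C" "irr Y" and m: "!!P f a. P \<in> C ==> reg Y (ph P) f a ==> reg C P (%R. f (ph R)) a"
  "dominant C Y ph" and f: "ratl Y f"
 shows "ratl C (%R. f (ph R))"
proof -
 have "aeg C (%P. P \<in> C & reg Y (ph P) f (f (ph P)))"
  using dominantD[OF m(2) ratl_reg[OF i(2) f]] gen_in[OF i(1)] by eventually_elim auto
 from gen_ex[OF i(1) this] show ?thesis using m(1) reg_imp_ratl by blast
qed

lemma morphism_reg_pull:
 assumes i: "irr C" and m: "morphism C Z ph" "dominant C Y ph" and P: "P \<in> C" and f: "reg Y (ph P) f a"
 shows "reg C P (%R. f (ph R)) a"
 by (rule reg_pull[OF i P morphism_mor_at[OF i m(1) P] m(2) f])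

lemma morphism_ratl_pull:
 assumes i: "irr C" "irr Y" and m: "morphism C Z ph" "dominant C Y ph" and f: "ratl Y f"
 shows "ratl C (%R. f (ph R))"
 by (rule ratl_pull[OF i morphism_reg_pull[OF i(1) m] m(2) f])

lemma pullback_cls:
 assumes i: "irr C" "irr Y" and m: "!!P f a. P \<in> C ==> reg Y (ph P) f a ==> reg C P (%R. f (ph R)) a"
  "dominant C Y ph" and f: "ratl Y f"
  and ps: "!!P. P \<in> C ==> ps P = Some (ph P)"
 shows "pullback C ps (cls Y f) = cls C (%R. f (ph R))"
 unfolding pullback_def
proof (rule rational_class_eq[OF i(1)])
 show "ratl C (%R. f (ph R))" by (rule ratl_pull[OF i m f])
 show "aeg C (%R. (cls Y f \<circ>\<^sub>m ps |` C) R = Some (f (ph R)))"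
  using gen_in[OF i(1)] dominantD[OF m(2) cls_generic[OF i(2) f]]
  by eventually_elim (simp add: map_comp_def ps)
 show "cls Y f \<circ>\<^sub>m ps |` C \<subseteq>\<^sub>m cls C (%R. f (ph R))"
 proof (rule map_leI)
  fix P c assume "(cls Y f \<circ>\<^sub>m ps |` C) P = Some c"
  then have "P \<in> C" "cls Y f (ph P) = Some c"
   by (auto simp: map_comp_def restrict_map_def ps split: if_splits option.splits)
  then show "cls C (%R. f (ph R)) P = Some c"
   using m(1) by (simp add: cls_eq_Some_iff i)
 qed
qed

lemma mor_at_comp:
 assumes i: "irr C" "P \<in> C" and Y: "irr Y" "y \<in> Y" and m: "mor_at C P ph y" "dominant C Y ph" and n: "mor_at Y y ps z"
 shows "mor_at C P (%R. ps (ph R)) z"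
proof -
 obtain H e where 1: "!!j. hmg e (H j)" "(\<chi> j. peval (H j) P) ~= 0"
  "y = abs_proj (\<chi> j. peval (H j) P)"
  "aeg C (%R. R \<in> C & (\<chi> j. peval (H j) R) ~= 0 & ph R = abs_proj (\<chi> j. peval (H j) R))"
  by (rule mor_atE[OF m(1) i]) blast
 obtain F d where F: "!!j. hmg d (F j)" "(\<chi> j. peval (F j) y) ~= 0"
  "z = abs_proj (\<chi> j. peval (F j) y)"
  "aeg Y (%R. R \<in> Y & (\<chi> j. peval (F j) R) ~= 0 & ps R = abs_proj (\<chi> j. peval (F j) R))"
  by (rule mor_atE[OF n Y]) blast
 have s: "abs_proj (\<chi> j. peval (F j) (abs_proj (\<chi> j. peval (H j) R))) = abs_proj (\<chi> j. peval (subst_mpoly (F j) H) R)"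
  if v: "(\<chi> j. peval (H j) R) ~= 0" and w: "(\<chi> j. peval (F j) (abs_proj (\<chi> j. peval (H j) R))) ~= 0" for R
 proof -
  obtain c where c: "c ~= 0" "!!F d. hmg d F ==>
   peval F (abs_proj (\<chi> j. peval (H j) R)) = c ^ d * evm F (\<chi> j. peval (H j) R)"
   using peval_abs[OF F(1) v] by blast
  have eq: "(\<chi> j. peval (F j) (abs_proj (\<chi> j. peval (H j) R))) = c ^ d *s (\<chi> j. peval (subst_mpoly (F j) H) R)"
   using c(2)[OF F(1)] by (simp add: vec_eq_iff peval_def eval_subst)
  with w have "(\<chi> j. peval (subst_mpoly (F j) H) R) ~= 0" by auto
  then show ?thesis unfolding eq using c(1) by (intro abs_proj_scale) auto
 qed
 have v: "(\<chi> j. peval (subst_mpoly (F j) H) P) ~= 0"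
  using peval_abs_eq_0_iff[OF F(1) 1(2)] F(2) 1(3) by (simp add: peval_def eval_subst vec_eq_iff)
 show ?thesis
 proof (rule mor_atI'[where F = "%j. subst_mpoly (F j) H" and d = "d * e", OF _ v])
  show "hmg (d * e) (subst_mpoly (F j) H)" for j by (rule homogeneous_subst[OF F(1) 1(1)])
  show "z = abs_proj (\<chi> j. peval (subst_mpoly (F j) H) P)" using s[OF 1(2)] F(2,3) 1(3) by simp
  show "aeg C (%R. ps (ph R) = abs_proj (\<chi> j. peval (subst_mpoly (F j) H) R))"
   using 1(4) dominantD[OF m(2) F(4)] by eventually_elim (auto simp: s)
 qed
qed

lemma mor_at_self: "mor_at C P (%R. R) P"
proof -
 obtain j where j: "peval (coordv j) P ~= 0" using ex_var_nonzero by blast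
 have "(\<chi> j. peval (coordv j) R) = rep_proj R" for R :: "('a, 'b) proj" by (simp add: vec_eq_iff peval_def)
 then show ?thesis
  by (intro mor_atI[where F = coordv and j = j and d = "Suc 0"]) (simp_all add: j)
qed

section \<open>Automorphisms\<close>

lemma automorphism_simps:
 assumes i: "irr C" and s: "sg \<in> automorphisms C"
 shows "bij_betw sg C C" "morphism C C sg" "!!P. P \<in> C ==> sg P \<in> C" "!!P. P \<in> C ==> mor_at C P sg (sg P)"
  "dominant C C sg" "sg \<in> extensional C"
proof -
 show b: "bij_betw sg C C" and m: "morphism C C sg" and "sg \<in> extensional C"
  using s by (auto simp: automorphisms_def Bij_def)
 show "!!P. P \<in> C ==> sg P \<in> C" using b by (auto simp: bij_betw_def)
 show "!!P. P \<in> C ==> mor_at C P sg (sg P)" by (rule morphism_mor_at[OF i m])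
 show "dominant C C sg" using dominant_image[OF i m] b by (simp add: bij_betw_def)
qed

text \<open>Inverses are recovered from finiteness: translation by an element is injective on
  \<open>G\<close>, so it hits the identity.\<close>

locale aut_group =
 fixes C :: "('k::field, 'n::finite) proj set" and G :: "(('k, 'n) proj => ('k, 'n) proj) set"
 assumes irrC: "irr C" and aut: "G \<subseteq> automorphisms C" and fin: "finite G"
  and one: "(\<lambda>x\<in>C. x) \<in> G" and comp: "!!sg ta. sg \<in> G ==> ta \<in> G ==> compose C sg ta \<in> G"
begin

lemma in_C [simp]: "sg \<in> G ==> P \<in> C ==> sg P \<in> C"
 using automorphism_simps[OF irrC] aut by blast

lemma mor: "sg \<in> G ==> P \<in> C ==> mor_at C P sg (sg P)"
 using automorphism_simps[OF irrC] aut by blast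

lemma morph: "sg \<in> G ==> morphism C C sg"
 using automorphism_simps[OF irrC] aut by blast

lemma domi: "sg \<in> G ==> dominant C C sg"
 using automorphism_simps[OF irrC] aut by blast

lemma inj: "sg \<in> G ==> inj_on sg C"
 using automorphism_simps(1)[OF irrC] aut by (auto simp: bij_betw_def)

lemma ext_eq: "sg \<in> G ==> ta \<in> G ==> (!!P. P \<in> C ==> sg P = ta P) ==> sg = ta"
 using automorphism_simps(6)[OF irrC] aut by (meson extensionalityI subsetD)

lemma bij_left:
 assumes t: "ta \<in> G" shows "bij_betw (%sg. compose C ta sg) G G"
proof -
 have "inj_on (%sg. compose C ta sg) G"
 proof (rule inj_onI)
  fix sg rh assume s: "sg \<in> G" "rh \<in> G" and e: "compose C ta sg = compose C ta rh"
  show "sg = rh"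
  proof (rule ext_eq[OF s])
   fix P assume P: "P \<in> C"
   have "ta (sg P) = ta (rh P)" using fun_cong[OF e, of P] P by (simp add: compose_def)
   then show "sg P = rh P" using inj[OF t] s P by (auto dest: inj_onD)
  qed
 qed
 moreover have "(%sg. compose C ta sg) ` G \<subseteq> G" using comp t by blast
 ultimately show ?thesis using endo_inj_surj[OF fin] by (simp add: bij_betw_def)
qed

lemma ex_inverse:
 assumes t: "ta \<in> G"
 obtains rh where "rh \<in> G" "!!P. P \<in> C ==> ta (rh P) = P" "!!P. P \<in> C ==> rh (ta P) = P"
proof -
 obtain rh where r: "rh \<in> G" "compose C ta rh = (\<lambda>x\<in>C. x)"
  using bij_left[OF t] one by (metis (no_types, lifting) bij_betw_imp_surj_on imageE)
 have 1: "ta (rh P) = P" if "P \<in> C" for P using fun_cong[OF r(2), of P] that by (simp add: compose_def)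
 have "rh (ta P) = P" if "P \<in> C" for P
  using 1[of "ta P"] inj[OF t] that t r(1) by (auto dest: inj_onD)
 with 1 r show ?thesis using that by blast
qed

lemma bij_right:
 assumes t: "ta \<in> G" shows "bij_betw (%sg. compose C sg ta) G G"
proof -
 obtain rh where rh: "rh \<in> G" "!!P. P \<in> C ==> ta (rh P) = P"
  by (rule ex_inverse[OF t]) blast
 have "inj_on (%sg. compose C sg ta) G"
 proof (rule inj_onI)
  fix sg sg' assume s: "sg \<in> G" "sg' \<in> G" and e: "compose C sg ta = compose C sg' ta"
  show "sg = sg'"
  proof (rule ext_eq[OF s])
   fix P assume P: "P \<in> C"
   then have "rh P \<in> C" using rh by simp
   then show "sg P = sg' P" using fun_cong[OF e, of "rh P"] P rh(2)[OF P] by (simp add: compose_def)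
  qed
 qed
 moreover have "(%sg. compose C sg ta) ` G \<subseteq> G" using comp t by blast
 ultimately show ?thesis using endo_inj_surj[OF fin] by (simp add: bij_betw_def)
qed

lemma prod_translate:
 assumes "ta \<in> G" "R \<in> C"
 shows "(\<Prod>sg\<in>G. g (sg (ta R))) = (\<Prod>sg\<in>G. g (sg R))"
 using prod.reindex_bij_betw[OF bij_right[OF assms(1)], of "%sg. g (sg R)"] assms(2) by (simp add: compose_def)

lemma ratl_trans: "sg \<in> G ==> ratl C f ==> ratl C (%R. f (sg R))"
 using morphism_ratl_pull[OF irrC irrC morph domi] by blast

lemma reg_trans: "sg \<in> G ==> P \<in> C ==> reg C (sg P) f a ==> reg C P (%R. f (sg R)) a"
 using reg_pull[OF irrC _ mor domi] by blast

text \<open>Each of the finitely many morphisms agrees with \<open>rh\<close> everywhere or differs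
  from it generically. If all differed, then generically \<open>rh\<close> would agree with none of
  them.\<close>

lemma finite_cover:
 assumes "morphism C Y rh" "aeg C (%R. \<exists>sg\<in>G. rh R = sg R)"
 obtains sg where "sg \<in> G" "!!R. R \<in> C ==> rh R = sg R"
proof (rule ccontr)
 assume no: "\<not> thesis"
 note found = that
 have "aeg C (%R. rh R ~= sg R)" if s: "sg \<in> G" for sg
  using morphism_dich[OF irrC assms(1) morph[OF s]] found[OF s] no by blast
 then have "aeg C (%R. \<forall>sg\<in>G. rh R ~= sg R)" by (intro eventually_ball_finite fin ballI)
 with assms(2) have "aeg C (%R. False)" by eventually_elim simp
 then show False using gen_const[OF irrC] by blast
qed

end

lemma aut_groupI:
 assumes i: "irr C" and s: "subgroup G (Aut C)" and f: "finite G" shows "aut_group C G"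
proof -
 have sub: "G \<subseteq> automorphisms C" using subgroup.subset[OF s] by (simp add: Aut_def)
 then have B: "G \<subseteq> Bij C" by (auto simp: automorphisms_def)
 show ?thesis
 proof
  show "(\<lambda>x\<in>C. x) \<in> G" using subgroup.one_closed[OF s] by (simp add: Aut_def BijGroup_def)
  show "compose C sg ta \<in> G" if "sg \<in> G" "ta \<in> G" for sg ta
   using subgroup.m_closed[OF s that] B that by (simp add: Aut_def BijGroup_def subset_iff)
 qed (use i sub f in auto)
qed

section \<open>Coefficients of products of linear factors, for characteristic polynomials\<close>

lemma coeff_linear_mult: "coeff ([:- a, 1:] * (p :: 'a::comm_ring_1 poly)) j = - a * coeff p j + (case j of 0 => 0 | Suc i => coeff p i)"
 by (cases j) (simp_all del: One_nat_def)

lemma ratl_coeff_prod: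
 assumes "irr C" "!!s. s \<in> S ==> ratl C (a s)"
 shows "ratl C (%R. coeff (\<Prod>s\<in>S. [:- a s R, 1:]) j)"
 using assms(2)
proof (induction S arbitrary: j rule: infinite_finite_induct)
 case (insert x S)
 have "ratl C (%R. case j of 0 => 0 | Suc i => coeff (\<Prod>s\<in>S. [:- a s R, 1:]) i)"
  using insert by (cases j) (auto intro: ratl_const assms(1))
 then show ?case unfolding prod.insert[OF insert(1,2)] coeff_linear_mult
  using insert by (intro ratl_add[OF assms(1)] ratl_mult[OF assms(1)] ratl_uminus[OF assms(1)]) auto
qed (auto intro: ratl_const assms(1))

lemma reg_coeff_prod:
 assumes "irr C" "P \<in> C" "!!s. s \<in> S ==> reg C P (a s) (b s)"
 shows "reg C P (%R. coeff (\<Prod>s\<in>S. [:- a s R, 1:]) j) (coeff (\<Prod>s\<in>S. [:- b s, 1:]) j)"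
 using assms(3)
proof (induction S arbitrary: j rule: infinite_finite_induct)
 case (insert x S)
 have "reg C P (%R. case j of 0 => 0 | Suc i => coeff (\<Prod>s\<in>S. [:- a s R, 1:]) i)
  (case j of 0 => 0 | Suc i => coeff (\<Prod>s\<in>S. [:- b s, 1:]) i)"
  using insert by (cases j) (auto intro: reg_const assms(1))
 then show ?case unfolding prod.insert[OF insert(1,2)] coeff_linear_mult
  using insert by (intro reg_add[OF assms(1,2)] reg_mult[OF assms(1,2)] reg_uminus[OF assms(1,2)]) auto
qed (auto intro: reg_const assms(1))

section \<open>The projective line\<close>

lemma infinite_alg_closed: "infinite (UNIV :: 'k::alg_closed_field set)"
proof
 assume f: "finite (UNIV :: 'k set)"
 define p where "p = (\<Prod>a\<in>(UNIV :: 'k set). [:- a, 1:]) + 1"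
 have ev: "poly p x = 1" for x
  unfolding p_def poly_add poly_prod using f by (simp add: prod_zero)
 have "Polynomial.degree (\<Prod>a\<in>(UNIV :: 'k set). [:- a, 1:]) = card (UNIV :: 'k set)"
  by (subst degree_prod_eq_sum_degree) simp_all
 then have "Polynomial.degree p > 0"
  unfolding p_def using finite_UNIV_card_ge_0[OF f] by (subst degree_add_eq_left) auto
 then obtain x where "poly p x = 0" using alg_closed_imp_poly_has_root by blast
 with ev show False by simp
qed

text \<open>The restriction of a form to a polynomially parametrized curve, here a line; it reduces
  questions on forms to roots of polynomials in one variable.\<close>

definition psubst :: "('k::field, 'n::finite) mpoly => ('n => 'k poly) => 'k poly" where
 "psubst F w = (\<Sum>m\<in>Poly_Mapping.keys F. [:lkp F m:] * (\<Prod>j\<in>UNIV. w j ^ lkp m j))"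

lemma poly_psubst: "poly (psubst F w) t = evm F (\<chi> j. poly (w j) t)"
 by (simp add: psubst_def eval_mpoly_def poly_sum poly_mult poly_prod poly_power)

definition psubst2 :: "('k::field, 'n::finite) mpoly => ('n => 'k poly poly) => 'k poly poly" where
 "psubst2 F w = (\<Sum>m\<in>Poly_Mapping.keys F. [:[:lkp F m:]:] * (\<Prod>j\<in>UNIV. w j ^ lkp m j))"

lemma poly_psubst2: "poly (poly (psubst2 F w) [:b:]) a = evm F (\<chi> j. poly (poly (w j) [:b:]) a)"
 by (simp add: psubst2_def eval_mpoly_def poly_sum poly_mult poly_prod poly_power)

lemma ex_good:
 fixes p q :: "'k::alg_closed_field poly"
 assumes "p ~= 0" "q ~= 0" shows "EX t. poly p t ~= 0 & poly q t ~= 0"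
proof -
 have "finite ({t. poly p t = 0} \<union> {t. poly q t = 0})" using assms by (simp add: poly_roots_finite)
 then have "{t. poly p t = 0} \<union> {t. poly q t = 0} ~= UNIV" using infinite_alg_closed by metis
 then show ?thesis by blast
qed

text \<open>On the line joining a point where \<open>F\<close> is nonzero to one where
  \<open>G\<close> is nonzero, both restrict to nonzero polynomials in one variable, and the
  infinite field contains a parameter that is a root of neither.\<close>

lemma irr_UNIV: "irr (UNIV :: ('k::alg_closed_field, 'n::finite) proj set)"
 unfolding irr_def
proof (intro conjI allI impI)
 fix F G :: "('k, 'n) mpoly" and d e
 assume h: "hmg d F" "hmg e G" "\<exists>P\<in>UNIV. peval F P ~= 0" "\<exists>P\<in>UNIV. peval G P ~= 0"
 then obtain P R where PR: "peval F P ~= 0" "peval G R ~= 0" by blast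
 let ?w = "%j. [:rep_proj P $ j, rep_proj R $ j - rep_proj P $ j:]"
 have "poly (psubst F ?w) 0 ~= 0" "poly (psubst G ?w) 1 ~= 0"
  using PR by (simp_all add: poly_psubst peval_def)
 then have "psubst F ?w ~= 0" "psubst G ?w ~= 0" by auto
 from ex_good[OF this] obtain t where t: "poly (psubst F ?w) t ~= 0" "poly (psubst G ?w) t ~= 0" by blast
 define v where "v = (\<chi> j. poly (?w j) t)"
 show "\<exists>P\<in>UNIV. peval F P ~= 0 & peval G P ~= 0"
 proof (cases "v = 0")
  case False
  then show ?thesis using t peval_abs_eq_0_iff[OF h(1) False] peval_abs_eq_0_iff[OF h(2) False]
   by (auto simp: poly_psubst v_def)
 next
  \<comment> \<open>The parameter yields the zero vector only if the two points coincide, and then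
    that point itself serves.\<close>
  case True
  have e: "(1 - t) * rep_proj P $ j = - t * rep_proj R $ j" for j
  proof -
   have "v $ j = 0" using True by simp
   then show ?thesis by (simp add: v_def algebra_simps eq_neg_iff_add_eq_0)
  qed
  have "P = R"
  proof (cases "t = 0")
   case True
   have "rep_proj P = 0" using e True by (simp add: vec_eq_iff)
   then show ?thesis using rep_proj_nonzero[of P] by simp
  next
   case False
   have "rep_proj R $ j = (- (1 - t) / t) * rep_proj P $ j" for j
   using e[of j] False by (simp add: field_simps)
   then show ?thesis unfolding proj_eq_cross by (simp add: mult_ac)
  qed
  then show ?thesis using PR by blast
 qed
qed simp

abbreviation PL :: "('k::field, 2) proj set" where "PL \<equiv> UNIV"

lemma irr_PL: "irr (PL :: ('k::alg_closed_field, 2) proj set)" by (rule irr_UNIV)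

text \<open>\<open>lam y\<close> is the linear form vanishing exactly at \<open>y\<close> and
  \<open>mu y\<close> a coordinate that is nonzero there. Hence \<open>sp y\<close> is a local
  parameter at \<open>y\<close>, and its inverse \<open>xc y\<close> is the affine coordinate on the
  rest of the line.\<close>

definition lam :: "('k::field, 2) proj => ('k, 2) mpoly" where
 "lam y = lin (vector [rep_proj y $ 2, - rep_proj y $ 1])"

definition mu :: "('k::field, 2) proj => ('k, 2) mpoly" where
 "mu y = coordv (SOME j. rep_proj y $ j ~= 0)"

definition sp :: "('k::field, 2) proj => ('k, 2) proj => 'k" where
 "sp y R = peval (lam y) R / peval (mu y) R"

lemma homogeneous_lam [simp]: "hmg (Suc 0) (lam y)" by (simp add: lam_def)
lemma homogeneous_mu [simp]: "hmg (Suc 0) (mu y)" by (simp add: mu_def)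

lemma peval_mu: "peval (mu y) y ~= 0"
proof -
 have "EX j. rep_proj y $ j ~= 0" using rep_proj_nonzero[of y] by (auto simp: vec_eq_iff)
 then have "rep_proj y $ (SOME j. rep_proj y $ j ~= 0) ~= 0" by (rule someI_ex)
 then show ?thesis by (simp add: mu_def peval_def)
qed

lemma eval_lam: "evm (lam y) v = v $ 1 * rep_proj y $ 2 - v $ 2 * rep_proj y $ 1"
 by (simp add: lam_def sum_2 mult.commute)

lemma peval_lam: "peval (lam y) R = 0 \<longleftrightarrow> R = y"
 unfolding proj_eq_cross peval_def eval_lam by (auto simp: forall_2 mult.commute)

lemma peval_lam_self [simp]: "peval (lam y) y = 0" by (simp add: peval_lam)

lemma sp_self [simp]: "sp y y = 0" by (simp add: sp_def peval_lam)

lemma reg_sp: "reg PL y (sp y) 0"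
 using reg_form[OF homogeneous_lam homogeneous_mu peval_mu, of PL y y] by (simp add: sp_def[abs_def])

lemma ratl_sp: "ratl PL (sp y)"
 using reg_imp_ratl[OF reg_sp] by simp

text \<open>The basis of the plane dual to \<open>mu y\<close>, \<open>lam y\<close>.\<close>

lemma line_basis:
 fixes y :: "('k::field, 2) proj"
 obtains a b where "!!v. v = evm (mu y) v *s a + evm (lam y) v *s b"
  "evm (mu y) a = 1" "evm (lam y) a = 0" "evm (mu y) b = 0" "evm (lam y) b = 1"
  "a = (1 / evm (mu y) (rep_proj y)) *s rep_proj y"
proof -
 define j where "j = (SOME j. rep_proj y $ j ~= 0)"
 have mu: "evm (mu y) v = v $ j" for v by (simp add: mu_def j_def)
 have j: "rep_proj y $ j ~= 0" using peval_mu[of y] by (simp add: peval_def mu)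
 define a where "a = (1 / rep_proj y $ j) *s rep_proj y"
 define b :: "'k ^ 2" where "b = (if j = 1 then vector [0, - 1 / rep_proj y $ 1] else vector [1 / rep_proj y $ 2, 0])"
 have "j = 1 \<or> j = 2" by (metis exhaust_2)
 then have "(ALL v. v = v $ j *s a + evm (lam y) v *s b) & a $ j = 1 & evm (lam y) a = 0 & b $ j = 0 & evm (lam y) b = 1"
  using j by (auto simp: a_def b_def eval_lam vec_eq_iff forall_2 field_simps)
 then show ?thesis using that[of a b] unfolding mu by (auto simp: a_def)
qed

lemma form_as_poly:
 assumes "hmg d F"
 obtains p where "!!R. peval (mu y) R ~= 0 ==> peval F R = peval (mu y) R ^ d * poly p (sp y R)"
proof -
 obtain a b where ab: "!!v. v = evm (mu y) v *s a + evm (lam y) v *s b"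
  by (rule line_basis[of y]) blast
 let ?p = "psubst F (%j. [:a $ j, b $ j:])"
 show ?thesis
 proof (rule that[of ?p])
  fix R assume m: "peval (mu y) R ~= 0"
  have "rep_proj R = peval (mu y) R *s (\<chi> j. poly [:a $ j, b $ j:] (sp y R))"
   using m by (subst ab[of "rep_proj R"]) (simp add: vec_eq_iff sp_def peval_def field_simps)
  then have "peval F R = evm F (peval (mu y) R *s (\<chi> j. poly [:a $ j, b $ j:] (sp y R)))"
   by (metis peval_def)
  then show "peval F R = peval (mu y) R ^ d * poly ?p (sp y R)"
   by (simp only: eval_mpoly_scale[OF assms] poly_psubst)
 qed
qed

lemma ae_mu: "aeg PL (%R. peval (mu (y :: ('k::alg_closed_field, 2) proj)) R ~= 0)"
 using gen_basic[OF irr_PL homogeneous_mu _ peval_mu] by (auto elim: eventually_mono)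

lemma ex_other: "EX R. R ~= (y :: ('k::field, 2) proj)"
proof -
 obtain a b where ab: "evm (lam y) b = 1" by (rule line_basis[of y]) blast
 then have "b ~= 0" by (auto simp: eval_lam)
 then have "peval (lam y) (abs_proj b) ~= 0" using peval_abs_eq_0_iff[OF homogeneous_lam, of b y] ab by simp
 then show ?thesis using peval_lam by blast
qed

lemma ae_neq: "aeg PL (%R. R ~= (y :: ('k::alg_closed_field, 2) proj))"
proof -
 obtain R where "peval (lam y) R ~= 0" using ex_other peval_lam by metis
 from gen_basic[OF irr_PL homogeneous_lam _ this] show ?thesis by (auto simp: peval_lam elim: eventually_mono)
qed

lemma sp_inj: "peval (mu y) R ~= 0 ==> peval (mu y) R' ~= 0 ==> sp y R = sp y R' ==> R = R'"
proof -
 assume m: "peval (mu y) R ~= 0" "peval (mu y) R' ~= 0" and e: "sp y R = sp y R'"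
 obtain a b where ab: "!!v. v = evm (mu y) v *s a + evm (lam y) v *s b"
  by (rule line_basis[of y]) blast
 have "rep_proj R = peval (mu y) R *s (a + sp y R *s b)" if "peval (mu y) R ~= 0" for R
  using that by (subst ab[of "rep_proj R"]) (simp add: vec_eq_iff sp_def peval_def field_simps)
 from this[OF m(1)] this[OF m(2)] show "R = R'" unfolding proj_eq_cross e by (simp add: mult_ac)
qed

lemma ae_sp_neq: "aeg PL (%R. sp y R ~= (c :: 'k::alg_closed_field))"
proof (cases "EX R. peval (mu y) R ~= 0 & sp y R = c")
 case True
 then obtain R where R: "peval (mu y) R ~= 0" "sp y R = c" by blast
 show ?thesis using ae_mu[of y] ae_neq[of R] by eventually_elim (use R sp_inj in metis)
next
 case False
 show ?thesis using ae_mu[of y] by eventually_elim (use False in auto)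
qed

lemma ae_poly_sp: "p ~= 0 ==> \<forall>\<^sub>F R in gen PL. poly p (sp y R) ~= (0 :: 'k::alg_closed_field)"
proof -
 assume "p ~= 0"
 then have "finite {t. poly p t = 0}" by (rule poly_roots_finite)
 then have "aeg PL (%R. \<forall>t\<in>{t. poly p t = 0}. sp y R ~= t)"
  by (intro eventually_ball_finite ballI ae_sp_neq)
 then show ?thesis by eventually_elim blast
qed

section \<open>Rational functions on the line as quotients of polynomials in one parameter\<close>

lemma ratl_PL_poly:
 fixes f :: "('k::alg_closed_field, 2) proj => 'k"
 assumes "ratl PL f"
 obtains a b where "b ~= 0" "aeg PL (%R. f R = poly a (sp y R) / poly b (sp y R))"
proof -
 obtain F G d P where 1: "hmg d F" "hmg d G" "peval G P ~= 0"
  "aeg PL (%R. f R = peval F R / peval G R)" using assms unfolding ratl_def by blast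
 obtain a where a: "!!R. peval (mu y) R ~= 0 ==> peval F R = peval (mu y) R ^ d * poly a (sp y R)"
  by (rule form_as_poly[OF 1(1)]) blast
 obtain b where b: "!!R. peval (mu y) R ~= 0 ==> peval G R = peval (mu y) R ^ d * poly b (sp y R)"
  by (rule form_as_poly[OF 1(2)]) blast
 note G = gen_basic[OF irr_PL 1(2) UNIV_I 1(3)]
 have "b ~= 0"
 proof
  assume "b = 0"
  have "\<forall>\<^sub>F R in gen (PL :: ('k, 2) proj set). False" using G ae_mu[of y] by eventually_elim (use b \<open>b = 0\<close> in auto)
  then show False using gen_const[OF irr_PL] by blast
 qed
 moreover have "aeg PL (%R. f R = poly a (sp y R) / poly b (sp y R))"
  using 1(4) ae_mu[of y] by eventually_elim (simp add: a b)
 ultimately show ?thesis using that by blast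
qed

lemma poly_factor_X:
 assumes "(p :: 'k::field poly) ~= 0"
 obtains n q where "!!t. poly p t = t ^ n * poly q t" "poly q 0 ~= 0"
proof -
 obtain q where q: "p = [:- 0, 1:] ^ Polynomial.order 0 p * q" "\<not> [:- 0, 1:] dvd q"
  using order_decomp[OF assms] by blast
 have "poly p t = t ^ Polynomial.order 0 p * poly q t" for t by (subst q(1)) simp
 moreover have "poly q 0 ~= 0" using q(2) by (simp add: poly_eq_0_iff_dvd)
 ultimately show ?thesis using that by blast
qed

lemma local_form_PL:
 fixes f :: "('k::alg_closed_field, 2) proj => 'k"
 assumes f: "ratl PL f" and ne: "\<not> (\<forall>\<^sub>F R in gen PL. f R = 0)"
 obtains n u c where "reg PL y u c" "c ~= 0" "aeg PL (%R. f R = sp y R powi n * u R)"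
proof -
 obtain a b where ab: "b ~= 0" "aeg PL (%R. f R = poly a (sp y R) / poly b (sp y R))"
  by (rule ratl_PL_poly[OF f]) blast
 have "a ~= 0"
 proof
  assume "a = 0"
  then have "aeg PL (%R. f R = 0)" using ab(2) by (auto elim: eventually_mono)
  with ne show False by blast
 qed
 obtain n a' where a: "!!t. poly a t = t ^ n * poly a' t" "poly a' 0 ~= 0"
  by (rule poly_factor_X[OF \<open>a ~= 0\<close>]) blast
 obtain m b' where b: "!!t. poly b t = t ^ m * poly b' t" "poly b' 0 ~= 0"
  by (rule poly_factor_X[OF ab(1)]) blast
 let ?u = "%R. poly a' (sp y R) / poly b' (sp y R)"
 have 1: "reg PL y ?u (poly a' 0 / poly b' 0)"
  by (intro reg_divide irr_PL UNIV_I reg_poly reg_sp b(2))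
 have 2: "aeg PL (%R. f R = sp y R powi (int n - int m) * ?u R)"
  using ab(2) ae_sp_neq[of y 0] by eventually_elim (simp add: a(1) b(1) power_int_diff)
 have "poly a' 0 / poly b' 0 ~= 0" using a(2) b(2) by simp
 from that[OF 1 this 2] show ?thesis .
qed

lemma reg_or_pole_PL:
 fixes f :: "('k::alg_closed_field, 2) proj => 'k"
 assumes f: "ratl PL f"
 shows "(EX a. reg PL y f a) \<or> (reg PL y (%R. inverse (f R)) 0 & (\<forall>\<^sub>F R in gen PL. f R ~= 0))"
proof (cases "aeg PL (%R. f R = 0)")
 case True
 then show ?thesis using reg_cong[OF reg_const[OF irr_PL, of y 0]] by blast
next
 case False
 obtain n u c where u: "reg PL y u c" "c ~= 0" "aeg PL (%R. f R = sp y R powi n * u R)"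
  by (rule local_form_PL[OF f False]) blast
 show ?thesis
 proof (cases "n \<ge> 0")
  case True
  have "reg PL y (%R. sp y R ^ nat n * u R) (0 ^ nat n * c)"
   by (intro reg_mult reg_power irr_PL UNIV_I reg_sp u)
  then have "reg PL y f (0 ^ nat n * c)"
   by (rule reg_cong) (use u(3) True in \<open>simp add: power_int_def\<close>)
  then show ?thesis by blast
 next
  case neg: False
  have "reg PL y (%R. sp y R ^ nat (- n) * inverse (u R)) (0 ^ nat (- n) * inverse c)"
   by (intro reg_mult reg_power reg_inverse irr_PL UNIV_I reg_sp u)
  moreover have "aeg PL (%R. inverse (f R) = sp y R ^ nat (- n) * inverse (u R))"
   using u(3) by eventually_elim (use neg in \<open>simp add: power_int_def power_inverse\<close>)
  ultimately have "reg PL y (%R. inverse (f R)) (0 ^ nat (- n) * inverse c)" by (rule reg_cong)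
  then have "reg PL y (%R. inverse (f R)) 0" using neg by (simp add: power_0_left)
  then show ?thesis using ratl_dich[OF irr_PL f] False by blast
 qed
qed

text \<open>The affine coordinate with a pole at \<open>y\<close>.\<close>

definition xc :: "('k::field, 2) proj => ('k, 2) proj => 'k" where
 "xc y R = peval (mu y) R / peval (lam y) R"

lemma xc_inverse: "xc y R = inverse (sp y R)" by (simp add: xc_def sp_def)

lemma reg_xc: "R ~= y ==> reg PL R (xc y) (xc y R)"
 using reg_form[OF homogeneous_mu homogeneous_lam] peval_lam unfolding xc_def[abs_def] by blast

lemma ratl_xc: "ratl PL (xc (y :: ('k::alg_closed_field, 2) proj))"
 using ratl_form[OF irr_PL homogeneous_mu homogeneous_lam] unfolding xc_def[abs_def] by blast

lemma xc_surj:
 fixes y :: "('k::field, 2) proj" obtains R where "R ~= y" "xc y R = c"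
proof -
 obtain a b where ab: "evm (mu y) a = 1" "evm (lam y) a = 0" "evm (mu y) b = 0" "evm (lam y) b = 1"
  by (rule line_basis[of y]) blast
 let ?v = "c *s a + b"
 have "evm (lam y) ?v = c * evm (lam y) a + evm (lam y) b"
  by (simp add: eval_lam algebra_simps)
 then have l: "evm (lam y) ?v = 1" using ab by simp
 have m: "evm (mu y) ?v = c" using ab(1,3) by (simp add: mu_def)
 have v: "?v ~= 0"
 proof
  assume "?v = 0"
  then have "evm (lam y) ?v = 0" by (simp only: eval_lam zero_index) simp
  with l show False by simp
 qed
 have "xc y (abs_proj ?v) = c"
  unfolding xc_def using peval_abs_ratio[OF homogeneous_mu homogeneous_lam v, of y y] l m by simp
 moreover have "abs_proj ?v ~= y"
  using peval_lam[of y "abs_proj ?v"] peval_abs_eq_0_iff[OF homogeneous_lam v, of y] l by simp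
 ultimately show ?thesis using that by blast
qed

text \<open>Among the fractions in \<open>xc y\<close> representing \<open>f\<close>, take one with
  denominator of least degree. A root of the denominator is the coordinate of a point other than
  \<open>y\<close>, where \<open>f\<close> is regular, so the numerator vanishes too and a linear
  factor cancels. Thus \<open>f\<close> is a polynomial in \<open>xc y\<close>, whose degree is
  bounded by the pole order at \<open>y\<close>.\<close>

lemma regular_off_point:
 fixes f :: "('k::alg_closed_field, 2) proj => 'k"
 assumes f: "!!R. R ~= y ==> EX c. reg PL R f c" and fy: "reg PL y (%R. sp y R ^ j * f R) c"
 obtains a where "Polynomial.degree a \<le> j" "aeg PL (%R. f R = poly a (xc y R))"
proof -
 have r: "ratl PL f" using f ex_other reg_imp_ratl by (metis UNIV_I)
 obtain a b where ab: "b ~= 0" "aeg PL (%R. f R = poly a (sp y R) / poly b (sp y R))"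
  by (rule ratl_PL_poly[OF r]) blast
 have nz: "aeg PL (%R. sp y R ~= 0)" by (rule ae_sp_neq)
 \<comment> \<open>Reflection turns \<open>sp y\<close> into its inverse \<open>xc y\<close>; the
   extra monomials give numerator and denominator the same factor \<open>xc y R ^ N\<close>.\<close>
 define N where "N = Polynomial.degree a + Polynomial.degree b"
 define A where "A = reflect_poly a * monom 1 (Polynomial.degree b)"
 define B where "B = reflect_poly b * monom 1 (Polynomial.degree a)"
 have "B ~= 0" using ab(1) by (simp add: B_def)
 have AB: "aeg PL (%R. f R * poly B (xc y R) = poly A (xc y R))"
  using ab(2) nz ae_poly_sp[OF ab(1), of y]
 proof eventually_elim
  case (elim R)
  have x: "xc y R = inverse (sp y R)" "xc y R ~= 0" using elim(2) by (auto simp: xc_inverse)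
  have "poly A (xc y R) = xc y R ^ N * poly a (sp y R)" "poly B (xc y R) = xc y R ^ N * poly b (sp y R)"
   using x elim(2) by (simp_all add: A_def B_def N_def poly_reflect_poly_nz poly_monom power_add)
  then show ?case using elim by simp
 qed
 let ?Q = "%B'. B' ~= 0 & (EX A'. \<forall>\<^sub>F R in gen PL. f R * poly B' (xc y R) = poly A' (xc y R))"
 obtain B' where B': "?Q B'" "!!D. ?Q D ==> Polynomial.degree B' \<le> Polynomial.degree D"
  using ex_has_least_nat[of ?Q B Polynomial.degree] AB \<open>B ~= 0\<close> by blast
 then obtain A' where A': "aeg PL (%R. f R * poly B' (xc y R) = poly A' (xc y R))" by blast
 have "Polynomial.degree B' = 0"
 proof (rule ccontr)
  assume "Polynomial.degree B' ~= 0"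
  then obtain t where t: "poly B' t = 0" using alg_closed_imp_poly_has_root[of B'] by auto
  obtain R where R: "R ~= y" "xc y R = t" by (rule xc_surj)
  obtain c where c: "reg PL R f c" using f[OF R(1)] by blast
  have "reg PL R (%R. f R * poly B' (xc y R)) (c * poly B' t)"
   using reg_xc[OF R(1)] R(2) c by (intro reg_mult reg_poly irr_PL UNIV_I) auto
  moreover have "reg PL R (%R. f R * poly B' (xc y R)) (poly A' t)"
   by (rule reg_cong[OF reg_poly[OF irr_PL UNIV_I reg_xc[OF R(1)], of A', unfolded R(2)] A'])
  ultimately have "c * poly B' t = poly A' t" by (rule reg_unique[OF irr_PL UNIV_I])
  then have "poly A' t = 0" using t by simp
  then obtain A2 B2 where 2: "A' = [:- t, 1:] * A2" "B' = [:- t, 1:] * B2"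
   using t unfolding poly_eq_0_iff_dvd by (elim dvdE)
  have "aeg PL (%R. xc y R ~= t)"
   using ae_sp_neq[of y "inverse t"] by eventually_elim (auto simp: xc_inverse)
  then have "aeg PL (%R. f R * poly B2 (xc y R) = poly A2 (xc y R))"
   using A'
  proof eventually_elim
   case (elim R)
   have "(xc y R - t) * (f R * poly B2 (xc y R)) = f R * poly B' (xc y R)"
   unfolding 2 poly_mult by (simp add: algebra_simps)
   also have "\<dots> = (xc y R - t) * poly A2 (xc y R)"
   unfolding elim(2) unfolding 2 poly_mult by (simp add: algebra_simps)
   finally show ?case using elim(1) by simp
  qed
  moreover have "B2 ~= 0" using B'(1) 2(2) by auto
  ultimately have "Polynomial.degree B' \<le> Polynomial.degree B2" using B'(2) by blast
  then show False unfolding 2(2) using \<open>B2 ~= 0\<close> by (subst (asm) degree_mult_eq) auto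
 qed
 then obtain \<beta> where \<beta>: "B' = [:\<beta>:]" by (rule degree_eq_zeroE)
 have "\<beta> ~= 0" using B'(1) \<beta> by auto
 define p where "p = Polynomial.smult (inverse \<beta>) A'"
 have p: "aeg PL (%R. f R = poly p (xc y R))"
  using A' by eventually_elim (use \<open>\<beta> ~= 0\<close> in \<open>auto simp: p_def \<beta> field_simps\<close>)
 have "Polynomial.degree p \<le> j"
 proof (rule ccontr)
  assume n: "\<not> ?thesis"
  define N where "N = Polynomial.degree p"
  have "reg PL y (%R. sp y R ^ (N - j) * (sp y R ^ j * f R)) (0 ^ (N - j) * c)"
   by (intro reg_mult reg_power irr_PL UNIV_I reg_sp fy)
  moreover have "reg PL y (%R. sp y R ^ (N - j) * (sp y R ^ j * f R)) (poly (reflect_poly p) 0)"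
  proof (rule reg_cong[OF reg_poly[OF irr_PL UNIV_I reg_sp]])
   show "aeg PL (%R. sp y R ^ (N - j) * (sp y R ^ j * f R) = poly (reflect_poly p) (sp y R))"
   using p nz
   proof eventually_elim
   case (elim R)
   have "sp y R ^ (N - j) * sp y R ^ j = sp y R ^ N" using n by (simp add: power_add[symmetric] N_def)
   then show ?case using elim by (simp add: poly_reflect_poly_nz xc_inverse N_def mult.assoc[symmetric])
   qed
  qed
  ultimately have "0 ^ (N - j) * c = poly (reflect_poly p) 0" by (rule reg_unique[OF irr_PL UNIV_I])
  then have "coeff p (Polynomial.degree p) = 0" using n by (simp add: N_def poly_0_coeff_0 power_0_left)
  then show False using n by auto
 qed
 with p show ?thesis using that by blast
qed

corollary regular_everywhere_const:
 fixes f :: "('k::alg_closed_field, 2) proj => 'k"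
 assumes f: "!!R. EX c. reg PL R f c"
 obtains c where "aeg PL (%R. f R = c)"
proof -
 fix y :: "('k, 2) proj"
 obtain c where "reg PL y f c" using f by blast
 then have "reg PL y (%R. sp y R ^ 0 * f R) c" by simp
 then obtain a where a: "Polynomial.degree a \<le> 0" "aeg PL (%R. f R = poly a (xc y R))"
  by (rule regular_off_point[rotated]) (use f in blast)+
 then obtain c where "a = [:c:]" by (metis degree_eq_zeroE le_zero_eq)
 with a(2) show ?thesis using that by simp
qed

section \<open>Orders of vanishing\<close>

definition unif :: "('k::field, 'n::finite) proj set => ('k, 'n) proj => (('k, 'n) proj => 'k) => bool" where
 "unif C P t \<longleftrightarrow> reg C P t 0 &
  (ALL f. reg C P f 0 --> (EX g a. reg C P g a & (\<forall>\<^sub>F R in gen C. f R = t R * g R)))"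

lemma local_ring_eq:
 assumes i: "irr C" and P: "P \<in> C" shows "local_ring C P = {cls C f | f. EX a. reg C P f a}"
proof -
 have "P \<in> dom (cls C f) \<longleftrightarrow> (EX a. reg C P f a)" for f using P by (simp add: dom_cls)
 then show ?thesis unfolding local_ring_def rational_funs_eq[OF i] using reg_imp_ratl[OF _ P] by blast
qed

lemma max_ideal_eq:
 assumes i: "irr C" and P: "P \<in> C" shows "max_ideal C P = {cls C f | f. reg C P f 0}"
 unfolding max_ideal_def local_ring_eq[OF i P] using P by (auto simp: cls_eq_Some_iff[OF i])

lemma FF_mult_local:
 assumes i: "irr C" and P: "P \<in> C" and t: "ratl C t"
 shows "{cls C t \<otimes>\<^bsub>FF C\<^esub> g | g. g \<in> local_ring C P} = {cls C (%R. t R * g R) | g. EX a. reg C P g a}"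
proof -
 have "cls C t \<otimes>\<^bsub>FF C\<^esub> cls C g = cls C (%R. t R * g R)" if "reg C P g a" for g a
  using FF_mult[OF i t reg_imp_ratl[OF that P]] .
 then show ?thesis unfolding local_ring_eq[OF i P] by (intro subset_antisym subsetI) (blast, force)
qed

lemma uniformizer_cls_iff:
 assumes i: "irr C" and P: "P \<in> C" and t: "ratl C t"
 shows "uniformizer C P (cls C t) \<longleftrightarrow> unif C P t"
proof
 assume "uniformizer C P (cls C t)"
 then have 1: "cls C t \<in> {cls C f | f. reg C P f 0}"
  "{cls C f | f. reg C P f 0} = {cls C (%R. t R * g R) | g. EX a. reg C P g a}"
  unfolding uniformizer_def max_ideal_eq[OF i P] FF_mult_local[OF i P t] by auto
 obtain f where f: "reg C P f 0" "cls C t = cls C f" using 1(1) by blast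
 have t0: "reg C P t 0"
  by (rule reg_cong[OF f(1)]) (use f cls_eq_iff[OF i t reg_imp_ratl[OF f(1) P]] in blast)
 show "unif C P t" unfolding unif_def
 proof (intro conjI t0 allI impI)
  fix f assume f: "reg C P f 0"
  then have "cls C f \<in> {cls C (%R. t R * g R) | g. EX a. reg C P g a}" using 1(2) by blast
  then obtain g a where g: "reg C P g a" "cls C f = cls C (%R. t R * g R)" by blast
  have "aeg C (%R. f R = t R * g R)"
   using cls_eq_iff[OF i reg_imp_ratl[OF f P] ratl_mult[OF i t reg_imp_ratl[OF g(1) P]]] g(2) by simp
  with g(1) show "EX g a. reg C P g a & (\<forall>\<^sub>F R in gen C. f R = t R * g R)" by blast
 qed
next
 assume u: "unif C P t"
 then have t0: "reg C P t 0" by (simp add: unif_def)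
 have "{cls C f | f. reg C P f 0} = {cls C (%R. t R * g R) | g. EX a. reg C P g a}" (is "?A = ?B")
 proof (intro subset_antisym subsetI)
  fix x assume "x \<in> ?A"
  then obtain f where f: "reg C P f 0" "x = cls C f" by blast
  then obtain g a where g: "reg C P g a" "aeg C (%R. f R = t R * g R)" using u unfolding unif_def by blast
  from cls_cong[OF g(2)] g(1) f(2) show "x \<in> ?B" by blast
 next
  fix x assume "x \<in> ?B"
  then obtain g a where g: "reg C P g a" "x = cls C (%R. t R * g R)" by blast
  have "reg C P (%R. t R * g R) 0" using reg_mult[OF i P t0 g(1)] by simp
  then show "x \<in> ?A" using g(2) by blast
 qed
 then show "uniformizer C P (cls C t)"
  unfolding uniformizer_def max_ideal_eq[OF i P] FF_mult_local[OF i P t] using t0 by blast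
qed

lemma uniformizerE:
 assumes i: "irr C" and P: "P \<in> C" and u: "uniformizer C P T"
 obtains t where "T = cls C t" "unif C P t"
proof -
 have "T \<in> max_ideal C P" using u unfolding uniformizer_def by blast
 then obtain t where t: "T = cls C t" "reg C P t 0" unfolding max_ideal_eq[OF i P] by blast
 show ?thesis using that[OF t(1)] u uniformizer_cls_iff[OF i P reg_imp_ratl[OF t(2) P]] unfolding t(1) by blast
qed

text \<open>After scaling by \<open>h\<close> the coordinates are regular at \<open>P\<close> and
  not all zero there. Multiplying each numerator by the denominators of the other coordinates gives
  forms of one degree with the same projective values.\<close>

lemma mor_at_of_reg:
 fixes v :: "'m::finite => ('k::field, 'n::finite) proj => 'k"
 assumes i: "irr C" and P: "P \<in> C" and a: "!!j. reg C P (%R. h R * v j R) (a j)" and a0: "(\<chi> j. a j) ~= 0"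
  and hnz: "aeg C (%R. h R ~= 0)"
 shows "mor_at C P (%R. abs_proj (\<chi> j. v j R)) (abs_proj (\<chi> j. a j))"
proof -
 have "ALL j. EX T. hmg (snd (snd T)) (fst T) & hmg (snd (snd T)) (fst (snd T)) & peval (fst (snd T)) P ~= 0 &
  a j = peval (fst T) P / peval (fst (snd T)) P &
  (\<forall>\<^sub>F R in gen C. h R * v j R = peval (fst T) R / peval (fst (snd T)) R)"
 proof
  fix j
  obtain F G d where "hmg d F & hmg d G & peval G P ~= 0 &
   a j = peval F P / peval G P & (\<forall>\<^sub>F R in gen C. h R * v j R = peval F R / peval G R)"
   using a[of j] unfolding reg_def by (elim exE)
  then show "EX T. hmg (snd (snd T)) (fst T) & hmg (snd (snd T)) (fst (snd T)) & peval (fst (snd T)) P ~= 0 &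
  a j = peval (fst T) P / peval (fst (snd T)) P &
  (\<forall>\<^sub>F R in gen C. h R * v j R = peval (fst T) R / peval (fst (snd T)) R)"
   by (intro exI[of _ "(F, G, d)"]) simp
 qed
 from choice[OF this] obtain T where T: "ALL j. hmg (snd (snd (T j))) (fst (T j)) & hmg (snd (snd (T j))) (fst (snd (T j))) & peval (fst (snd (T j))) P ~= 0 &
  a j = peval (fst (T j)) P / peval (fst (snd (T j))) P &
  (\<forall>\<^sub>F R in gen C. h R * v j R = peval (fst (T j)) R / peval (fst (snd (T j))) R)" ..
 define F G d where "F j = fst (T j)" and "G j = fst (snd (T j))" and "d j = snd (snd (T j))" for j
 have F: "hmg (d j) (F j)" "hmg (d j) (G j)" "peval (G j) P ~= 0"
  "a j = peval (F j) P / peval (G j) P" "aeg C (%R. h R * v j R = peval (F j) R / peval (G j) R)" for j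
  using T by (auto simp: F_def G_def d_def)
 define H where "H j = F j * (\<Prod>i\<in>UNIV - {j}. G i)" for j
 define g where "g R = (\<Prod>i\<in>UNIV. peval (G i) R)" for R
 have H: "peval (H j) R = g R * (peval (F j) R / peval (G j) R)" if "!!i. peval (G i) R ~= 0" for j R
 proof -
  have "g R = peval (G j) R * (\<Prod>i\<in>UNIV - {j}. peval (G i) R)"
   unfolding g_def by (rule prod.remove) auto
  then show ?thesis using that by (simp add: H_def peval_simps)
 qed
 have Hd: "hmg (\<Sum>i\<in>UNIV. d i) (H j)" for j
 proof -
  have "(\<Sum>i\<in>UNIV. d i) = d j + (\<Sum>i\<in>UNIV - {j}. d i)" by (rule sum.remove) auto
  then show ?thesis unfolding H_def by (simp only: homogeneous_mult[OF F(1) homogeneous_prod[OF F(2)]])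
 qed
 have gP: "g P ~= 0" using F(3) by (simp add: g_def)
 have HP: "(\<chi> j. peval (H j) P) = g P *s (\<chi> j. a j)" by (simp add: vec_eq_iff H F)
 have "aeg C (%R. peval (G i) R ~= 0)" for i
  using gen_basic[OF i F(2) P F(3), of i] by eventually_elim simp
 then have "aeg C (%R. ALL i. peval (G i) R ~= 0)" by (intro eventually_all_finite)
 moreover have "aeg C (%R. ALL i. h R * v i R = peval (F i) R / peval (G i) R)"
  by (intro eventually_all_finite F(5))
 moreover note hnz
 moreover have "aeg C (%R. (\<chi> j. peval (H j) R) ~= 0)"
 proof -
  obtain l where l: "a l ~= 0" using a0 by (auto simp: vec_eq_iff)
  have "peval (H l) P ~= 0" using HP gP l by (metis (no_types, lifting) mult_eq_0_iff vec_lambda_beta vector_smult_component)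
  from gen_basic[OF i Hd P this] show ?thesis by eventually_elim (auto simp: vec_eq_iff)
 qed
 ultimately have ev: "aeg C (%R. abs_proj (\<chi> j. v j R) = abs_proj (\<chi> j. peval (H j) R))"
 proof eventually_elim
  case (elim R)
  have "(\<chi> j. peval (H j) R) = (g R * h R) *s (\<chi> j. v j R)"
   using elim by (simp add: vec_eq_iff H mult.assoc)
  moreover have "g R ~= 0" using elim by (simp add: g_def)
  moreover from calculation(1) have "(\<chi> j. v j R) ~= 0" using elim(4) by auto
  ultimately show ?case using abs_proj_scale[of "g R * h R" "\<chi> j. v j R"] elim(3) by simp
 qed
 have eq: "abs_proj (\<chi> j. a j) = abs_proj (\<chi> j. peval (H j) P)"
  unfolding HP using abs_proj_scale[OF gP a0] by simp
 have nz: "(\<chi> j. peval (H j) P) ~= 0" unfolding HP using gP a0 by simp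
 show ?thesis
  by (rule mor_atI'[OF Hd nz eq ev])
qed

text \<open>\<open>order_ex\<close> makes the local rings discrete valuation rings. It is an
  assumption here and is established for covers of the line, where algebraic relations are at
  hand.\<close>

locale curve =
 fixes C :: "('k::field, 'n::finite) proj set"
 assumes irrC: "irr C"
  and unif_ex: "!!P. P \<in> C ==> EX t. unif C P t"
  and unif_nz: "!!P t. P \<in> C ==> unif C P t ==> \<forall>\<^sub>F R in gen C. t R ~= 0"
  and order_ex: "!!P t f. P \<in> C ==> unif C P t ==> ratl C f ==> \<forall>\<^sub>F R in gen C. f R ~= 0 ==>
   EX n u c. reg C P u c & c ~= 0 & (\<forall>\<^sub>F R in gen C. f R = t R powi n * u R)"
begin

definition tt :: "('k, 'n) proj => ('k, 'n) proj => 'k" where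
 "tt P = (SOME t. unif C P t)"

lemma unif_tt: "P \<in> C ==> unif C P (tt P)"
 unfolding tt_def using unif_ex by (rule someI_ex)

lemma tt_nz: "P \<in> C ==> \<forall>\<^sub>F R in gen C. tt P R ~= 0"
 using unif_nz unif_tt by blast

lemma reg_tt: "P \<in> C ==> reg C P (tt P) 0"
 using unif_tt by (simp add: unif_def)

text \<open>A relation and not a function, so that the zero function simply has no order;
  \<open>hord_unique\<close> shows that there is at most one.\<close>

definition hord :: "('k, 'n) proj => (('k, 'n) proj => 'k) => int => bool" where
 "hord P f n \<longleftrightarrow> (EX u c. reg C P u c & c ~= 0 & (\<forall>\<^sub>F R in gen C. f R = tt P R powi n * u R))"

lemma hord_ex: "P \<in> C ==> ratl C f ==> \<forall>\<^sub>F R in gen C. f R ~= 0 ==> EX n. hord P f n"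
 unfolding hord_def using order_ex unif_tt by blast

lemma hord_cong: "hord P f n ==> \<forall>\<^sub>F R in gen C. g R = f R ==> hord P g n"
proof -
 assume "hord P f n" and e: "aeg C (%R. g R = f R)"
 then obtain u c where u: "reg C P u c" "c ~= 0" "aeg C (%R. f R = tt P R powi n * u R)"
  unfolding hord_def by blast
 have "aeg C (%R. g R = tt P R powi n * u R)" using e u(3) by eventually_elim simp
 with u show ?thesis unfolding hord_def by blast
qed

lemma reg_nz: assumes "P \<in> C" "reg C P u c" "c ~= 0" shows "aeg C (%R. u R ~= 0)"
proof -
 have False if "aeg C (%R. u R = 0)"
  using reg_unique[OF irrC assms(1,2) reg_cong[OF reg_const[OF irrC, of P 0] that]] assms(3) by simp
 then show ?thesis using ratl_dich[OF irrC reg_imp_ratl[OF assms(2,1)]] by blast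
qed

lemma hord_nz: assumes "P \<in> C" "hord P f n" shows "aeg C (%R. f R ~= 0)"
proof -
 obtain u c where u: "reg C P u c" "c ~= 0" "aeg C (%R. f R = tt P R powi n * u R)"
  using assms(2) unfolding hord_def by blast
 show ?thesis using u(3) reg_nz[OF assms(1) u(1,2)] tt_nz[OF assms(1)] by eventually_elim simp
qed

lemma hord_mult: assumes P: "P \<in> C" and "hord P f n" "hord P g m" shows "hord P (%R. f R * g R) (n + m)"
proof -
 obtain u c where u: "reg C P u c" "c ~= 0" "aeg C (%R. f R = tt P R powi n * u R)"
  using assms(2) unfolding hord_def by blast
 obtain v d where v: "reg C P v d" "d ~= 0" "aeg C (%R. g R = tt P R powi m * v R)"
  using assms(3) unfolding hord_def by blast
 have "aeg C (%R. f R * g R = tt P R powi (n + m) * (u R * v R))"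
  using u(3) v(3) tt_nz[OF P] by eventually_elim (simp add: power_int_add)
 moreover have "c * d ~= 0" using u(2) v(2) by simp
 ultimately show ?thesis unfolding hord_def using reg_mult[OF irrC P u(1) v(1)] by blast
qed

lemma hord_inverse: assumes P: "P \<in> C" and "hord P f n" shows "hord P (%R. inverse (f R)) (- n)"
proof -
 obtain u c where u: "reg C P u c" "c ~= 0" "aeg C (%R. f R = tt P R powi n * u R)"
  using assms(2) unfolding hord_def by blast
 have "aeg C (%R. inverse (f R) = tt P R powi (- n) * inverse (u R))"
  using u(3) by eventually_elim (simp add: power_int_minus)
 moreover have "inverse c ~= 0" using u(2) by simp
 ultimately show ?thesis unfolding hord_def using reg_inverse[OF irrC P u(1,2)] by blast
qed

lemma hord_divide: "P \<in> C ==> hord P f n ==> hord P g m ==> hord P (%R. f R / g R) (n - m)"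
 using hord_mult[of P f n "%R. inverse (g R)" "- m"] hord_inverse[of P g m]
 by (simp add: field_class.field_divide_inverse)

lemma hord_unit: "reg C P u c ==> c ~= 0 ==> hord P u 0"
 unfolding hord_def by (intro exI[of _ u] exI[of _ c]) auto

lemma hord_const: "c ~= 0 ==> hord P (%_. c) 0"
 using hord_unit[OF reg_const[OF irrC]] by blast

lemma hord_prod: "P \<in> C ==> (!!s. s \<in> S ==> hord P (f s) (n s)) ==> hord P (%R. \<Prod>s\<in>S. f s R) (\<Sum>s\<in>S. n s)"
 by (induction S rule: infinite_finite_induct) (auto intro: hord_mult hord_const)

lemma hord_tt: "P \<in> C ==> hord P (tt P) 1"
 unfolding hord_def by (intro exI[of _ "%_. 1"] exI[of _ 1]) (auto intro: reg_const irrC)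

lemma hord_tt_powi: "P \<in> C ==> hord P (%R. tt P R powi n) n"
 unfolding hord_def by (intro exI[of _ "%_. 1"] exI[of _ 1]) (auto intro: reg_const irrC)

lemma hord_nonneg: assumes P: "P \<in> C" and "hord P f n" "0 \<le> n" shows "EX a. reg C P f a & (a = 0 \<longleftrightarrow> 0 < n)"
proof -
 obtain u c where u: "reg C P u c" "c ~= 0" "aeg C (%R. f R = tt P R powi n * u R)"
  using assms(2) unfolding hord_def by blast
 have "reg C P (%R. tt P R ^ nat n * u R) (0 ^ nat n * c)"
  by (intro reg_mult reg_power irrC P reg_tt u)
 then have "reg C P f (0 ^ nat n * c)"
  by (rule reg_cong) (use u(3) assms(3) in \<open>simp add: power_int_def\<close>)
 moreover have "0 ^ nat n * c = 0 \<longleftrightarrow> 0 < n" using assms(3) u(2) by (auto simp: power_0_left)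
 ultimately show ?thesis by blast
qed

lemma hord_reg: assumes P: "P \<in> C" and f: "hord P f n" "reg C P f a" shows "0 \<le> n" "a = 0 \<longleftrightarrow> 0 < n"
proof -
 show n: "0 \<le> n"
 proof (rule ccontr)
  assume n: "\<not> 0 \<le> n"
  obtain b where b: "reg C P (%R. inverse (f R)) b" "b = 0"
   using hord_nonneg[OF P hord_inverse[OF P f(1)]] n by auto
  have "reg C P (%R. f R * inverse (f R)) (a * b)" using reg_mult[OF irrC P f(2) b(1)] .
  moreover have "reg C P (%R. f R * inverse (f R)) 1"
   by (rule reg_cong[OF reg_const[OF irrC]]) (use hord_nz[OF P f(1)] in \<open>eventually_elim, simp\<close>)
  ultimately have "a * b = 1" by (rule reg_unique[OF irrC P])
  then show False using b(2) by simp
 qed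
 from hord_nonneg[OF P f(1) n] obtain b where "reg C P f b" "b = 0 \<longleftrightarrow> 0 < n" by blast
 then show "a = 0 \<longleftrightarrow> 0 < n" using reg_unique[OF irrC P f(2)] by blast
qed

lemma hord_unique: assumes P: "P \<in> C" and "hord P f n" "hord P f m" shows "n = m"
proof -
 have "hord P (%R. f R / f R) (n - m)" "hord P (%R. f R / f R) (m - n)"
  using hord_divide[OF P] assms by blast+
 moreover have "reg C P (%R. f R / f R) 1"
  by (rule reg_cong[OF reg_const[OF irrC]]) (use hord_nz[OF P assms(2)] in \<open>eventually_elim, simp\<close>)
 ultimately have "0 \<le> n - m" "0 \<le> m - n" using hord_reg(1)[OF P] by blast+
 then show ?thesis by simp
qed

lemma hord_unif: assumes P: "P \<in> C" and t: "unif C P t" shows "hord P t 1"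
proof -
 obtain n where n: "hord P t n" using hord_ex[OF P _ unif_nz[OF P t]] t reg_imp_ratl[OF _ P] unfolding unif_def by blast
 have "reg C P t 0" using t by (simp add: unif_def)
 then have "0 < n" using hord_reg[OF P n] by blast
 obtain g a where g: "reg C P g a" "aeg C (%R. tt P R = t R * g R)"
  using t reg_tt[OF P] unfolding unif_def by blast
 have "aeg C (%R. g R ~= 0)" using g(2) tt_nz[OF P] by eventually_elim auto
 then obtain m where m: "hord P g m" using hord_ex[OF P reg_imp_ratl[OF g(1) P]] by blast
 have "0 \<le> m" using hord_reg(1)[OF P m g(1)] .
 have "n + m = 1" using hord_unique[OF P hord_cong[OF hord_mult[OF P n m] g(2)] hord_tt[OF P]] .
 with \<open>0 < n\<close> \<open>0 \<le> m\<close> have "n = 1" by linarith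
 with n show ?thesis by simp
qed

lemma hord_power_int: assumes P: "P \<in> C" and "hord P f n" shows "hord P (%R. f R powi k) (k * n)"
proof -
 have nat: "hord P (%R. f R ^ j) (int j * n)" for j
 proof (induction j)
  case (Suc j)
  from hord_mult[OF P assms(2) Suc] show ?case by (simp add: algebra_simps)
 qed (simp add: hord_const)
 show ?thesis
 proof (cases "0 \<le> k")
  case True
  then show ?thesis using nat[of "nat k"] by (simp add: power_int_def)
 next
  case False
  then show ?thesis using hord_inverse[OF P nat[of "nat (- k)"]] by (simp add: power_int_def power_inverse)
 qed
qed

lemma ord_at_cls:
 assumes P: "P \<in> C" and f: "ratl C f" and hf: "hord P f n"
 shows "ord_at C P (cls C f) = n"
proof -
 have *: "m = n" if h: "uniformizer C P t" "u \<in> local_ring C P" "u P ~= Some 0"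
  "cls C f = t [^]\<^bsub>FF C\<^esub> m \<otimes>\<^bsub>FF C\<^esub> u" for m t u
 proof -
  obtain t' where t: "t = cls C t'" "unif C P t'" using uniformizerE[OF irrC P h(1)] by metis
  obtain u' c where u: "u = cls C u'" "reg C P u' c" using h(2) unfolding local_ring_eq[OF irrC P] by blast
  have c: "c ~= 0" using h(3) u P by (auto simp: cls_eq_Some_iff[OF irrC] dest: reg_unique[OF irrC P])
  have rt: "ratl C t'" using t(2) reg_imp_ratl[OF _ P] unfolding unif_def by blast
  have ru: "ratl C u'" by (rule reg_imp_ratl[OF u(2) P])
  note rtm = ratl_power_int[OF irrC rt, of m]
  have "cls C f = cls C (%R. t' R powi m * u' R)"
   using h(4) unfolding t(1) u(1) FF_int_pow[OF irrC rt unif_nz[OF P t(2)]] FF_mult[OF irrC rtm ru] .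
  then have e: "aeg C (%R. f R = t' R powi m * u' R)"
   using cls_eq_iff[OF irrC f ratl_mult[OF irrC rtm ru]] by blast
  have "hord P (%R. t' R powi m * u' R) (m * 1 + 0)"
   by (intro hord_mult[OF P] hord_power_int[OF P] hord_unif[OF P t(2)] hord_unit[OF u(2) c])
  from hord_unique[OF P hord_cong[OF this e] hf] show ?thesis by simp
 qed
 obtain u c where u: "reg C P u c" "c ~= 0" "aeg C (%R. f R = tt P R powi n * u R)"
  using hf unfolding hord_def by blast
 have rt: "ratl C (tt P)" using reg_imp_ratl[OF reg_tt[OF P] P] .
 have ru: "ratl C u" by (rule reg_imp_ratl[OF u(1) P])
 show ?thesis unfolding ord_at_def
 proof (rule the_equality)
  show "EX t u. uniformizer C P t & u \<in> local_ring C P & u P ~= Some 0 & cls C f = t [^]\<^bsub>FF C\<^esub> n \<otimes>\<^bsub>FF C\<^esub> u"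
  proof (intro exI conjI)
   show "uniformizer C P (cls C (tt P))" using uniformizer_cls_iff[OF irrC P rt] unif_tt[OF P] by blast
   show "cls C u \<in> local_ring C P" unfolding local_ring_eq[OF irrC P] using u(1) by blast
   show "cls C u P ~= Some 0" using u(1,2) P by (auto simp: cls_eq_Some_iff[OF irrC] dest: reg_unique[OF irrC P])
   show "cls C f = cls C (tt P) [^]\<^bsub>FF C\<^esub> n \<otimes>\<^bsub>FF C\<^esub> cls C u"
   unfolding FF_int_pow[OF irrC rt tt_nz[OF P]] FF_mult[OF irrC ratl_power_int[OF irrC rt] ru] by (rule cls_cong[OF u(3)])
  qed
 qed (use * in blast)
qed

text \<open>Unlike \<open>hord\<close> this also holds for the zero function, so it is stable under
  sums and describes Riemann-Roch spaces; a negative \<open>m\<close> bounds a pole.\<close>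

definition ordge :: "('k, 'n) proj => (('k, 'n) proj => 'k) => int => bool" where
 "ordge P f m \<longleftrightarrow> (EX a. reg C P (%R. tt P R powi (- m) * f R) a)"

lemma ordge_cong: "ordge P f m ==> \<forall>\<^sub>F R in gen C. g R = f R ==> ordge P g m"
 unfolding ordge_def by (elim exE, rule exI, erule reg_cong) (simp add: eventually_mono)

lemma ordge_hord: "P \<in> C ==> hord P f n ==> ordge P f m \<longleftrightarrow> m \<le> n"
proof -
 assume P: "P \<in> C" and f: "hord P f n"
 have "hord P (%R. tt P R powi (- m) * f R) (- m + n)" by (intro hord_mult[OF P] hord_tt_powi[OF P] f)
 from hord_reg(1)[OF P this] hord_nonneg[OF P this] show ?thesis unfolding ordge_def by auto
qed

lemma ordge_0: "ordge P (%_. 0) m"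
 unfolding ordge_def using reg_const[OF irrC, of P 0] by auto

lemma ordge_zero_fun: "\<forall>\<^sub>F R in gen C. f R = 0 ==> ordge P f m"
 using ordge_cong[OF ordge_0] by blast

lemma ordge_add: "P \<in> C ==> ordge P f m ==> ordge P g m ==> ordge P (%R. f R + g R) m"
 unfolding ordge_def distrib_left using reg_add[OF irrC] by blast

lemma ordge_cmult: "P \<in> C ==> ordge P f m ==> ordge P (%R. c * f R) m"
 unfolding ordge_def mult.left_commute[of _ c] using reg_cmult[OF irrC] by blast

lemma ordge_reg: "ordge P f 0 \<longleftrightarrow> (EX a. reg C P f a)"
 unfolding ordge_def by simp

lemma ordge_iff: "P \<in> C ==> ratl C f ==> ordge P f m \<longleftrightarrow> (\<forall>\<^sub>F R in gen C. f R = 0) \<or> (\<exists>n\<ge>m. hord P f n)"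
 using ratl_dich[OF irrC, of f] hord_ex[of P f] ordge_hord[of P f] ordge_zero_fun by blast

lemma ordge_mono: assumes "P \<in> C" "ratl C f" "ordge P f m" "l \<le> m" shows "ordge P f l"
 using assms ordge_iff[OF assms(1,2)] by (meson order_trans)

text \<open>Rational maps from a smooth curve extend to every point.\<close>

lemma extend_map:
 fixes v :: "'m::finite => ('k, 'n) proj => 'k"
 assumes P: "P \<in> C" and v: "!!j. ratl C (v j)" and l: "aeg C (%R. v l R ~= 0)"
 obtains h :: "('k, 'n) proj => 'k" and a :: "'m => 'k" where "!!j. reg C P (%R. h R * v j R) (a j)" "(\<chi> j. a j) ~= 0"
  "aeg C (%R. h R ~= 0)" "mor_at C P (%R. abs_proj (\<chi> j. v j R)) (abs_proj (\<chi> j. a j))"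
proof -
 let ?J = "{j. \<forall>\<^sub>F R in gen C. v j R ~= 0}"
 define n where "n j = (SOME n. hord P (v j) n)" for j
 have n: "hord P (v j) (n j)" if "j \<in> ?J" for j
  unfolding n_def using someI_ex[OF hord_ex[OF P v]] that by blast
 have "finite (n ` ?J)" "n ` ?J ~= {}" using l by auto
 then obtain j0 where j0: "j0 \<in> ?J" "!!j. j \<in> ?J ==> n j0 \<le> n j"
  using Min_in[of "n ` ?J"] Min_le[of "n ` ?J"] by (metis (no_types, lifting) image_iff imageI)
 define h where "h R = tt P R powi (- n j0)" for R
 have hn: "hord P h (- n j0)" unfolding h_def using hord_tt_powi[OF P] .
 have ex: "EX a. reg C P (%R. h R * v j R) a & (j = j0 --> a ~= 0)" for j
 proof (cases "j \<in> ?J")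
  case True
  have "hord P (%R. h R * v j R) (- n j0 + n j)" using hord_mult[OF P hn n[OF True]] .
  then show ?thesis using hord_nonneg[OF P] j0(2)[OF True] by fastforce
 next
  case False
  then have z: "aeg C (%R. v j R = 0)" using ratl_dich[OF irrC v] by blast
  have "reg C P (%R. h R * v j R) 0"
   by (rule reg_cong[OF reg_const[OF irrC]]) (use z in \<open>eventually_elim, simp\<close>)
  then show ?thesis using False j0(1) by blast
 qed
 define a where "a j = (SOME a. reg C P (%R. h R * v j R) a & (j = j0 --> a ~= 0))" for j
 have a: "reg C P (%R. h R * v j R) (a j)" "j = j0 --> a j ~= 0" for j
  unfolding a_def using someI_ex[OF ex[of j]] by blast+
 have a0: "(\<chi> j. a j) ~= 0" using a(2)[of j0] by (auto simp: vec_eq_iff)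
 have hnz: "aeg C (%R. h R ~= 0)" using hord_nz[OF P hn] .
 show ?thesis by (rule that[OF a(1) a0 hnz mor_at_of_reg[OF irrC P a(1) a0 hnz]])
qed

end

section \<open>Curves covering the projective line\<close>

lemma poly_factor_X_idom:
 assumes "(p :: 'a::idom poly) ~= 0"
 obtains n q where "!!t. poly p t = t ^ n * poly q t" "poly q 0 ~= 0"
proof -
 obtain q where q: "p = [:- 0, 1:] ^ Polynomial.order 0 p * q" "\<not> [:- 0, 1:] dvd q"
  using order_decomp[OF assms] by blast
 have "poly p t = t ^ Polynomial.order 0 p * poly q t" for t by (subst q(1)) simp
 moreover have "poly q 0 ~= 0" using q(2) by (simp add: poly_eq_0_iff_dvd)
 ultimately show ?thesis using that by blast
qed

text \<open>\<open>A\<close> is a relation between \<open>x\<close> and \<open>y\<close>, a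
  polynomial in \<open>y\<close> with coefficients polynomials in \<open>x\<close>. Once a power of
  \<open>y\<close> is divided out, the constant coefficient \<open>p\<close> is nonzero and all
  other terms are multiples of \<open>y\<close>. With regular functions in place of \<open>x\<close>
  and \<open>y\<close> this says that \<open>y\<close> divides \<open>p (x)\<close>.\<close>

lemma relation_const_coeff:
 fixes A :: "'k::field poly poly"
 assumes "A ~= 0"
 obtains p B where "p ~= 0" "!!x y. y ~= 0 ==> poly (poly A [:y:]) x = 0 ==> poly p x = - y * poly (poly B [:y:]) x"
proof -
 obtain n Q where Q: "!!t. poly A t = t ^ n * poly Q t" "poly Q 0 ~= 0"
  by (rule poly_factor_X_idom[OF assms]) blast
 obtain p B where pB: "Q = pCons p B" by (cases Q)
 show ?thesis
 proof (rule that[of p B])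
  show "p ~= 0" using Q(2) pB by simp
  fix x y :: 'k assume "y ~= 0" "poly (poly A [:y:]) x = 0"
  then have "poly (poly Q [:y:]) x = 0" by (simp add: Q(1) poly_power)
  then show "poly p x = - y * poly (poly B [:y:]) x"
   unfolding pB by (simp add: eq_neg_iff_add_eq_0)
 qed
qed

text \<open>The counterpart in the other variable: factors \<open>x\<close> are removed until some
  coefficient is nonzero at \<open>x = 0\<close>. Each removal lowers the degree of the leading
  coefficient.\<close>

lemma relation_divide_X:
 fixes A :: "'k::field poly poly"
 assumes "A ~= 0"
 shows "EX n B. (EX j. poly (coeff B j) 0 ~= 0) & (ALL x y. poly (poly A [:y:]) x = x ^ n * poly (poly B [:y:]) x)"
 using assms
proof (induction "Polynomial.degree (coeff A (Polynomial.degree A))" arbitrary: A rule: less_induct)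
 case less
 show ?case
 proof (cases "EX j. poly (coeff A j) 0 ~= 0")
  case True
  then show ?thesis by (intro exI[of _ 0] exI[of _ A]) simp
 next
  case False
  define A' where "A' = map_poly (%p. synthetic_div p 0) A"
  have c: "coeff A j = [:0, 1:] * coeff A' j" for j
  proof -
   have "[:- 0, 1:] * synthetic_div (coeff A j) 0 + [:poly (coeff A j) 0:] = coeff A j"
   by (rule synthetic_div_correct')
   then show ?thesis using False by (simp add: A'_def coeff_map_poly)
  qed
  have A: "A = [:[:0, 1:]:] * A'" by (rule poly_eqI) (simp add: c)
  have A'0: "A' ~= 0" using less.prems A by auto
  have d: "Polynomial.degree A = Polynomial.degree A'"
   unfolding A by (subst degree_mult_eq) (use A'0 in auto)
  have lc: "coeff A' (Polynomial.degree A') ~= 0" using A'0 by simp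
  have "Polynomial.degree (coeff A (Polynomial.degree A)) = Suc (Polynomial.degree (coeff A' (Polynomial.degree A')))"
   unfolding c d by (subst degree_mult_eq) (use lc in auto)
  then obtain n B where nB: "EX j. poly (coeff B j) 0 ~= 0" "!!x y. poly (poly A' [:y:]) x = x ^ n * poly (poly B [:y:]) x"
   using less.hyps[OF _ A'0] by auto
  have "poly (poly A [:y:]) x = x ^ Suc n * poly (poly B [:y:]) x" for x y
   by (subst A) (simp add: nB(2))
  then show ?thesis using nB(1) by blast
 qed
qed

lemma relation_split_X:
 fixes B :: "'k::field poly poly"
 defines "p0 \<equiv> map_poly (%p. poly p 0) B" and "D \<equiv> map_poly (%p. synthetic_div p 0) B"
 shows "poly (poly B [:y:]) x = poly p0 y + x * poly (poly D [:y:]) x"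
proof -
 have "coeff B j = [:0, 1:] * coeff D j + coeff (map_poly (%p. [:p:]) p0) j" for j
  using synthetic_div_correct'[of 0 "coeff B j"] by (simp add: D_def p0_def coeff_map_poly)
 then have B: "B = [:[:0, 1:]:] * D + map_poly (%p. [:p:]) p0"
  by - (rule poly_eqI, simp)
 have "poly (poly (map_poly (%p. [:p:]) q) [:y:]) x = poly q y" for q :: "'k poly"
  by (induction q) (simp_all add: map_poly_pCons)
 then show ?thesis by (subst B) simp
qed

text \<open>The part of a finite covering on which valuations rest. The crucial assumption is
  \<open>rel\<close>: every function is algebraic over the coordinate of the line. Galois quotients
  satisfy it, and so does the projection from a Galois point, for which it is available before the
  fibres are known.\<close>

locale cover =
 fixes C :: "('k::alg_closed_field, 'n::finite) proj set" and q :: "('k, 'n) proj => ('k, 2) proj"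
 assumes irr: "irr C"
  and uex: "!!P. P \<in> C ==> EX t. unif C P t"
  and pull: "!!P f a. P \<in> C ==> reg PL (q P) f a ==> reg C P (%R. f (q R)) a"
  and domin: "dominant C PL q"
  and rel: "!!h y. ratl C h ==> EX A. A ~= 0 & (\<forall>\<^sub>F R in gen C. poly (poly A [:h R:]) (sp y (q R)) = 0)"
begin

lemma ratl_pull_q: "ratl PL f ==> ratl C (%R. f (q R))"
proof -
 assume f: "ratl PL f"
 have "aeg C (%R. R \<in> C & reg PL (q R) f (f (q R)))"
  using dominantD[OF domin ratl_reg[OF irr_PL f]] gen_in[OF irr] by eventually_elim auto
 from gen_ex[OF irr this] show ?thesis using pull reg_imp_ratl by blast
qed

abbreviation (input) s where "s P \<equiv> (%R. sp (q P) (q R))"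

lemma reg_s: "P \<in> C ==> reg C P (s P) 0"
 using pull[OF _ reg_sp] .

lemma s_neq: "aeg C (%R. sp y (q R) ~= c)"
 using dominantD[OF domin ae_sp_neq] .

text \<open>The relation makes \<open>p (s P)\<close> a multiple of \<open>h\<close>, and
  \<open>p\<close> is a power of its variable times a factor that is a unit at
  \<open>P\<close>.\<close>

lemma divides_s_power:
 assumes P: "P \<in> C" and h: "reg C P h a" "aeg C (%R. h R ~= 0)"
 shows "EX m g b. reg C P g b & (\<forall>\<^sub>F R in gen C. s P R ^ m = h R * g R)"
proof -
 obtain A where A: "A ~= 0" "aeg C (%R. poly (poly A [:h R:]) (s P R) = 0)"
  using rel[OF reg_imp_ratl[OF h(1) P]] by blast
 obtain p B where pB: "p ~= 0" "!!x y. y ~= 0 ==> poly (poly A [:y:]) x = 0 ==> poly p x = - y * poly (poly B [:y:]) x"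
  by (rule relation_const_coeff[OF A(1)]) blast
 obtain m p' where p': "!!t. poly p t = t ^ m * poly p' t" "poly p' 0 ~= 0"
  by (rule poly_factor_X_idom[OF pB(1)]) blast
 have r: "reg C P (%R. poly p' (s P R)) (poly p' 0)" by (intro reg_poly irr P reg_s)
 have "reg C P (%R. - poly (poly B [:h R:]) (s P R) / poly p' (s P R)) (- poly (poly B [:a:]) 0 / poly p' 0)"
  by (intro reg_divide reg_uminus reg_poly2 irr P reg_s h r p')
 moreover have "aeg C (%R. s P R ^ m = h R * (- poly (poly B [:h R:]) (s P R) / poly p' (s P R)))"
 proof -
  have "aeg C (%R. poly p' (s P R) ~= 0)"
  proof -
   have "p' ~= 0" using p'(2) by auto
   from dominantD[OF domin ae_poly_sp[OF this]] show ?thesis .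
  qed
  then show ?thesis using A(2) h(2)
  proof eventually_elim
   case (elim R)
   have "s P R ^ m * poly p' (s P R) = - h R * poly (poly B [:h R:]) (s P R)"
   using pB(2)[OF elim(3,2)] p'(1) by metis
   then show ?case using elim(1) by (simp add: field_simps)
  qed
 qed
 ultimately show ?thesis by blast
qed

text \<open>Setting \<open>x = 0\<close> in the reduced relation leaves a nonzero polynomial
  \<open>p\<close>, and \<open>p (t)\<close> is a multiple of \<open>s P\<close>. On the other hand
  \<open>p (t)\<close> is a power of \<open>t\<close> times a unit.\<close>

lemma s_divides_power:
 assumes P: "P \<in> C" and t: "reg C P t 0"
 shows "EX m g b. reg C P g b & (\<forall>\<^sub>F R in gen C. t R ^ m = s P R * g R)"
proof -
 obtain A where A: "A ~= 0" "aeg C (%R. poly (poly A [:t R:]) (s P R) = 0)"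
  using rel[OF reg_imp_ratl[OF t P]] by blast
 obtain n B j where B: "poly (coeff B j) 0 ~= 0" "!!x y. poly (poly A [:y:]) x = x ^ n * poly (poly B [:y:]) x"
  using relation_divide_X[OF A(1)] by blast
 define p where "p = map_poly (%p. poly p 0) B"
 define D where "D = map_poly (%p. synthetic_div p 0) B"
 have split: "poly (poly B [:y:]) x = poly p y + x * poly (poly D [:y:]) x" for x y
  unfolding p_def D_def by (rule relation_split_X)
 have "p ~= 0"
 proof
  assume "p = 0"
  then have "coeff p j = 0" by simp
  then show False using B(1) by (simp add: p_def coeff_map_poly)
 qed
 obtain m p' where p': "!!t. poly p t = t ^ m * poly p' t" "poly p' 0 ~= 0"
  by (rule poly_factor_X_idom[OF \<open>p ~= 0\<close>]) blast
 have r: "reg C P (%R. poly p' (t R)) (poly p' 0)" by (intro reg_poly irr P t)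
 have "reg C P (%R. - poly (poly D [:t R:]) (s P R) / poly p' (t R)) (- poly (poly D [:0:]) 0 / poly p' 0)"
  by (intro reg_divide reg_uminus reg_poly2 irr P reg_s t r p')
 moreover have "aeg C (%R. t R ^ m = s P R * (- poly (poly D [:t R:]) (s P R) / poly p' (t R)))"
 proof -
  have nz: "aeg C (%R. poly p' (t R) ~= 0)"
  proof -
   have False if z: "aeg C (%R. poly p' (t R) = 0)"
   using reg_unique[OF irr P r reg_cong[OF reg_const[OF irr, of P 0] z]] p'(2) by simp
   then show ?thesis using ratl_dich[OF irr reg_imp_ratl[OF r P]] by blast
  qed
  show ?thesis using A(2) nz s_neq[of "q P" 0]
  proof eventually_elim
   case (elim R)
   have "poly (poly B [:t R:]) (s P R) = 0" using elim(1,3) by (simp add: B(2))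
   then have "t R ^ m * poly p' (t R) + s P R * poly (poly D [:t R:]) (s P R) = 0"
   by (simp add: split p'(1))
   then have "t R ^ m * poly p' (t R) = - (s P R * poly (poly D [:t R:]) (s P R))"
   by (simp add: eq_neg_iff_add_eq_0)
   then show ?case using elim(2) by (simp add: field_simps)
  qed
 qed
 ultimately show ?thesis by blast
qed

lemma unif_nonzero:
 assumes P: "P \<in> C" and t: "unif C P t" shows "aeg C (%R. t R ~= 0)"
proof -
 obtain g a where "reg C P g a" "aeg C (%R. s P R = t R * g R)"
  using t reg_s[OF P] unfolding unif_def by blast
 then show ?thesis using s_neq[of "q P" 0] by (auto elim: eventually_elim2)
qed

text \<open>Divide \<open>h\<close> by \<open>t\<close> as long as it vanishes at \<open>P\<close>;
  every division lowers the exponent \<open>N\<close>, so the process ends with a unit.\<close>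

lemma unit_decomp:
 assumes P: "P \<in> C" and t: "unif C P t"
 shows "reg C P h a ==> reg C P g b ==> \<forall>\<^sub>F R in gen C. t R ^ N = h R * g R ==>
  EX n u c. reg C P u c & c ~= 0 & (\<forall>\<^sub>F R in gen C. h R = t R ^ n * u R)"
proof (induction N arbitrary: h a)
 case 0
 have "reg C P (%R. h R * g R) (a * b)" by (intro reg_mult irr P 0)
 moreover have "reg C P (%R. h R * g R) 1"
  by (rule reg_cong[OF reg_const[OF irr]]) (use 0(3) in \<open>eventually_elim, simp\<close>)
 ultimately have "a * b = 1" by (rule reg_unique[OF irr P])
 then have "a ~= 0" by auto
 with 0 show ?case by (intro exI[of _ 0] exI[of _ h] exI[of _ a]) simp
next
 case (Suc N)
 show ?case
 proof (cases "a = 0")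
  case False
  then show ?thesis using Suc.prems by (intro exI[of _ 0] exI[of _ h] exI[of _ a]) simp
 next
  case True
  then obtain h' a' where h': "reg C P h' a'" "aeg C (%R. h R = t R * h' R)"
   using Suc.prems t unfolding unif_def by blast
  have "aeg C (%R. t R ^ N = h' R * g R)"
   using Suc.prems(3) h'(2) unif_nonzero[OF P t] by eventually_elim simp
  from Suc.IH[OF h'(1) Suc.prems(2) this] obtain n u c
   where u: "reg C P u c" "c ~= 0" "aeg C (%R. h' R = t R ^ n * u R)" by blast
  have "aeg C (%R. h R = t R ^ Suc n * u R)" using h'(2) u(3) by eventually_elim simp
  then show ?thesis using u by blast
 qed
qed

lemma unit_decomp_reg:
 assumes P: "P \<in> C" and t: "unif C P t" and h: "reg C P h a" "aeg C (%R. h R ~= 0)"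
 shows "EX n u c. reg C P u c & c ~= 0 & (\<forall>\<^sub>F R in gen C. h R = t R ^ n * u R)"
proof -
 obtain m g b where g: "reg C P g b" "aeg C (%R. s P R ^ m = h R * g R)"
  using divides_s_power[OF P h] by blast
 have "reg C P t 0" using t by (simp add: unif_def)
 then obtain M k d where k: "reg C P k d" "aeg C (%R. t R ^ M = s P R * k R)"
  using s_divides_power[OF P] by blast
 have "aeg C (%R. t R ^ (M * m) = h R * (g R * k R ^ m))"
  using g(2) k(2) by eventually_elim (simp add: power_mult power_mult_distrib)
 moreover have "reg C P (%R. g R * k R ^ m) (b * d ^ m)" by (intro reg_mult reg_power irr P g k)
 ultimately show ?thesis using unit_decomp[OF P t h(1)] by blast
qed

sublocale curve C
proof
 fix P t f assume P: "P \<in> C" and t: "unif C P t" and f: "ratl C f" "aeg C (%R. f R ~= 0)"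
 obtain F G d R0 where FG: "hmg d F" "hmg d G" "R0 \<in> C" "peval G R0 ~= 0"
  "aeg C (%R. f R = peval F R / peval G R)" using f(1) unfolding ratl_def by blast
 obtain j where j: "peval (coordv j) P ~= 0" using ex_var_nonzero by blast
 have Ld: "hmg d (coordv j ^ d)" for j :: 'n
  using homogeneous_power[OF homogeneous_coordv, of d j] by simp
 have L: "peval (coordv j ^ d) P ~= 0" using j by (simp add: peval_simps)
 \<comment> \<open>A coordinate that is nonzero at \<open>P\<close> replaces the denominator, so
   that \<open>f\<close> becomes a quotient of two functions regular at \<open>P\<close>.\<close>
 define F' where "F' R = peval F R / peval (coordv j ^ d) R" for R
 define G' where "G' R = peval G R / peval (coordv j ^ d) R" for R
 have F': "EX a. reg C P F' a" and G': "EX a. reg C P G' a"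
  unfolding F'_def[abs_def] G'_def[abs_def] using reg_form[OF _ Ld L] FG by blast+
 have e: "aeg C (%R. f R = F' R / G' R & F' R ~= 0 & G' R ~= 0)"
  using FG(5) gen_basic[OF irr Ld P L] gen_basic[OF irr FG(2-4)] f(2)
  by eventually_elim (auto simp: F'_def G'_def)
 have e1: "aeg C (%R. F' R ~= 0)" using e by eventually_elim simp
 have e2: "aeg C (%R. G' R ~= 0)" using e by eventually_elim simp
 obtain n u c where u: "reg C P u c" "c ~= 0" "aeg C (%R. F' R = t R ^ n * u R)"
  using F' unit_decomp_reg[OF P t _ e1] by blast
 obtain m v d where v: "reg C P v d" "d ~= 0" "aeg C (%R. G' R = t R ^ m * v R)"
  using G' unit_decomp_reg[OF P t _ e2] by blast
 have "reg C P (%R. u R / v R) (c / d)" by (intro reg_divide irr P u v)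
 moreover have "c / d ~= 0" using u v by simp
 moreover have "aeg C (%R. f R = t R powi (int n - int m) * (u R / v R))"
  using e u(3) v(3) unif_nonzero[OF P t] by eventually_elim (simp add: power_int_diff)
 ultimately show "EX n u c. reg C P u c & c ~= 0 & (\<forall>\<^sub>F R in gen C. f R = t R powi n * u R)" by blast
qed (use irr uex unif_nonzero in auto)

text \<open>Dividing \<open>H\<close> by a power of a coordinate gives a function \<open>h\<close>
  that divides some \<open>p (sp y (q R))\<close>; at a zero of \<open>H\<close> the parameter of
  \<open>q R\<close> is therefore a root of \<open>p\<close>. Finitely many coordinates cover
  \<open>C\<close>, and the parameter misses a single point of the line.\<close>

lemma finite_image_zeros:
 assumes H: "hmg d H" "P0 \<in> C" "peval H P0 ~= 0"
 shows "finite (q ` {R\<in>C. peval H R = 0})"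
proof -
 fix y :: "('k, 2) proj"
 have fin1: "EX p. p ~= 0 & (\<forall>R\<in>C. peval H R = 0 --> peval (coordv j) R ~= 0 --> peval (mu y) (q R) ~= 0 --> poly p (sp y (q R)) = 0)" for j
 proof (cases "\<exists>R\<in>C. peval (coordv j) R ~= 0")
  case False
  then show ?thesis by (intro exI[of _ 1]) auto
 next
  case True
  then obtain R0 where R0: "R0 \<in> C" "peval (coordv j) R0 ~= 0" by blast
  have Ld: "hmg d (coordv j ^ d)" using homogeneous_power[OF homogeneous_coordv, of d j] by simp
  define h where "h R = peval H R / peval (coordv j ^ d) R" for R
  have hr: "ratl C h" unfolding h_def[abs_def] by (rule ratl_form[OF irr H(1) Ld])
  have hnz: "aeg C (%R. h R ~= 0)"
   using gen_basic[OF irr H] gen_basic[OF irr homogeneous_coordv R0]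
   by eventually_elim (simp add: h_def peval_simps)
  obtain A where A: "A ~= 0" "aeg C (%R. poly (poly A [:h R:]) (sp y (q R)) = 0)"
   using rel[OF hr] by blast
  obtain p B where pB: "p ~= 0" "!!x y. y ~= 0 ==> poly (poly A [:y:]) x = 0 ==> poly p x = - y * poly (poly B [:y:]) x"
   by (rule relation_const_coeff[OF A(1)]) blast
  have e: "aeg C (%R. poly p (sp y (q R)) = - h R * poly (poly B [:h R:]) (sp y (q R)))"
   using A(2) hnz by eventually_elim (rule pB(2))
  have "poly p (sp y (q R)) = 0" if R: "R \<in> C" "peval H R = 0" "peval (coordv j) R ~= 0" "peval (mu y) (q R) ~= 0" for R
  proof -
   have "reg PL (q R) (sp y) (sp y (q R))"
   using reg_form[OF homogeneous_lam homogeneous_mu R(4)] unfolding sp_def[abs_def] .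
   then have rs: "reg C R (%R. sp y (q R)) (sp y (q R))" by (rule pull[OF R(1)])
   have rh: "reg C R h 0"
   using reg_form[OF H(1) Ld, of R C] R(2,3) unfolding h_def[abs_def] by (simp add: peval_simps)
   have "reg C R (%R. - h R * poly (poly B [:h R:]) (sp y (q R))) (- 0 * poly (poly B [:0:]) (sp y (q R)))"
   by (intro reg_mult reg_uminus reg_poly2 irr R(1) rs rh)
   from reg_cong[OF this e] have "reg C R (%R. poly p (sp y (q R))) 0" by simp
   moreover have "reg C R (%R. poly p (sp y (q R))) (poly p (sp y (q R)))" by (rule reg_poly[OF irr R(1) rs])
   ultimately show ?thesis by (metis reg_unique[OF irr R(1)])
  qed
  with pB(1) show ?thesis by blast
 qed
 have "ALL j. EX p. p ~= 0 & (\<forall>R\<in>C. peval H R = 0 --> peval (coordv j) R ~= 0 --> peval (mu y) (q R) ~= 0 --> poly p (sp y (q R)) = 0)"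
  using fin1 by blast
 from choice[OF this] obtain p where p: "ALL j. p j ~= 0 & (\<forall>R\<in>C. peval H R = 0 --> peval (coordv j) R ~= 0 --> peval (mu y) (q R) ~= 0 --> poly (p j) (sp y (q R)) = 0)" ..
 have pn: "p j ~= 0" for j using p by blast
 define Z where "Z = (\<Union>j. {t. poly (p j) t = 0})"
 have fZ: "finite Z" unfolding Z_def using pn by (auto intro: poly_roots_finite)
 obtain b where b: "!!v. evm (mu y) v = 0 ==> v = evm (lam y) v *s b"
 proof -
  obtain a b where "!!v. v = evm (mu y) v *s a + evm (lam y) v *s b"
   by (rule line_basis[of y]) blast
  then show ?thesis using that[of b] by (metis add.left_neutral vector_smult_lzero)
 qed
 have one: "R = R'" if "peval (mu y) R = 0" "peval (mu y) R' = 0" for R R'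
 proof -
  have *: "rep_proj T $ i = evm (lam y) (rep_proj T) * b $ i" if "peval (mu y) T = 0" for T i
   using arg_cong[OF b[of "rep_proj T"], of "%v. v $ i"] that by (simp add: peval_def)
  show ?thesis unfolding proj_eq_cross by (simp add: *[OF that(1)] *[OF that(2)] mult_ac)
 qed
 have "q ` {R\<in>C. peval H R = 0} \<subseteq> {z. peval (mu y) z = 0} \<union> {z. peval (mu y) z ~= 0 & sp y z \<in> Z}"
 proof (rule subsetI)
  fix z assume "z \<in> q ` {R\<in>C. peval H R = 0}"
  then obtain R where R: "R \<in> C" "peval H R = 0" "z = q R" by blast
  obtain j where "peval (coordv j) R ~= 0" using ex_var_nonzero by blast
  then show "z \<in> {z. peval (mu y) z = 0} \<union> {z. peval (mu y) z ~= 0 & sp y z \<in> Z}"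
   using p R unfolding Z_def by blast
 qed
 moreover have "finite {z. peval (mu y) z = 0}"
 proof (cases "EX R. peval (mu y) R = 0")
  case True
  then obtain R where "peval (mu y) R = 0" by blast
  then have "{z. peval (mu y) z = 0} \<subseteq> {R}" using one by blast
  then show ?thesis by (rule finite_subset) simp
 next
  case False
  then have "{z. peval (mu y) z = 0} = {}" by blast
  then show ?thesis by (simp only: finite.emptyI)
 qed
 moreover have "finite {z. peval (mu y) z ~= 0 & sp y z \<in> Z}"
 proof (rule finite_imageD)
  show "finite (sp y ` {z. peval (mu y) z ~= 0 & sp y z \<in> Z})" by (rule finite_subset[OF _ fZ]) auto
  show "inj_on (sp y) {z. peval (mu y) z ~= 0 & sp y z \<in> Z}" by (rule inj_onI) (use sp_inj in auto)
 qed
 ultimately show ?thesis by (meson finite_UnI finite_subset)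
qed

text \<open>Otherwise \<open>1 / f\<close> vanishes at \<open>q P\<close>, and its pullback would
  vanish at \<open>P\<close> while being inverse to a function regular there.\<close>

lemma reg_q_converse:
 assumes P: "P \<in> C" and f: "ratl PL f" and r: "reg C P (%R. f (q R)) a"
 shows "reg PL (q P) f a"
 using reg_or_pole_PL[OF f, of "q P"]
proof (elim disjE exE conjE)
 fix b assume "reg PL (q P) f b"
 then show ?thesis using reg_unique[OF irr P r pull[OF P]] by blast
next
 assume i: "reg PL (q P) (%R. inverse (f R)) 0" and nz: "aeg PL (%R. f R ~= 0)"
 have "reg C P (%R. f (q R) * inverse (f (q R))) (a * 0)" by (intro reg_mult irr P r pull[OF P i])
 moreover have "reg C P (%R. f (q R) * inverse (f (q R))) 1"
  by (rule reg_cong[OF reg_const[OF irr]]) (use dominantD[OF domin nz] in \<open>eventually_elim, simp\<close>)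
 ultimately have "a * 0 = 1" by (rule reg_unique[OF irr P])
 then show ?thesis by simp
qed

end

section \<open>Galois covers of the projective line\<close>

lemma separating_form:
 assumes "P ~= R"
 obtains a where "peval (lin a) P ~= 0" "peval (lin a) R = 0"
proof -
 obtain i j where ij: "rep_proj P $ i * rep_proj R $ j ~= rep_proj P $ j * rep_proj R $ i"
  using assms unfolding proj_eq_cross by blast
 define a where "a = (\<chi> l. (if l = i then rep_proj R $ j else 0) - (if l = j then rep_proj R $ i else 0))"
 have "(\<Sum>l\<in>UNIV. a $ l * v $ l) = rep_proj R $ j * v $ i - rep_proj R $ i * v $ j" for v
  by (simp add: a_def left_diff_distrib sum_subtractf if_distrib[of "%x. x * _"] cong: if_cong)
 then have "peval (lin a) T = rep_proj R $ j * rep_proj T $ i - rep_proj R $ i * rep_proj T $ j" for T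
  by (simp add: peval_def)
 then show ?thesis using that[of a] ij by (simp add: mult.commute)
qed

lemma openin_cofinite:
 assumes "finite S" shows "openin (subtopology zariski C) (C - S)"
 unfolding openin_zariski_sub
proof (intro conjI ballI)
 fix P assume P: "P \<in> C - S"
 have "EX a. peval (lin a) P ~= 0 & peval (lin a) R = 0" if "R \<in> S" for R
  using separating_form[of P R] P that by blast
 then have "\<forall>R\<in>S. EX a. peval (lin a) P ~= 0 & peval (lin a) R = 0" by blast
 from bchoice[OF this] obtain a where a: "\<forall>R\<in>S. peval (lin (a R)) P ~= 0 & peval (lin (a R)) R = 0" ..
 define F where "F = (\<Prod>R\<in>S. lin (a R))"
 have "hmg (\<Sum>R\<in>S. Suc 0) F" unfolding F_def by (rule homogeneous_prod) simp
 moreover have "peval F P ~= 0" using a assms by (auto simp: F_def peval_def eval_mpoly_prod)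
 moreover have "peval F R = 0" if "R \<in> S" for R
  using a assms that by (auto simp: F_def peval_def eval_mpoly_prod intro!: prod_zero)
 ultimately show "EX F d. hmg d F & peval F P ~= 0 & (\<forall>R\<in>C. peval F R ~= 0 --> R \<in> C - S)"
  by blast
qed simp

lemma finite_zeros_PL:
 fixes F :: "('k::alg_closed_field, 2) mpoly"
 assumes "hmg d F" "peval F P0 ~= 0"
 shows "finite {R. peval F R = 0}"
proof -
 obtain p where p: "!!R. peval (mu P0) R ~= 0 ==> peval F R = peval (mu P0) R ^ d * poly p (sp P0 R)"
  by (rule form_as_poly[OF assms(1)]) blast
 have "p ~= 0" using p[OF peval_mu] assms(2) by auto
 obtain b where b: "!!v. evm (mu P0) v = 0 ==> v = evm (lam P0) v *s b"
 proof -
  obtain a b where "!!v. v = evm (mu P0) v *s a + evm (lam P0) v *s b"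
   by (rule line_basis[of P0]) blast
  then show ?thesis using that[of b] by (metis add.left_neutral vector_smult_lzero)
 qed
 have one: "R = R'" if "peval (mu P0) R = 0" "peval (mu P0) R' = 0" for R R'
 proof -
  have *: "rep_proj T $ i = evm (lam P0) (rep_proj T) * b $ i" if "peval (mu P0) T = 0" for T i
   using arg_cong[OF b[of "rep_proj T"], of "%v. v $ i"] that by (simp add: peval_def)
  show ?thesis unfolding proj_eq_cross by (simp add: *[OF that(1)] *[OF that(2)] mult_ac)
 qed
 have "{R. peval F R = 0} \<subseteq> {z. peval (mu P0) z = 0} \<union> {z. peval (mu P0) z ~= 0 & poly p (sp P0 z) = 0}"
  using p by auto
 moreover have "finite {z. peval (mu P0) z = 0}"
 proof (cases "EX R. peval (mu P0) R = 0")
  case True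
  then obtain R where "peval (mu P0) R = 0" by blast
  then have "{z. peval (mu P0) z = 0} \<subseteq> {R}" using one by blast
  then show ?thesis by (rule finite_subset) simp
 next
  case False
  then have "{z. peval (mu P0) z = 0} = {}" by blast
  then show ?thesis by (simp only: finite.emptyI)
 qed
 moreover have "finite {z. peval (mu P0) z ~= 0 & poly p (sp P0 z) = 0}"
 proof (rule finite_imageD)
  show "finite (sp P0 ` {z. peval (mu P0) z ~= 0 & poly p (sp P0 z) = 0})"
   by (rule finite_subset[OF _ poly_roots_finite[OF \<open>p ~= 0\<close>]]) auto
  show "inj_on (sp P0) {z. peval (mu P0) z ~= 0 & poly p (sp P0 z) = 0}" by (rule inj_onI) (use sp_inj in auto)
 qed
 ultimately show ?thesis by (meson finite_UnI finite_subset)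
qed

lemma cofinite_open_PL:
 fixes U :: "('k::alg_closed_field, 2) proj set"
 assumes "openin (subtopology zariski PL) U" "U ~= {}"
 shows "finite (- U)"
proof -
 obtain P F d where "hmg d F" "peval F P ~= 0" "!!R. peval F R ~= 0 ==> R \<in> U"
  using assms unfolding openin_zariski_sub by blast
 then show ?thesis using finite_zeros_PL[of d F P] finite_subset[of "- U" "{R. peval F R = 0}"] by blast
qed

lemma regular_fun_restrict:
 assumes f: "regular_fun C f" and U: "openin (subtopology zariski C) U" "U \<subseteq> dom f"
 shows "regular_fun C (f |` U)"
 unfolding regular_fun_def
proof (intro conjI ballI)
 have d: "dom (f |` U) = U" using U(2) by auto
 show "openin (subtopology zariski C) (dom (f |` U))" unfolding d by (rule U)
 fix P assume "P \<in> dom (f |` U)"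
 then have P: "P \<in> U" by auto
 then obtain V d F G where V: "P \<in> V" "V \<subseteq> dom f" "openin (subtopology zariski C) V"
   "hmg d F" "hmg d G" "\<forall>R\<in>V. peval G R ~= 0 & f R = Some (peval F R / peval G R)"
  using f[unfolded regular_fun_def, THEN conjunct2, rule_format, OF subsetD[OF U(2) P]] by blast
 show "EX V d F G. P \<in> V & V \<subseteq> dom (f |` U) & openin (subtopology zariski C) V & hmg d F &
  hmg d G & (\<forall>R\<in>V. peval G R ~= 0 & (f |` U) R = Some (peval F R / peval G R))"
 proof (intro exI conjI)
  show "P \<in> U \<inter> V" "U \<inter> V \<subseteq> dom (f |` U)" using P V(1) d by auto
  show "openin (subtopology zariski C) (U \<inter> V)" by (rule openin_Int[OF U(1) V(3)])
  show "hmg d F" "hmg d G" by (rule V)+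
  show "\<forall>R\<in>U \<inter> V. peval G R ~= 0 & (f |` U) R = Some (peval F R / peval G R)" using V(6) by simp
 qed
qed

lemma regular_funI:
 assumes i: "irr C" and U: "openin (subtopology zariski C) (dom f)"
  and r: "!!P a. f P = Some a ==> reg C P h a"
 shows "regular_fun C f"
proof -
 have sub: "dom f \<subseteq> C" using openin_subset[OF U] topspace_zariski_sub by blast
 have eq: "cls C h P = Some a" if "f P = Some a" for P a
  using r[OF that] sub that by (auto simp: cls_eq_Some_iff[OF i])
 then have "f = cls C h |` dom f" by (auto simp: restrict_map_def fun_eq_iff domIff)
 moreover have "regular_fun C (cls C h |` dom f)"
  using eq by (intro regular_fun_restrict[OF regular_fun_cls[OF i] U]) auto
 ultimately show ?thesis by simp
qed

lemma common_denominator: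
 fixes f :: "'i => ('k::alg_closed_field, 2) proj => 'k"
 assumes "finite I" "!!i. i \<in> I ==> ratl PL (f i)"
 obtains a b where "b ~= 0" "!!i. i \<in> I ==> \<forall>\<^sub>F R in gen PL. f i R = poly (a i) (sp y R) / poly b (sp y R)"
proof -
 have "EX ab. snd ab ~= 0 & (\<forall>\<^sub>F R in gen PL. f i R = poly (fst ab) (sp y R) / poly (snd ab) (sp y R))" if i: "i \<in> I" for i
 proof -
  obtain a b where "b ~= 0" "aeg PL (%R. f i R = poly a (sp y R) / poly b (sp y R))"
   by (rule ratl_PL_poly[OF assms(2)[OF i]]) blast
  then show ?thesis by (intro exI[of _ "(a, b)"]) simp
 qed
 then have "\<forall>i\<in>I. EX ab. snd ab ~= 0 & (\<forall>\<^sub>F R in gen PL. f i R = poly (fst ab) (sp y R) / poly (snd ab) (sp y R))" by blast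
 from bchoice[OF this] obtain ab where ab: "\<forall>i\<in>I. snd (ab i) ~= 0 & (\<forall>\<^sub>F R in gen PL. f i R = poly (fst (ab i)) (sp y R) / poly (snd (ab i)) (sp y R))" ..
 define b where "b = (\<Prod>i\<in>I. snd (ab i))"
 define a where "a i = fst (ab i) * (\<Prod>j\<in>I - {i}. snd (ab j))" for i
 have b0: "b ~= 0" unfolding b_def using ab assms(1) by simp
 show ?thesis
 proof (rule that[of b a, OF b0])
  fix i assume i: "i \<in> I"
  have b: "b = snd (ab i) * (\<Prod>j\<in>I - {i}. snd (ab j))" unfolding b_def by (rule prod.remove[OF assms(1) i])
  have "aeg PL (%R. f i R = poly (fst (ab i)) (sp y R) / poly (snd (ab i)) (sp y R))" using ab i by blast
  then show "aeg PL (%R. f i R = poly (a i) (sp y R) / poly b (sp y R))"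
   using ae_poly_sp[OF b0, of y] by eventually_elim (simp add: a_def b)
 qed
qed

lemma finite_values_const:
 assumes i: "irr C" and h: "ratl C h" and S: "finite S" "aeg C (%R. h R \<in> S)"
 obtains c where "aeg C (%R. h R = c)"
proof (rule ccontr)
 note found = that
 assume no: "\<not> thesis"
 have "aeg C (%R. h R ~= c)" for c
  using ratl_dich_eq[OF i h ratl_const[OF i, of c]] found no by blast
 then have "aeg C (%R. \<forall>c\<in>S. h R ~= c)" by (intro eventually_ball_finite S(1) ballI)
 with S(2) have "aeg C (%R. False)" by eventually_elim blast
 then show False using gen_const[OF i] by blast
qed

lemma monic_prod_linear:
 fixes a :: "'i => 'k::field"
 shows "Polynomial.degree (\<Prod>s\<in>G. [:- a s, 1:]) = card G" "coeff (\<Prod>s\<in>G. [:- a s, 1:]) (card G) = 1"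
proof -
 show 1: "Polynomial.degree (\<Prod>s\<in>G. [:- a s, 1:]) = card G"
  by (subst degree_prod_eq_sum_degree) simp_all
 have "coeff (\<Prod>s\<in>G. [:- a s, 1:]) (Polynomial.degree (\<Prod>s\<in>G. [:- a s, 1:])) = 1"
  by (subst lead_coeff_prod) simp
 then show "coeff (\<Prod>s\<in>G. [:- a s, 1:]) (card G) = 1" using 1 by simp
qed

text \<open>The content of a geometric quotient in terms of functions: fibres are orbits, regular
  functions pull back, and invariant functions descend. That it amounts to the same is shown by
  \<open>geometric_quotient\<close> and \<open>geometric_quotient_gal_cover\<close>.\<close>

locale gal_cover = aut_group C G
 for C :: "('k::alg_closed_field, 'n::finite) proj set" and G +
 fixes q :: "('k, 'n) proj => ('k, 2) proj"
 assumes uex: "!!P. P \<in> C ==> EX t. unif C P t"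
  and surj: "q ` C = UNIV"
  and fib: "!!P R. P \<in> C ==> R \<in> C ==> q P = q R \<longleftrightarrow> (\<exists>sg\<in>G. R = sg P)"
  and pull: "!!P f a. P \<in> C ==> reg PL (q P) f a ==> reg C P (%R. f (q R)) a"
  and domin: "dominant C PL q"
  and descend: "!!h. ratl C h ==> (!!sg. sg \<in> G ==> \<forall>\<^sub>F R in gen C. h (sg R) = h R) ==>
   EX f. ratl PL f & (\<forall>\<^sub>F R in gen C. f (q R) = h R)"
begin

lemma q_inv: "sg \<in> G ==> R \<in> C ==> q (sg R) = q R"
 using fib[of R "sg R"] by auto

lemma descend_exact:
 assumes "ratl C h" "!!sg R. sg \<in> G ==> R \<in> C ==> h (sg R) = h R"
 shows "EX f. ratl PL f & (\<forall>\<^sub>F R in gen C. f (q R) = h R)"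
proof (rule descend[OF assms(1)])
 show "aeg C (%R. h (sg R) = h R)" if "sg \<in> G" for sg
  using gen_in[OF irrC] by eventually_elim (rule assms(2)[OF that])
qed

lemma char_coeffs:
 assumes "ratl C h"
 shows "EX f. ALL j. ratl PL (f j) & (\<forall>\<^sub>F R in gen C. f j (q R) = coeff (\<Prod>sg\<in>G. [:- h (sg R), 1:]) j)"
proof -
 have "ALL j. EX f. ratl PL f & (\<forall>\<^sub>F R in gen C. f (q R) = coeff (\<Prod>sg\<in>G. [:- h (sg R), 1:]) j)"
 proof (intro allI descend_exact)
  show "ratl C (%R. coeff (\<Prod>sg\<in>G. [:- h (sg R), 1:]) j)" for j
   by (rule ratl_coeff_prod[OF irrC ratl_trans[OF _ assms]])
  show "coeff (\<Prod>sg\<in>G. [:- h (sg (ta R)), 1:]) j = coeff (\<Prod>sg\<in>G. [:- h (sg R), 1:]) j"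
   if "ta \<in> G" "R \<in> C" for ta R j
   using prod_translate[OF that, of "%P. [:- h P, 1:]"] by simp
 qed
 from choice[OF this] show ?thesis by blast
qed

lemma char_root: "R \<in> C ==> poly (\<Prod>sg\<in>G. [:- h (sg R), 1:]) (h R :: 'k) = 0"
 unfolding poly_prod using fin one by (intro prod_zero bexI[of _ "\<lambda>x\<in>C. x"]) auto

text \<open>\<open>h\<close> is a root of the polynomial whose roots are its conjugates. The
  coefficients are invariant and descend to the line, where a common denominator turns them into
  polynomials in \<open>sp y\<close>.\<close>

lemma algebraic_relation:
 assumes h: "ratl C h"
 shows "EX A. A ~= 0 & (\<forall>\<^sub>F R in gen C. poly (poly A [:h R:]) (sp y (q R)) = 0)"
proof -
 obtain f where f: "!!j. ratl PL (f j)" "!!j. \<forall>\<^sub>F R in gen C. f j (q R) = coeff (\<Prod>sg\<in>G. [:- h (sg R), 1:]) j"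
  using char_coeffs[OF h] by blast
 let ?n = "card G"
 obtain a b where ab: "b ~= 0" "!!j. j \<in> {..?n} ==> \<forall>\<^sub>F R in gen PL. f j R = poly (a j) (sp y R) / poly b (sp y R)"
  by (rule common_denominator[of "{..?n}" f y, OF finite_atMost f(1)]) blast
 define A where "A = (\<Sum>j\<le>?n. monom (a j) j)"
 have bn: "aeg C (%R. poly b (sp y (q R)) ~= 0)" using dominantD[OF domin ae_poly_sp[OF ab(1)]] .
 have "aeg C (%R. \<forall>j\<in>{..?n}. poly (a j) (sp y (q R)) = poly b (sp y (q R)) * coeff (\<Prod>sg\<in>G. [:- h (sg R), 1:]) j)"
 proof (intro eventually_ball_finite finite_atMost ballI)
  fix j assume "j \<in> {..?n}"
  from dominantD[OF domin ab(2)[OF this]] f(2)[of j] bn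
  show "aeg C (%R. poly (a j) (sp y (q R)) = poly b (sp y (q R)) * coeff (\<Prod>sg\<in>G. [:- h (sg R), 1:]) j)"
   by eventually_elim auto
 qed
 then have e: "aeg C (%R. \<forall>j\<le>?n. poly (a j) (sp y (q R)) = poly b (sp y (q R)) * coeff (\<Prod>sg\<in>G. [:- h (sg R), 1:]) j)"
  by eventually_elim simp
 have "A ~= 0"
 proof
  assume "A = 0"
  then have "coeff A ?n = 0" by simp
  then have "a ?n = 0" unfolding A_def coeff_sum coeff_monom by simp
  have "aeg C (%R. False)"
   using e bn
  proof eventually_elim
   case (elim R)
   from elim(1)[rule_format, of ?n] elim(2) show ?case
   by (simp add: \<open>a ?n = 0\<close> monic_prod_linear(2))
  qed
  then show False using gen_const[OF irrC] by blast
 qed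
 moreover have "aeg C (%R. poly (poly A [:h R:]) (sp y (q R)) = 0)"
  using e gen_in[OF irrC]
 proof eventually_elim
  case (elim R)
  let ?p = "\<Prod>sg\<in>G. [:- h (sg R), 1:]"
  have "poly (poly A [:h R:]) (sp y (q R)) = (\<Sum>j\<le>?n. poly (a j) (sp y (q R)) * h R ^ j)"
   by (simp add: A_def poly_sum poly_monom poly_mult poly_power)
  also have "\<dots> = poly b (sp y (q R)) * (\<Sum>j\<le>?n. coeff ?p j * h R ^ j)"
   using elim(1) by (simp add: sum_distrib_left mult.assoc)
  also have "(\<Sum>j\<le>?n. coeff ?p j * h R ^ j) = poly ?p (h R)"
   by (simp add: poly_altdef monic_prod_linear(1))
  finally show ?case using char_root[OF elim(2)] by simp
 qed
 ultimately show ?thesis by blast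
qed

sublocale cover C q
 by unfold_locales (use irrC uex pull domin algebraic_relation in auto)

text \<open>The coefficients of the characteristic polynomial of \<open>h\<close> descend to
  functions regular on the whole line, which are constant. So \<open>h\<close> generically takes
  values in a finite set, and a rational function of this kind is constant.\<close>

lemma global_const:
 assumes h: "!!P. P \<in> C ==> EX a. reg C P h a"
 obtains c where "aeg C (%R. h R = c)"
proof -
 have hr: "ratl C h" using irrC h reg_imp_ratl unfolding irr_def by blast
 obtain f where f: "!!j. ratl PL (f j)" "!!j. \<forall>\<^sub>F R in gen C. f j (q R) = coeff (\<Prod>sg\<in>G. [:- h (sg R), 1:]) j"
  using char_coeffs[OF hr] by blast
 have "EX d. \<forall>\<^sub>F R in gen C. coeff (\<Prod>sg\<in>G. [:- h (sg R), 1:]) j = d" for j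
 proof -
  have "EX c. reg PL y (f j) c" for y
  proof -
   obtain P where P: "P \<in> C" "y = q P" using surj by blast
   have "\<forall>sg\<in>G. EX a. reg C P (%R. h (sg R)) a" using reg_trans[OF _ P(1)] h in_C[OF _ P(1)] by blast
   from bchoice[OF this] obtain a where "\<forall>sg\<in>G. reg C P (%R. h (sg R)) (a sg)" ..
   then have "reg C P (%R. coeff (\<Prod>sg\<in>G. [:- h (sg R), 1:]) j) (coeff (\<Prod>sg\<in>G. [:- a sg, 1:]) j)"
   by (intro reg_coeff_prod irrC P) auto
   from reg_q_converse[OF P(1) f(1) reg_cong[OF this f(2)]] show ?thesis unfolding P(2) by blast
  qed
  then obtain d where "aeg PL (%R. f j R = d)" by (rule regular_everywhere_const)
  from dominantD[OF domin this] f(2)[of j] have "aeg C (%R. coeff (\<Prod>sg\<in>G. [:- h (sg R), 1:]) j = d)"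
   by eventually_elim simp
  then show ?thesis ..
 qed
 then have "ALL j. EX d. \<forall>\<^sub>F R in gen C. coeff (\<Prod>sg\<in>G. [:- h (sg R), 1:]) j = d" by blast
 from choice[OF this] obtain d where d: "ALL j. \<forall>\<^sub>F R in gen C. coeff (\<Prod>sg\<in>G. [:- h (sg R), 1:]) j = d j" ..
 let ?n = "card G"
 define p where "p = (\<Sum>j\<le>?n. monom (d j) j)"
 have "aeg C (%R. \<forall>j\<in>{..?n}. coeff (\<Prod>sg\<in>G. [:- h (sg R), 1:]) j = d j)"
  using d by (intro eventually_ball_finite finite_atMost ballI) blast
 then have e: "aeg C (%R. p = (\<Prod>sg\<in>G. [:- h (sg R), 1:]))"
 proof eventually_elim
  case (elim R)
  have "(\<Prod>sg\<in>G. [:- h (sg R), 1:]) = (\<Sum>j\<le>?n. monom (coeff (\<Prod>sg\<in>G. [:- h (sg R), 1:]) j) j)"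
   using poly_as_sum_of_monoms[of "\<Prod>sg\<in>G. [:- h (sg R), 1:]"] by (simp add: monic_prod_linear(1))
  then show ?case using elim by (simp add: p_def)
 qed
 obtain R0 where "p = (\<Prod>sg\<in>G. [:- h (sg R0), 1:])" using gen_ex[OF irrC e] by blast
 then have "p ~= 0" using monic_prod_linear(2)[of "%sg. h (sg R0)" G] by auto
 have "aeg C (%R. h R \<in> {x. poly p x = 0})"
  using e gen_in[OF irrC] by eventually_elim (use char_root in auto)
 from finite_values_const[OF irrC hr poly_roots_finite[OF \<open>p ~= 0\<close>] this] show ?thesis using that by blast
qed

lemma mem_G:
 assumes r: "rh \<in> automorphisms C" "aeg C (%R. q (rh R) = q R)"
 shows "rh \<in> G"
proof -
 note r' = automorphism_simps[OF irrC r(1)]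
 have "aeg C (%R. \<exists>sg\<in>G. rh R = sg R)"
  using r(2) gen_in[OF irrC] by eventually_elim (use fib r'(3) in metis)
 then obtain sg where s: "sg \<in> G" "!!R. R \<in> C ==> rh R = sg R" by (rule finite_cover[OF r'(2)]) blast
 have "rh = sg"
  by (rule extensionalityI[OF r'(6)]) (use s automorphism_simps(6)[OF irrC] aut in auto)
 with s show ?thesis by simp
qed

lemma unif_trans:
 assumes s: "sg \<in> G" and P: "P \<in> C" and t: "unif C (sg P) t" shows "unif C P (%R. t (sg R))"
 unfolding unif_def
proof (intro conjI allI impI)
 show "reg C P (%R. t (sg R)) 0" using t reg_trans[OF s P] unfolding unif_def by blast
 fix f assume f: "reg C P f 0"
 obtain rh where rh: "rh \<in> G" "!!P. P \<in> C ==> sg (rh P) = P" "!!P. P \<in> C ==> rh (sg P) = P"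
  by (rule ex_inverse[OF s]) blast
 have "reg C (sg P) (%R. f (rh R)) 0" using reg_trans[OF rh(1), of "sg P" f 0] f s P rh(3) by simp
 then obtain g a where g: "reg C (sg P) g a" "aeg C (%R. f (rh R) = t R * g R)"
  using t unfolding unif_def by blast
 have "aeg C (%R. f R = t (sg R) * g (sg R))"
  using dominantD[OF domi[OF s] g(2)] gen_in[OF irrC] by eventually_elim (simp add: rh(3))
 then show "EX g a. reg C P g a & (\<forall>\<^sub>F R in gen C. f R = t (sg R) * g R)" using reg_trans[OF s P g(1)] by blast
qed

lemma hord_trans:
 assumes s: "sg \<in> G" and P: "P \<in> C" and h: "hord (sg P) f n" shows "hord P (%R. f (sg R)) n"
proof -
 have sP: "sg P \<in> C" using s P by simp
 obtain u c where u: "reg C (sg P) u c" "c ~= 0" "aeg C (%R. f R = tt (sg P) R powi n * u R)"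
  using h unfolding hord_def by blast
 have "hord P (%R. tt (sg P) (sg R) powi n * u (sg R)) (n * 1 + 0)"
  by (intro hord_mult[OF P] hord_power_int[OF P] hord_unif[OF P] unif_trans[OF s P unif_tt[OF sP]]
   hord_unit[OF reg_trans[OF s P u(1)] u(2)])
 then show ?thesis using hord_cong[OF _ dominantD[OF domi[OF s] u(3)]] by simp
qed

text \<open>The topological part reduces to cofinite sets. A nonempty open subset of the line has a
  finite complement, and its preimage omits finitely many orbits; conversely the zeros of a form on
  \<open>C\<close> have a finite image. The values are treated by pulling back and by
  descending.\<close>

lemma geometric_quotient: "geometric_quotient C G PL q"
 unfolding geometric_quotient_def
proof (intro conjI allI impI ballI surj)
 show "q P = q R \<longleftrightarrow> (\<exists>sg\<in>G. R = sg P)" if "P \<in> C" "R \<in> C" for P R using fib that .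
 fix f :: "('k, 2) proj \<rightharpoonup> 'k"
 let ?g = "f \<circ>\<^sub>m ((Some \<circ> q) |` C)"
 have g: "?g R = (if R \<in> C then f (q R) else None)" for R by (simp add: map_comp_def restrict_map_def)
 have dg: "dom ?g = {R\<in>C. q R \<in> dom f}" by (auto simp: g domIff split: if_splits)
 have df: "y \<in> dom f \<longleftrightarrow> (\<exists>P\<in>dom ?g. y = q P)" for y unfolding dg using surj by fastforce
 have orbit: "finite {R\<in>C. q R = y}" for y
 proof -
  obtain P where P: "P \<in> C" "y = q P" using surj by blast
  have "{R\<in>C. q R = y} \<subseteq> (%sg. sg P) ` G" using fib[OF P(1)] unfolding P(2) by force
  then show ?thesis using fin finite_subset by blast
 qed
 show "regular_fun PL f \<longleftrightarrow> regular_fun C ?g"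
 proof
  assume f: "regular_fun PL f"
  have o: "openin (subtopology zariski C) (dom ?g)"
  proof (cases "dom f = {}")
   case True then show ?thesis by (simp add: dg)
  next
   case False
   have "finite (- dom f)" using cofinite_open_PL f False unfolding regular_fun_def by blast
   then have "finite (\<Union>y\<in>- dom f. {R\<in>C. q R = y})" using orbit by blast
   from openin_cofinite[OF this, of C] show ?thesis
   by (rule back_subst[of "openin _"]) (auto simp: dg)
  qed
  show "regular_fun C ?g"
  proof (rule regular_funI[OF irrC o])
   fix P a assume "?g P = Some a"
   then have Pa: "P \<in> C" "f (q P) = Some a" by (auto simp: g split: if_splits)
   then have "reg PL (q P) (%R. the (f R)) a" using regular_fun_reg(2)[OF irr_PL f, of "q P"] by auto
   then show "reg C P (%R. the (f (q R))) a" by (rule pull[OF Pa(1)])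
  qed
 next
  assume r: "regular_fun C ?g"
  show "regular_fun PL f"
  proof (cases "dom ?g = {}")
   case True
   then have "dom f = {}" using df by blast
   then show ?thesis unfolding regular_fun_def by (simp only: openin_empty simp_thms ball_empty)
  next
   case False
   have hr: "ratl C (%R. the (?g R))" using regular_fun_ratl[OF irrC r False] .
   have "EX f'. ratl PL f' & (\<forall>\<^sub>F R in gen C. f' (q R) = the (?g R))"
   by (rule descend_exact[OF hr]) (simp add: g q_inv)
   then obtain f' where f': "ratl PL f'" "aeg C (%R. f' (q R) = the (?g R))" by blast
   obtain P H d where H: "P \<in> C" "hmg d H" "peval H P ~= 0" "!!R. R \<in> C ==> peval H R ~= 0 ==> R \<in> dom ?g"
   proof -
   have o: "openin (subtopology zariski C) (dom ?g)" using r unfolding regular_fun_def by (rule conjunct1)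
   obtain P where P: "P \<in> dom ?g" using False by blast
   obtain H d where "hmg d H" "peval H P ~= 0" "\<forall>R\<in>C. peval H R ~= 0 --> R \<in> dom ?g"
   using o[unfolded openin_zariski_sub, THEN conjunct2, rule_format, OF P] by blast
   moreover have "P \<in> C" using P dg by blast
   ultimately show ?thesis using that by blast
   qed
   have "- dom f \<subseteq> q ` {R\<in>C. peval H R = 0}"
   proof
   fix y assume y: "y \<in> - dom f"
   obtain R where R: "R \<in> C" "y = q R" using surj by blast
   then have "R \<notin> dom ?g" using y df by blast
   then show "y \<in> q ` {R\<in>C. peval H R = 0}" using H(4)[OF R(1)] R by blast
   qed
   then have "finite (- dom f)" using finite_image_zeros[OF H(2,1,3)] finite_subset by blast
   from openin_cofinite[OF this, of UNIV] have o: "openin (subtopology zariski PL) (dom f)"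
   by (rule back_subst[of "openin _"]) auto
   show ?thesis
   proof (rule regular_funI[OF irr_PL o])
   fix y a assume ya: "f y = Some a"
   then obtain P where P: "P \<in> dom ?g" "y = q P" using df[of y] by blast
   have Pa: "P \<in> C" "?g P = Some a" using P ya dg by (auto simp: g)
   have "reg C P (%R. the (?g R)) a" using regular_fun_reg(2)[OF irrC r P(1)] Pa(2) by simp
   from reg_q_converse[OF Pa(1) f'(1) reg_cong[OF this f'(2)]] show "reg PL y f' a" unfolding P(2) .
   qed
  qed
 qed
qed

end

lemma geometric_quotient_gal_cover:
 fixes C :: "('k::alg_closed_field, 'n::finite) proj set"
 assumes ag: "aut_group C G" and uex: "!!P. P \<in> C ==> EX t. unif C P t"
  and gq: "geometric_quotient C G (PL :: ('k, 2) proj set) q"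
 shows "gal_cover C G q"
proof -
 interpret aut_group C G by (rule ag)
 have surj: "q ` C = UNIV" and fib: "!!P R. P \<in> C ==> R \<in> C ==> q P = q R \<longleftrightarrow> (\<exists>sg\<in>G. R = sg P)"
  and iff: "!!f. regular_fun PL f \<longleftrightarrow> regular_fun C (f \<circ>\<^sub>m ((Some \<circ> q) |` C))"
  using gq unfolding geometric_quotient_def by auto
 have g: "(f \<circ>\<^sub>m ((Some \<circ> q) |` C)) R = (if R \<in> C then f (q R) else None)" for R and f :: "('k, 2) proj \<rightharpoonup> 'k"
  by (simp add: map_comp_def restrict_map_def)
 \<comment> \<open>Quotients of forms, defined exactly where the denominator is nonzero. Testing the
   clause on regular functions with them shows that preimages of open sets are open and that regular
   functions pull back.\<close>
 define loc where "loc F H = (%R. if peval H R ~= 0 then Some (peval F R / peval H R) else None)"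
  for F H :: "('k, 2) mpoly"
 have loc: "regular_fun PL (loc F H)" if "hmg d F" "hmg d H" for F H d
 proof (rule regular_funI[OF irr_PL])
  have "dom (loc F H) = {R\<in>UNIV. peval H R ~= 0}" by (auto simp: loc_def split: if_splits)
  then show "openin (subtopology zariski PL) (dom (loc F H))" using openin_basic[OF that(2), of UNIV] by simp
  show "reg PL P (%R. peval F R / peval H R) a" if "loc F H P = Some a" for P a
   using that reg_form[OF \<open>hmg d F\<close> \<open>hmg d H\<close>, of P] by (auto simp: loc_def split: if_splits)
 qed
 have ae: "aeg C (%R. R \<in> C & peval H (q R) ~= 0)" if H: "hmg d H" "peval H y ~= 0" for H d y
 proof -
  have r: "regular_fun C (loc H H \<circ>\<^sub>m ((Some \<circ> q) |` C))" using iff loc[OF H(1) H(1)] by blast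
  obtain P where P: "P \<in> C" "q P = y" using surj by (metis UNIV_I imageE)
  then have "P \<in> dom (loc H H \<circ>\<^sub>m ((Some \<circ> q) |` C))" using H(2) by (simp add: g domIff loc_def)
  then have "aeg C (%R. R \<in> dom (loc H H \<circ>\<^sub>m ((Some \<circ> q) |` C)))" using regular_fun_dom[OF irrC r] by blast
  then show ?thesis by eventually_elim (auto simp: g domIff loc_def split: if_splits)
 qed
 have dom: "dominant C PL q"
  unfolding filterlim_iff
 proof (intro allI impI)
  fix Q assume "\<forall>\<^sub>F y in gen (PL :: ('k, 2) proj set). Q y"
  then obtain H d y where H: "hmg d H" "peval H y ~= 0" "!!y. peval H y ~= 0 ==> Q y"
   unfolding eventually_gen[OF irr_PL] by blast
  from ae[OF H(1,2)] show "aeg C (%R. Q (q R))" by eventually_elim (use H(3) in auto)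
 qed
 show ?thesis
 proof
  show "q ` C = UNIV" by (rule surj)
  show "q P = q R \<longleftrightarrow> (\<exists>sg\<in>G. R = sg P)" if "P \<in> C" "R \<in> C" for P R by (rule fib[OF that])
  show "dominant C PL q" by (rule dom)
  show "reg C P (%R. f (q R)) a" if P: "P \<in> C" and f: "reg PL (q P) f a" for P f a
  proof -
   obtain F H d where FH: "hmg d F" "hmg d H" "peval H (q P) ~= 0"
   "a = peval F (q P) / peval H (q P)" "aeg PL (%R. f R = peval F R / peval H R)"
   using f unfolding reg_def by blast
   have r: "regular_fun C (loc F H \<circ>\<^sub>m ((Some \<circ> q) |` C))" using iff loc[OF FH(1,2)] by blast
   have Pd: "(loc F H \<circ>\<^sub>m ((Some \<circ> q) |` C)) P = Some a" using P FH(3,4) by (simp add: g loc_def)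
   have "reg C P (%R. the ((loc F H \<circ>\<^sub>m ((Some \<circ> q) |` C)) R)) a"
   using regular_fun_reg(2)[OF irrC r, of P] Pd by auto
   moreover have "aeg C (%R. f (q R) = the ((loc F H \<circ>\<^sub>m ((Some \<circ> q) |` C)) R))"
   using ae[OF FH(2,3)] dominantD[OF dom FH(5)] by eventually_elim (simp add: g loc_def)
   ultimately show ?thesis by (rule reg_cong)
  qed
  show "EX f. ratl PL f & (\<forall>\<^sub>F R in gen C. f (q R) = h R)"
   if h: "ratl C h" and inv: "!!sg. sg \<in> G ==> \<forall>\<^sub>F R in gen C. h (sg R) = h R" for h
  proof -
   have 1: "reg C P h a" if "sg \<in> G" "P \<in> C" "reg C (sg P) h a" for sg P a
   proof -
   have "aeg C (%R. h R = h (sg R))" using inv[OF that(1)] by eventually_elim simp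
   from reg_cong[OF reg_trans[OF that] this] show ?thesis .
   qed
   have 2: "cls C h (sg P) = cls C h P" if s: "sg \<in> G" "P \<in> C" for sg P
   proof -
   obtain rh where rh: "rh \<in> G" "!!P. P \<in> C ==> sg (rh P) = P" "!!P. P \<in> C ==> rh (sg P) = P"
   by (rule ex_inverse[OF s(1)]) blast
   have "reg C (sg P) h a \<longleftrightarrow> reg C P h a" for a
   using 1[OF s, of a] 1[OF rh(1), of "sg P" a] s rh(3)[OF s(2)] by auto
   then have "reg C (sg P) h = reg C P h" by blast
   then show ?thesis using s by (simp add: cls_def cong: if_cong)
   qed
   \<comment> \<open>\<open>cls C h\<close> is invariant together with its domain, so it induces a
     partial function on the line; the quotient property makes it regular.\<close>
   define f where "f y = cls C h (SOME P. P \<in> C & q P = y)" for y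
   have fq: "f (q P) = cls C h P" if P: "P \<in> C" for P
   proof -
   have "EX R. R \<in> C & q R = q P" using P by blast
   then have "(SOME R. R \<in> C & q R = q P) \<in> C & q (SOME R. R \<in> C & q R = q P) = q P" by (rule someI_ex)
   then obtain R where R: "f (q P) = cls C h R" "R \<in> C" "q P = q R" unfolding f_def by metis
   then obtain sg where "sg \<in> G" "R = sg P" using fib[OF P R(2)] by blast
   then show ?thesis using R(1) 2 P by simp
   qed
   have eq: "f \<circ>\<^sub>m ((Some \<circ> q) |` C) = cls C h"
   by (rule ext) (auto simp: g fq cls_def)
   then have r: "regular_fun PL f" using iff regular_fun_cls[OF irrC] by metis
   have "aeg C (%R. R \<in> C & f (q R) = Some (h R))"
   using gen_in[OF irrC] cls_generic[OF irrC h] by eventually_elim (simp add: fq)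
   then have "EX R. f (q R) ~= None" using gen_ex[OF irrC] by fastforce
   then have "dom f ~= {}" by blast
   then have "ratl PL (%R. the (f R))" by (rule regular_fun_ratl[OF irr_PL r])
   moreover have "aeg C (%R. the (f (q R)) = h R)"
   using gen_in[OF irrC] cls_generic[OF irrC h] by eventually_elim (simp add: fq)
   ultimately show ?thesis by blast
  qed
 qed (use uex in auto)
qed

section \<open>Divisors and linear systems\<close>

context curve
begin

lemma riemann_roch_cls:
 assumes f: "ratl C f"
 shows "cls C f \<in> riemann_roch_space C D \<longleftrightarrow> (\<forall>P\<in>C. ordge P f (- lkp D P))"
proof (cases "aeg C (%R. f R = 0)")
 case True
 then have "cls C f = \<zero>\<^bsub>FF C\<^esub>" using cls_eq_zero_iff[OF irrC f] by blast
 then show ?thesis using cls_in_rational_funs[OF irrC f] ordge_zero_fun[OF True]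
  by (simp add: riemann_roch_space_def)
next
 case False
 then have nz: "aeg C (%R. f R ~= 0)" using ratl_dich[OF irrC f] by blast
 have "cls C f ~= \<zero>\<^bsub>FF C\<^esub>" using cls_eq_zero_iff[OF irrC f] False by blast
 moreover have "0 \<le> ord_at C P (cls C f) + d \<longleftrightarrow> ordge P f (- d)" if P: "P \<in> C" for P d
 proof -
  obtain n where n: "hord P f n" using hord_ex[OF P f nz] by blast
  show ?thesis unfolding ordge_hord[OF P n] ord_at_cls[OF P f n] by linarith
 qed
 ultimately show ?thesis using cls_in_rational_funs[OF irrC f] by (simp add: riemann_roch_space_def)
qed

lemma divisor_of_cls:
 assumes f: "ratl C f" "aeg C (%R. f R ~= 0)"
 shows "divisor_of C (cls C f) E \<longleftrightarrow> is_divisor C E & (\<forall>P\<in>C. hord P f (lkp E P))"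
proof -
 have "lkp E P = ord_at C P (cls C f) \<longleftrightarrow> hord P f (lkp E P)" if P: "P \<in> C" for P
 proof -
  obtain n where n: "hord P f n" using hord_ex[OF P f] by blast
  have "hord P f m \<longleftrightarrow> m = n" for m using hord_unique[OF P n] n by blast
  then show ?thesis unfolding ord_at_cls[OF P f(1) n] by simp
 qed
 then show ?thesis by (simp add: divisor_of_def)
qed

lemma linear_system_iff:
 assumes V: "V \<subseteq> carrier (FF C)"
 shows "E \<in> linear_system C D V \<longleftrightarrow> is_divisor C (E - D) & (EX f. ratl C f & (\<forall>\<^sub>F R in gen C. f R ~= 0) & cls C f \<in> V &
  (\<forall>P\<in>C. hord P f (lkp E P - lkp D P)))"
proof -
 have *: "x \<in> V - {\<zero>\<^bsub>FF C\<^esub>} \<longleftrightarrow> (EX f. ratl C f & (\<forall>\<^sub>F R in gen C. f R ~= 0) & x = cls C f & cls C f \<in> V)" for x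
 proof
  assume x: "x \<in> V - {\<zero>\<^bsub>FF C\<^esub>}"
  then obtain f where f: "ratl C f" "x = cls C f" using V carrier_FF[OF irrC] by blast
  then show "EX f. ratl C f & (\<forall>\<^sub>F R in gen C. f R ~= 0) & x = cls C f & cls C f \<in> V"
   using x cls_eq_zero_iff[OF irrC f(1)] ratl_dich[OF irrC f(1)] by blast
 next
  assume "EX f. ratl C f & (\<forall>\<^sub>F R in gen C. f R ~= 0) & x = cls C f & cls C f \<in> V"
  then obtain f where f: "ratl C f" "aeg C (%R. f R ~= 0)" "x = cls C f" "cls C f \<in> V" by blast
  have "cls C f ~= \<zero>\<^bsub>FF C\<^esub>"
   unfolding cls_eq_zero_iff[OF irrC f(1)] using f(2) gen_False[OF irrC, of "%R. f R = 0"] by blast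
  then have "x ~= \<zero>\<^bsub>FF C\<^esub>" using f(3) by simp
  then show "x \<in> V - {\<zero>\<^bsub>FF C\<^esub>}" using f by blast
 qed
 have "E \<in> linear_system C D V \<longleftrightarrow> (EX f. ratl C f & (\<forall>\<^sub>F R in gen C. f R ~= 0) & cls C f \<in> V & divisor_of C (cls C f) (E - D))"
  unfolding linear_system_def Bex_def * by blast
 also have "\<dots> \<longleftrightarrow> is_divisor C (E - D) & (EX f. ratl C f & (\<forall>\<^sub>F R in gen C. f R ~= 0) & cls C f \<in> V &
  (\<forall>P\<in>C. hord P f (lkp E P - lkp D P)))"
 proof -
  have "(ratl C f & (\<forall>\<^sub>F R in gen C. f R ~= 0) & cls C f \<in> V & divisor_of C (cls C f) (E - D)) \<longleftrightarrow>
   (is_divisor C (E - D) & (ratl C f & (\<forall>\<^sub>F R in gen C. f R ~= 0) & cls C f \<in> V &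
  (\<forall>P\<in>C. hord P f (lkp E P - lkp D P))))" for f
  proof (cases "ratl C f & (\<forall>\<^sub>F R in gen C. f R ~= 0)")
   case True
   then show ?thesis by (simp only: divisor_of_cls lookup_minus simp_thms conj_ac)
  qed blast
  then show ?thesis by (simp only: ex_simps)
 qed
 finally show ?thesis .
qed

end

lemma cls_smult_closed:
 assumes i: "irr C" and V: "subalgebra (constants C) V (FF C)" and f: "ratl C f" "cls C f \<in> V"
 shows "cls C (%R. c * f R) \<in> V"
proof -
 have "const_fun C c \<otimes>\<^bsub>FF C\<^esub> cls C f \<in> V"
  by (rule subalgebra.smult_closed[OF V]) (auto simp: constants_def f)
 then show ?thesis by (simp add: const_fun_cls[OF i] FF_mult[OF i ratl_const[OF i] f(1)])
qed

lemma cls_add_closed: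
 assumes i: "irr C" and V: "subalgebra (constants C) V (FF C)" and f: "ratl C f" "cls C f \<in> V" "ratl C g" "cls C g \<in> V"
 shows "cls C (%R. f R + g R) \<in> V"
 using subgroup.m_closed[OF subalgebra.axioms(1)[OF V] f(2,4)] by (simp add: FF_add[OF i f(1,3)])

lemma lam_mobius:
 fixes y y0 :: "('k::alg_closed_field, 2) proj"
 assumes "y ~= y0"
 obtains \<alpha> \<beta> where "\<beta> ~= 0" "!!R. R ~= y0 ==> peval (lam y) R / peval (lam y0) R = \<alpha> + \<beta> * xc y0 R"
proof -
 obtain a b where ab: "!!v. v = evm (mu y0) v *s a + evm (lam y0) v *s b"
  "a = (1 / evm (mu y0) (rep_proj y0)) *s rep_proj y0" by (rule line_basis[of y0]) blast
 have *: "evm (lam y) (c *s a + d *s b) = c * evm (lam y) a + d * evm (lam y) b" for c d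
  by (simp add: eval_lam algebra_simps)
 have "evm (lam y) (rep_proj y0) ~= 0" using assms peval_lam[of y y0] by (simp add: peval_def)
 moreover have "evm (mu y0) (rep_proj y0) ~= 0" using peval_mu[of y0] by (simp add: peval_def)
 moreover have "evm (lam y) a = (1 / evm (mu y0) (rep_proj y0)) * evm (lam y) (rep_proj y0)"
  unfolding ab(2) by (subst eval_mpoly_scale[OF homogeneous_lam]) simp
 ultimately have \<beta>: "evm (lam y) a ~= 0" by simp
 show ?thesis
 proof (rule that[OF \<beta>, of "evm (lam y) b"])
  fix R assume "R ~= y0"
  then have "peval (lam y0) R ~= 0" by (simp add: peval_lam)
  moreover have "peval (lam y) R = peval (mu y0) R * evm (lam y) a + peval (lam y0) R * evm (lam y) b"
   unfolding peval_def by (subst (1) ab(1)[of "rep_proj R"]) (rule *)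
  ultimately show "peval (lam y) R / peval (lam y0) R = evm (lam y) b + evm (lam y) a * xc y0 R"
   by (simp add: xc_def field_simps)
 qed
qed

lemma unif_sp: "unif PL y (sp (y :: ('k::alg_closed_field, 2) proj))"
 unfolding unif_def
proof (intro conjI reg_sp allI impI)
 fix f :: "('k, 2) proj => 'k" assume f: "reg PL y f 0"
 show "EX g a. reg PL y g a & (\<forall>\<^sub>F R in gen PL. f R = sp y R * g R)"
 proof (cases "aeg PL (%R. f R = 0)")
  case True
  then have "aeg PL (%R. f R = sp y R * 0)" by simp
  then show ?thesis using reg_const[OF irr_PL, of y 0] by blast
 next
  case False
  obtain n u c where u: "reg PL y u c" "c ~= 0" "aeg PL (%R. f R = sp y R powi n * u R)"
   by (rule local_form_PL[OF reg_imp_ratl[OF f UNIV_I] False]) blast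
  have "n > 0"
  proof (rule ccontr)
   assume n: "\<not> n > 0"
   have "reg PL y (%R. f R * sp y R ^ nat (- n)) (0 * 0 ^ nat (- n))"
   by (intro reg_mult reg_power irr_PL UNIV_I f reg_sp)
   moreover have "aeg PL (%R. f R * sp y R ^ nat (- n) = u R)"
   using u(3) ae_sp_neq[of y 0]
   proof eventually_elim
   case (elim R)
   have "sp y R powi n * sp y R ^ nat (- n) = inverse (sp y R ^ nat (- n)) * sp y R ^ nat (- n)"
   using n by (cases "n = 0") (simp_all add: power_int_def power_inverse)
   also have "\<dots> = 1" using elim(2) by simp
   finally show ?case using elim(1) by (simp add: mult_ac)
   qed
   then have "aeg PL (%R. u R = f R * sp y R ^ nat (- n))" by eventually_elim simp
   ultimately have "reg PL y u (0 * 0 ^ nat (- n))" by (metis reg_cong)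
   then show False using reg_unique[OF irr_PL UNIV_I u(1)] u(2) by simp
  qed
  have "reg PL y (%R. sp y R ^ nat (n - 1) * u R) (0 ^ nat (n - 1) * c)"
   by (intro reg_mult reg_power irr_PL UNIV_I u reg_sp)
  moreover have "aeg PL (%R. f R = sp y R * (sp y R ^ nat (n - 1) * u R))"
   using u(3)
  proof eventually_elim
   case (elim R)
   have "sp y R powi n = sp y R ^ Suc (nat (n - 1))" using \<open>n > 0\<close> by (simp add: power_int_def Suc_nat_eq_nat_zadd1 del: power_Suc)
   then show ?case using elim by (simp add: mult.assoc)
  qed
  ultimately show ?thesis by blast
 qed
qed

section \<open>Fibres of the quotient map as divisors, and the linear system they form\<close>

context gal_cover
begin

text \<open>The ramification index of \<open>q\<close> at \<open>P\<close>. Its relation to the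
  stabilizer of \<open>P\<close> is a separate matter, settled differently in the two
  directions.\<close>

definition ram :: "('k, 'n) proj => int" where
 "ram P = (SOME n. hord P (%R. sp (q P) (q R)) n)"

lemma hord_ram: "P \<in> C ==> hord P (%R. sp (q P) (q R)) (ram P)"
 unfolding ram_def by (rule someI_ex[OF hord_ex[OF _ ratl_pull_q[OF ratl_sp] s_neq]])

lemma ram_pos: "P \<in> C ==> 0 < ram P"
 using hord_reg(2)[OF _ hord_ram reg_s] by blast

lemma ram_trans: assumes "sg \<in> G" "P \<in> C" shows "ram (sg P) = ram P"
proof -
 have sP: "sg P \<in> C" using assms by simp
 have "hord P (%R. sp (q (sg P)) (q (sg R))) (ram (sg P))" by (rule hord_trans[OF assms hord_ram[OF sP]])
 moreover have "aeg C (%R. sp (q P) (q R) = sp (q (sg P)) (q (sg R)))"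
  using gen_in[OF irrC] by eventually_elim (simp add: q_inv assms)
 ultimately have "hord P (%R. sp (q P) (q R)) (ram (sg P))" by (rule hord_cong)
 from hord_unique[OF assms(2) this hord_ram[OF assms(2)]] show ?thesis .
qed

lemma finite_fibre: "finite {P\<in>C. q P = y}"
proof -
 obtain P where P: "P \<in> C" "y = q P" using surj by blast
 have "{R\<in>C. q R = y} \<subseteq> (%sg. sg P) ` G" using fib[OF P(1)] unfolding P(2) by force
 then show ?thesis using fin finite_subset by blast
qed

definition fibd :: "('k, 2) proj => ('k, 'n) divisor" where
 "fibd y = (\<Sum>P\<in>{P\<in>C. q P = y}. Poly_Mapping.single P (ram P))"

lemma lookup_fibd: "lkp (fibd y) P = (if P \<in> C & q P = y then ram P else 0)"
 unfolding fibd_def lookup_sum lookup_single when_def using finite_fibre[of y] by (simp add: sum.delta)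

lemma is_divisor_fibd: "is_divisor C (fibd y)"
 unfolding is_divisor_def by (auto simp: in_keys_iff lookup_fibd split: if_splits)

lemma divisor_eqI:
 assumes "is_divisor C D" "is_divisor C E" "!!P. P \<in> C ==> lkp D P = lkp E P"
 shows "D = E"
proof (rule poly_mapping_eqI)
 fix P
 show "lkp D P = lkp E P"
 proof (cases "P \<in> C")
  case False
  then have "P \<notin> Poly_Mapping.keys D" "P \<notin> Poly_Mapping.keys E" using assms(1,2) by (auto simp: is_divisor_def)
  then show ?thesis by (simp add: in_keys_iff)
 qed (rule assms(3))
qed

lemma pullback_q: "ratl PL f ==> pullback C (Some \<circ> q) (cls PL f) = cls C (%R. f (q R))"
 by (rule pullback_cls[OF irrC irr_PL pull domin]) auto

text \<open>Two quotient maps for the same group have the same invariants, so a local parameter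
  pulled back along one descends along the other and is divisible there by the parameter. Hence the
  two ramification indices bound each other.\<close>

lemma quotient_order:
 assumes g2: "gal_cover C G q'" and P: "P \<in> C" and t: "unif PL (q' P) t"
 shows "hord P (%R. t (q' R)) (ram P)"
proof -
 interpret g2: gal_cover C G q' by (rule g2)
 let ?s = "%R. sp (q P) (q R)" and ?t = "%R. t (q' R)"
 have t0: "reg PL (q' P) t 0" using t by (simp add: unif_def)
 have rt: "ratl PL t" using reg_imp_ratl[OF t0 UNIV_I] .
 have "EX g. ratl PL g & (\<forall>\<^sub>F R in gen C. g (q' R) = ?s R)"
  by (rule g2.descend_exact[OF ratl_pull_q[OF ratl_sp]]) (simp add: q_inv)
 then obtain g where g: "ratl PL g" "aeg C (%R. g (q' R) = ?s R)" by blast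
 have "reg PL (q' P) g 0" using g2.reg_q_converse[OF P g(1) reg_cong[OF reg_s[OF P] g(2)]] .
 then obtain b \<beta> where b: "reg PL (q' P) b \<beta>" "aeg PL (%R. g R = t R * b R)" using t unfolding unif_def by blast
 have sb: "aeg C (%R. ?s R = ?t R * b (q' R))"
  using g(2) dominantD[OF g2.domin b(2)] by eventually_elim simp
 have rb: "reg C P (%R. b (q' R)) \<beta>" by (rule g2.pull[OF P b(1)])
 have nz: "aeg C (%R. ?t R ~= 0)" "aeg C (%R. b (q' R) ~= 0)"
  using sb s_neq[of "q P" 0] by (eventually_elim, auto)+
 obtain m where m: "hord P ?t m" using hord_ex[OF P g2.ratl_pull_q[OF rt] nz(1)] by blast
 obtain l where l: "hord P (%R. b (q' R)) l" using hord_ex[OF P reg_imp_ratl[OF rb P] nz(2)] by blast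
 have "m + l = ram P" using hord_unique[OF P hord_cong[OF hord_mult[OF P m l] sb] hord_ram[OF P]] .
 then have le: "m \<le> ram P" using hord_reg(1)[OF P l rb] by simp
 have "EX f. ratl PL f & (\<forall>\<^sub>F R in gen C. f (q R) = ?t R)"
  by (rule descend_exact[OF g2.ratl_pull_q[OF rt]]) (simp add: g2.q_inv)
 then obtain f where f: "ratl PL f" "aeg C (%R. f (q R) = ?t R)" by blast
 have "reg PL (q P) f 0" using reg_q_converse[OF P f(1) reg_cong[OF g2.pull[OF P t0] f(2)]] .
 then obtain k \<kappa> where k: "reg PL (q P) k \<kappa>" "aeg PL (%R. f R = sp (q P) R * k R)"
  using unif_sp[of "q P"] unfolding unif_def by blast
 have tk: "aeg C (%R. ?t R = ?s R * k (q R))"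
  using f(2) dominantD[OF domin k(2)] by eventually_elim simp
 have rk: "reg C P (%R. k (q R)) \<kappa>" by (rule pull[OF P k(1)])
 have "aeg C (%R. k (q R) ~= 0)" using tk nz(1) by eventually_elim auto
 then obtain j where j: "hord P (%R. k (q R)) j" using hord_ex[OF P reg_imp_ratl[OF rk P]] by blast
 have "ram P + j = m" using hord_unique[OF P hord_cong[OF hord_mult[OF P hord_ram[OF P] j] tk] m] .
 then have "ram P \<le> m" using hord_reg(1)[OF P j rk] by simp
 with le m show ?thesis by simp
qed

lemma quotient_system_eq: "quotient_system C G = range fibd"
proof (intro subset_antisym subsetI)
 fix E assume "E \<in> quotient_system C G"
 then obtain q' y' where E: "geometric_quotient C G PL q'" "pullback_point C PL q' y' E"
  unfolding quotient_system_def by blast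
 have g2: "gal_cover C G q'" by (rule geometric_quotient_gal_cover[OF aut_group_axioms uex E(1)])
 interpret g2: gal_cover C G q' by (rule g2)
 obtain T where T: "uniformizer PL y' T" "!!P. P \<in> C ==> lkp E P =
   (if q' P = y' then ord_at C P (pullback C (Some \<circ> q') T) else 0)" and ED: "is_divisor C E"
  using E(2) unfolding pullback_point_def by blast
 obtain t where t: "T = cls PL t" "unif PL y' t" by (rule uniformizerE[OF irr_PL UNIV_I T(1)])
 have rt: "ratl PL t" using t(2) reg_imp_ratl[OF _ UNIV_I] unfolding unif_def by blast
 obtain P0 where P0: "P0 \<in> C" "y' = q' P0" using g2.surj by blast
 have "E = fibd (q P0)"
 proof (rule divisor_eqI[OF ED is_divisor_fibd])
  fix P assume P: "P \<in> C"
  have iff: "q' P = y' \<longleftrightarrow> q P = q P0" unfolding P0(2) using fib[OF P P0(1)] g2.fib[OF P P0(1)] by simp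
  show "lkp E P = lkp (fibd (q P0)) P"
  proof (cases "q' P = y'")
   case True
   have "ord_at C P (cls C (%R. t (q' R))) = ram P"
   by (rule ord_at_cls[OF P g2.ratl_pull_q[OF rt] quotient_order[OF g2 P]]) (use t(2) True in simp)
   then show ?thesis using T(2)[OF P] True iff P unfolding t(1) g2.pullback_q[OF rt] by (simp add: lookup_fibd)
  next
   case False then show ?thesis using T(2)[OF P] iff by (simp add: lookup_fibd)
  qed
 qed
 then show "E \<in> range fibd" by blast
next
 fix E assume "E \<in> range fibd"
 then obtain y where E: "E = fibd y" by blast
 have u: "uniformizer PL y (cls PL (sp y))" using uniformizer_cls_iff[OF irr_PL UNIV_I ratl_sp] unif_sp by blast
 have "lkp E P = (if q P = y then ord_at C P (pullback C (Some \<circ> q) (cls PL (sp y))) else 0)" if P: "P \<in> C" for P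
  unfolding E lookup_fibd pullback_q[OF ratl_sp] using P ord_at_cls[OF P ratl_pull_q[OF ratl_sp] hord_ram[OF P]] by auto
 then have "pullback_point C PL q y E" unfolding pullback_point_def E using is_divisor_fibd u by blast
 then show "E \<in> quotient_system C G" unfolding quotient_system_def using geometric_quotient by blast
qed

lemma hord_lam_ratio:
 assumes P: "P \<in> C"
 shows "hord P (%R. peval (lam y) (q R) / peval (lam y0) (q R))
  (lkp (fibd y) P - lkp (fibd y0) P)"
proof -
 have 1: "hord P (%R. peval (lam y) (q R) / peval (mu (q P)) (q R)) (lkp (fibd y) P)" for y
 proof (cases "q P = y")
  case True
  then show ?thesis using hord_ram[OF P] P by (simp add: lookup_fibd sp_def)
 next
  case False
  have "reg PL (q P) (%R. peval (lam y) R / peval (mu (q P)) R) (peval (lam y) (q P) / peval (mu (q P)) (q P))"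
   by (rule reg_form[OF homogeneous_lam homogeneous_mu peval_mu])
  from pull[OF P this] have "hord P (%R. peval (lam y) (q R) / peval (mu (q P)) (q R)) 0"
   by (rule hord_unit) (use False in \<open>simp add: peval_lam peval_mu\<close>)
  then show ?thesis using False by (simp add: lookup_fibd)
 qed
 have "aeg C (%R. peval (lam y) (q R) / peval (lam y0) (q R) =
  (peval (lam y) (q R) / peval (mu (q P)) (q R)) / (peval (lam y0) (q R) / peval (mu (q P)) (q R)))"
  using dominantD[OF domin ae_mu[of "q P"]] by eventually_elim simp
 then show ?thesis by (rule hord_cong[OF hord_divide[OF P 1 1]])
qed

lemma same_order_scale:
 assumes f: "!!P. P \<in> C ==> hord P f (n P)" "!!P. P \<in> C ==> hord P g (n P)"
 obtains c where "c ~= 0" "aeg C (%R. g R = c * f R)"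
proof -
 have h: "hord P (%R. g R / f R) 0" if "P \<in> C" for P using hord_divide[OF that f(2) f(1)] that by fastforce
 have "EX a. reg C P (%R. g R / f R) a" if "P \<in> C" for P using hord_nonneg[OF that h[OF that]] by auto
 then obtain c where c: "aeg C (%R. g R / f R = c)" by (rule global_const)
 obtain P where P: "P \<in> C" using irrC unfolding irr_def by blast
 have e: "aeg C (%R. g R = c * f R)" using c hord_nz[OF P f(1)[OF P]] by eventually_elim auto
 have "c ~= 0"
 proof
  assume "c = 0"
  have "aeg C (%R. False)" using c hord_nz[OF P h[OF P]] by eventually_elim (use \<open>c = 0\<close> in auto)
  then show False using gen_const[OF irrC] by blast
 qed
 then show ?thesis using that e by blast
qed

text \<open>A function in \<open>V\<close> with divisor \<open>fibd y - fibd y0\<close> is a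
  multiple of the quotient of the linear forms of \<open>y\<close> and \<open>y0\<close>, because
  their ratio has neither zeros nor poles. The choice \<open>y = y0\<close> gives the constants, any
  other \<open>y\<close> an affine function of the coordinate.\<close>

lemma system_contains:
 assumes V: "subalgebra (constants C) V (FF C)" and sub: "quotient_system C G \<subseteq> linear_system C (fibd y0) V"
 shows "cls C (%_. 1) \<in> V" "cls C (%R. xc y0 (q R)) \<in> V"
proof -
 interpret field "FF C" by (rule field_FF[OF irrC])
 have Vc: "V \<subseteq> carrier (FF C)" by (rule subalgebra_in_carrier[OF V])
 have ex: "EX c g. c ~= 0 & ratl C g & cls C g \<in> V & (\<forall>\<^sub>F R in gen C. g R = c * (peval (lam y) (q R) / peval (lam y0) (q R)))" for y
 proof -
  have "fibd y \<in> linear_system C (fibd y0) V" using sub unfolding quotient_system_eq by blast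
  then obtain g where g: "ratl C g" "cls C g \<in> V" "\<forall>P\<in>C. hord P g (lkp (fibd y) P - lkp (fibd y0) P)"
   unfolding linear_system_iff[OF Vc] by blast
  obtain c where "c ~= 0" "aeg C (%R. g R = c * (peval (lam y) (q R) / peval (lam y0) (q R)))"
   by (rule same_order_scale[OF hord_lam_ratio]) (use g(3) in auto)
  then show ?thesis using g by blast
 qed
 note ael = dominantD[OF domin ae_neq[of y0]]
 show one: "cls C (%_. 1) \<in> V"
 proof -
  obtain c g where g: "c ~= 0" "ratl C g" "cls C g \<in> V" "aeg C (%R. g R = c * (peval (lam y0) (q R) / peval (lam y0) (q R)))"
   using ex by blast
  have "aeg C (%R. inverse c * g R = 1)"
   using g(4) ael by eventually_elim (use g(1) in \<open>simp add: peval_lam\<close>)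
  then have "cls C (%R. inverse c * g R) = cls C (%_. 1)" by (rule cls_cong)
  then show ?thesis using cls_smult_closed[OF irrC V g(2,3), of "inverse c"] by simp
 qed
 obtain y where y: "y ~= y0" using ex_other by blast
 obtain \<alpha> \<beta> where ab: "\<beta> ~= 0" "!!R. R ~= y0 ==> peval (lam y) R / peval (lam y0) R = \<alpha> + \<beta> * xc y0 R"
  by (rule lam_mobius[OF y]) blast
 obtain c g where g: "c ~= 0" "ratl C g" "cls C g \<in> V" "aeg C (%R. g R = c * (peval (lam y) (q R) / peval (lam y0) (q R)))"
  using ex by blast
 have "aeg C (%R. inverse (c * \<beta>) * g R + (- \<alpha> / \<beta>) * 1 = xc y0 (q R))"
  using g(4) ael by eventually_elim (use g(1) ab in \<open>simp add: field_simps\<close>)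
 then have "cls C (%R. inverse (c * \<beta>) * g R + (- \<alpha> / \<beta>) * 1) = cls C (%R. xc y0 (q R))" by (rule cls_cong)
 moreover have "cls C (%R. inverse (c * \<beta>) * g R + (- \<alpha> / \<beta>) * 1) \<in> V"
  by (intro cls_add_closed[OF irrC V] cls_smult_closed[OF irrC V] ratl_mult ratl_const irrC g one)
 ultimately show "cls C (%R. xc y0 (q R)) \<in> V" by simp
qed

lemma system_subset:
 assumes V: "subalgebra (constants C) V (FF C)" and one: "cls C (%_. 1) \<in> V" and x: "cls C (%R. xc y0 (q R)) \<in> V"
 shows "quotient_system C G \<subseteq> linear_system C (fibd y0) V"
proof
 interpret field "FF C" by (rule field_FF[OF irrC])
 have Vc: "V \<subseteq> carrier (FF C)" by (rule subalgebra_in_carrier[OF V])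
 fix E assume "E \<in> quotient_system C G"
 then obtain y where E: "E = fibd y" unfolding quotient_system_eq by blast
 let ?f = "%R. peval (lam y) (q R) / peval (lam y0) (q R)"
 note ael = dominantD[OF domin ae_neq[of y0]]
 have fr: "ratl C ?f" using ratl_pull_q[OF ratl_form[OF irr_PL homogeneous_lam homogeneous_lam]] .
 have "cls C ?f \<in> V"
 proof (cases "y = y0")
  case True
  have "aeg C (%R. ?f R = 1)" using ael by eventually_elim (use True in \<open>simp add: peval_lam\<close>)
  from cls_cong[OF this] one show ?thesis by simp
 next
  case False
  obtain \<alpha> \<beta> where ab: "\<beta> ~= 0" "!!R. R ~= y0 ==> peval (lam y) R / peval (lam y0) R = \<alpha> + \<beta> * xc y0 R"
   by (rule lam_mobius[OF False]) blast
  have "aeg C (%R. ?f R = \<alpha> * 1 + \<beta> * xc y0 (q R))"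
   using ael by eventually_elim (use ab in simp)
  from cls_cong[OF this] show ?thesis
   using cls_add_closed[OF irrC V _ cls_smult_closed[OF irrC V _ one, of \<alpha>] _ cls_smult_closed[OF irrC V _ x, of \<beta>]]
   by (simp add: ratl_mult ratl_const irrC ratl_pull_q[OF ratl_xc])
 qed
 moreover have "is_divisor C (E - fibd y0)"
  unfolding E is_divisor_def by (auto simp: in_keys_iff lookup_minus lookup_fibd split: if_splits)
 moreover obtain P where P: "P \<in> C" using irrC unfolding irr_def by blast
 moreover have "aeg C (%R. ?f R ~= 0)" using hord_nz[OF P hord_lam_ratio[OF P]] .
 ultimately show "E \<in> linear_system C (fibd y0) V"
  unfolding linear_system_iff[OF Vc] using fr hord_lam_ratio unfolding E by blast
qed

lemma xc_order: assumes P: "P \<in> C" shows "ordge P (%R. xc y0 (q R)) (- lkp (fibd y0) P)"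
proof (cases "q P = y0")
 case True
 have "hord P (%R. xc y0 (q R)) (- ram P)"
  using hord_inverse[OF P hord_ram[OF P]] True by (simp add: xc_inverse)
 then show ?thesis using ordge_hord[OF P] P True by (auto simp: lookup_fibd)
next
 case False
 from pull[OF P reg_xc[OF False]] show ?thesis using ordge_reg False by (auto simp: lookup_fibd)
qed

text \<open>On the orbit of \<open>Q\<close> both divisors are constant, so a rational function with divisor their
 difference has no pole, or its inverse has none.\<close>

lemma orbit_divisor:
 assumes Q: "Q \<in> C"
 shows "lkp (\<Sum>sg\<in>G. Poly_Mapping.single (sg Q) (1::int)) P =
  (if P \<in> C & q P = q Q then int (card {sg\<in>G. sg Q = Q}) else 0)"
proof -
 have "lkp (\<Sum>sg\<in>G. Poly_Mapping.single (sg Q) (1::int)) P = (\<Sum>sg\<in>G. if sg Q = P then 1 else 0)"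
  unfolding lookup_sum lookup_single when_def by (rule sum.cong) auto
 also have "\<dots> = int (card {sg\<in>G. sg Q = P})" using fin by (simp add: sum.If_cases Int_def)
 also have "\<dots> = (if P \<in> C & q P = q Q then int (card {sg\<in>G. sg Q = Q}) else 0)"
 proof (cases "P \<in> C & q P = q Q")
  case True
  then obtain ta where t: "ta \<in> G" "P = ta Q" using fib[OF Q, of P] by auto
  have "bij_betw (%sg. compose C ta sg) {sg\<in>G. sg Q = Q} {sg\<in>G. sg Q = P}"
  proof (rule bij_betw_imageI)
   show "inj_on (%sg. compose C ta sg) {sg\<in>G. sg Q = Q}"
   using bij_left[OF t(1)] by (auto simp: bij_betw_def intro: inj_on_subset)
   show "(%sg. compose C ta sg) ` {sg\<in>G. sg Q = Q} = {sg\<in>G. sg Q = P}"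
   proof (intro subset_antisym subsetI)
   fix x assume "x \<in> (%sg. compose C ta sg) ` {sg\<in>G. sg Q = Q}"
   then show "x \<in> {sg\<in>G. sg Q = P}" using comp[OF t(1)] Q t(2) by (auto simp: compose_def)
   next
   fix x assume x: "x \<in> {sg\<in>G. sg Q = P}"
   then obtain sg where s: "sg \<in> G" "x = compose C ta sg" using bij_left[OF t(1)] by (auto simp: bij_betw_def)
   have "ta (sg Q) = ta Q" using x s Q t(2) by (auto simp: compose_def)
   then have "sg Q = Q" using inj[OF t(1)] s(1) Q by (auto dest: inj_onD)
   then show "x \<in> (%sg. compose C ta sg) ` {sg\<in>G. sg Q = Q}" using s by blast
   qed
  qed
  then show ?thesis using bij_betw_same_card True by fastforce
 next
  case False
  then have "{sg\<in>G. sg Q = P} = {}" using Q q_inv by auto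
  then show ?thesis using False by (simp only: card.empty if_False)
 qed
 finally show ?thesis .
qed

lemma is_divisor_orbit: "Q \<in> C ==> is_divisor C (\<Sum>sg\<in>G. Poly_Mapping.single (sg Q) (1::int))"
 unfolding is_divisor_def by (auto simp: in_keys_iff orbit_divisor split: if_splits)

text \<open>Membership of the fibre in the linear system supplies a function whose order is
  \<open>ram Q - ?d\<close> along the orbit and 0 elsewhere. According to the sign, it or its
  inverse is regular everywhere, hence constant, so that \<open>ram Q = ?d\<close>.\<close>

lemma orbit_divisor_eq_fibre:
 assumes Q: "Q \<in> C" and V: "V \<subseteq> carrier (FF C)"
  and sub: "quotient_system C G \<subseteq> linear_system C (\<Sum>sg\<in>G. Poly_Mapping.single (sg Q) 1) V"
 shows "(\<Sum>sg\<in>G. Poly_Mapping.single (sg Q) 1) = fibd (q Q)"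
proof -
 let ?D = "\<Sum>sg\<in>G. Poly_Mapping.single (sg Q) (1::int)"
 let ?d = "int (card {sg\<in>G. sg Q = Q})"
 have fD: "lkp (fibd (q Q)) P - lkp ?D P = (if P \<in> C & q P = q Q then ram Q - ?d else 0)" for P
 proof (cases "P \<in> C & q P = q Q")
  case True
  then have "ram P = ram Q" using fib[OF Q, of P] ram_trans[OF _ Q] by auto
  then show ?thesis using True by (simp add: orbit_divisor[OF Q] lookup_fibd)
 next
  case False
  then show ?thesis unfolding orbit_divisor[OF Q] lookup_fibd by auto
 qed
 have "fibd (q Q) \<in> linear_system C ?D V" using sub unfolding quotient_system_eq by blast
 then obtain f where f: "!!P. P \<in> C ==> hord P f (if P \<in> C & q P = q Q then ram Q - ?d else 0)"
  unfolding linear_system_iff[OF V] fD by blast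
 have eq: "n Q = 0" if n: "!!P. P \<in> C ==> 0 \<le> n P" "!!P. P \<in> C ==> hord P g (n P)" for g n
 proof -
  have "EX a. reg C P g a" if "P \<in> C" for P using hord_nonneg[OF that n(2)[OF that] n(1)[OF that]] by blast
  then obtain c where c: "aeg C (%R. g R = c)" by (rule global_const)
  have "c ~= 0"
  proof
   assume "c = 0"
   have "aeg C (%R. False)" using c hord_nz[OF Q n(2)[OF Q]] by eventually_elim (use \<open>c = 0\<close> in auto)
   then show False using gen_const[OF irrC] by blast
  qed
  have "hord Q g 0" by (rule hord_cong[OF hord_const[OF \<open>c ~= 0\<close>] c])
  then show ?thesis using hord_unique[OF Q n(2)[OF Q]] by blast
 qed
 have "ram Q = ?d"
 proof (cases "0 \<le> ram Q - ?d")
  case True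
  have "(%P. if P \<in> C & q P = q Q then ram Q - ?d else 0) Q = 0" by (rule eq[OF _ f]) (use True in auto)
  then show ?thesis using Q by simp
 next
  case False
  have "(%P. - (if P \<in> C & q P = q Q then ram Q - ?d else 0)) Q = 0"
   by (rule eq[OF _ hord_inverse[OF _ f]]) (use False in auto)
  then show ?thesis using Q by simp
 qed
 then have "lkp (fibd (q Q)) P - lkp ?D P = 0" for P unfolding fD by simp
 then show ?thesis
  by (intro divisor_eqI[OF is_divisor_orbit[OF Q] is_divisor_fibd]) (metis eq_iff_diff_eq_0)
qed

end

section \<open>Plane models and projections\<close>

lemma dominant_ae_eq:
 assumes i: "irr C" "irr Y" and d: "dominant C Y ph" and g: "ratl Y g" "ratl Y g'"
  and e: "aeg C (%R. g (ph R) = g' (ph R))"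
 shows "aeg Y (%R. g R = g' R)"
proof (rule ccontr)
 assume "\<not> ?thesis"
 then have "aeg Y (%R. g R ~= g' R)" using ratl_dich_eq[OF i(2) g] by blast
 from dominantD[OF d this] e have "aeg C (%R. False)" by eventually_elim simp
 then show False using gen_const[OF i(1)] by blast
qed

lemma pullback_ring_iso:
 assumes i: "irr C" "irr Y" and m: "!!P f a. P \<in> C ==> reg Y (ph P) f a ==> reg C P (%R. f (ph R)) a"
  and d: "dominant C Y ph" and s: "!!h. ratl C h ==> EX g. ratl Y g & (\<forall>\<^sub>F R in gen C. h R = g (ph R))"
 shows "pullback C (Some \<circ> ph) \<in> ring_iso (FF Y) (FF C)"
proof -
 have P: "pullback C (Some \<circ> ph) (cls Y g) = cls C (%R. g (ph R))" if "ratl Y g" for g by (rule pullback_cls[OF i m d that]) auto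
 have r: "ratl C (%R. g (ph R))" if "ratl Y g" for g by (rule ratl_pull[OF i m d that])
 have "pullback C (Some \<circ> ph) \<in> ring_hom (FF Y) (FF C)"
 proof (rule ring_hom_memI)
  fix x assume "x \<in> carrier (FF Y)"
  then show "pullback C (Some \<circ> ph) x \<in> carrier (FF C)" by (elim FF_cases[OF i(2)]) (simp add: P r cls_in_carrier[OF i(1)])
 next
  fix x y assume "x \<in> carrier (FF Y)" "y \<in> carrier (FF Y)"
  then show "pullback C (Some \<circ> ph) (x \<otimes>\<^bsub>FF Y\<^esub> y) = pullback C (Some \<circ> ph) x \<otimes>\<^bsub>FF C\<^esub> pullback C (Some \<circ> ph) y"
   "pullback C (Some \<circ> ph) (x \<oplus>\<^bsub>FF Y\<^esub> y) = pullback C (Some \<circ> ph) x \<oplus>\<^bsub>FF C\<^esub> pullback C (Some \<circ> ph) y"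
   by (elim FF_cases[OF i(2)], simp add: P r FF_mult i FF_add ratl_mult ratl_add)+
 next
  show "pullback C (Some \<circ> ph) \<one>\<^bsub>FF Y\<^esub> = \<one>\<^bsub>FF C\<^esub>" by (simp add: FF_one i P ratl_const)
 qed
 moreover have "bij_betw (pullback C (Some \<circ> ph)) (carrier (FF Y)) (carrier (FF C))"
 proof (rule bij_betw_imageI)
  show "inj_on (pullback C (Some \<circ> ph)) (carrier (FF Y))"
  proof (rule inj_onI)
   fix x y assume "x \<in> carrier (FF Y)" "y \<in> carrier (FF Y)" and e: "pullback C (Some \<circ> ph) x = pullback C (Some \<circ> ph) y"
   then obtain f g where fg: "ratl Y f" "ratl Y g" "x = cls Y f" "y = cls Y g" by (auto simp: carrier_FF i)
   have "aeg C (%R. f (ph R) = g (ph R))"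
   using e fg cls_eq_iff[OF i(1) r[OF fg(1)] r[OF fg(2)]] by (simp add: P)
   from cls_cong[OF dominant_ae_eq[OF i d fg(1,2) this]] show "x = y" using fg by simp
  qed
  show "pullback C (Some \<circ> ph) ` carrier (FF Y) = carrier (FF C)"
  proof (intro subset_antisym subsetI)
   fix y assume "y \<in> carrier (FF C)"
   then obtain h where h: "ratl C h" "y = cls C h" by (auto simp: carrier_FF i)
   then obtain g where g: "ratl Y g" "aeg C (%R. h R = g (ph R))" using s by blast
   have "y = pullback C (Some \<circ> ph) (cls Y g)" unfolding P[OF g(1)] h(2) by (rule cls_cong[OF g(2)])
   then show "y \<in> pullback C (Some \<circ> ph) ` carrier (FF Y)" using cls_in_carrier[OF i(2) g(1)] by blast
  next
   fix y assume "y \<in> pullback C (Some \<circ> ph) ` carrier (FF Y)"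
   then obtain g where "ratl Y g" "y = cls C (%R. g (ph R))" by (auto simp: carrier_FF i P)
   then show "y \<in> carrier (FF C)" using cls_in_carrier[OF i(1) r] by simp
  qed
 qed
 ultimately show ?thesis by (simp add: ring_iso_def)
qed

lemma (in aut_group) pullback_aut: "sg \<in> G ==> ratl C h ==> pullback C (Some \<circ> sg) (cls C h) = cls C (%R. h (sg R))"
 by (rule pullback_cls[OF irrC irrC reg_trans domi]) auto

lemma (in aut_group) pullback_aut_iso:
 assumes s: "sg \<in> G" shows "pullback C (Some \<circ> sg) \<in> ring_iso (FF C) (FF C)"
proof (rule pullback_ring_iso[OF irrC irrC reg_trans[OF s] domi[OF s]])
 fix h assume h: "ratl C h"
 obtain rh where rh: "rh \<in> G" "!!P. P \<in> C ==> sg (rh P) = P" "!!P. P \<in> C ==> rh (sg P) = P"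
  by (rule ex_inverse[OF s]) blast
 have "aeg C (%R. h R = h (rh (sg R)))" using gen_in[OF irrC] by eventually_elim (simp add: rh)
 then show "EX g. ratl C g & (\<forall>\<^sub>F R in gen C. h R = g (sg R))" using ratl_trans[OF rh(1) h] by blast
qed

section \<open>Projection from a point of the plane\<close>

definition Mx :: "('k::field, 3) proj => 'k ^ 3 ^ 2" where
 "Mx P = (SOME M :: 'k ^ 3 ^ 2. ALL x. M *v x = 0 \<longleftrightarrow> x = 0 \<or> abs_proj x = P)"

definition pr :: "('k::field, 3) proj => ('k, 3) proj => ('k, 2) proj" where
 "pr P R = abs_proj (Mx P *v rep_proj R)"

lemma projection_from_pr: "R ~= P ==> projection_from P R = Some (pr P R)"
 by (simp add: projection_from_def Mx_def pr_def Let_def)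

text \<open>The rows express two of the three proportionality conditions with
  \<open>rep_proj P\<close>, chosen so that a nonzero coordinate of \<open>P\<close> makes the third
  one follow.\<close>

lemma projection_matrix_exists: "\<exists>M :: 'k::field ^ 3 ^ 2. ALL x. M *v x = 0 \<longleftrightarrow> x = 0 \<or> abs_proj x = P"
proof -
 let ?p = "rep_proj P"
 have cr: "(x = 0 \<or> abs_proj x = P) \<longleftrightarrow> (ALL i j. x $ i * ?p $ j = x $ j * ?p $ i)" for x
  using abs_proj_eq_cross[OF _ rep_proj_nonzero, of x P] by (cases "x = 0") auto
 have nz: "?p $ 1 ~= 0 \<or> ?p $ 2 ~= 0 \<or> ?p $ 3 ~= 0" using rep_proj_nonzero[of P] by (auto simp: vec_eq_iff forall_3)
 define M :: "'k ^ 3 ^ 2" where "M = (if ?p $ 1 ~= 0 then vector [vector [- ?p $ 2, ?p $ 1, 0], vector [- ?p $ 3, 0, ?p $ 1]]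
  else if ?p $ 2 ~= 0 then vector [vector [?p $ 2, - ?p $ 1, 0], vector [0, - ?p $ 3, ?p $ 2]]
  else vector [vector [?p $ 3, 0, - ?p $ 1], vector [0, ?p $ 3, - ?p $ 2]])"
 have c3: "(ALL i j. x $ i * ?p $ j = x $ j * ?p $ i) \<longleftrightarrow>
  x $ 1 * ?p $ 2 = x $ 2 * ?p $ 1 & x $ 1 * ?p $ 3 = x $ 3 * ?p $ 1 & x $ 2 * ?p $ 3 = x $ 3 * ?p $ 2" for x
  by (auto simp: forall_3)
 have e: "- u + v = 0 \<longleftrightarrow> u = v" "u - v = 0 \<longleftrightarrow> u = v" for u v :: 'k
  by (auto simp: algebra_simps)
 have third: "c * e' = d * b" if "a * b = c * p" "a * e' = d * p" "p ~= 0" for a b c d e' p :: 'k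
 proof -
  have "p * (c * e') = p * (d * b)" using that(1,2) by (metis mult.assoc mult.commute)
  then show ?thesis using that(3) by simp
 qed
 have "M *v x = 0 \<longleftrightarrow> (ALL i j. x $ i * ?p $ j = x $ j * ?p $ i)" for x
 proof (cases "?p $ 1 ~= 0")
  case True
  then have "M *v x = 0 \<longleftrightarrow> x $ 1 * ?p $ 2 = x $ 2 * ?p $ 1 & x $ 1 * ?p $ 3 = x $ 3 * ?p $ 1"
   by (auto simp: M_def vec_eq_iff forall_2 matrix_vector_mult_def sum_3 e mult.commute)
  then show ?thesis unfolding c3 using third[of "x $ 1" "?p $ 2" "x $ 2" "?p $ 1" "?p $ 3" "x $ 3"] True by blast
 next
  case 1: False
  show ?thesis
  proof (cases "?p $ 2 ~= 0")
   case True
   then have "M *v x = 0 \<longleftrightarrow> x $ 1 * ?p $ 2 = x $ 2 * ?p $ 1 & x $ 2 * ?p $ 3 = x $ 3 * ?p $ 2"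
   using 1 by (auto simp: M_def vec_eq_iff forall_2 matrix_vector_mult_def sum_3 e mult.commute)
   then show ?thesis unfolding c3 using True 1 by auto
  next
   case False
   then show ?thesis unfolding c3 using 1 nz
   by (auto simp: M_def vec_eq_iff forall_2 matrix_vector_mult_def sum_3 e mult.commute)
  qed
 qed
 then show ?thesis using cr by blast
qed

lemma Mx_ker: "Mx P *v x = 0 \<longleftrightarrow> x = 0 \<or> abs_proj x = P"
 using someI_ex[OF projection_matrix_exists[of P]] unfolding Mx_def by blast

lemma peval_lin_Mx: "(\<chi> i. peval (lin (Mx P $ i)) R) = Mx P *v rep_proj R"
 by (simp add: vec_eq_iff peval_def matrix_vector_mult_def)

lemma pr_mor_at: "R ~= P ==> mor_at Z R (pr P) (pr P R)"
 using Mx_ker[of P "rep_proj R"] rep_proj_nonzero[of R]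
 by (intro mor_atI'[where F = "%i. lin (Mx P $ i)" and d = "Suc 0"]) (auto simp: peval_lin_Mx pr_def)

text \<open>Birationality takes the form of an inverse given by forms \<open>Ps\<close> at generic
  points. This is how the inverse of the constructed model arises, and it suffices to identify the
  function fields.\<close>

locale plane_map =
 fixes C :: "('k::alg_closed_field, 'n::finite) proj set" and ph :: "('k, 'n) proj => ('k, 3) proj"
 assumes irrC: "irr C" and phi: "morphism C UNIV ph"
  and phi_inverse: "EX Ps d. (ALL j. hmg d (Ps j)) &
   (\<forall>\<^sub>F R in gen C. (EX j. peval (Ps j) (ph R) ~= 0) & R = abs_proj (\<chi> j. peval (Ps j) (ph R)))"
begin

lemma irrY: "irr (ph ` C)" by (rule irr_image[OF irrC phi])
lemma dphi: "dominant C (ph ` C) ph" by (rule dominant_image[OF irrC phi])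
lemma mphi: "P \<in> C ==> mor_at C P ph (ph P)" by (rule morphism_mor_at[OF irrC phi])
lemmas reg_phi = morphism_reg_pull[OF irrC phi dphi]
lemmas ratl_phi = morphism_ratl_pull[OF irrC irrY phi dphi]

lemma phi_surj_ratl:
 assumes h: "ratl C h" shows "EX g. ratl (ph ` C) g & (\<forall>\<^sub>F R in gen C. h R = g (ph R))"
proof -
 obtain Ps e where P: "ALL j. hmg e (Ps j)"
  "aeg C (%R. (EX j. peval (Ps j) (ph R) ~= 0) & R = abs_proj (\<chi> j. peval (Ps j) (ph R)))" using phi_inverse by blast
 obtain F G d R0 where FG: "hmg d F" "hmg d G" "R0 \<in> C" "peval G R0 ~= 0"
  "aeg C (%R. h R = peval F R / peval G R)" using h unfolding ratl_def by blast
 let ?g = "%y. peval (subst_mpoly F Ps) y / peval (subst_mpoly G Ps) y"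
 have "ratl (ph ` C) ?g"
  by (rule ratl_form[OF irrY homogeneous_subst[OF FG(1)] homogeneous_subst[OF FG(2)]]) (use P(1) in auto)
 moreover have "aeg C (%R. h R = ?g (ph R))"
  using P(2) FG(5)
 proof eventually_elim
  case (elim R)
  have nz: "(\<chi> j. peval (Ps j) (ph R)) ~= 0" using elim(1) by (auto simp: vec_eq_iff)
  have "?g (ph R) = evm F (\<chi> j. peval (Ps j) (ph R)) / evm G (\<chi> j. peval (Ps j) (ph R))"
   by (simp add: peval_def eval_subst)
  also have "\<dots> = peval F R / peval G R" using peval_abs_ratio[OF FG(1,2) nz] elim(1) by metis
  finally show ?case using elim(2) by simp
 qed
 ultimately show ?thesis by blast
qed

lemma Phi_cls: "ratl (ph ` C) g ==> pullback C (Some \<circ> ph) (cls (ph ` C) g) = cls C (%R. g (ph R))"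
 by (rule pullback_cls[OF irrC irrY reg_phi dphi]) auto

lemma Phi_iso: "pullback C (Some \<circ> ph) \<in> ring_iso (FF (ph ` C)) (FF C)"
 by (rule pullback_ring_iso[OF irrC irrY reg_phi dphi phi_surj_ratl])

lemma ae_Y: "ratl (ph ` C) g ==> ratl (ph ` C) g' ==> \<forall>\<^sub>F R in gen C. g (ph R) = g' (ph R) ==> \<forall>\<^sub>F R in gen (ph ` C). g R = g' R"
 by (rule dominant_ae_eq[OF irrC irrY dphi])

lemma proj_morphism:
 assumes "P \<notin> ph ` C" shows "morphism C UNIV (%R. pr P (ph R))"
proof (rule morphismI[OF irrC])
 fix R assume R: "R \<in> C"
 then have "ph R ~= P" using assms by blast
 from mor_at_comp[OF irrC R irrY _ mphi[OF R] dphi pr_mor_at[OF this]] R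
 show "mor_at C R (%R. pr P (ph R)) (pr P (ph R))" by blast
qed simp

lemma proj_dominant:
 assumes "P \<notin> ph ` C" and s: "(%R. pr P (ph R)) ` C = UNIV"
 shows "dominant C PL (%R. pr P (ph R))" "dominant (ph ` C) PL (pr P)"
proof -
 show "dominant C PL (%R. pr P (ph R))" using dominant_image[OF irrC proj_morphism[OF assms(1)]] unfolding s .
 show "dominant (ph ` C) PL (pr P)"
 proof (rule dominantI[OF irrY irr_PL])
  fix z :: "('k, 2) proj"
  obtain R where R: "R \<in> C" "z = pr P (ph R)" using s by blast
  then have "ph R ~= P" using assms(1) by blast
  from pr_mor_at[OF this] show "\<exists>R\<in>ph ` C. mor_at (ph ` C) R (pr P) z" using R by blast
 qed simp
qed

lemma projection_field_eq:
 assumes P: "P \<notin> ph ` C" and s: "(%R. pr P (ph R)) ` C = UNIV"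
 shows "projection_field (ph ` C) P = {cls (ph ` C) (%R. f (pr P R)) | f. ratl PL f}"
  "ratl PL f ==> ratl (ph ` C) (%R. f (pr P R))"
proof -
 let ?Y = "ph ` C"
 note d = proj_dominant(2)[OF P s]
 have rp: "reg ?Y R (%R. f (pr P R)) a" if "R \<in> ?Y" "reg PL (pr P R) f a" for R f a
 proof -
  have "R ~= P" using that P by blast
  from reg_pull[OF irrY that(1) pr_mor_at[OF this] d that(2)] show ?thesis .
 qed
 have pb: "pullback ?Y (projection_from P) (cls PL f) = cls ?Y (%R. f (pr P R))" if "ratl PL f" for f
 proof (rule pullback_cls[OF irrY irr_PL rp d that])
  fix R assume "R \<in> ?Y"
  then have "R ~= P" using P by blast
  then show "projection_from P R = Some (pr P R)" by (rule projection_from_pr)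
 qed
 show "ratl PL f ==> ratl (ph ` C) (%R. f (pr P R))" by (rule ratl_pull[OF irrY irr_PL rp d])
 have dm: "dom (cls PL f \<circ>\<^sub>m (projection_from P |` ?Y)) ~= {}" if f: "ratl PL f" for f
 proof -
  have "\<forall>\<^sub>F R in gen ?Y. R \<in> ?Y & cls PL f (pr P R) = Some (f (pr P R))"
   using dominantD[OF d cls_generic[OF irr_PL f]] gen_in[OF irrY] by eventually_elim simp
  from gen_ex[OF irrY this] obtain R where R: "R \<in> ?Y" "cls PL f (pr P R) = Some (f (pr P R))" by blast
  have "R ~= P" using R P by blast
  then have "(cls PL f \<circ>\<^sub>m (projection_from P |` ?Y)) R = Some (f (pr P R))"
   using R by (simp add: map_comp_def projection_from_pr)
  then show ?thesis by blast
 qed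
 show "projection_field ?Y P = {cls ?Y (%R. f (pr P R)) | f. ratl PL f}"
 proof (intro subset_antisym subsetI)
  fix x assume "x \<in> projection_field ?Y P"
  then obtain f where f: "x = pullback ?Y (projection_from P) f" "f \<in> rational_funs PL"
   unfolding projection_field_def by blast
  from f(2) obtain f' where f': "ratl PL f'" "f = cls PL f'" unfolding rational_funs_eq[OF irr_PL] by blast
  show "x \<in> {cls ?Y (%R. f (pr P R)) | f. ratl PL f}" unfolding f(1) f'(2) pb[OF f'(1)] using f'(1) by blast
 next
  fix x assume "x \<in> {cls ?Y (%R. f (pr P R)) | f. ratl PL f}"
  then obtain f where f: "ratl PL f" "x = cls ?Y (%R. f (pr P R))" by blast
  have "x = pullback ?Y (projection_from P) (cls PL f)" using f(2) pb[OF f(1)] by simp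
  then show "x \<in> projection_field ?Y P"
   unfolding projection_field_def using cls_in_rational_funs[OF irr_PL f(1)] dm[OF f(1)] by blast
 qed
qed

lemma projection_field_const:
 assumes P: "P \<notin> ph ` C" and s: "(%R. pr P (ph R)) ` C = UNIV"
 shows "cls (ph ` C) (%_. c) \<in> projection_field (ph ` C) P"
 unfolding projection_field_eq[OF P s] using ratl_const[OF irr_PL, of c] by (intro CollectI exI[of _ "%_. c"]) simp

text \<open>Such an automorphism fixes the pullbacks of all functions on the line, among them that
  of \<open>sp y\<close>, which is injective on its chart. The two morphisms thus agree generically,
  hence everywhere.\<close>

lemma induced_fixes_projection:
 assumes P: "P \<notin> ph ` C" and s: "(%R. pr P (ph R)) ` C = UNIV"
  and sg: "sg \<in> galois_group_at C ph P"
 shows "\<forall>R\<in>C. pr P (ph (sg R)) = pr P (ph R)"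
proof -
 let ?Y = "ph ` C" and ?q = "%R. pr P (ph R)"
 obtain ta where sa: "sg \<in> automorphisms C" and t: "ta \<in> galois_group (FF ?Y) (projection_field ?Y P)"
  and e: "!!f. f \<in> rational_funs ?Y ==>
   pullback C (Some \<circ> sg) (pullback C (Some \<circ> ph) f) = pullback C (Some \<circ> ph) (ta f)"
  using sg unfolding galois_group_at_def by blast
 note a = automorphism_simps[OF irrC sa]
 note r = projection_field_eq(2)[OF P s]
 have inv: "aeg C (%R. f (?q (sg R)) = f (?q R))" if f: "ratl PL f" for f
 proof -
  let ?x = "cls ?Y (%R. f (pr P R))"
  have "?x \<in> projection_field ?Y P" unfolding projection_field_eq(1)[OF P s] using f by blast
  then have "ta ?x = ?x" using t unfolding galois_group_def by blast
  moreover have "?x \<in> rational_funs ?Y" by (rule cls_in_rational_funs[OF irrY r[OF f]])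
  ultimately have "pullback C (Some \<circ> sg) (pullback C (Some \<circ> ph) ?x) = pullback C (Some \<circ> ph) ?x" using e by metis
  moreover have "pullback C (Some \<circ> ph) ?x = cls C (%R. f (?q R))" by (rule Phi_cls[OF r[OF f]])
  moreover have "pullback C (Some \<circ> sg) (cls C (%R. f (?q R))) = cls C (%R. f (?q (sg R)))"
   by (rule pullback_cls[OF irrC irrC morphism_reg_pull[OF irrC a(2,5)] a(5) ratl_phi[OF r[OF f]]]) auto
  ultimately show ?thesis
   using cls_eq_iff[OF irrC morphism_ratl_pull[OF irrC irrC a(2,5) ratl_phi[OF r[OF f]]] ratl_phi[OF r[OF f]]] by simp
 qed
 fix y :: "('k, 2) proj"
 note d = proj_dominant(1)[OF P s]
 have m: "aeg C (%R. peval (mu y) (?q R) ~= 0)" by (rule dominantD[OF d ae_mu])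
 have "aeg C (%R. ?q (sg R) = ?q R)"
  using m dominantD[OF a(5) m] inv[OF ratl_sp[of y]] by eventually_elim (rule sp_inj)
 moreover have "morphism C UNIV (%R. ?q (sg R))"
 proof (rule morphismI[OF irrC])
  fix R assume R: "R \<in> C"
  show "mor_at C R (%R. ?q (sg R)) (?q (sg R))"
   by (rule mor_at_comp[OF irrC R irrC a(3)[OF R] a(4)[OF R] a(5) morphism_mor_at[OF irrC proj_morphism[OF P] a(3)[OF R]]])
 qed simp
 ultimately show ?thesis using morphism_eq[OF irrC _ proj_morphism[OF P]] by blast
qed

end

text \<open>The function-valued counterpart of \<open>ring.eval\<close>: lists of coefficients with
  the leading one in front. It carries characteristic polynomials over to algebraicity in the sense
  of \<open>HOL-Algebra\<close>.\<close>

fun horner_list :: "('a => 'k::comm_ring_1) list => ('a => 'k) => 'a => 'k" where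
 "horner_list [] x R = 0"
| "horner_list (g # gs) x R = g R * x R ^ length gs + horner_list gs x R"

lemma horner_list_upt: "horner_list (map f (rev [0..<n])) x R = (\<Sum>j<n. f j R * x R ^ j)"
 by (induction n) simp_all

lemma FF_eval:
 assumes i: "irr C" and x: "ratl C x" and g: "\<forall>g\<in>set gs. ratl C g"
 shows "ratl C (horner_list gs x) & ring.eval (FF C) (map (cls C) gs) (cls C x) = cls C (horner_list gs x)"
proof -
 interpret field "FF C" by (rule field_FF[OF i])
 show ?thesis using g
 proof (induction gs)
  case Nil
  then show ?case by (simp add: FF_zero[OF i] ratl_const[OF i])
 next
  case (Cons g gs)
  then have r: "ratl C g" "ratl C (horner_list gs x)" by auto
  have e: "horner_list (g # gs) x = (%R. g R * x R ^ length gs + horner_list gs x R)" by (rule ext) simp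
  have "ratl C (horner_list (g # gs) x)" unfolding e by (intro ratl_add ratl_mult ratl_power i r x)
  moreover have "eval (map (cls C) (g # gs)) (cls C x) = cls C (horner_list (g # gs) x)"
   unfolding e using Cons r
   by (simp add: FF_nat_pow[OF i x] FF_mult[OF i r(1) ratl_power[OF i x]] FF_add[OF i ratl_mult[OF i r(1) ratl_power[OF i x]]])
  ultimately show ?case by blast
 qed
qed

section \<open>Centres whose projection is a Galois quotient are Galois points\<close>

locale plane_gal = plane_map C ph + gal: gal_cover C G "%R. pr P (ph R)"
 for C :: "('k::alg_closed_field, 'n::finite) proj set" and ph G P +
 assumes outer: "P \<notin> ph ` C"
begin

abbreviation Y where "Y \<equiv> ph ` C"
abbreviation K0 where "K0 \<equiv> projection_field Y P"

lemmas K0_eq = projection_field_eq(1)[OF outer gal.surj]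
lemmas K0_ratl = projection_field_eq(2)[OF outer gal.surj]

lemma K0I: "ratl PL f ==> cls Y (%R. f (pr P R)) \<in> K0"
 unfolding K0_eq by blast

lemma K0_iff:
 assumes g: "ratl Y g"
 shows "cls Y g \<in> K0 \<longleftrightarrow> (\<forall>sg\<in>G. \<forall>\<^sub>F R in gen C. g (ph (sg R)) = g (ph R))"
proof
 assume "cls Y g \<in> K0"
 then obtain f where f: "ratl PL f" "cls Y g = cls Y (%R. f (pr P R))" unfolding K0_eq by blast
 have "aeg Y (%R. g R = f (pr P R))" using cls_eq_iff[OF irrY g K0_ratl[OF f(1)]] f(2) by simp
 from dominantD[OF dphi this] have e: "aeg C (%R. g (ph R) = f (pr P (ph R)))" .
 show "\<forall>sg\<in>G. \<forall>\<^sub>F R in gen C. g (ph (sg R)) = g (ph R)"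
 proof
  fix sg assume s: "sg \<in> G"
  show "aeg C (%R. g (ph (sg R)) = g (ph R))"
   using e dominantD[OF gal.domi[OF s] e] gen_in[OF irrC] by eventually_elim (simp add: gal.q_inv[OF s])
 qed
next
 assume inv: "\<forall>sg\<in>G. \<forall>\<^sub>F R in gen C. g (ph (sg R)) = g (ph R)"
 have "EX f. ratl PL f & (\<forall>\<^sub>F R in gen C. f (pr P (ph R)) = g (ph R))"
  by (rule gal.descend[OF ratl_phi[OF g]]) (use inv in blast)
 then obtain f where f: "ratl PL f" "aeg C (%R. f (pr P (ph R)) = g (ph R))" by blast
 have "cls Y g = cls Y (%R. f (pr P R))" by (rule cls_cong[OF ae_Y[OF K0_ratl[OF f(1)] g f(2)], symmetric])
 then show "cls Y g \<in> K0" unfolding K0_eq using f(1) by blast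
qed

lemma K0_subfield: "subfield K0 (FF Y)"
proof -
 interpret field "FF Y" by (rule field_FF[OF irrY])
 note r = K0_ratl
 show ?thesis
 proof (rule subfieldI', rule subringI)
  show "K0 \<subseteq> carrier (FF Y)" unfolding K0_eq using r cls_in_carrier[OF irrY] by blast
  show "\<one>\<^bsub>FF Y\<^esub> \<in> K0" unfolding FF_one[OF irrY] by (rule projection_field_const[OF outer gal.surj])
  fix x assume "x \<in> K0"
  then obtain f where f: "ratl PL f" "x = cls Y (%R. f (pr P R))" unfolding K0_eq by blast
  show "\<ominus>\<^bsub>FF Y\<^esub> x \<in> K0" unfolding f(2) FF_uminus[OF irrY r[OF f(1)]]
   using K0I[OF ratl_uminus[OF irr_PL f(1)]] .
  fix y assume "y \<in> K0"
  then obtain g where g: "ratl PL g" "y = cls Y (%R. g (pr P R))" unfolding K0_eq by blast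
  show "x \<otimes>\<^bsub>FF Y\<^esub> y \<in> K0" unfolding f(2) g(2) FF_mult[OF irrY r[OF f(1)] r[OF g(1)]]
   using K0I[OF ratl_mult[OF irr_PL f(1) g(1)]] .
  show "x \<oplus>\<^bsub>FF Y\<^esub> y \<in> K0" unfolding f(2) g(2) FF_add[OF irrY r[OF f(1)] r[OF g(1)]]
   using K0I[OF ratl_add[OF irr_PL f(1) g(1)]] .
 next
  fix x assume x: "x \<in> K0 - {\<zero>\<^bsub>FF Y\<^esub>}"
  then obtain f where f: "ratl PL f" "x = cls Y (%R. f (pr P R))" unfolding K0_eq by blast
  have "aeg Y (%R. f (pr P R) ~= 0)"
   using x cls_eq_zero_iff[OF irrY r[OF f(1)]] ratl_dich[OF irrY r[OF f(1)]] unfolding f(2) by blast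
  from FF_inv[OF irrY r[OF f(1)] this] show "inv\<^bsub>FF Y\<^esub> x \<in> K0"
   unfolding f(2) using K0I[OF ratl_inverse[OF irr_PL f(1)]] by simp
 qed
qed

lemma K0_algebraic:
 assumes x: "x \<in> carrier (FF Y)" shows "\<not> (ring.transcendental (FF Y) over K0) x"
proof -
 interpret field "FF Y" by (rule field_FF[OF irrY])
 obtain g where g: "ratl Y g" "x = cls Y g" using x by (rule FF_cases[OF irrY])
 let ?h = "%R. g (ph R)"
 obtain f where f: "!!j. ratl PL (f j)" "!!j. \<forall>\<^sub>F R in gen C. f j (pr P (ph R)) = Polynomial.coeff (\<Prod>sg\<in>G. [:- ?h (sg R), 1:]) j"
  using gal.char_coeffs[OF ratl_phi[OF g(1)]] by blast
 let ?n = "card G" and ?f = "%j R. f j (pr P R)"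
 let ?gs = "map ?f (rev [0..<Suc ?n])"
 have rg: "\<forall>g\<in>set ?gs. ratl Y g" using K0_ratl f(1) by auto
 note ev = FF_eval[OF irrY g(1) rg]
 have "aeg C (%R. \<forall>j\<in>{..?n}. f j (pr P (ph R)) = Polynomial.coeff (\<Prod>sg\<in>G. [:- ?h (sg R), 1:]) j)"
  by (intro eventually_ball_finite finite_atMost ballI f(2))
 then have "aeg C (%R. horner_list ?gs g (ph R) = 0)"
  using gen_in[OF irrC]
 proof eventually_elim
  case (elim R)
  let ?p = "\<Prod>sg\<in>G. [:- ?h (sg R), 1:]"
  have "horner_list ?gs g (ph R) = (\<Sum>j\<le>?n. Polynomial.coeff ?p j * ?h R ^ j)"
   unfolding horner_list_upt lessThan_Suc_atMost using elim(1) by simp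
  also have "\<dots> = poly ?p (?h R)" by (simp add: poly_altdef monic_prod_linear(1))
  also have "\<dots> = 0" by (rule gal.char_root[OF elim(2)])
  finally show ?case .
 qed
 from ae_Y[OF conjunct1[OF ev] ratl_const[OF irrY] this]
 have ev0: "eval (map (cls Y) ?gs) x = \<zero>\<^bsub>FF Y\<^esub>"
  unfolding g(2) conjunct2[OF ev] FF_zero[OF irrY] by (rule cls_cong)
 have pol: "map (cls Y) ?gs \<in> carrier (K0[X]\<^bsub>FF Y\<^esub>)"
 proof -
  have "cls Y (?f j) \<in> K0" for j unfolding K0_eq using f(1) by blast
  moreover have "cls Y (?f ?n) ~= \<zero>\<^bsub>FF Y\<^esub>"
  proof
   assume "cls Y (?f ?n) = \<zero>\<^bsub>FF Y\<^esub>"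
   then have "aeg Y (%R. ?f ?n R = 0)" using cls_eq_zero_iff[OF irrY K0_ratl[OF f(1)]] by blast
   from dominantD[OF dphi this] f(2)[of ?n] have "aeg C (%R. False)"
   proof eventually_elim
   case (elim R)
   then show ?case using monic_prod_linear(2)[of "%sg. g (ph (sg R))" G] by simp
   qed
   then show False using gen_const[OF irrC] by blast
  qed
  moreover have "EX gs. map (cls Y) ?gs = cls Y (?f ?n) # map (cls Y) gs & set gs \<subseteq> range ?f"
   by (intro exI[of _ "map ?f (rev [0..<?n])"]) auto
  ultimately have "polynomial\<^bsub>FF Y\<^esub> K0 (map (cls Y) ?gs)"
   unfolding polynomial_def by (elim exE conjE) auto
  then show ?thesis by (simp only: univ_poly_carrier)
 qed
 have "map (cls Y) ?gs ~= []" by simp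
 from algebraicI[OF pol this ev0] show ?thesis by (simp add: over_def)
qed

lemma Phi_bij: "bij_betw (pullback C (Some \<circ> ph)) (carrier (FF Y)) (carrier (FF C))"
 using Phi_iso by (simp add: ring_iso_def)

lemma induced:
 assumes s: "sg \<in> G"
 obtains ta where "ta \<in> galois_group (FF Y) K0"
  "!!x. x \<in> carrier (FF Y) ==> pullback C (Some \<circ> ph) (ta x) = pullback C (Some \<circ> sg) (pullback C (Some \<circ> ph) x)"
proof -
 let ?Ph = "pullback C (Some \<circ> ph)" and ?s = "pullback C (Some \<circ> sg)"
 interpret Y: field "FF Y" by (rule field_FF[OF irrY])
 interpret X: field "FF C" by (rule field_FF[OF irrC])
 have inv: "inv_into (carrier (FF Y)) ?Ph \<in> ring_iso (FF C) (FF Y)" by (rule ring_iso_set_sym[OF Y.ring_axioms Phi_iso])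
 define ta where "ta = inv_into (carrier (FF Y)) ?Ph \<circ> (?s \<circ> ?Ph)"
 have te: "ta x = inv_into (carrier (FF Y)) ?Ph (?s (?Ph x))" for x unfolding ta_def by simp
 have t: "ta \<in> ring_iso (FF Y) (FF Y)"
  unfolding ta_def by (intro ring_iso_set_trans[OF ring_iso_set_trans[OF Phi_iso gal.pullback_aut_iso[OF s]] inv])
 have pc: "?s (?Ph x) \<in> carrier (FF C)" if "x \<in> carrier (FF Y)" for x
  using that Phi_iso gal.pullback_aut_iso[OF s] by (auto simp: ring_iso_def ring_hom_def)
 have e: "?Ph (ta x) = ?s (?Ph x)" if "x \<in> carrier (FF Y)" for x
  unfolding te using f_inv_into_f[of "?s (?Ph x)" ?Ph "carrier (FF Y)"] pc[OF that] Phi_bij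
  by (simp add: bij_betw_def)
 have tc: "ta x \<in> carrier (FF Y)" if "x \<in> carrier (FF Y)" for x using t that by (auto simp: ring_iso_def ring_hom_def)
 have "ta x = x" if x: "x \<in> K0" for x
 proof -
  obtain f where f: "ratl PL f" "x = cls Y (%R. f (pr P R))" using x unfolding K0_eq by blast
  have xc: "x \<in> carrier (FF Y)" unfolding f(2) by (rule cls_in_carrier[OF irrY K0_ratl[OF f(1)]])
  have "?Ph (ta x) = ?Ph x"
   unfolding e[OF xc] unfolding f(2) Phi_cls[OF K0_ratl[OF f(1)]] gal.pullback_aut[OF s ratl_phi[OF K0_ratl[OF f(1)]]]
   by (rule cls_cong) (use gen_in[OF irrC] in \<open>eventually_elim, simp add: gal.q_inv[OF s]\<close>)
  then show ?thesis using Phi_bij tc[OF xc] xc by (auto simp: bij_betw_def dest: inj_onD)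
 qed
 then have "ta \<in> galois_group (FF Y) K0" using t by (simp add: galois_group_def)
 then show ?thesis using that e by blast
qed

text \<open>An element fixed by the Galois group is fixed in particular by what \<open>G\<close>
  induces, so its pullback to \<open>C\<close> is invariant and descends to the line.\<close>

theorem galois_point: "galois_point Y P"
 unfolding galois_point_def galois_extension_def
proof (intro conjI field_FF irrY K0_subfield ballI K0_algebraic)
 show "{x \<in> carrier (FF Y). \<forall>ta\<in>galois_group (FF Y) K0. ta x = x} = K0"
 proof (intro subset_antisym subsetI)
  fix x assume "x \<in> K0"
  moreover have "K0 \<subseteq> carrier (FF Y)" unfolding K0_eq using K0_ratl cls_in_carrier[OF irrY] by blast
  ultimately show "x \<in> {x \<in> carrier (FF Y). \<forall>ta\<in>galois_group (FF Y) K0. ta x = x}"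
   by (auto simp: galois_group_def)
 next
  fix x assume x: "x \<in> {x \<in> carrier (FF Y). \<forall>ta\<in>galois_group (FF Y) K0. ta x = x}"
  then obtain g where g: "ratl Y g" "x = cls Y g" using FF_cases[OF irrY] by blast
  have "aeg C (%R. g (ph (sg R)) = g (ph R))" if s: "sg \<in> G" for sg
  proof -
   obtain ta where t: "ta \<in> galois_group (FF Y) K0"
   "!!x. x \<in> carrier (FF Y) ==> pullback C (Some \<circ> ph) (ta x) = pullback C (Some \<circ> sg) (pullback C (Some \<circ> ph) x)"
   by (rule induced[OF s]) blast
   have "pullback C (Some \<circ> ph) x = pullback C (Some \<circ> sg) (pullback C (Some \<circ> ph) x)"
   using t x by fastforce
   then show ?thesis
   using cls_eq_iff[OF irrC gal.ratl_trans[OF s ratl_phi[OF g(1)]] ratl_phi[OF g(1)]]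
   unfolding g(2) Phi_cls[OF g(1)] gal.pullback_aut[OF s ratl_phi[OF g(1)]] by simp
  qed
  then show "x \<in> K0" unfolding g(2) K0_iff[OF g(1)] by blast
 qed
qed

text \<open>An automorphism that induces an element of the Galois group preserves the fibres of the
  projection, so generically it moves each point as some element of \<open>G\<close> does;
  \<open>mem_G\<close> identifies it with one of them.\<close>

theorem galois_group_at: "galois_group_at C ph P = G"
proof (intro subset_antisym subsetI)
 fix sg assume s: "sg \<in> galois_group_at C ph P"
 have "aeg C (%R. pr P (ph (sg R)) = pr P (ph R))"
  using gen_in[OF irrC] by eventually_elim (use induced_fixes_projection[OF outer gal.surj s] in blast)
 moreover have "sg \<in> automorphisms C" using s unfolding galois_group_at_def by blast
 ultimately show "sg \<in> G" by (rule gal.mem_G[rotated])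
next
 fix sg assume s: "sg \<in> G"
 obtain ta where t: "ta \<in> galois_group (FF Y) K0"
   "!!x. x \<in> carrier (FF Y) ==> pullback C (Some \<circ> ph) (ta x) = pullback C (Some \<circ> sg) (pullback C (Some \<circ> ph) x)"
  by (rule induced[OF s]) blast
 have "sg \<in> automorphisms C" using gal.aut s by blast
 moreover have "\<forall>f\<in>rational_funs Y. pullback C (Some \<circ> sg) (pullback C (Some \<circ> ph) f) = pullback C (Some \<circ> ph) (ta f)"
  using t(2) by (simp add: function_field_def)
 ultimately show "sg \<in> galois_group_at C ph P" using t(1) unfolding galois_group_at_def by blast
qed

end

text \<open>The locale knows \<open>q\<close> by its effect on functions. Its homogeneous
  coordinates at \<open>P\<close> are recovered from the pulled back parameter \<open>s P\<close>
  and the basis dual to \<open>mu\<close>, \<open>lam\<close>.\<close>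

lemma (in cover) q_mor_at:
 assumes P: "P \<in> C" shows "mor_at C P q (q P)"
proof -
 let ?y = "q P"
 obtain a b where ab: "!!v. v = evm (mu ?y) v *s a + evm (lam ?y) v *s b"
  "a = (1 / evm (mu ?y) (rep_proj ?y)) *s rep_proj ?y" by (rule line_basis[of ?y]) blast
 obtain F G d where FG: "hmg d F" "hmg d G" "peval G P ~= 0" "0 = peval F P / peval G P"
  "aeg C (%R. sp ?y (q R) = peval F R / peval G R)" using reg_s[OF P] unfolding reg_def by blast
 define H where "H j = cst (a $ j) * G + cst (b $ j) * F" for j
 have H: "(\<chi> j. peval (H j) R) = peval G R *s a + peval F R *s b" for R
  by (simp add: H_def vec_eq_iff peval_simps mult.commute)
 have my: "evm (mu ?y) (rep_proj ?y) ~= 0" using peval_mu[of ?y] by (simp add: peval_def)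
 have HP: "(\<chi> j. peval (H j) P) = (peval G P / evm (mu ?y) (rep_proj ?y)) *s rep_proj ?y"
  unfolding H ab(2) using FG(3,4) by (simp add: vec_eq_iff)
 have nz: "(\<chi> j. peval (H j) P) ~= 0" unfolding HP using FG(3) my rep_proj_nonzero by simp
 show ?thesis
 proof (rule mor_atI'[OF _ nz])
  show "hmg d (H j)" for j unfolding H_def by (intro homogeneous_add homogeneous_cst_mult FG)
  show "?y = abs_proj (\<chi> j. peval (H j) P)" unfolding HP using FG(3) my rep_proj_nonzero by (subst abs_proj_scale) auto
  show "aeg C (%R. q R = abs_proj (\<chi> j. peval (H j) R))"
   using FG(5) dominantD[OF domin ae_mu[of ?y]] gen_basic[OF irr FG(2) P FG(3)]
  proof eventually_elim
   case (elim R)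
   let ?m = "peval (mu ?y) (q R)"
   have r: "rep_proj (q R) = ?m *s a + peval (lam ?y) (q R) *s b"
   using ab(1)[of "rep_proj (q R)"] by (simp only: peval_def)
   have "rep_proj (q R) = (?m / peval G R) *s (\<chi> j. peval (H j) R)"
   unfolding H using elim by (subst r) (simp add: vec_eq_iff sp_def field_simps)
   then show ?case using elim by (metis abs_rep_proj abs_proj_scale divide_eq_0_iff rep_proj_nonzero vector_mul_eq_0)
  qed
 qed
qed

lemma linear_mor_at:
 fixes N :: "'k::alg_closed_field ^ 2 ^ 2"
 assumes "!!x. N *v x = 0 ==> x = 0"
 shows "mor_at PL z (%z. abs_proj (N *v rep_proj z)) (abs_proj (N *v rep_proj z))"
proof -
 have "(\<chi> i. peval (lin (N $ i)) R) = N *v rep_proj R" for R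
  by (simp add: vec_eq_iff peval_def matrix_vector_mult_def)
 moreover have "N *v rep_proj z ~= 0" using assms rep_proj_nonzero[of z] by blast
 ultimately show ?thesis by (intro mor_atI'[where F = "%i. lin (N $ i)" and d = "Suc 0"]) auto
qed

lemma linear_comp:
 fixes N N' :: "'k::alg_closed_field ^ 2 ^ 2"
 assumes "!!x. N *v x = 0 ==> x = 0" "N' ** N = mat 1"
 shows "abs_proj (N' *v rep_proj (abs_proj (N *v rep_proj z))) = z"
proof -
 have "N *v rep_proj z ~= 0" using assms(1) rep_proj_nonzero[of z] by blast
 then obtain c where c: "c ~= 0" "rep_proj (abs_proj (N *v rep_proj z)) = c *s (N *v rep_proj z)"
  by (rule rep_abs_proj)
 have "N' *v (c *s (N *v rep_proj z)) = c *s rep_proj z"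
  using assms(2) by (simp add: matrix_vector_mul_assoc vector_scalar_commute)
 then show ?thesis unfolding c(2) using abs_proj_scale[OF c(1) rep_proj_nonzero] by simp
qed

text \<open>The matrix behind a projection is an arbitrary choice, so a projection can match a given
  quotient map only up to a linear change of the coordinates of the line.\<close>

lemma gal_cover_linear:
 fixes N :: "'k::alg_closed_field ^ 2 ^ 2"
 assumes g: "gal_cover C G q" and N: "!!x. N *v x = 0 ==> x = 0"
  and q': "!!R. R \<in> C ==> q' R = abs_proj (N *v rep_proj (q R))"
 shows "gal_cover C G q'"
proof -
 interpret gal_cover C G q by (rule g)
 let ?\<alpha> = "%z. abs_proj (N *v rep_proj z)"
 have "inj ((*v) N)"
 proof (rule injI)
  fix x y assume "N *v x = N *v y"
  then have "N *v (x - y) = 0" by (simp add: matrix_vector_mult_diff_distrib)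
  then show "x = y" using N by (metis right_minus_eq)
 qed
 then obtain N' where N': "N' ** N = mat 1" using matrix_left_invertible_injective by blast
 then have N'': "N ** N' = mat 1" using matrix_left_right_inverse by blast
 have N'0: "x = 0" if "N' *v x = 0" for x
 proof -
  have "x = (N ** N') *v x" unfolding N'' by simp
  then show ?thesis using that by (simp add: matrix_vector_mul_assoc[symmetric])
 qed
 let ?\<beta> = "%z. abs_proj (N' *v rep_proj z)"
 have ba: "?\<beta> (?\<alpha> z) = z" and ab: "?\<alpha> (?\<beta> z) = z" for z
  using linear_comp[OF N N'] linear_comp[OF N'0 N''] by blast+
 have da: "dominant PL PL ?\<alpha>"
 proof (rule dominantI[OF irr_PL irr_PL])
  show "\<exists>P\<in>PL. mor_at PL P ?\<alpha> y" for y
   using linear_mor_at[of N "?\<beta> y", OF N] unfolding ab by blast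
 qed simp
 have db: "dominant PL PL ?\<beta>"
 proof (rule dominantI[OF irr_PL irr_PL])
  show "\<exists>P\<in>PL. mor_at PL P ?\<beta> y" for y
   using linear_mor_at[of N' "?\<alpha> y", OF N'0] unfolding ba by blast
 qed simp
 have ra: "reg PL z (%z. f (?\<alpha> z)) a" if "reg PL (?\<alpha> z) f a" for f z a
  by (rule reg_pull[OF irr_PL UNIV_I linear_mor_at[OF N] da that])
 have rb: "reg PL z (%z. f (?\<beta> z)) a" if "reg PL (?\<beta> z) f a" for f z a
  by (rule reg_pull[OF irr_PL UNIV_I linear_mor_at[OF N'0] db that])
 have ae: "aeg C (%R. q' R = ?\<alpha> (q R))" using gen_in[OF irrC] by eventually_elim (rule q')
 show ?thesis
 proof
  show "EX t. unif C P t" if "P \<in> C" for P by (rule uex[OF that])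
  show "q' ` C = UNIV"
  proof (intro subset_antisym subsetI UNIV_I)
   fix z
   obtain R where "R \<in> C" "?\<beta> z = q R" using surj by blast
   then have "q' R = z" using q' ab by metis
   then show "z \<in> q' ` C" using \<open>R \<in> C\<close> by blast
  qed
  show "q' P = q' R \<longleftrightarrow> (\<exists>sg\<in>G. R = sg P)" if "P \<in> C" "R \<in> C" for P R
   using fib[OF that] q'[OF that(1)] q'[OF that(2)] ba by metis
  show "reg C P (%R. f (q' R)) a" if P: "P \<in> C" and f: "reg PL (q' P) f a" for P f a
  proof -
   have "reg PL (?\<alpha> (q P)) f a" using f q'[OF P] by simp
   moreover have "aeg C (%R. f (q' R) = f (?\<alpha> (q R)))" using ae by eventually_elim simp
   ultimately show ?thesis by (intro reg_cong[OF pull[OF P ra[of _ f]]])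
  qed
  show "dominant C PL q'"
   using filterlim_cong[OF refl refl ae] filterlim_compose[OF da domin] by simp
  show "EX f. ratl PL f & (\<forall>\<^sub>F R in gen C. f (q' R) = h R)"
   if h: "ratl C h" "!!sg. sg \<in> G ==> \<forall>\<^sub>F R in gen C. h (sg R) = h R" for h
  proof -
   obtain f where f: "ratl PL f" "aeg C (%R. f (q R) = h R)" using descend[OF h] by blast
   have "ratl PL (%z. f (?\<beta> z))" by (rule ratl_pull[OF irr_PL irr_PL rb db f(1)])
   moreover have "aeg C (%R. f (?\<beta> (q' R)) = h R)" using ae f(2) by eventually_elim (simp add: ba)
   ultimately show ?thesis by blast
  qed
 qed
qed

section \<open>Birational embeddings\<close>

lemma morphism_subset:
 assumes m: "morphism C Y ph" and U: "U \<subseteq> C" "ph ` U \<subseteq> V"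
 shows "morphism U V ph"
 unfolding morphism_def
proof (intro conjI ballI U(2))
 fix P assume P: "P \<in> U"
 then obtain W d F where W: "P \<in> W" "openin (subtopology zariski C) W" "ALL j. hmg d (F j)"
   "\<forall>R\<in>W. (EX j. peval (F j) R ~= 0) & ph R = abs_proj (\<chi> j. peval (F j) R)"
  using m[unfolded morphism_def, THEN conjunct2, rule_format, OF subsetD[OF U(1) P]] by blast
 have "openin (subtopology zariski U) (W \<inter> U)"
  unfolding openin_zariski_sub
 proof (intro conjI ballI)
  fix T assume T: "T \<in> W \<inter> U"
  then obtain H c where H: "hmg c H" "peval H T ~= 0" "\<forall>R\<in>C. peval H R ~= 0 --> R \<in> W"
   using W(2)[unfolded openin_zariski_sub, THEN conjunct2] by blast
  then have "\<forall>R\<in>U. peval H R ~= 0 --> R \<in> W \<inter> U" using U(1) by blast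
  with H(1,2) show "EX H c. hmg c H & peval H T ~= 0 & (\<forall>R\<in>U. peval H R ~= 0 --> R \<in> W \<inter> U)" by blast
 qed simp
 then show "EX W d F. P \<in> W & openin (subtopology zariski U) W & (ALL j. hmg d (F j)) &
   (\<forall>R\<in>W. (EX j. peval (F j) R ~= 0) & ph R = abs_proj (\<chi> j. peval (F j) R))"
  using W P by (intro exI[of _ "W \<inter> U"] exI[of _ d] exI[of _ F]) auto
qed

text \<open>The forms \<open>Ps\<close> invert \<open>ph\<close> generically, and by uniqueness of
  extensions they do so wherever they do not all vanish. This determines the open sets
  \<open>U\<close> and \<open>V\<close>.\<close>

lemma (in plane_map) birational: "birational_embedding C ph"
proof -
 obtain Ps e where P: "!!j. hmg e (Ps j)"
  "aeg C (%R. (EX j. peval (Ps j) (ph R) ~= 0) & R = abs_proj (\<chi> j. peval (Ps j) (ph R)))" using phi_inverse by blast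
 define ps where "ps y = abs_proj (\<chi> j. peval (Ps j) y)" for y
 define V where "V = {y\<in>ph ` C. EX j. peval (Ps j) y ~= 0}"
 define U where "U = {R\<in>C. EX j. peval (Ps j) (ph R) ~= 0}"
 have inv: "ps (ph R) = R" if R: "R \<in> U" for R
 proof -
  obtain j where j: "R \<in> C" "peval (Ps j) (ph R) ~= 0" using R unfolding U_def by blast
  have "(\<chi> j. peval (Ps j) (ph R)) ~= 0" using j(2) by (auto simp: vec_eq_iff)
  then have "mor_at (ph ` C) (ph R) ps (ps (ph R))"
   by (intro mor_atI'[where F = Ps, OF P(1)]) (auto simp: ps_def)
  moreover have "ph R \<in> ph ` C" using j(1) by blast
  ultimately have "mor_at C R (%R. ps (ph R)) (ps (ph R))"
   using mor_at_comp[OF irrC j(1) irrY _ mphi[OF j(1)] dphi] by blast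
  moreover have "aeg C (%R. ps (ph R) = R)" using P(2) by eventually_elim (simp add: ps_def)
  ultimately show ?thesis using mor_at_unique[OF irrC j(1) _ mor_at_self] by blast
 qed
 have oV: "openin (subtopology zariski (ph ` C)) V"
  unfolding openin_zariski_sub V_def using P(1) by blast
 have oU: "openin (subtopology zariski C) U"
  unfolding openin_zariski_sub
 proof (intro conjI ballI)
  fix R assume "R \<in> U"
  then obtain j where j: "R \<in> C" "peval (Ps j) (ph R) ~= 0" unfolding U_def by blast
  obtain W d F where W: "R \<in> W" "openin (subtopology zariski C) W" "ALL j. hmg d (F j)"
   "\<forall>R\<in>W. (EX j. peval (F j) R ~= 0) & ph R = abs_proj (\<chi> j. peval (F j) R)"
   using phi j(1) unfolding morphism_def by blast
  obtain H c where H: "hmg c H" "peval H R ~= 0" "!!T. T \<in> C ==> peval H T ~= 0 ==> T \<in> W"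
   using W(1,2) unfolding openin_zariski_sub by blast
  have s: "peval (subst_mpoly (Ps j) F) T ~= 0 \<longleftrightarrow> peval (Ps j) (ph T) ~= 0" if T: "T \<in> W" for T
  proof -
   have "(\<chi> j. peval (F j) T) ~= 0" using W(4) T by (auto simp: vec_eq_iff)
   from peval_abs_eq_0_iff[OF P(1) this] show ?thesis using W(4) T by (simp add: peval_def eval_subst)
  qed
  have "hmg (c + e * d) (H * subst_mpoly (Ps j) F)"
   by (intro homogeneous_mult H homogeneous_subst P) (use W(3) in blast)
  moreover have "peval (H * subst_mpoly (Ps j) F) R ~= 0" using H(2) s[OF W(1)] j(2) by (simp add: peval_simps)
  moreover have "T \<in> U" if "T \<in> C" "peval (H * subst_mpoly (Ps j) F) T ~= 0" for T
  proof -
   have "peval H T ~= 0" "peval (subst_mpoly (Ps j) F) T ~= 0" using that(2) by (auto simp: peval_simps)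
   then show ?thesis using s[OF H(3)[OF that(1)]] that(1) unfolding U_def by blast
  qed
  ultimately show "EX F d. hmg d F & peval F R ~= 0 & (\<forall>R\<in>C. peval F R ~= 0 --> R \<in> U)" by blast
 qed (auto simp: U_def)
 have img: "ph ` U = V" unfolding U_def V_def by blast
 have ne: "U ~= {}"
 proof -
  have "aeg C (%R. R \<in> U)" using P(2) gen_in[OF irrC] unfolding U_def by eventually_elim blast
  from gen_ex[OF irrC this] show ?thesis by blast
 qed
 have mV: "morphism V U ps" unfolding morphism_def
 proof (intro conjI ballI)
  show "ps ` V \<subseteq> U" unfolding img[symmetric] using inv by auto
  fix y assume "y \<in> V"
  then show "EX W d F. y \<in> W & openin (subtopology zariski V) W & (ALL j. hmg d (F j)) &
   (\<forall>R\<in>W. (EX j. peval (F j) R ~= 0) & ps R = abs_proj (\<chi> j. peval (F j) R))"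
   using P(1) openin_topspace[of "subtopology zariski V"] unfolding topspace_zariski_sub ps_def
   by (intro exI[of _ V] exI[of _ e] exI[of _ Ps]) (auto simp: V_def)
 qed
 have mU: "morphism U V ph" by (rule morphism_subset[OF phi]) (use img in \<open>auto simp: U_def\<close>)
 have "V ~= {}" using ne img by blast
 moreover have "\<forall>R\<in>V. ph (ps R) = R" unfolding img[symmetric] using inv by simp
 moreover have "\<forall>P\<in>U. ps (ph P) = P" using inv by blast
 ultimately show ?thesis unfolding birational_embedding_def using phi oU ne oV mU mV by blast
qed

section \<open>Lines in the plane\<close>

lemma homogeneous_one_lin:
 fixes F :: "('k::field, 'n::finite) mpoly"
 assumes "hmg 1 F" obtains a where "F = lin a"
proof -
 let ?a = "\<chi> j. lkp F (Poly_Mapping.single j 1)"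
 have key: "EX j. m = Poly_Mapping.single j 1" if m: "(\<Sum>i\<in>UNIV. lkp m i) = 1" for m :: "'n \<Rightarrow>\<^sub>0 nat"
 proof -
  obtain j where j: "lkp m j = 1" "!!i. i ~= j ==> lkp m i = 0"
   using m sum_eq_1_iff[of UNIV "lkp m"] by auto
  then have "m = Poly_Mapping.single j 1" by (intro poly_mapping_eqI) (auto simp: lookup_single when_def)
  then show ?thesis ..
 qed
 have single_mult: "cst c * coordv j = Poly_Mapping.single (Poly_Mapping.single j 1) c" for c :: 'k and j :: 'n
  by (simp add: cst_def coordv_def mult_single)
 have "F = lin ?a"
 proof (rule poly_mapping_eqI)
  fix m
  have l: "lkp (lin ?a) m = (\<Sum>j\<in>UNIV. if Poly_Mapping.single j 1 = m then lkp F (Poly_Mapping.single j 1) else 0)"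
   by (simp add: lin_def single_mult lookup_sum lookup_single when_def del: One_nat_def)
  show "lkp F m = lkp (lin ?a) m"
  proof (cases "EX j. m = Poly_Mapping.single j 1")
   case True
   then obtain j where j: "m = Poly_Mapping.single j 1" ..
   have "Poly_Mapping.single i (1::nat) = Poly_Mapping.single j 1 \<longleftrightarrow> i = j" for i
   by (metis lookup_single_eq lookup_single_not_eq zero_neq_one)
   then show ?thesis unfolding l unfolding j by (simp add: sum.delta del: One_nat_def)
  next
   case False
   then have "m \<notin> Poly_Mapping.keys F" using assms key unfolding homogeneous_def by blast
   then have "lkp F m = 0" by (simp add: in_keys_iff)
   moreover have "Poly_Mapping.single j 1 ~= m" for j using False by blast
   ultimately show ?thesis unfolding l by simp
  qed
 qed
 then show ?thesis using that by blast
qed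

lemma lin_0 [simp]: "lin 0 = 0" by (simp add: lin_def)

lemma lin_nonzero: "lin a ~= 0 \<longleftrightarrow> a ~= (0 :: 'k::field ^ 'n::finite)"
proof
 assume "a ~= 0"
 then obtain i where i: "a $ i ~= 0" by (auto simp: vec_eq_iff)
 have "evm (lin a) (axis i 1) = a $ i"
  by (simp add: axis_def if_distrib[of "%x. _ * x"] sum.delta cong: if_cong)
 then show "lin a ~= 0" using i by (metis eval_mpoly_zero)
qed auto

lemma is_line_lin: "is_line L \<longleftrightarrow> (EX a. a ~= 0 & L = {R. peval (lin a) R = 0})"
proof
 assume "is_line L"
 then obtain F where F: "F ~= 0" "hmg 1 F" "L = zero_locus {F}" unfolding is_line_def by blast
 obtain a where "F = lin a" by (rule homogeneous_one_lin[OF F(2)])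
 with F have "a ~= 0 & L = {R. peval (lin a) R = 0}" using lin_nonzero[of a] by (auto simp: zero_locus_def)
 then show "EX a. a ~= 0 & L = {R. peval (lin a) R = 0}" ..
next
 assume "EX a. a ~= 0 & L = {R. peval (lin a) R = 0}"
 then obtain a where "a ~= 0" "L = {R. peval (lin a) R = 0}" by blast
 then show "is_line L" unfolding is_line_def
  by (intro exI[of _ "lin a"]) (simp add: zero_locus_def lin_nonzero)
qed

text \<open>Two distinct points determine the coefficients of a line up to a factor: compare with the
 cross product.\<close>

lemma line_coeffs_unique:
 fixes a b :: "'k::field ^ 3"
 assumes PR: "P ~= R" and a: "a ~= 0" "peval (lin a) P = 0" "peval (lin a) R = 0"
  and b: "peval (lin b) P = 0" "peval (lin b) R = 0"
 obtains c where "b = c *s a"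
proof -
 let ?p = "rep_proj P" and ?r = "rep_proj R"
 define n :: "'k ^ 3" where "n = vector [?p $ 2 * ?r $ 3 - ?p $ 3 * ?r $ 2, ?p $ 3 * ?r $ 1 - ?p $ 1 * ?r $ 3, ?p $ 1 * ?r $ 2 - ?p $ 2 * ?r $ 1]"
 have n0: "n ~= 0"
 proof
  assume "n = 0"
  then have "n $ 1 = 0" "n $ 2 = 0" "n $ 3 = 0" by simp_all
  then have "ALL i j. ?p $ i * ?r $ j = ?p $ j * ?r $ i" by (auto simp: n_def forall_3)
  then show False using PR proj_eq_cross by blast
 qed
 have cr: "v $ i * n $ j = v $ j * n $ i" if v: "peval (lin v) P = 0" "peval (lin v) R = 0" for v i j
 proof -
  have e: "v $ 1 * ?p $ 1 + v $ 2 * ?p $ 2 + v $ 3 * ?p $ 3 = 0" "v $ 1 * ?r $ 1 + v $ 2 * ?r $ 2 + v $ 3 * ?r $ 3 = 0"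
   using v by (simp_all add: peval_def sum_3)
  have "v $ 1 * n $ 2 - v $ 2 * n $ 1 = ?p $ 3 * (v $ 1 * ?r $ 1 + v $ 2 * ?r $ 2 + v $ 3 * ?r $ 3) - ?r $ 3 * (v $ 1 * ?p $ 1 + v $ 2 * ?p $ 2 + v $ 3 * ?p $ 3)"
   by (simp add: n_def algebra_simps)
  moreover have "v $ 1 * n $ 3 - v $ 3 * n $ 1 = ?r $ 2 * (v $ 1 * ?p $ 1 + v $ 2 * ?p $ 2 + v $ 3 * ?p $ 3) - ?p $ 2 * (v $ 1 * ?r $ 1 + v $ 2 * ?r $ 2 + v $ 3 * ?r $ 3)"
   by (simp add: n_def algebra_simps)
  moreover have "v $ 2 * n $ 3 - v $ 3 * n $ 2 = ?p $ 1 * (v $ 1 * ?r $ 1 + v $ 2 * ?r $ 2 + v $ 3 * ?r $ 3) - ?r $ 1 * (v $ 1 * ?p $ 1 + v $ 2 * ?p $ 2 + v $ 3 * ?p $ 3)"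
   by (simp add: n_def algebra_simps)
  ultimately have 3: "v $ 1 * n $ 2 = v $ 2 * n $ 1" "v $ 1 * n $ 3 = v $ 3 * n $ 1" "v $ 2 * n $ 3 = v $ 3 * n $ 2"
   unfolding e by simp_all
  then have "ALL i j. v $ i * n $ j = v $ j * n $ i" unfolding forall_3 by auto
  then show ?thesis by blast
 qed
 have sc: "EX c. v = c *s n" if "peval (lin v) P = 0" "peval (lin v) R = 0" for v
 proof -
  obtain i where i: "n $ i ~= 0" using n0 by (auto simp: vec_eq_iff)
  have "v = (v $ i / n $ i) *s n" using i cr[OF that, of i] by (auto simp: vec_eq_iff field_simps)
  then show ?thesis by blast
 qed
 obtain \<alpha> \<beta> where ab: "a = \<alpha> *s n" "b = \<beta> *s n" using sc[OF a(2,3)] sc[OF b] by blast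
 then have "\<alpha> ~= 0" using a(1) by auto
 then have "b = (\<beta> / \<alpha>) *s a" unfolding ab by (simp add: vec_eq_iff)
 then show ?thesis using that by blast
qed

lemma line_through_eq:
 assumes PR: "P ~= R" and a: "a ~= 0" "peval (lin a) P = 0" "peval (lin a) R = 0"
 shows "line_through P R = {T. peval (lin a) T = 0}"
 unfolding line_through_def
proof (rule the_equality)
 show "is_line {T. peval (lin a) T = 0} & P \<in> {T. peval (lin a) T = 0} & R \<in> {T. peval (lin a) T = 0}"
  using a is_line_lin by blast
 fix L assume L: "is_line L & P \<in> L & R \<in> L"
 then obtain b where b: "b ~= 0" "L = {T. peval (lin b) T = 0}" unfolding is_line_lin by blast
 obtain c where c: "b = c *s a" by (rule line_coeffs_unique[OF PR a, of b]) (use L b in auto)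
 then have "c ~= 0" using b(1) by auto
 have "peval (lin b) T = c * peval (lin a) T" for T
  unfolding c by (simp add: peval_def sum_distrib_left mult.assoc)
 then show "L = {T. peval (lin a) T = 0}" unfolding b(2) using \<open>c ~= 0\<close> by simp
qed

section \<open>Construction of the plane model\<close>

text \<open>Scaling the roots by \<open>t\<close> multiplies the coefficient of index
  \<open>j\<close> by \<open>t ^ (card G - j)\<close>; the factor \<open>t ^ j\<close> is kept on
  the left to avoid the subtraction.\<close>

lemma scaled_coeff:
 fixes a :: "'i => 'k::comm_ring_1"
 shows "coeff (\<Prod>s\<in>G. [:- (t * a s), 1:]) j * t ^ j = t ^ card G * coeff (\<Prod>s\<in>G. [:- a s, 1:]) j"
proof (induction G arbitrary: j rule: infinite_finite_induct)
 case (insert x G)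
 have "coeff ([:- (t * a x), 1:] * (\<Prod>s\<in>G. [:- (t * a s), 1:])) j * t ^ j =
  - (t * a x) * (coeff (\<Prod>s\<in>G. [:- (t * a s), 1:]) j * t ^ j) +
  t * (case j of 0 => 0 | Suc i => coeff (\<Prod>s\<in>G. [:- (t * a s), 1:]) i * t ^ i)"
  unfolding coeff_linear_mult by (cases j) (simp_all add: algebra_simps)
 also have "\<dots> = t ^ Suc (card G) * coeff ([:- a x, 1:] * (\<Prod>s\<in>G. [:- a s, 1:])) j"
  unfolding insert.IH coeff_linear_mult by (cases j) (simp_all add: algebra_simps)
 finally show ?case using insert(1,2) by simp
qed (auto simp: one_pCons coeff_pCons power_0_left split: nat.splits)

lemma vector3_eta: "(v :: 'k::zero ^ 3) = vector [v $ 1, v $ 2, v $ 3]"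
 by (simp add: vec_eq_iff forall_3)

lemma vector3_scale: "c *s vector [x, y, z] = (vector [c * x, c * y, c * z] :: 'k::semiring_1 ^ 3)"
 by (simp add: vec_eq_iff forall_3)

lemma vector3_nz: "(vector [x, y, z] :: 'k::zero ^ 3) = 0 \<longleftrightarrow> x = 0 & y = 0 & z = 0"
 by (simp add: vec_eq_iff forall_3)

text \<open>The data of a plane model: the quotient coordinate with pole at \<open>y0\<close>, and a
  function \<open>v\<close> whose poles are bounded by the same fibre. \<open>distinct\<close> makes
  the conjugates of \<open>v\<close> different, so that \<open>v\<close> generates the function
  field over that of the line.\<close>

locale plane_build = gal_cover C G q
 for C :: "('k::alg_closed_field, 'n::finite) proj set" and G q +
 fixes y0 :: "('k, 2) proj" and v :: "('k, 'n) proj => 'k"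
 assumes rv: "ratl C v" and pole: "!!P. P \<in> C ==> ordge P v (- lkp (fibd y0) P)"
  and distinct: "!!sg. sg \<in> G ==> \<forall>\<^sub>F R in gen C. v (sg R) = v R ==> sg = (\<lambda>x\<in>C. x)"
begin

definition u where "u R = xc y0 (q R)"

text \<open>\<open>dl P\<close> clears the denominators of \<open>1\<close>, \<open>u\<close>, \<open>v\<close> at \<open>P\<close>; the values there are \<open>a1 P\<close>, \<open>a2 P\<close>,
 \<open>a3 P\<close>.\<close>

definition dl :: "('k, 'n) proj => ('k, 'n) proj => 'k" where
 "dl P R = (if q P = y0 then sp y0 (q R) else 1)"
definition a1 :: "('k, 'n) proj => 'k" where "a1 P = (if q P = y0 then 0 else 1)"
definition a2 :: "('k, 'n) proj => 'k" where "a2 P = (if q P = y0 then 1 else xc y0 (q P))"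
definition a3 :: "('k, 'n) proj => 'k" where "a3 P = (THE a. reg C P (%R. dl P R * v R) a)"

definition ph :: "('k, 'n) proj => ('k, 3) proj" where
 "ph P = abs_proj (vector [a1 P, a2 P, a3 P])"

lemma ru: "ratl C u" unfolding u_def[abs_def] by (rule ratl_pull_q[OF ratl_xc])

lemma dl_nz: "aeg C (%R. dl P R ~= 0)"
 unfolding dl_def using s_neq[of y0 0] by (cases "q P = y0") auto

lemma reg_dl: assumes P: "P \<in> C" shows "reg C P (dl P) (a1 P)"
proof (cases "q P = y0")
 case True
 then show ?thesis using reg_s[OF P] by (simp add: dl_def[abs_def] a1_def)
next
 case False
 then show ?thesis by (simp add: dl_def[abs_def] a1_def reg_const irrC)
qed

lemma reg_dlu: assumes P: "P \<in> C" shows "reg C P (%R. dl P R * u R) (a2 P)"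
proof (cases "q P = y0")
 case True
 have "aeg C (%R. dl P R * u R = 1)"
  using s_neq[of y0 0] by eventually_elim (simp add: dl_def True u_def xc_inverse)
 then show ?thesis using reg_cong[OF reg_const[OF irrC]] True by (simp add: a2_def)
next
 case False
 then show ?thesis using pull[OF P reg_xc[OF False]] by (simp add: dl_def a2_def u_def[abs_def])
qed

lemma dlv_regular: assumes P: "P \<in> C" shows "EX a. reg C P (%R. dl P R * v R) a"
proof -
 have r: "ratl C (%R. dl P R * v R)" by (rule ratl_mult[OF irrC reg_imp_ratl[OF reg_dl[OF P] P] rv])
 consider "aeg C (%R. v R = 0)" | n where "hord P v n" "- lkp (fibd y0) P \<le> n"
  using pole[OF P] unfolding ordge_iff[OF P rv] by blast
 then show ?thesis
 proof cases
  case 1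
  have "aeg C (%R. dl P R * v R = 0)" using 1 by eventually_elim simp
  from reg_cong[OF reg_const[OF irrC] this] show ?thesis by blast
 next
  case 2
  have "hord P (dl P) (lkp (fibd y0) P)"
  proof (cases "q P = y0")
   case True
   then show ?thesis using hord_ram[OF P] P by (simp add: dl_def[abs_def] lookup_fibd)
  next
   case False
   then show ?thesis using hord_const[of 1] by (simp add: dl_def[abs_def] lookup_fibd)
  qed
  from hord_nonneg[OF P hord_mult[OF P this 2(1)]] 2(2) show ?thesis by auto
 qed
qed

lemma reg_dlv: assumes P: "P \<in> C" shows "reg C P (%R. dl P R * v R) (a3 P)"
proof -
 obtain a where a: "reg C P (%R. dl P R * v R) a" using dlv_regular[OF P] ..
 then have "a3 P = a" unfolding a3_def using reg_unique[OF irrC P] by blast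
 with a show ?thesis by simp
qed

lemma a3_eq: "P \<in> C ==> reg C P (%R. dl P R * v R) a ==> a3 P = a"
 using reg_unique[OF irrC _ reg_dlv] by blast

lemma a12_nz: "a1 P ~= 0 \<or> a2 P ~= 0" by (simp add: a1_def a2_def)

lemma dl_trans: "sg \<in> G ==> P \<in> C ==> dl (sg P) = dl P" "sg \<in> G ==> R \<in> C ==> dl P (sg R) = dl P R"
 by (auto simp: dl_def q_inv)

lemma a12_trans: "sg \<in> G ==> P \<in> C ==> a1 (sg P) = a1 P" "sg \<in> G ==> P \<in> C ==> a2 (sg P) = a2 P"
 by (simp_all add: a1_def a2_def q_inv)

lemma reg_dlv_trans: assumes s: "sg \<in> G" and P: "P \<in> C" shows "reg C P (%R. dl P R * v (sg R)) (a3 (sg P))"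
proof -
 have "sg P \<in> C" using s P by simp
 from reg_trans[OF s P reg_dlv[OF this]] have "reg C P (%R. dl (sg P) (sg R) * v (sg R)) (a3 (sg P))" .
 moreover have "aeg C (%R. dl P R * v (sg R) = dl (sg P) (sg R) * v (sg R))"
  using gen_in[OF irrC] by eventually_elim (simp add: dl_trans s P)
 ultimately show ?thesis by (rule reg_cong)
qed

lemma phi_mor_at: assumes P: "P \<in> C" shows "mor_at C P (%R. abs_proj (vector [1, u R, v R])) (ph P)"
proof -
 let ?v = "%j R. (vector [1, u R, v R] :: 'k ^ 3) $ j" and ?a = "%j. (vector [a1 P, a2 P, a3 P] :: 'k ^ 3) $ j"
 have "mor_at C P (%R. abs_proj (\<chi> j. ?v j R)) (abs_proj (\<chi> j. ?a j))"
 proof (rule mor_at_of_reg[OF irrC P _ _ dl_nz[of P]])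
  have "ALL j. reg C P (%R. dl P R * ?v j R) (?a j)"
   unfolding forall_3 using reg_dl[OF P] reg_dlu[OF P] reg_dlv[OF P] by simp
  then show "!!j. reg C P (%R. dl P R * ?v j R) (?a j)" by blast
  show "(\<chi> j. ?a j) ~= 0" using a12_nz[of P] by (auto simp: vec_eq_iff forall_3)
 qed
 then show ?thesis by (simp add: ph_def)
qed

lemma phi_morphism: "morphism C UNIV ph"
 by (rule morphismI[OF irrC phi_mor_at]) auto

lemma phi_generic: "aeg C (%R. ph R = abs_proj (vector [1, u R, v R]))"
 using dominantD[OF domin ae_neq[of y0]] gen_in[OF irrC] ratl_reg[OF irrC rv]
proof eventually_elim
 case (elim R)
 then have "a3 R = v R" by (intro a3_eq) (auto simp: dl_def)
 then show ?case using elim by (simp add: ph_def a1_def a2_def u_def)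
qed

lemma ae_poly_u: assumes "p ~= 0" shows "aeg C (%R. poly p (u R) ~= 0)"
proof -
 have "aeg C (%R. u R ~= t)" for t
  using s_neq[of y0 "inverse t"] by eventually_elim (auto simp: u_def xc_inverse)
 then have "aeg C (%R. \<forall>t\<in>{t. poly p t = 0}. u R ~= t)"
  by (intro eventually_ball_finite ballI poly_roots_finite assms)
 then show ?thesis by eventually_elim blast
qed

abbreviation n where "n \<equiv> card G"

lemma n_pos: "0 < n" using fin one by (auto simp: card_gt_0_iff)

text \<open>Up to sign, the coefficient of index \<open>j\<close> is the elementary symmetric
  function of degree \<open>n - j\<close> in the conjugates of \<open>v\<close>. It descends to the
  line, where it is regular off \<open>y0\<close> and has a pole of order at most
  \<open>n - j\<close> there; so it is a polynomial in \<open>u\<close> of at most this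
  degree.\<close>

lemma coeff_polys:
 "EX gm. \<forall>j\<le>n. Polynomial.degree (gm j) \<le> n - j & (\<forall>\<^sub>F R in gen C. coeff (\<Prod>sg\<in>G. [:- v (sg R), 1:]) j = poly (gm j) (u R))"
proof -
 obtain g where g: "!!j. ratl PL (g j)" "!!j. \<forall>\<^sub>F R in gen C. g j (q R) = coeff (\<Prod>sg\<in>G. [:- v (sg R), 1:]) j"
  using char_coeffs[OF rv] by blast
 have "EX gm. Polynomial.degree gm \<le> n - j & (\<forall>\<^sub>F R in gen C. coeff (\<Prod>sg\<in>G. [:- v (sg R), 1:]) j = poly gm (u R))" if j: "j \<le> n" for j
 proof -
  have off: "EX c. reg PL z (g j) c" if z: "z ~= y0" for z
  proof -
   obtain P where P: "P \<in> C" "z = q P" using surj by blast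
   have "reg C P (%R. v (sg R)) (a3 (sg P))" if "sg \<in> G" for sg
   using reg_dlv_trans[OF that P(1)] z P(2) by (simp add: dl_def)
   from reg_q_converse[OF P(1) g(1) reg_cong[OF reg_coeff_prod[OF irrC P(1) this] g(2)]]
   show ?thesis unfolding P(2) by blast
  qed
  obtain P where P: "P \<in> C" "y0 = q P" using surj by blast
  have "reg C P (%R. coeff (\<Prod>sg\<in>G. [:- (dl P R * v (sg R)), 1:]) j) (coeff (\<Prod>sg\<in>G. [:- a3 (sg P), 1:]) j)"
   by (rule reg_coeff_prod[OF irrC P(1) reg_dlv_trans[OF _ P(1)]])
  moreover have "aeg C (%R. sp y0 (q R) ^ (n - j) * g j (q R) = coeff (\<Prod>sg\<in>G. [:- (dl P R * v (sg R)), 1:]) j)"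
   using g(2)[of j] s_neq[of y0 0]
  proof eventually_elim
   case (elim R)
   let ?t = "sp y0 (q R)"
   have "?t ^ j * (?t ^ (n - j) * g j (q R)) = ?t ^ n * g j (q R)"
   using j by (simp add: power_add[symmetric] mult.assoc[symmetric])
   also have "\<dots> = ?t ^ j * coeff (\<Prod>sg\<in>G. [:- (dl P R * v (sg R)), 1:]) j"
   using scaled_coeff[where t = ?t and a = "%sg. v (sg R)" and G = G and j = j]
   unfolding elim(1) dl_def by (simp add: P(2)[symmetric] mult.commute)
   finally show ?case using elim(2) by simp
  qed
  ultimately have r: "reg C P (%R. sp y0 (q R) ^ (n - j) * g j (q R)) (coeff (\<Prod>sg\<in>G. [:- a3 (sg P), 1:]) j)"
   by (rule reg_cong)
  have "reg PL y0 (%z. sp y0 z ^ (n - j) * g j z) (coeff (\<Prod>sg\<in>G. [:- a3 (sg P), 1:]) j)"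
   using reg_q_converse[OF P(1) _ r] P(2) ratl_mult[OF irr_PL ratl_power[OF irr_PL ratl_sp] g(1)] by simp
  from regular_off_point[OF off this] obtain a where a: "Polynomial.degree a \<le> n - j" "aeg PL (%R. g j R = poly a (xc y0 R))" by blast
  have "aeg C (%R. coeff (\<Prod>sg\<in>G. [:- v (sg R), 1:]) j = poly a (u R))"
   using dominantD[OF domin a(2)] g(2)[of j] by eventually_elim (simp add: u_def)
  with a(1) show ?thesis by blast
 qed
 then have "ALL j. EX gm. j \<le> n --> Polynomial.degree gm \<le> n - j & (\<forall>\<^sub>F R in gen C. coeff (\<Prod>sg\<in>G. [:- v (sg R), 1:]) j = poly gm (u R))"
  by blast
 from choice[OF this] show ?thesis by blast
qed

definition gm :: "nat => 'k poly" where
 "gm = (SOME gm. \<forall>j\<le>n. Polynomial.degree (gm j) \<le> n - j & (\<forall>\<^sub>F R in gen C. coeff (\<Prod>sg\<in>G. [:- v (sg R), 1:]) j = poly (gm j) (u R)))"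

lemma gamma: "j \<le> n ==> Polynomial.degree (gm j) \<le> n - j"
 "j \<le> n ==> \<forall>\<^sub>F R in gen C. coeff (\<Prod>sg\<in>G. [:- v (sg R), 1:]) j = poly (gm j) (u R)"
 using someI_ex[OF coeff_polys] unfolding gm_def by blast+

lemma gamma_n: "gm n = [:1:]"
proof -
 obtain c where c: "gm n = [:c:]" using gamma(1)[of n] by (auto elim: degree_eq_zeroE)
 have "aeg C (%R. c = 1)" using gamma(2)[OF order_refl] by eventually_elim (simp add: c monic_prod_linear(2))
 then show ?thesis using c gen_const[OF irrC] by simp
qed

lemma gamma_char: "aeg C (%R. ALL b. (\<Sum>j\<le>n. poly (gm j) (u R) * b ^ j) = (\<Prod>sg\<in>G. (b - v (sg R))))"
proof -
 have "aeg C (%R. \<forall>j\<in>{..n}. coeff (\<Prod>sg\<in>G. [:- v (sg R), 1:]) j = poly (gm j) (u R))"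
  by (intro eventually_ball_finite finite_atMost ballI gamma(2)) simp
 then show ?thesis
 proof eventually_elim
  case (elim R)
  show ?case
  proof
   fix b
   let ?p = "\<Prod>sg\<in>G. [:- v (sg R), 1:]"
   have "(\<Sum>j\<le>n. poly (gm j) (u R) * b ^ j) = poly ?p b"
   using elim by (simp add: poly_altdef monic_prod_linear(1))
   then show "(\<Sum>j\<le>n. poly (gm j) (u R) * b ^ j) = (\<Prod>sg\<in>G. (b - v (sg R)))" by (simp add: poly_prod)
  qed
 qed
qed

text \<open>The homogenized characteristic polynomial of \<open>v\<close> over the coordinate
  \<open>u\<close>. It is monic of degree \<open>n\<close> in the third coordinate.\<close>

definition F :: "('k, 3) mpoly" where
 "F = (\<Sum>j\<le>n. \<Sum>i\<le>n - j. cst (coeff (gm j) i) * (coordv 1 ^ (n - j - i) * coordv 2 ^ i * coordv 3 ^ j))"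

lemma evalF: "evm F (vector [a, b, c]) = (\<Sum>j\<le>n. \<Sum>i\<le>n - j. coeff (gm j) i * (a ^ (n - j - i) * b ^ i * c ^ j))"
 by (simp add: F_def eval_simps)

lemma homogeneous_F: "hmg n F"
 unfolding F_def
proof (intro homogeneous_sum homogeneous_cst_mult)
 fix j i assume "j \<in> {..n}" "i \<in> {..n - j}"
 then have e: "n = (n - j - i) * Suc 0 + i * Suc 0 + j * Suc 0" by auto
 have "hmg ((n - j - i) * Suc 0 + i * Suc 0 + j * Suc 0) (coordv 1 ^ (n - j - i) * coordv 2 ^ i * coordv 3 ^ j :: ('k, 3) mpoly)"
  by (intro homogeneous_mult homogeneous_power homogeneous_coordv)
 then show "hmg n (coordv 1 ^ (n - j - i) * coordv 2 ^ i * coordv 3 ^ j :: ('k, 3) mpoly)" using e by metis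
qed

lemma evalF_scale:
 assumes "t ~= 0"
 shows "evm F (vector [t, t * x, y]) = t ^ n * (\<Sum>j\<le>n. poly (gm j) x * (y / t) ^ j)"
 unfolding evalF sum_distrib_left
proof (rule sum.cong[OF refl])
 fix j assume j: "j \<in> {..n}"
 have p: "poly (gm j) x = (\<Sum>i\<le>n - j. coeff (gm j) i * x ^ i)"
  unfolding poly_altdef using gamma(1)[of j] j by (intro sum.mono_neutral_left) (auto simp: coeff_eq_0)
 have tn: "t ^ n = t ^ (n - j) * t ^ j" using j by (simp add: power_add[symmetric])
 have "coeff (gm j) i * (t ^ (n - j - i) * (t * x) ^ i * y ^ j) = t ^ n * (coeff (gm j) i * x ^ i * (y / t) ^ j)" if i: "i \<le> n - j" for i
 proof -
  have "t ^ (n - j) = t ^ (n - j - i) * t ^ i" using i by (simp only: power_add[symmetric] le_add_diff_inverse2)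
  then show ?thesis unfolding tn using assms by (simp add: power_mult_distrib power_divide)
 qed
 then have "(\<Sum>i\<le>n - j. coeff (gm j) i * (t ^ (n - j - i) * (t * x) ^ i * y ^ j)) =
   (\<Sum>i\<le>n - j. t ^ n * (coeff (gm j) i * x ^ i * (y / t) ^ j))"
  by (intro sum.cong refl) blast
 also have "\<dots> = t ^ n * (poly (gm j) x * (y / t) ^ j)"
  unfolding p sum_distrib_left[symmetric] sum_distrib_right[symmetric] ..
 finally show "(\<Sum>i\<le>n - j. coeff (gm j) i * (t ^ (n - j - i) * (t * x) ^ i * y ^ j)) = t ^ n * (poly (gm j) x * (y / t) ^ j)" .
qed

lemma evalF_top: "evm F (vector [0, 0, c]) = c ^ n"
proof -
 have "(\<Sum>i\<le>n - j. coeff (gm j) i * (0 ^ (n - j - i) * 0 ^ i * c ^ j)) = (if j = n then c ^ n else 0)" if j: "j \<le> n" for j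
 proof (cases "j = n")
  case True then show ?thesis by (simp add: gamma_n)
 next
  case False
  then have "(0 :: 'k) ^ (n - j - i) * 0 ^ i = 0" if "i \<le> n - j" for i
   using j that by (cases "i = 0") auto
  then show ?thesis using False by (auto intro!: sum.neutral)
 qed
 then have "evm F (vector [0, 0, c]) = (\<Sum>j\<le>n. if j = n then c ^ n else 0)"
  unfolding evalF by (intro sum.cong) auto
 then show ?thesis by (simp add: sum.delta)
qed

text \<open>Over \<open>y0\<close> the functions \<open>u\<close> and \<open>v\<close> may have
  poles. Multiplied by \<open>dl P\<close>, the generic factorization is one of functions regular at
  \<open>P\<close>, and uniqueness of values specializes it.\<close>

lemma F_factor:
 assumes P: "P \<in> C" shows "evm F (vector [a1 P, a2 P, b]) = (\<Prod>sg\<in>G. (b - a3 (sg P)))"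
proof -
 have "reg C P (%R. \<Sum>j\<le>n. \<Sum>i\<le>n - j. coeff (gm j) i * (dl P R ^ (n - j - i) * (dl P R * u R) ^ i * b ^ j))
  (\<Sum>j\<le>n. \<Sum>i\<le>n - j. coeff (gm j) i * (a1 P ^ (n - j - i) * a2 P ^ i * b ^ j))"
  by (intro reg_sum reg_cmult reg_mult reg_power reg_const irrC P reg_dl reg_dlu)
 then have 1: "reg C P (%R. evm F (vector [dl P R, dl P R * u R, b])) (evm F (vector [a1 P, a2 P, b]))"
  unfolding evalF .
 have 2: "reg C P (%R. \<Prod>sg\<in>G. (b - dl P R * v (sg R))) (\<Prod>sg\<in>G. (b - a3 (sg P)))"
  by (intro reg_prod reg_diff reg_const irrC P reg_dlv_trans)
 have "aeg C (%R. evm F (vector [dl P R, dl P R * u R, b]) = (\<Prod>sg\<in>G. (b - dl P R * v (sg R))))"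
  using dl_nz[of P] gamma_char
 proof eventually_elim
  case (elim R)
  have "evm F (vector [dl P R, dl P R * u R, b]) = dl P R ^ n * (\<Prod>sg\<in>G. (b / dl P R - v (sg R)))"
   unfolding evalF_scale[OF elim(1)] using elim(2) by simp
  also have "\<dots> = (\<Prod>sg\<in>G. dl P R * (b / dl P R - v (sg R)))" by (simp add: prod.distrib)
  also have "\<dots> = (\<Prod>sg\<in>G. (b - dl P R * v (sg R)))" using elim(1) by (simp add: right_diff_distrib)
  finally show ?case .
 qed
 from reg_unique[OF irrC P 1 reg_cong[OF 2 this]] show ?thesis .
qed

lemma phi_vec_nz: "(vector [a1 P, a2 P, c] :: 'k ^ 3) ~= 0"
 unfolding vector3_nz using a12_nz[of P] by blast

text \<open>Above the point with coordinates \<open>a1 P\<close>, \<open>a2 P\<close> the zeros of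
  \<open>F\<close> are the values of \<open>a3\<close> on the orbit of \<open>P\<close>. The leading
  term excludes the point with only the third coordinate nonzero, so every zero lies above some
  point of \<open>C\<close>.\<close>

lemma image_phi: "ph ` C = zero_locus {F}"
proof (intro subset_antisym subsetI)
 fix T assume "T \<in> ph ` C"
 then obtain P where P: "P \<in> C" "T = ph P" by blast
 have "(\<Prod>sg\<in>G. (a3 P - a3 (sg P))) = 0"
  using fin one P(1) by (intro prod_zero bexI[of _ "\<lambda>x\<in>C. x"]) auto
 then have "evm F (vector [a1 P, a2 P, a3 P]) = 0" by (simp add: F_factor[OF P(1)])
 then show "T \<in> zero_locus {F}" unfolding P(2) ph_def zero_locus_def
  using peval_abs_eq_0_iff[OF homogeneous_F phi_vec_nz] by simp
next
 fix T assume "T \<in> zero_locus {F}"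
 then have T: "evm F (rep_proj T) = 0" by (simp add: zero_locus_def peval_def)
 obtain p1 p2 p3 where p: "rep_proj T = vector [p1, p2, p3]" using vector3_eta by blast
 have nz: "p1 ~= 0 \<or> p2 ~= 0"
 proof (rule ccontr)
  assume z: "\<not> ?thesis"
  then have "p3 ^ n = 0" using T evalF_top[of p3] by (simp add: p)
  then show False using z rep_proj_nonzero[of T] by (simp add: p vector3_nz)
 qed
 obtain P c where P: "P \<in> C" and c: "c ~= 0" "c * p1 = a1 P" "c * p2 = a2 P"
 proof (cases "p1 = 0")
  case True
  obtain P where "P \<in> C" "q P = y0" using surj by (metis UNIV_I imageE)
  then show ?thesis using that[of P "1 / p2"] True nz by (simp add: a1_def a2_def)
 next
  case False
  obtain z where z: "z ~= y0" "xc y0 z = p2 / p1" by (rule xc_surj)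
  obtain P where "P \<in> C" "q P = z" using surj by (metis UNIV_I imageE)
  then show ?thesis using that[of P "1 / p1"] False z by (simp add: a1_def a2_def)
 qed
 have cv: "vector [a1 P, a2 P, c * p3] = c *s rep_proj T" unfolding p vector3_scale c(2,3) ..
 have "evm F (vector [a1 P, a2 P, c * p3]) = 0" unfolding cv eval_mpoly_scale[OF homogeneous_F] T by simp
 then have "(\<Prod>sg\<in>G. (c * p3 - a3 (sg P))) = 0" using F_factor[OF P] by simp
 then obtain sg where s: "sg \<in> G" "c * p3 = a3 (sg P)" using fin by (auto simp: prod_zero_iff)
 have "ph (sg P) = abs_proj (c *s rep_proj T)" unfolding ph_def a12_trans[OF s(1) P] s(2)[symmetric] cv ..
 also have "\<dots> = T" using abs_proj_scale[OF c(1) rep_proj_nonzero] by simp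
 finally show "T \<in> ph ` C" using s(1) P in_C by (metis imageI)
qed

lemma F_nz: "F ~= 0"
 using evalF_top[of 1] by (metis eval_mpoly_zero power_one zero_neq_one)

lemma conj_distinct: "aeg C (%R. inj_on (%sg. v (sg R)) G)"
proof -
 have "aeg C (%R. v (sg R) ~= v (ta R))" if st: "sg \<in> G" "ta \<in> G" "sg ~= ta" for sg ta
 proof (rule ccontr)
  assume "\<not> ?thesis"
  then have e: "aeg C (%R. v (sg R) = v (ta R))" using ratl_dich_eq[OF irrC ratl_trans[OF st(1) rv] ratl_trans[OF st(2) rv]] by blast
  obtain rh where rh: "rh \<in> G" "!!P. P \<in> C ==> ta (rh P) = P" "!!P. P \<in> C ==> rh (ta P) = P"
   by (rule ex_inverse[OF st(2)]) blast
  have "aeg C (%R. v (compose C sg rh R) = v R)"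
   using dominantD[OF domi[OF rh(1)] e] gen_in[OF irrC] by eventually_elim (simp add: compose_def rh(2))
  then have id: "compose C sg rh = (\<lambda>x\<in>C. x)" by (rule distinct[OF comp[OF st(1) rh(1)]])
  have "sg P = ta P" if P: "P \<in> C" for P
   using fun_cong[OF id, of "ta P"] P st(2) by (simp add: compose_def rh(3))
  then show False using ext_eq[OF st(1,2)] st(3) by blast
 qed
 then have "aeg C (%R. \<forall>sg\<in>G. \<forall>ta\<in>G. sg ~= ta --> v (sg R) ~= v (ta R))"
  by (intro eventually_ball_finite fin ballI) simp
 then show ?thesis by eventually_elim (auto intro: inj_onI)
qed

text \<open>At a generic point the \<open>n\<close> different conjugates of \<open>v\<close> are
  roots of the specialized polynomial, which is then too small in degree not to vanish.\<close>

lemma relation_degree: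
 assumes deg: "Polynomial.degree A < n" and vals: "aeg C (%R. poly (poly A [:v R:]) (u R) = 0)"
 shows "A = 0"
proof -
 have vals': "aeg C (%R. \<forall>sg\<in>G. poly (poly A [:v (sg R):]) (u R) = 0)"
 proof (intro eventually_ball_finite fin ballI)
  fix sg assume s: "sg \<in> G"
  show "aeg C (%R. poly (poly A [:v (sg R):]) (u R) = 0)"
   using dominantD[OF domi[OF s] vals] gen_in[OF irrC] by eventually_elim (simp add: u_def q_inv s)
 qed
 have "coeff A j = 0" for j
 proof (rule ccontr)
  assume "coeff A j ~= 0"
  from ae_poly_u[OF this] vals' conj_distinct have "aeg C (%R. False)"
  proof eventually_elim
   case (elim R)
   define p where "p = map_poly (%c. poly c (u R)) A"
   have pe: "poly p y = poly (poly A [:y:]) (u R)" for y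
   unfolding p_def by (induction A) (simp_all add: map_poly_pCons)
   have "p ~= 0"
   proof
   assume "p = 0"
   then have "coeff p j = 0" by simp
   then show False using elim(1) by (simp add: p_def coeff_map_poly)
   qed
   have "(%sg. v (sg R)) ` G \<subseteq> {y. poly p y = 0}" using elim(2) by (auto simp: pe)
   then have "n \<le> card {y. poly p y = 0}"
   using card_mono[OF poly_roots_finite[OF \<open>p ~= 0\<close>]] card_image[OF elim(3)] by metis
   also have "\<dots> \<le> Polynomial.degree p" by (rule card_poly_roots_bound[OF \<open>p ~= 0\<close>])
   also have "\<dots> \<le> Polynomial.degree A" unfolding p_def by (rule degree_le) (simp add: coeff_map_poly coeff_eq_0)
   finally show False using deg by simp
  qed
  then show False using gen_const[OF irrC] by blast
 qed
 then show "A = 0" by (simp add: poly_eq_iff)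
qed

text \<open>Setting the leading coordinate to 1 loses nothing, as in a form two exponents determine
  the third; what remains is a relation of degree below \<open>n\<close> in
  \<open>v\<close>.\<close>

lemma small_degree_zero:
 assumes B: "hmg e B" "!!m. m \<in> Poly_Mapping.keys B ==> lkp m 3 < n"
  and z: "!!T. T \<in> ph ` C ==> peval B T = 0"
 shows "B = 0"
proof -
 define w :: "3 => 'k poly poly" where "w j = (vector [1, [:[:0, 1:]:], [:0, 1:]] :: 'k poly poly ^ 3) $ j" for j
 define A where "A = psubst2 B w"
 have A: "A = (\<Sum>m\<in>Poly_Mapping.keys B. monom (monom (lkp B m) (lkp m 2)) (lkp m 3))"
 proof -
  have X: "[:[:0, 1 :: 'k:]:] ^ i = [:monom 1 i:]" for i
   by (induction i) (simp_all add: monom_Suc)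
  have M: "[:[:c:]:] * ([:[:0, 1:]:] ^ i * [:0, 1:] ^ j) = monom (monom c i) j" for c :: 'k and i j
  proof -
   have "[:[:c:]:] * ([:[:0, 1:]:] ^ i * [:0, 1:] ^ j) = [:[:c:] * monom 1 i:] * [:0, 1:] ^ j"
   unfolding X by (simp only: mult.assoc[symmetric]) simp
   also have "[:c:] * monom 1 i = monom c i" by (simp add: smult_monom)
   also have "[:monom c i:] * [:0, 1:] ^ j = monom (monom c i) j" by (simp add: monom_altdef[of _ j])
   finally show ?thesis .
  qed
  have W: "(\<Prod>j\<in>UNIV. w j ^ lkp m j) =
   [:[:0, 1:]:] ^ lkp m 2 * [:0, 1:] ^ lkp m 3" for m :: "3 \<Rightarrow>\<^sub>0 nat"
  proof -
   have "w 1 = 1" "w 2 = [:[:0, 1:]:]" "w 3 = [:0, 1:]" by (simp_all add: w_def)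
   moreover have "(\<Prod>j\<in>UNIV. g j) = g 1 * (g 2 * g 3)" for g :: "3 => 'k poly poly"
   unfolding UNIV_3 by simp
   ultimately show ?thesis by (simp only: power_one mult_1_left)
  qed
  show ?thesis unfolding A_def psubst2_def W M ..
 qed
 have ev: "poly (poly A [:y:]) x = evm B (vector [1, x, y])" for x y
 proof -
  have "(\<chi> j. poly (poly (w j) [:y:]) x) = vector [1, x, y]" by (simp add: vec_eq_iff forall_3 w_def)
  then show ?thesis unfolding A_def poly_psubst2 by simp
 qed
 have deg: "Polynomial.degree A < n"
 proof -
  have "Polynomial.degree A \<le> n - 1" unfolding A
  proof (intro degree_sum_le finite_keys)
   fix m assume "m \<in> Poly_Mapping.keys B"
   from B(2)[OF this] show "Polynomial.degree (monom (monom (lkp B m) (lkp m 2)) (lkp m 3)) \<le> n - 1"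
   using degree_monom_le[of "monom (lkp B m) (lkp m 2)" "lkp m 3"] by linarith
  qed
  then show ?thesis using n_pos by simp
 qed
 have vals: "aeg C (%R. evm B (vector [1, u R, v R]) = 0)"
  using phi_generic gen_in[OF irrC]
 proof eventually_elim
  case (elim R)
  have "peval B (abs_proj (vector [1, u R, v R])) = 0" using z elim by (metis imageI)
  then show ?case using peval_abs_eq_0_iff[OF B(1), of "vector [1, u R, v R]"] by (simp add: vector3_nz)
 qed
 have A0: "A = 0"
  by (rule relation_degree[OF deg]) (use vals in \<open>simp add: ev\<close>)
 show "B = 0"
 proof (rule poly_mapping_eqI)
  fix m
  show "lkp B m = lkp 0 m"
  proof (cases "m \<in> Poly_Mapping.keys B")
   case True
   have same: "m' = m" if m': "m' \<in> Poly_Mapping.keys B" "lkp m' 2 = lkp m 2" "lkp m' 3 = lkp m 3" for m'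
   proof -
   have "(\<Sum>i\<in>UNIV. lkp m' i) = (\<Sum>i\<in>UNIV. lkp m i)"
   using B(1) m'(1) True unfolding homogeneous_def by simp
   then have "ALL i. lkp m' i = lkp m i"
   unfolding forall_3 using m'(2,3) by (simp add: sum_3)
   then show ?thesis by (intro poly_mapping_eqI) blast
   qed
   have "0 = coeff (coeff A (lkp m 3)) (lkp m 2)" unfolding A0 by simp
   also have "\<dots> = (\<Sum>m'\<in>Poly_Mapping.keys B. if m' = m then lkp B m' else 0)"
   unfolding A coeff_sum by (rule sum.cong) (auto dest: same)
   also have "\<dots> = lkp B m" using True by (simp add: sum.delta)
   finally show ?thesis by simp
  qed (simp add: in_keys_iff)
 qed
qed

end

section \<open>The homogeneous ideal of the image is generated by \<open>F\<close>\<close>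

lemma coordv_power: "(coordv j :: ('k::field, 'n::finite) mpoly) ^ c = Poly_Mapping.single (Poly_Mapping.single j c) 1"
 by (induction c) (simp_all add: coordv_def mult_single single_add[symmetric] add.commute)

context plane_build
begin

lemma keys_monomial: "m \<in> Poly_Mapping.keys (cst c * (coordv 1 ^ a * coordv 2 ^ b * coordv 3 ^ d) :: ('k, 3) mpoly) ==> lkp m 3 = d"
 by (auto simp: coordv_power cst_def mult_single lookup_add lookup_single when_def split: if_splits)

lemma F_split: "EX F0. F = coordv 3 ^ n + F0 & (\<forall>m\<in>Poly_Mapping.keys F0. lkp m 3 < n)"
proof -
 define F0 :: "('k, 3) mpoly" where "F0 = (\<Sum>j<n. \<Sum>i\<le>n - j. cst (coeff (gm j) i) * (coordv 1 ^ (n - j - i) * coordv 2 ^ i * coordv 3 ^ j))"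
 have "F = F0 + (\<Sum>i\<le>n - n. cst (coeff (gm n) i) * (coordv 1 ^ (n - n - i) * coordv 2 ^ i * coordv 3 ^ n))"
  unfolding F_def F0_def lessThan_Suc_atMost[symmetric] sum.lessThan_Suc by simp
 then have 1: "F = coordv 3 ^ n + F0" by (simp add: gamma_n cst_1 add.commute)
 have "lkp m 3 < n" if "m \<in> Poly_Mapping.keys F0" for m
 proof -
  have "m \<in> (\<Union>j\<in>{..<n}. Poly_Mapping.keys (\<Sum>i\<le>n - j. cst (coeff (gm j) i) * (coordv 1 ^ (n - j - i) * coordv 2 ^ i * coordv 3 ^ j) :: ('k, 3) mpoly))"
   using that keys_sum unfolding F0_def by (rule rev_subsetD)
  then obtain j where j: "j < n" "m \<in> Poly_Mapping.keys (\<Sum>i\<le>n - j. cst (coeff (gm j) i) * (coordv 1 ^ (n - j - i) * coordv 2 ^ i * coordv 3 ^ j) :: ('k, 3) mpoly)"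
   by blast
  have "m \<in> (\<Union>i\<in>{..n - j}. Poly_Mapping.keys (cst (coeff (gm j) i) * (coordv 1 ^ (n - j - i) * coordv 2 ^ i * coordv 3 ^ j) :: ('k, 3) mpoly))"
   using j(2) keys_sum by (rule rev_subsetD)
  then obtain i where "m \<in> Poly_Mapping.keys (cst (coeff (gm j) i) * (coordv 1 ^ (n - j - i) * coordv 2 ^ i * coordv 3 ^ j) :: ('k, 3) mpoly)"
   by blast
  from keys_monomial[OF this] j(1) show ?thesis by simp
 qed
 with 1 show ?thesis by blast
qed

text \<open>Division with remainder by \<open>F\<close>, which is monic in the third coordinate. The
  induction runs over the excess \<open>N\<close>: the terms of degree exactly \<open>n + N\<close>
  in that coordinate are cancelled by \<open>T' * F\<close>.\<close>

lemma division:
 "hmg e H ==> (\<forall>m\<in>Poly_Mapping.keys H. lkp m 3 < n + N) ==>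
 EX A B. H = A * F + B & hmg e B & (\<forall>m\<in>Poly_Mapping.keys B. lkp m 3 < n)"
proof (induction N arbitrary: H)
 case 0
 then show ?case by (intro exI[of _ 0] exI[of _ H]) simp
next
 case (Suc N)
 define T where "T = {m\<in>Poly_Mapping.keys H. lkp m 3 = n + N}"
 show ?case
 proof (cases "T = {}")
  case True
  have "lkp m 3 < n + N" if "m \<in> Poly_Mapping.keys H" for m
  proof -
   have "lkp m 3 < n + Suc N" "lkp m 3 ~= n + N" using Suc.prems(2) that True unfolding T_def by blast+
   then show ?thesis by linarith
  qed
  then show ?thesis using Suc.IH[OF Suc.prems(1)] by blast
 next
  case False
  have finT: "finite T" by (simp add: T_def)
  obtain F0 where F0: "F = coordv 3 ^ n + F0" "!!m. m \<in> Poly_Mapping.keys F0 ==> lkp m 3 < n"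
   using F_split by blast
  define T' where "T' = (\<Sum>m\<in>T. Poly_Mapping.single (m - Poly_Mapping.single 3 n) (lkp H m))"
  have mT: "m - Poly_Mapping.single 3 n + Poly_Mapping.single 3 n = m" if "m \<in> T" for m
  proof (rule poly_mapping_eqI)
   fix k show "lkp (m - Poly_Mapping.single 3 n + Poly_Mapping.single 3 n) k = lkp m k"
   using that by (auto simp: T_def lookup_add lookup_minus lookup_single when_def)
  qed
  have top: "T' * coordv 3 ^ n = (\<Sum>m\<in>T. Poly_Mapping.single m (lkp H m))"
   unfolding T'_def coordv_power sum_distrib_right mult_single by (rule sum.cong) (simp_all add: mT)
  have kT': "\<exists>m\<in>T. k = m - Poly_Mapping.single 3 n" if "k \<in> Poly_Mapping.keys T'" for k
  proof -
   have "k \<in> (\<Union>m\<in>T. Poly_Mapping.keys (Poly_Mapping.single (m - Poly_Mapping.single 3 n) (lkp H m)))"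
   using that keys_sum unfolding T'_def by (rule rev_subsetD)
   then show ?thesis by (auto split: if_splits)
  qed
  have tot: "(\<Sum>i\<in>UNIV. lkp (m - Poly_Mapping.single 3 n) i) + n = e" if m: "m \<in> T" for m
  proof -
   have "(\<Sum>i\<in>UNIV. lkp m i) = e" using m Suc.prems(1) unfolding T_def homogeneous_def by blast
   then show ?thesis using m by (auto simp: T_def sum_3 lookup_minus lookup_single)
  qed
  then have en: "n \<le> e" using False by fastforce
  have hT': "hmg (e - n) T'" unfolding homogeneous_def
  proof
   fix k assume "k \<in> Poly_Mapping.keys T'"
   then obtain m where "m \<in> T" "k = m - Poly_Mapping.single 3 n" using kT' by blast
   then show "(\<Sum>i\<in>UNIV. lkp k i) = e - n" using tot[of m] by simp
  qed
  define H' where "H' = H - T' * F"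
  have hH': "hmg e H'" unfolding H'_def
   using homogeneous_diff[OF Suc.prems(1)] homogeneous_mult[OF hT' homogeneous_F] en by simp
  have H'eq: "H' = (H - (\<Sum>m\<in>T. Poly_Mapping.single m (lkp H m))) - T' * F0"
   unfolding H'_def F0(1) distrib_left top by simp
  have "lkp m 3 < n + N" if m: "m \<in> Poly_Mapping.keys H'" for m
  proof (rule ccontr)
   assume big: "\<not> ?thesis"
   have "lkp (T' * F0) m = 0"
   proof (rule ccontr)
   assume "lkp (T' * F0) m ~= 0"
   then have "m \<in> Poly_Mapping.keys (T' * F0)" by (simp add: in_keys_iff)
   then obtain a b where ab: "m = a + b" "a \<in> Poly_Mapping.keys T'" "b \<in> Poly_Mapping.keys F0" using keys_mult by blast
   obtain t where t: "t \<in> T" "a = t - Poly_Mapping.single 3 n" using kT'[OF ab(2)] by blast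
   then have "lkp a 3 = N" by (simp add: T_def lookup_minus)
   then show False using big F0(2)[OF ab(3)] by (simp add: ab(1) lookup_add)
   qed
   moreover have "lkp (\<Sum>m\<in>T. Poly_Mapping.single m (lkp H m)) m = lkp H m"
   proof -
   have "lkp (\<Sum>m\<in>T. Poly_Mapping.single m (lkp H m)) m = (if m \<in> T then lkp H m else 0)"
   using finT by (simp add: lookup_sum lookup_single when_def sum.delta)
   moreover have "m \<notin> T ==> lkp H m = 0"
   proof (rule ccontr)
   assume "m \<notin> T" "lkp H m ~= 0"
   then have "m \<in> Poly_Mapping.keys H" "lkp m 3 ~= n + N" by (auto simp: T_def in_keys_iff)
   then show False using big Suc.prems(2) by fastforce
   qed
   ultimately show ?thesis by simp
   qed
   ultimately have "lkp H' m = 0" unfolding H'eq by (simp add: lookup_minus)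
   then show False using m by (simp add: in_keys_iff)
  qed
  then obtain A B where AB: "H' = A * F + B" "hmg e B" "\<forall>m\<in>Poly_Mapping.keys B. lkp m 3 < n"
   using Suc.IH[OF hH'] by blast
  have "H = (T' + A) * F + B" using AB(1) unfolding H'_def by (simp add: algebra_simps)
  with AB(2,3) show ?thesis by blast
 qed
qed

text \<open>The remainder of a form vanishing on the image also vanishes there, and its degree in
  the third coordinate is too small unless it is zero.\<close>

lemma has_degree_phi: "has_degree (ph ` C) n"
 unfolding has_degree_def
proof (rule exI[of _ F], intro conjI F_nz homogeneous_F image_phi allI impI)
 fix H :: "('k, 3) mpoly" and e assume H: "hmg e H"
 show "ph ` C \<subseteq> zero_locus {H} \<longleftrightarrow> F dvd H"
 proof
  assume sub: "ph ` C \<subseteq> zero_locus {H}"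
  have "\<forall>m\<in>Poly_Mapping.keys H. lkp m 3 < n + Suc e"
  proof
   fix m assume "m \<in> Poly_Mapping.keys H"
   then have "(\<Sum>i\<in>UNIV. lkp m i) = e" using H by (simp add: homogeneous_def)
   then show "lkp m 3 < n + Suc e" by (simp add: sum_3)
  qed
  from division[OF H this] obtain A B where AB: "H = A * F + B" "hmg e B" "\<forall>m\<in>Poly_Mapping.keys B. lkp m 3 < n" by blast
  have "peval B T = 0" if T: "T \<in> ph ` C" for T
  proof -
   have "peval H T = 0" using sub T by (auto simp: zero_locus_def)
   moreover have "peval F T = 0" using T unfolding image_phi by (simp add: zero_locus_def)
   ultimately show ?thesis unfolding AB(1) by (simp add: peval_simps)
  qed
  then have "B = 0" using small_degree_zero[OF AB(2)] AB(3) by blast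
  then show "F dvd H" using AB(1) by simp
 next
  assume "F dvd H"
  then obtain K where "H = F * K" ..
  then show "ph ` C \<subseteq> zero_locus {H}" unfolding image_phi by (auto simp: zero_locus_def peval_simps)
 qed
qed

text \<open>The value of \<open>Mp h R\<close> at \<open>v R\<close> is \<open>h R\<close> times a factor not depending on \<open>h\<close>, and its
 coefficients are invariant, hence rational in \<open>u\<close>.\<close>

definition Mp :: "(('k, 'n) proj => 'k) => ('k, 'n) proj => 'k poly" where
 "Mp h R = (\<Sum>sg\<in>G. Polynomial.smult (h (sg R)) (\<Prod>ta\<in>G - {sg}. [:- v (ta R), 1:]))"

lemma ratl_Mp: assumes h: "ratl C h" shows "ratl C (%R. coeff (Mp h R) i)"
proof -
 have "ratl C (%R. h (sg R) * coeff (\<Prod>ta\<in>G - {sg}. [:- v (ta R), 1:]) i)" if "sg \<in> G" for sg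
  by (rule ratl_mult[OF irrC ratl_trans[OF that h] ratl_coeff_prod[OF irrC ratl_trans[OF _ rv]]]) simp
 then show ?thesis unfolding Mp_def coeff_sum coeff_smult by (intro ratl_sum irrC) simp
qed

lemma Mp_inv: assumes r: "rh \<in> G" "R \<in> C" shows "Mp h (rh R) = Mp h R"
proof -
 let ?f = "%sg. compose C sg rh"
 note b = bij_right[OF r(1)]
 have "Mp h (rh R) = (\<Sum>sg\<in>G. Polynomial.smult (h (?f sg R)) (\<Prod>ta\<in>G - {?f sg}. [:- v (ta R), 1:]))"
  unfolding Mp_def
 proof (rule sum.cong[OF refl])
  fix sg assume s: "sg \<in> G"
  have "bij_betw ?f (G - {sg}) (G - {?f sg})"
   using b s by (intro bij_betw_subset[OF b]) (auto simp: bij_betw_def inj_on_def)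
  from prod.reindex_bij_betw[OF this, of "%ta. [:- v (ta R), 1:]"]
  have "(\<Prod>ta\<in>G - {?f sg}. [:- v (ta R), 1:]) = (\<Prod>ta\<in>G - {sg}. [:- v (ta (rh R)), 1:])"
   using r(2) by (simp add: compose_def)
  then show "Polynomial.smult (h (sg (rh R))) (\<Prod>ta\<in>G - {sg}. [:- v (ta (rh R)), 1:]) =
   Polynomial.smult (h (?f sg R)) (\<Prod>ta\<in>G - {?f sg}. [:- v (ta R), 1:])"
   using r(2) by (simp add: compose_def)
 qed
 also have "\<dots> = Mp h R" unfolding Mp_def
  by (rule sum.reindex_bij_betw[OF b, of "%sg. Polynomial.smult (h (sg R)) (\<Prod>ta\<in>G - {sg}. [:- v (ta R), 1:])"])
 finally show ?thesis .
qed

text \<open>The derivative of the characteristic polynomial at its root \<open>v R\<close>, which is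
  the factor common to all interpolated functions.\<close>

definition wf :: "('k, 'n) proj => 'k" where
 "wf R = (\<Prod>ta\<in>G - {\<lambda>x\<in>C. x}. v R - v (ta R))"

lemma Mp_value: assumes R: "R \<in> C" shows "poly (Mp h R) (v R) = h R * wf R"
proof -
 have "poly (Mp h R) (v R) = (\<Sum>sg\<in>G. h (sg R) * (\<Prod>ta\<in>G - {sg}. v R - v (ta R)))"
  by (simp add: Mp_def poly_sum poly_prod)
 also have "\<dots> = (\<Sum>sg\<in>G. if sg = (\<lambda>x\<in>C. x) then h R * wf R else 0)"
 proof (rule sum.cong[OF refl])
  fix sg assume s: "sg \<in> G"
  show "h (sg R) * (\<Prod>ta\<in>G - {sg}. v R - v (ta R)) = (if sg = (\<lambda>x\<in>C. x) then h R * wf R else 0)"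
  proof (cases "sg = (\<lambda>x\<in>C. x)")
   case True then show ?thesis using R by (simp add: wf_def)
  next
   case False
   have "(\<Prod>ta\<in>G - {sg}. v R - v (ta R)) = 0"
   using fin one False R by (intro prod_zero bexI[of _ "\<lambda>x\<in>C. x"]) auto
   then show ?thesis using False by simp
  qed
 qed
 also have "\<dots> = h R * wf R" using fin one by (simp add: sum.delta)
 finally show ?thesis .
qed

lemma wf_nz: "aeg C (%R. wf R ~= 0)"
 using conj_distinct gen_in[OF irrC]
proof eventually_elim
 case (elim R)
 have "v R ~= v (ta R)" if "ta \<in> G - {\<lambda>x\<in>C. x}" for ta
  using inj_onD[OF elim(1), of "\<lambda>x\<in>C. x" ta] one that elim(2) by auto
 then show ?case unfolding wf_def using fin by simp
qed

lemma Mp_degree: "Polynomial.degree (Mp h R) \<le> n"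
 unfolding Mp_def
proof (intro degree_sum_le fin)
 fix sg assume "sg \<in> G"
 have "Polynomial.degree (\<Prod>ta\<in>G - {sg}. [:- v (ta R), 1:]) \<le> n"
  unfolding monic_prod_linear(1) by (rule card_mono[OF fin]) auto
 then show "Polynomial.degree (Polynomial.smult (h (sg R)) (\<Prod>ta\<in>G - {sg}. [:- v (ta R), 1:])) \<le> n"
  using degree_smult_le order_trans by blast
qed

text \<open>Lagrange interpolation at the conjugates of \<open>v\<close> writes each coordinate
  ratio of \<open>C\<close>, times \<open>wf\<close>, as a polynomial in \<open>v\<close> over the
  functions of the line. All coordinates carry the same factor, which disappears projectively, so
  the homogenized expressions return the point.\<close>

lemma inverse_forms:
 "EX Ps d. (ALL j. hmg d (Ps j)) &
   (\<forall>\<^sub>F R in gen C. (EX j. peval (Ps j) (ph R) ~= 0) & R = abs_proj (\<chi> j. peval (Ps j) (ph R)))"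
proof -
 obtain P0 where P0: "P0 \<in> C" using irrC unfolding irr_def by blast
 obtain j0 :: 'n where j0: "peval (coordv j0) P0 ~= 0" using ex_var_nonzero by blast
 define h where "h j R = peval (coordv j) R / peval (coordv j0) R" for j :: 'n and R :: "('k, 'n) proj"
 have rh: "ratl C (h j)" for j unfolding h_def[abs_def] by (rule ratl_form[OF irrC homogeneous_coordv homogeneous_coordv])
 have "EX f. ratl PL f & (\<forall>\<^sub>F R in gen C. f (q R) = coeff (Mp (h (fst x)) R) (snd x))" for x
  by (rule descend_exact[OF ratl_Mp[OF rh]]) (simp add: Mp_inv)
 then have "ALL x. EX f. ratl PL f & (\<forall>\<^sub>F R in gen C. f (q R) = coeff (Mp (h (fst x)) R) (snd x))" by blast
 from choice[OF this] obtain f where f: "ALL x. ratl PL (f x) & (\<forall>\<^sub>F R in gen C. f x (q R) = coeff (Mp (h (fst x)) R) (snd x))" ..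
 let ?I = "UNIV \<times> {..n} :: ('n \<times> nat) set"
 have finI: "finite ?I" by simp
 obtain a b where ab: "b ~= 0" "!!x. x \<in> ?I ==> \<forall>\<^sub>F z in gen PL. f x z = poly (a x) (sp y0 z) / poly b (sp y0 z)"
  by (rule common_denominator[OF finI, of f y0]) (use f in blast)+
 \<comment> \<open>The numerators are polynomials in \<open>sp y0\<close>, the inverse of
   \<open>u\<close>, of degree at most \<open>N\<close>; the factor \<open>u ^ N\<close> turns them
   into polynomials in \<open>u\<close>.\<close>
 define N where "N = (\<Sum>x\<in>?I. Polynomial.degree (a x))"
 have degN: "Polynomial.degree (a x) \<le> N" if "x \<in> ?I" for x
  unfolding N_def by (rule member_le_sum[OF that _ finI]) simp
 define Ps :: "'n => ('k, 3) mpoly" where "Ps j = (\<Sum>i\<le>n. \<Sum>k\<le>N. cst (coeff (a (j, i)) k) * (coordv 1 ^ (k + n - i) * coordv 2 ^ (N - k) * coordv 3 ^ i))" for j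
 have hom: "hmg (n + N) (Ps j)" for j
  unfolding Ps_def
 proof (intro homogeneous_sum homogeneous_cst_mult)
  fix i k assume "i \<in> {..n}" "k \<in> {..N}"
  then have e: "n + N = (k + n - i) * Suc 0 + (N - k) * Suc 0 + i * Suc 0" by auto
  have "hmg ((k + n - i) * Suc 0 + (N - k) * Suc 0 + i * Suc 0) (coordv 1 ^ (k + n - i) * coordv 2 ^ (N - k) * coordv 3 ^ i :: ('k, 3) mpoly)"
   by (intro homogeneous_mult homogeneous_power homogeneous_coordv)
  then show "hmg (n + N) (coordv 1 ^ (k + n - i) * coordv 2 ^ (N - k) * coordv 3 ^ i :: ('k, 3) mpoly)" using e by metis
 qed
 have ev: "evm (Ps j) (vector [1, x, y]) = x ^ N * (\<Sum>i\<le>n. poly (a (j, i)) (inverse x) * y ^ i)" if x: "x ~= 0" for j x y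
 proof -
  have "(\<Sum>k\<le>N. coeff (a (j, i)) k * (x ^ (N - k) * y ^ i)) = x ^ N * (poly (a (j, i)) (inverse x) * y ^ i)" if i: "i \<le> n" for i
  proof -
   have p: "poly (a (j, i)) (inverse x) = (\<Sum>k\<le>N. coeff (a (j, i)) k * inverse x ^ k)"
   unfolding poly_altdef using degN[of "(j, i)"] i by (intro sum.mono_neutral_left) (auto simp: coeff_eq_0)
   have "x ^ (N - k) = x ^ N * inverse x ^ k" if "k \<le> N" for k
   using x that by (simp add: power_diff power_inverse divide_inverse)
   then show ?thesis unfolding p sum_distrib_left sum_distrib_right by (intro sum.cong) (simp_all add: mult_ac)
  qed
  then show ?thesis by (simp add: Ps_def eval_simps sum_distrib_left)
 qed
 have "aeg C (%R. \<forall>x\<in>?I. poly (a x) (sp y0 (q R)) = poly b (sp y0 (q R)) * coeff (Mp (h (fst x)) R) (snd x))"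
 proof (intro eventually_ball_finite finI ballI)
  fix x assume x: "x \<in> ?I"
  have "aeg C (%R. f x (q R) = coeff (Mp (h (fst x)) R) (snd x))" using f by blast
  then show "aeg C (%R. poly (a x) (sp y0 (q R)) = poly b (sp y0 (q R)) * coeff (Mp (h (fst x)) R) (snd x))"
   using dominantD[OF domin ab(2)[OF x]] dominantD[OF domin ae_poly_sp[OF ab(1), of y0]] by eventually_elim (simp add: divide_eq_eq mult.commute)
 qed
 then have "aeg C (%R. (EX j. peval (Ps j) (ph R) ~= 0) & R = abs_proj (\<chi> j. peval (Ps j) (ph R)))"
  using dominantD[OF domin ae_poly_sp[OF ab(1), of y0]] s_neq[of y0 0] ae_poly_u[of "[:0, 1:]", simplified] wf_nz gen_in[OF irrC]
   gen_basic[OF irrC homogeneous_coordv P0 j0] phi_generic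
 proof eventually_elim
  case (elim R)
  let ?s = "sp y0 (q R)"
  have us: "inverse (u R) = ?s" by (simp add: u_def xc_inverse)
  define K where "K = u R ^ N * poly b ?s * wf R / peval (coordv j0) R"
  have K: "K ~= 0" using elim by (simp add: K_def)
  have e: "evm (Ps j) (vector [1, u R, v R]) = K * rep_proj R $ j" for j
  proof -
   have "(\<Sum>i\<le>n. poly (a (j, i)) ?s * v R ^ i) = poly b ?s * (\<Sum>i\<le>n. coeff (Mp (h j) R) i * v R ^ i)"
   unfolding sum_distrib_left using elim(1) by (intro sum.cong) (auto simp: mult.assoc)
   also have "(\<Sum>i\<le>n. coeff (Mp (h j) R) i * v R ^ i) = poly (Mp (h j) R) (v R)"
   unfolding poly_altdef using Mp_degree[of "h j" R] by (intro sum.mono_neutral_right) (auto simp: coeff_eq_0)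
   also have "\<dots> = h j R * wf R" by (rule Mp_value[OF elim(6)])
   finally show ?thesis unfolding ev[OF elim(4)] us by (simp add: K_def h_def peval_def)
  qed
  have vn: "(vector [1, u R, v R] :: 'k ^ 3) ~= 0" by (simp add: vector3_nz)
  obtain c where c: "c ~= 0" "rep_proj (abs_proj (vector [1, u R, v R] :: 'k ^ 3)) = c *s vector [1, u R, v R]"
   by (rule rep_abs_proj[OF vn])
  have "peval (Ps j) (abs_proj (vector [1, u R, v R])) = c ^ (n + N) * evm (Ps j) (vector [1, u R, v R])" for j
   unfolding peval_def c(2) by (rule eval_mpoly_scale[OF hom])
  then have pv: "(\<chi> j. peval (Ps j) (ph R)) = (c ^ (n + N) * K) *s rep_proj R"
   using elim(8) by (simp add: vec_eq_iff e)
  have "abs_proj (\<chi> j. peval (Ps j) (ph R)) = R" unfolding pv using c(1) K by (subst abs_proj_scale) (auto simp: rep_proj_nonzero)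
  moreover have "(\<chi> j. peval (Ps j) (ph R)) ~= 0" unfolding pv using c(1) K rep_proj_nonzero[of R] by simp
  ultimately have "EX j. peval (Ps j) (ph R) ~= 0" by (simp only: vec_eq_iff vec_lambda_beta zero_index) blast
  with \<open>abs_proj (\<chi> j. peval (Ps j) (ph R)) = R\<close>[symmetric] show ?case by (intro conjI)
 qed
 then show ?thesis using hom by blast
qed

sublocale plane_map C ph
 by unfold_locales (use irrC phi_morphism inverse_forms in auto)

end

text \<open>The projection from \<open>(0 : -c : b)\<close> is \<open>b u + c v\<close> up to a coordinate change, so an affine
 coordinate \<open>b u + c v\<close> of a second quotient makes this point a Galois point.\<close>

locale plane_point = plane_build C G q y0 v + g2: gal_cover C G' q'
 for C :: "('k::alg_closed_field, 'n::finite) proj set" and G q y0 v G' q' +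
 fixes y' :: "('k, 2) proj" and b c e :: 'k
 assumes bc: "b ~= 0 \<or> c ~= 0" and same: "g2.fibd y' = fibd y0"
  and coord: "aeg C (%R. b * u R + c * v R = xc y' (q' R) + e)"
begin

abbreviation Pt where "Pt \<equiv> abs_proj (vector [0, - c, b] :: 'k ^ 3)"

lemma Pt_vec: "(vector [0, - c, b] :: 'k ^ 3) ~= 0" using bc by (auto simp: vector3_nz)

text \<open>Image points on the line at infinity come from the fibre over \<open>y0\<close>. If
  \<open>P\<close> mapped to \<open>Pt\<close>, then \<open>dl P\<close> times the coordinate of the
  second quotient would vanish at \<open>P\<close>; but the orders of the two factors are
  \<open>ram P\<close> and \<open>- ram P\<close>, because the fibres are equal.\<close>

lemma Pt_outer: "Pt \<notin> ph ` C"
proof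
 assume "Pt \<in> ph ` C"
 then obtain P where P: "P \<in> C" "Pt = ph P" by blast
 then have *: "ALL i j. (vector [0, - c, b] :: 'k ^ 3) $ i * (vector [a1 P, a2 P, a3 P] :: 'k ^ 3) $ j = (vector [0, - c, b] :: 'k ^ 3) $ j * (vector [a1 P, a2 P, a3 P] :: 'k ^ 3) $ i"
  unfolding ph_def abs_proj_eq_cross[OF Pt_vec phi_vec_nz] by blast
 have e: "c * a1 P = 0" "b * a1 P = 0" "- c * a3 P = b * a2 P"
  using *[rule_format, of 2 1] *[rule_format, of 3 1] *[rule_format, of 2 3] by simp_all
 then have a1: "a1 P = 0" using bc by auto
 then have qP: "q P = y0" by (auto simp: a1_def split: if_splits)
 then have "b = - (c * a3 P)" using e(3) by (simp add: a2_def)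
 then have "b + c * a3 P = 0" by simp
 have "reg C P (%R. b * (dl P R * u R) + c * (dl P R * v R) - e * dl P R) (b * a2 P + c * a3 P - e * a1 P)"
  by (intro reg_add reg_diff reg_cmult irrC P reg_dl reg_dlu reg_dlv)
 moreover have "aeg C (%R. dl P R * xc y' (q' R) = b * (dl P R * u R) + c * (dl P R * v R) - e * dl P R)"
  using coord
 proof eventually_elim
  case (elim R)
  have "xc y' (q' R) = b * u R + c * v R - e" using elim by simp
  then show ?case by (simp only:) (simp add: algebra_simps)
 qed
 ultimately have "reg C P (%R. dl P R * xc y' (q' R)) (b * a2 P + c * a3 P - e * a1 P)" by (rule reg_cong)
 then have r: "reg C P (%R. dl P R * xc y' (q' R)) 0" using qP \<open>b + c * a3 P = 0\<close> by (simp add: a2_def a1_def)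
 have f: "g2.ram P = ram P" "q' P = y'"
  using arg_cong[OF same, of "%D. lkp D P"] P(1) qP ram_pos[OF P(1)]
  by (auto simp: lookup_fibd g2.lookup_fibd split: if_splits)
 have h1: "hord P (dl P) (ram P)" using hord_ram[OF P(1)] qP by (simp add: dl_def[abs_def])
 have h2: "hord P (%R. xc y' (q' R)) (- ram P)"
  using hord_inverse[OF P(1) g2.hord_ram[OF P(1)]] f by (simp add: xc_inverse)
 have "hord P (%R. dl P R * xc y' (q' R)) (ram P + - ram P)" by (rule hord_mult[OF P(1) h1 h2])
 from hord_reg(2)[OF P(1) this r] show False by simp
qed

text \<open>Modulo the vector of \<open>Pt\<close> the point \<open>(1, u, v)\<close> depends only
  on \<open>1\<close> and \<open>b u + c v\<close>. Since the latter is the coordinate of the second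
  quotient plus \<open>e\<close>, projection and quotient map differ by an invertible
  matrix.\<close>

lemma Pt_gal: "gal_cover C G' (%R. pr Pt (ph R))"
proof -
 \<comment> \<open>With these, \<open>?f0\<close>, \<open>?f1\<close> and the vector of
   \<open>Pt\<close> form a basis, and \<open>(b, c)\<close> takes the value 1 on the last two
   entries of \<open>?f1\<close>.\<close>
 obtain gm1 \<delta>1 :: 'k where gd: "b * gm1 + c * \<delta>1 = 1"
 proof (cases "b = 0")
  case True then show ?thesis using that[of 0 "1 / c"] bc by simp
 next
  case False then show ?thesis using that[of "1 / b" 0] by simp
 qed
 let ?M = "Mx Pt" and ?f0 = "vector [1, 0, 0] :: 'k ^ 3" and ?f1 = "vector [0, gm1, \<delta>1] :: 'k ^ 3"
 obtain l m where lm: "lam y' = lin l" "mu y' = lin m"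
  using homogeneous_one_lin[of "lam y'"] homogeneous_one_lin[of "mu y'"] homogeneous_lam homogeneous_mu by (metis One_nat_def)
 \<comment> \<open>Built so that the representative of \<open>q' R\<close> goes to the image of
   \<open>?f0 + (b u + c v) ?f1\<close>, up to the factor \<open>lam y'\<close>; the summand with
   \<open>e\<close> absorbs the constant in \<open>coord\<close>.\<close>
 define N :: "'k ^ 2 ^ 2" where "N = (\<chi> i. (?M *v ?f0) $ i *s l + (?M *v ?f1) $ i *s (m + e *s l))"
 have N: "N *v x = ?M *v (evm (lam y') x *s ?f0 + (evm (mu y') x + e * evm (lam y') x) *s ?f1)" for x
 proof -
  have "N *v x = evm (lam y') x *s (?M *v ?f0) + (evm (mu y') x + e * evm (lam y') x) *s (?M *v ?f1)"
   unfolding lm eval_lin by (simp add: vec_eq_iff N_def matrix_vector_mult_def sum_2 algebra_simps)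
  then show ?thesis by (simp add: matrix_vector_right_distrib vector_scalar_commute)
 qed
 have ker: "?M *v x = 0 \<longleftrightarrow> (EX t. x = t *s vector [0, - c, b])" for x
 proof
  assume "?M *v x = 0"
  then have "x = 0 \<or> abs_proj (vector [0, - c, b]) = abs_proj x" unfolding Mx_ker by auto
  then show "EX t. x = t *s vector [0, - c, b]"
   using abs_proj_eq_iff[OF Pt_vec, of x] by (metis proportional_def vector_smult_lzero)
 next
  assume "EX t. x = t *s vector [0, - c, b]"
  then obtain t where "x = t *s vector [0, - c, b]" ..
  then show "?M *v x = 0" unfolding Mx_ker using abs_proj_scale[OF _ Pt_vec, of t] by (cases "t = 0") auto
 qed
 have inj: "x = 0" if x: "N *v x = 0" for x
 proof -
  let ?L = "evm (lam y') x" and ?m = "evm (mu y') x + e * evm (lam y') x"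
  obtain t where t: "?L *s ?f0 + ?m *s ?f1 = t *s vector [0, - c, b]" using x unfolding N ker by blast
  have c1: "?L = 0" using arg_cong[OF t, of "%v. v $ 1"] by simp
  have c2: "?m * gm1 = t * - c" "?m * \<delta>1 = t * b" using arg_cong[OF t, of "%v. v $ 2"] arg_cong[OF t, of "%v. v $ 3"] by simp_all
  have "?m * (b * gm1 + c * \<delta>1) = b * (?m * gm1) + c * (?m * \<delta>1)" by (simp add: algebra_simps)
  also have "\<dots> = 0" unfolding c2 by (simp add: algebra_simps)
  finally have c3: "?m = 0" unfolding gd c1 by simp
  obtain a b' where "!!v. v = evm (mu y') v *s a + evm (lam y') v *s b'" by (rule line_basis[of y']) blast
  moreover have "evm (mu y') x = 0" using c3 unfolding c1 by simp
  ultimately show "x = 0" using c1 by (metis add.right_neutral vector_smult_lzero)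
 qed
 have ae: "aeg C (%R. pr Pt (ph R) = abs_proj (N *v rep_proj (q' R)))"
  using phi_generic coord dominantD[OF g2.domin ae_neq[of y']] gen_in[OF irrC]
 proof eventually_elim
  case (elim R)
  let ?l = "peval (lam y') (q' R)" and ?m = "peval (mu y') (q' R)"
  have l0: "?l ~= 0" using elim(3) by (simp add: peval_lam)
  have xm: "?m + e * ?l = ?l * (b * u R + c * v R)" unfolding elim(2) using l0 by (simp add: xc_def algebra_simps)
  have vn: "(vector [1, u R, v R] :: 'k ^ 3) ~= 0" by (simp add: vector3_nz)
  obtain k where k: "k ~= 0" "rep_proj (ph R) = k *s vector [1, u R, v R]" unfolding elim(1) by (rule rep_abs_proj[OF vn])
  \<comment> \<open>The coefficient of the vector of \<open>Pt\<close>, which the projection kills,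
    solved from whichever of \<open>b\<close>, \<open>c\<close> is known to be nonzero.\<close>
  define t where "t = (if c = 0 then (v R - (b * u R) * \<delta>1) / b else - (u R - (b * u R + c * v R) * gm1) / c)"
  have t: "vector [1, u R, v R] = ?f0 + (b * u R + c * v R) *s ?f1 + t *s vector [0, - c, b]"
  proof (cases "c = 0")
   case True
   then have "b ~= 0" "b * gm1 = 1" using bc gd by auto
   then show ?thesis using True by (simp add: vec_eq_iff forall_3 t_def mult.assoc mult.left_commute[of b])
  next
   case False
   have "v R = (b * u R + c * v R) * \<delta>1 + t * b"
   proof -
   have "c * ((b * u R + c * v R) * \<delta>1 + t * b) = (b * u R + c * v R) * (b * gm1 + c * \<delta>1) - b * u R"
   using False by (simp add: t_def field_simps)
   also have "\<dots> = c * v R" unfolding gd by simp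
   finally show ?thesis using False by simp
   qed
   then show ?thesis using False by (simp add: vec_eq_iff forall_3 t_def)
  qed
  have Mt: "?M *v (t *s vector [0, - c, b]) = 0" unfolding ker by blast
  have "?M *v rep_proj (ph R) = k *s (?M *v (?f0 + (b * u R + c * v R) *s ?f1))"
  proof -
   have "?M *v vector [1, u R, v R] = ?M *v (?f0 + (b * u R + c * v R) *s ?f1)"
   unfolding t by (simp only: matrix_vector_right_distrib Mt add_0_right)
   then show ?thesis unfolding k(2) by (simp only: vector_scalar_commute)
  qed
  moreover have "N *v rep_proj (q' R) = ?l *s (?M *v (?f0 + (b * u R + c * v R) *s ?f1))"
  proof -
   have "evm (lam y') (rep_proj (q' R)) *s ?f0 + (evm (mu y') (rep_proj (q' R)) + e * evm (lam y') (rep_proj (q' R))) *s ?f1 = ?l *s (?f0 + (b * u R + c * v R) *s ?f1)"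
   using xm by (simp add: peval_def vec_eq_iff forall_3)
   then show ?thesis unfolding N by (simp add: vector_scalar_commute)
  qed
  moreover have "N *v rep_proj (q' R) ~= 0" using inj rep_proj_nonzero by blast
  ultimately show ?case unfolding pr_def using k(1) l0 by (simp add: abs_proj_scale)
 qed
 have m2: "morphism C UNIV (%R. abs_proj (N *v rep_proj (q' R)))"
 proof (rule morphismI[OF irrC])
  fix P assume P: "P \<in> C"
  show "mor_at C P (%R. abs_proj (N *v rep_proj (q' R))) (abs_proj (N *v rep_proj (q' P)))"
   by (rule mor_at_comp[OF irrC P irr_PL UNIV_I g2.q_mor_at[OF P] g2.domin linear_mor_at[OF inj]])
 qed simp
 show ?thesis
 proof (rule gal_cover_linear[OF g2.gal_cover_axioms, of N])
  show "x = 0" if "N *v x = 0" for x by (rule inj[OF that])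
  show "pr Pt (ph R) = abs_proj (N *v rep_proj (q' R))" if "R \<in> C" for R
   by (rule morphism_eq[OF irrC proj_morphism[OF Pt_outer] m2 ae that])
 qed
qed

lemma Pt_galois: "outer_galois_point (ph ` C) Pt" "galois_group_at C ph Pt = G'"
proof -
 interpret pg: plane_gal C ph G' Pt
  by (intro plane_gal.intro plane_map_axioms Pt_gal plane_gal_axioms.intro Pt_outer)
 show "outer_galois_point (ph ` C) Pt" unfolding outer_galois_point_def using pg.galois_point Pt_outer by blast
 show "galois_group_at C ph Pt = G'" by (rule pg.galois_group_at)
qed

end

lemma (in gal_cover) xc_mem:
 assumes r: "rh \<in> automorphisms C" and e: "aeg C (%R. xc y (q (rh R)) = xc y (q R))"
 shows "rh \<in> G"
proof (rule mem_G[OF r])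
 note m = dominantD[OF domin ae_mu[of y]]
 show "aeg C (%R. q (rh R) = q R)"
  using e m dominantD[OF automorphism_simps(5)[OF irrC r] m]
  by eventually_elim (auto intro!: sp_inj[of y] simp: xc_inverse)
qed

section \<open>Linear relations among functions, and the assembly of the plane model\<close>

fun combination :: "'k::field list => ('a => 'k) list => 'a => 'k" where
 "combination (c # cs) (f # fs) R = c * f R + combination cs fs R"
| "combination _ _ R = 0"

lemma combine_cls:
 assumes i: "irr C"
 shows "\<forall>f\<in>set fs. ratl C f ==> ratl C (combination cs fs) &
  ring.combine (FF C) (map (const_fun C) cs) (map (cls C) fs) = cls C (combination cs fs)"
proof (induction cs fs rule: list_induct2')
 case (4 c cs f fs)
 interpret field "FF C" by (rule field_FF[OF i])
 have c: "combination (c # cs) (f # fs) = (%R. c * f R + combination cs fs R)" by (rule ext) simp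
 have r: "ratl C f" "ratl C (combination cs fs)" "ratl C (%R. c * f R)"
  using 4 by (auto intro: ratl_mult[OF i ratl_const[OF i]])
 show ?case unfolding c using 4 r
  by (simp add: const_fun_cls[OF i] FF_mult[OF i ratl_const[OF i]] FF_add[OF i] ratl_add[OF i])
next
 case 1
 interpret field "FF C" by (rule field_FF[OF i])
 have "combination [] [] = (%R :: ('a, 'b) proj. 0 :: 'a)" by (rule ext) simp
 then show ?case by (simp add: FF_zero[OF i] ratl_const[OF i])
next
 case (2 c cs)
 interpret field "FF C" by (rule field_FF[OF i])
 have "combination (c # cs) [] = (%R :: ('a, 'b) proj. 0 :: 'a)" by (rule ext) simp
 then show ?case by (simp add: FF_zero[OF i] ratl_const[OF i])
next
 case (3 f fs)
 interpret field "FF C" by (rule field_FF[OF i])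
 have "combination [] (f # fs) = (%R :: ('a, 'b) proj. 0 :: 'a)" by (rule ext) simp
 then show ?case by (simp add: FF_zero[OF i] ratl_const[OF i])
qed

lemma dependent_functions:
 assumes i: "irr C" and d: "ring.dimension (FF C) m (constants C) V"
  and f: "!!f. f \<in> set fs ==> ratl C f & cls C f \<in> V" and l: "m < length fs"
 obtains cs where "length cs = length fs" "\<exists>c\<in>set cs. c ~= 0" "aeg C (%R. combination cs fs R = 0)"
proof -
 interpret field "FF C" by (rule field_FF[OF i])
 note K = subfield_constants[OF i]
 let ?Us = "map (cls C) fs"
 have Uc: "set ?Us \<subseteq> carrier (FF C)" using f cls_in_carrier[OF i] by auto
 have "dependent (constants C) ?Us"
 proof
  assume "independent (constants C) ?Us"
  from independent_length_le_dimension[OF K d this] f l show False by auto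
 qed
 from dependent_imp_non_trivial_combine[OF K Uc this] obtain Ks where Ks: "length Ks = length ?Us"
  "combine Ks ?Us = \<zero>\<^bsub>FF C\<^esub>" "set Ks \<subseteq> constants C" "set Ks ~= {\<zero>\<^bsub>FF C\<^esub>}" by blast
 obtain cs where cs: "Ks = map (const_fun C) cs"
  using Ks(3) unfolding constants_def by (metis ex_map_conv subset_iff rangeE)
 have "\<forall>f\<in>set fs. ratl C f" using f by blast
 note cc = combine_cls[OF i this, of cs]
 have "cls C (combination cs fs) = \<zero>\<^bsub>FF C\<^esub>"
  unfolding cc[THEN conjunct2, symmetric] cs[symmetric] by (rule Ks(2))
 then have "aeg C (%R. combination cs fs R = 0)"
  unfolding cls_eq_zero_iff[OF i cc[THEN conjunct1]] .
 moreover have "\<exists>c\<in>set cs. c ~= 0"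
 proof (rule ccontr)
  assume "\<not> ?thesis"
  then have "set Ks \<subseteq> {\<zero>\<^bsub>FF C\<^esub>}" unfolding cs FF_zero[OF i] const_fun_cls[OF i] by auto
  from subset_singletonD[OF this] show False using Ks(1,4) l by auto
 qed
 moreover have "length cs = length fs" using Ks(1) cs by simp
 ultimately show ?thesis using that by blast
qed

text \<open>All centres lie on the line where the leading coordinate vanishes, and so does the image
  of \<open>Q\<close>, since \<open>Q\<close> lies over \<open>y0\<close>. The determinants in
  \<open>ind\<close> keep the centres apart.\<close>

lemma plane_model:
 fixes G :: "nat => (('k::alg_closed_field, 'n::finite) proj => ('k, 'n) proj) set"
 assumes pb: "plane_build C (G 1) q y0 v" and Q: "Q \<in> C" "q Q = y0"
  and pp: "!!i. i \<in> {1, 2, 3} ==> plane_point C (G 1) q y0 v (G i) (q' i) (y' i) (b i) (c i) (e i)"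
  and ind: "!!i j. i \<in> {1, 2, 3} ==> j \<in> {1, 2, 3} ==> i ~= j ==> b i * c j ~= b j * c i"
 shows "\<exists>(ph :: ('k, 'n) proj => ('k, 3) proj) (P :: nat => ('k, 3) proj).
   birational_embedding C ph & has_degree (ph ` C) (card (G 1)) &
   inj_on P {1, 2, 3} & collinear_points (P ` {1, 2, 3}) &
   (\<forall>i\<in>{1, 2, 3}. outer_galois_point (ph ` C) (P i) & galois_group_at C ph (P i) = G i) &
   ph Q \<in> line_through (P 1) (P 2)"
proof -
 interpret plane_build C "G 1" q y0 v by (rule pb)
 define P where "P i = abs_proj (vector [0, - c i, b i] :: 'k ^ 3)" for i
 have nz: "(vector [0, - c i, b i] :: 'k ^ 3) ~= 0" if "i \<in> {1, 2, 3}" for i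
 proof -
  interpret plane_point C "G 1" q y0 v "G i" "q' i" "y' i" "b i" "c i" "e i" by (rule pp[OF that])
  show ?thesis by (rule Pt_vec)
 qed
 have gal: "outer_galois_point (ph ` C) (P i) & galois_group_at C ph (P i) = G i" if "i \<in> {1, 2, 3}" for i
 proof -
  interpret plane_point C "G 1" q y0 v "G i" "q' i" "y' i" "b i" "c i" "e i" by (rule pp[OF that])
  show ?thesis unfolding P_def using Pt_galois by blast
 qed
 have neq: "P i ~= P j" if ij: "i \<in> {1, 2, 3}" "j \<in> {1, 2, 3}" "i ~= j" for i j
 proof
  assume "P i = P j"
  then have "ALL k l. (vector [0, - c i, b i] :: 'k ^ 3) $ k * (vector [0, - c j, b j] :: 'k ^ 3) $ l =
   (vector [0, - c i, b i] :: 'k ^ 3) $ l * (vector [0, - c j, b j] :: 'k ^ 3) $ k"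
   unfolding P_def abs_proj_eq_cross[OF nz[OF ij(1)] nz[OF ij(2)]] .
  from this[rule_format, of 3 2] have "b i * c j = b j * c i" by (simp add: mult.commute)
  with ind[OF ij] show False by blast
 qed
 let ?a = "vector [1, 0, 0] :: 'k ^ 3"
 have a: "?a ~= 0" by (simp add: vector3_nz)
 have line: "peval (lin ?a) (P i) = 0" if "i \<in> {1, 2, 3}" for i
  unfolding P_def peval_abs_eq_0_iff[OF homogeneous_lin nz[OF that]] by (simp add: sum_3)
 have lQ: "peval (lin ?a) (ph Q) = 0"
  unfolding ph_def peval_abs_eq_0_iff[OF homogeneous_lin phi_vec_nz] using Q(2) by (simp add: sum_3 a1_def)
 have "line_through (P 1) (P 2) = {T. peval (lin ?a) T = 0}"
  by (rule line_through_eq[OF neq a line line]) auto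
 then have "ph Q \<in> line_through (P 1) (P 2)" using lQ by simp
 moreover have "collinear_points (P ` {1, 2, 3})"
  unfolding collinear_points_def is_line_lin using a line by blast
 moreover have "inj_on P {1, 2, 3}" using neq by (meson inj_onI)
 moreover have "\<forall>i\<in>{1, 2, 3}. outer_galois_point (ph ` C) (P i) & galois_group_at C ph (P i) = G i"
  by (intro ballI gal)
 ultimately show ?thesis using birational has_degree_phi by blast
qed

lemma Aut_one: "\<one>\<^bsub>Aut C\<^esub> = (\<lambda>x\<in>C. x)"
 by (simp add: Aut_def BijGroup_def)

theorem galois_points_of_quotients:
 fixes C :: "('k::alg_closed_field, 'n::finite) proj set"
  and G :: "nat => (('k, 'n) proj => ('k, 'n) proj) set"
 assumes irrC: "irr C" and q: "!!i. i \<in> {1, 2, 3} ==> gal_cover C (G i) (q i)" and Q: "Q \<in> C"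
  and triv: "!!i j. i \<in> {1, 2, 3} ==> j \<in> {1, 2, 3} ==> i ~= j ==> G i \<inter> G j = {\<lambda>x\<in>C. x}"
  and D: "!!i. i \<in> {1, 2, 3} ==> D = (\<Sum>sg\<in>G i. Poly_Mapping.single (sg Q) 1)"
  and sub: "!!i. i \<in> {1, 2, 3} ==> quotient_system C (G i) \<subseteq> \<Lambda>"
  and dim: "has_projective_dim C D \<Lambda> m" "m \<le> 2"
 shows "\<exists>(ph :: ('k, 'n) proj => ('k, 3) proj) (P :: nat => ('k, 3) proj).
   birational_embedding C ph & has_degree (ph ` C) (card (G 1)) &
   inj_on P {1, 2, 3} & collinear_points (P ` {1, 2, 3}) &
   (\<forall>i\<in>{1, 2, 3}. outer_galois_point (ph ` C) (P i) & galois_group_at C ph (P i) = G i) &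
   ph Q \<in> line_through (P 1) (P 2)"
proof -
 let ?I = "{1, 2, 3} :: nat set"
 have ag: "aut_group C (G i)" if "i \<in> ?I" for i using q[OF that] unfolding gal_cover_def by blast
 obtain V where V: "subalgebra (constants C) V (FF C)" "V \<subseteq> riemann_roch_space C D" "\<Lambda> = linear_system C D V"
  "ring.dimension (FF C) (Suc m) (constants C) V" using dim(1) unfolding has_projective_dim_def by blast
 have Vc: "V \<subseteq> carrier (FF C)" using V(2) by (auto simp: riemann_roch_space_def function_field_def)
 define y where "y i = q i Q" for i
 define x where "x i R = xc (y i) (q i R)" for i R
 \<comment> \<open>The common orbit sum is identified with the fibre through \<open>Q\<close> for
   each quotient; this is what bounds the poles of all three coordinates by the same
   divisor.\<close>
 have fd: "gal_cover.fibd C (q i) (y i) = D" if i: "i \<in> ?I" for i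
  unfolding y_def using gal_cover.orbit_divisor_eq_fibre[OF q[OF i] Q Vc] sub[OF i] V(3) D[OF i] by simp
 have rx: "ratl C (x i)" if i: "i \<in> ?I" for i
 proof -
  interpret gal_cover C "G i" "q i" by (rule q[OF i])
  show ?thesis unfolding x_def[abs_def] by (rule ratl_pull_q[OF ratl_xc])
 qed
 have xV: "cls C (%_. 1) \<in> V" "cls C (x i) \<in> V" if i: "i \<in> ?I" for i
  using gal_cover.system_contains[OF q[OF i] V(1), of "y i"] sub[OF i] V(3) fd[OF i] by (simp_all add: x_def[abs_def])
 have pole: "curve.ordge C P (x j) (- lkp D P)" if j: "j \<in> ?I" and P: "P \<in> C" for j P
  using gal_cover.xc_order[OF q[OF j] P, of "y j"] fd[OF j] by (simp add: x_def[abs_def])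
 have inv: "x i (sg R) = x i R" if "i \<in> ?I" "sg \<in> G i" "R \<in> C" for i sg R
  using gal_cover.q_inv[OF q[OF that(1)] that(2,3)] by (simp add: x_def)
 have mem: "sg = (\<lambda>x\<in>C. x)" if ij: "i \<in> ?I" "j \<in> ?I" "i ~= j" and s: "sg \<in> G i"
  and e: "aeg C (%R. x j (sg R) = x j R)" for i j sg
 proof -
  have "sg \<in> automorphisms C" using aut_group.aut[OF ag[OF ij(1)]] s by blast
  then have "sg \<in> G j" by (rule gal_cover.xc_mem[OF q[OF ij(2)]]) (use e in \<open>simp add: x_def\<close>)
  then show ?thesis using triv[OF ij] s by blast
 qed
 \<comment> \<open>If \<open>x j\<close> is an affine function of \<open>x i\<close>, it is
   invariant under \<open>G i\<close>. Then \<open>G i\<close> lies in \<open>G j\<close>, and the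
   intersection is trivial.\<close>
 have pair: "G i = {\<lambda>x\<in>C. x}" if ij: "i \<in> ?I" "j \<in> ?I" "i ~= j" and e: "aeg C (%R. x j R = \<alpha> + \<beta> * x i R)" for i j \<alpha> \<beta>
 proof -
  interpret aut_group C "G i" by (rule ag[OF ij(1)])
  have "sg = (\<lambda>x\<in>C. x)" if s: "sg \<in> G i" for sg
  proof (rule mem[OF ij s])
   show "aeg C (%R. x j (sg R) = x j R)"
   using dominantD[OF domi[OF s] e] e gen_in[OF irrC] by eventually_elim (simp add: inv[OF ij(1) s])
  qed
  then show ?thesis using one by blast
 qed
 show ?thesis
 proof (cases "\<exists>i\<in>?I. G i = {\<lambda>x\<in>C. x}")
  \<comment> \<open>One trivial group makes \<open>D\<close> the point \<open>Q\<close> with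
    multiplicity 1, so in every group all elements fix \<open>Q\<close> and the stabilizer has one
    element. The image is then a line, with \<open>v = 0\<close>, and three points of another line
    off the curve serve as centres; \<open>t\<close> provides the third of them.\<close>
  case True
  then obtain i where i: "i \<in> ?I" "G i = {\<lambda>x\<in>C. x}" by blast
  have D1: "D = Poly_Mapping.single Q 1" using D[OF i(1)] Q by (simp add: i(2))
  have all: "G j = {\<lambda>x\<in>C. x}" if j: "j \<in> ?I" for j
  proof -
   interpret gal_cover C "G j" "q j" by (rule q[OF j])
   have l: "lkp D P = (if P \<in> C & q j P = q j Q then int (card {sg\<in>G j. sg Q = Q}) else 0)" for P
   unfolding D[OF j] by (rule orbit_divisor[OF Q])
   have c1: "card {sg\<in>G j. sg Q = Q} = 1" using l[of Q] Q by (simp add: D1)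
   have "sg Q = Q" if s: "sg \<in> G j" for sg
   proof (rule ccontr)
   assume "sg Q ~= Q"
   then show False using l[of "sg Q"] Q s c1 q_inv[OF s Q] by (simp add: D1 lookup_single when_def split: if_splits)
   qed
   then have "{sg\<in>G j. sg Q = Q} = G j" by blast
   then obtain sg where "G j = {sg}" using c1 by (metis card_1_singletonE)
   then show ?thesis using one by auto
  qed
  interpret g1: gal_cover C "G 1" "q 1" by (rule q) simp
  have pb: "plane_build C (G 1) (q 1) (y 1) (%_. 0)"
  proof
   show "ratl C (%_. 0)" by (rule ratl_const[OF irrC])
   show "g1.ordge P (%_. 0) (- lkp (g1.fibd (y 1)) P)" for P by (rule g1.ordge_0)
   show "sg = (\<lambda>x\<in>C. x)" if "sg \<in> G 1" for sg using all[of 1] that by auto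
  qed
  interpret pb: plane_build C "G 1" "q 1" "y 1" "%_. 0" by (rule pb)
  have "infinite (UNIV - {0, 1 :: 'k})" using infinite_alg_closed by (simp add: Diff_infinite_finite)
  then obtain t :: 'k where t: "t ~= 0" "t ~= 1" by (metis Diff_iff finite.emptyI insertCI ex_in_conv)
  define c :: "nat => 'k" where "c i = (if i = 1 then 0 else if i = 2 then 1 else t)" for i
  show ?thesis
  proof (rule plane_model[where G = G and q' = "%_. q 1" and y' = "%_. y 1" and b = "%_. 1" and c = c and e = "%_. 0", OF pb Q y_def[of 1, symmetric]])
   fix i assume i: "i \<in> ?I"
   have Gi: "G i = G 1" using all[OF i] all[of 1] by simp
   show "plane_point C (G 1) (q 1) (y 1) (%_. 0) (G i) (q 1) (y 1) 1 (c i) 0"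
   unfolding Gi by unfold_locales (auto simp: pb.u_def simp del: One_nat_def)
  next
   fix i j assume "i \<in> ?I" "j \<in> ?I" "i ~= j"
   then show "1 * c j ~= 1 * c i" using t by (auto simp: c_def)
  qed
 next
  case False
  then have nt: "!!i. i \<in> ?I ==> G i ~= {\<lambda>x\<in>C. x}" by blast
  \<comment> \<open>The vector space \<open>V\<close> has dimension \<open>Suc m\<close>, at most 3,
    so the four functions are dependent.\<close>
  have "EX cs. length cs = length [%_. 1, x 1, x 2, x 3] & (\<exists>c\<in>set cs. c ~= 0) &
   (\<forall>\<^sub>F R in gen C. combination cs [%_. 1, x 1, x 2, x 3] R = 0)"
  proof (rule dependent_functions[OF irrC V(4), of "[%_. 1, x 1, x 2, x 3]"])
   fix f assume "f \<in> set [%_. 1, x 1, x 2, x 3]"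
   then consider "f = (%_. 1)" | i where "i \<in> ?I" "f = x i" by auto
   then show "ratl C f & cls C f \<in> V" by cases (use rx xV ratl_const[OF irrC] in auto)
  qed (use dim(2) in auto)
  then obtain cs where cs: "length cs = 4" "\<exists>c\<in>set cs. c ~= 0"
   "aeg C (%R. combination cs [%_. 1, x 1, x 2, x 3] R = 0)" by (elim exE conjE) (rule that, simp_all)
  then obtain a0 a1 a2 a3 where "cs = [a0, a1, a2, a3]" by (auto simp: length_Suc_conv numeral_eq_Suc)
  with cs have a: "a0 ~= 0 \<or> a1 ~= 0 \<or> a2 ~= 0 \<or> a3 ~= 0"
   and rel: "aeg C (%R. a0 + a1 * x 1 R + a2 * x 2 R + a3 * x 3 R = 0)" by (simp_all add: add.assoc)
  have no: False if ij: "i \<in> ?I" "j \<in> ?I" "i ~= j" and e: "aeg C (%R. \<alpha> + \<beta> * x i R + gm * x j R = 0)" and g: "gm ~= 0" for i j \<alpha> \<beta> gm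
  proof -
   have "aeg C (%R. x j R = - \<alpha> / gm + (- \<beta> / gm) * x i R)"
   using e
   proof eventually_elim
   case (elim R)
   have "gm * x j R = - \<alpha> - \<beta> * x i R" using elim by (simp add: eq_neg_iff_add_eq_0 algebra_simps)
   then have "x j R = (- \<alpha> - \<beta> * x i R) / gm" using g by (simp add: eq_divide_eq mult.commute)
   then show ?case by (simp add: diff_divide_distrib)
   qed
   from pair[OF ij this] nt[OF ij(1)] show False by blast
  qed
  \<comment> \<open>A vanishing coefficient would leave a relation between at most two of the
    coordinates, which \<open>no\<close> excludes for nontrivial groups.\<close>
  have a3: "a3 ~= 0"
  proof
   assume z: "a3 = 0"
   have "a2 = 0" using no[of 1 2 a0 a1 a2] rel z by auto
   moreover from this have "a1 = 0" using no[of 2 1 a0 0 a1] rel z by auto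
   ultimately show False using a rel z gen_const[OF irrC] by auto
  qed
  have a2: "a2 ~= 0" using no[of 1 3 a0 a1 a3] rel a3 by auto
  have a1: "a1 ~= 0" using no[of 2 3 a0 a2 a3] rel a3 by auto
  define b3 c3 e3 where "b3 = - a1 / a3" and "c3 = - a2 / a3" and "e3 = a0 / a3"
  have x3: "aeg C (%R. b3 * x 1 R + c3 * x 2 R = x 3 R + e3)"
   using rel
  proof eventually_elim
   case (elim R)
   have "a3 * (x 3 R + e3) = - (a1 * x 1 R) - a2 * x 2 R"
   proof -
   have "a3 * (x 3 R + e3) = a3 * x 3 R + a0" using a3 by (simp add: e3_def distrib_left)
   also have "\<dots> = (a0 + a1 * x 1 R + a2 * x 2 R + a3 * x 3 R) - a1 * x 1 R - a2 * x 2 R" by (simp add: algebra_simps)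
   finally show ?thesis unfolding elim by simp
   qed
   also have "\<dots> = a3 * (b3 * x 1 R + c3 * x 2 R)" using a3 by (simp add: b3_def c3_def right_diff_distrib)
   finally show ?case using a3 by simp
  qed
  interpret g1: gal_cover C "G 1" "q 1" by (rule q) simp
  have pb: "plane_build C (G 1) (q 1) (y 1) (x 2)"
  proof
   show "ratl C (x 2)" by (rule rx) simp
   show "g1.ordge P (x 2) (- lkp (g1.fibd (y 1)) P)" if "P \<in> C" for P
   using pole[of 2, OF _ that] fd[of 1] by simp
   show "sg = (\<lambda>x\<in>C. x)" if "sg \<in> G 1" "aeg C (%R. x 2 (sg R) = x 2 R)" for sg
   by (rule mem[of 1 2, OF _ _ _ that]) auto
  qed
  interpret pb: plane_build C "G 1" "q 1" "y 1" "x 2" by (rule pb)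
  have u: "pb.u = x 1" unfolding pb.u_def[abs_def] x_def[abs_def] ..
  define b c e where "b i = (if i = 1 then 1 else if i = 2 then 0 else b3)"
   and "c i = (if i = 1 then 0 else if i = 2 then 1 else c3)"
   and "e i = (if i = 3 then e3 else 0)" for i :: nat
  have bc: "b3 ~= 0" "c3 ~= 0" using a1 a2 a3 by (simp_all add: b3_def c3_def)
  show ?thesis
  proof (rule plane_model[where G = G and q' = q and y' = y and b = b and c = c and e = e, OF pb Q y_def[of 1, symmetric]])
   fix i assume i: "i \<in> ?I"
   interpret gi: gal_cover C "G i" "q i" by (rule q[OF i])
   show "plane_point C (G 1) (q 1) (y 1) (x 2) (G i) (q i) (y i) (b i) (c i) (e i)"
   proof
   show "b i ~= 0 \<or> c i ~= 0" using bc by (simp add: b_def c_def)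
   show "gi.fibd (y i) = g1.fibd (y 1)" using fd[OF i] fd[of 1] by simp
   have "aeg C (%R. b i * x 1 R + c i * x 2 R = x i R + e i)"
   proof -
   consider "i = 1" | "i = 2" | "i = 3" using i by auto
   then show ?thesis by cases (use x3 in \<open>simp_all add: b_def c_def e_def\<close>)
   qed
   then show "aeg C (%R. b i * pb.u R + c i * x 2 R = xc (y i) (q i R) + e i)"
   unfolding u x_def .
   qed
  next
   fix i j assume "i \<in> ?I" "j \<in> ?I" "i ~= j"
   then show "b i * c j ~= b j * c i" using bc by (auto simp: b_def c_def)
  qed
 qed
qed

section \<open>Linear forms that avoid finitely many points\<close>

lemma avoid_finite:
 fixes S :: "('k::alg_closed_field, 'n::finite) proj set"
 assumes "finite S" and V: "0 \<in> V" "!!a b c. a \<in> V ==> b \<in> V ==> a + c *s b \<in> V"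
  and "!!s. s \<in> S ==> \<exists>a\<in>V. peval (lin a) s ~= 0"
 shows "\<exists>a\<in>V. \<forall>s\<in>S. peval (lin a) s ~= 0"
 using assms(1,4)
proof (induction S rule: finite_induct)
 case empty
 then show ?case using V(1) by blast
next
 case (insert s S)
 obtain a where a: "a \<in> V" "!!s. s \<in> S ==> peval (lin a) s ~= 0" using insert by blast
 obtain b where b: "b \<in> V" "peval (lin b) s ~= 0" using insert.prems by blast
 have "finite (insert s S)" using insert(1) by simp
 \<comment> \<open>Each point at which \<open>b\<close> is nonzero excludes a single value of
   \<open>c\<close>.\<close>
 then obtain c where c: "c \<notin> (%t. - peval (lin a) t / peval (lin b) t) ` insert s S"
  by (rule exE[OF ex_new_if_finite[OF infinite_alg_closed finite_imageI]])
 have e: "peval (lin (a + c *s b)) t = peval (lin a) t + c * peval (lin b) t" for t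
  by (simp add: peval_def sum.distrib sum_distrib_left algebra_simps)
 have "peval (lin (a + c *s b)) t ~= 0" if t: "t \<in> insert s S" for t
 proof
  assume z: "peval (lin (a + c *s b)) t = 0"
  show False
  proof (cases "peval (lin b) t = 0")
   case True
   then show False using z a(2) b(2) t unfolding e by auto
  next
   case False
   have "c * peval (lin b) t = - peval (lin a) t" using z unfolding e by (simp add: eq_neg_iff_add_eq_0 add.commute)
   then have "c * peval (lin b) t / peval (lin b) t = - peval (lin a) t / peval (lin b) t" by (rule arg_cong)
   then have "c = - peval (lin a) t / peval (lin b) t" using False by simp
   then show False using c t by blast
  qed
 qed
 then show ?case using V(2)[OF a(1) b(1)] by blast
qed

lemma form_avoiding:
 fixes S :: "('k::alg_closed_field, 'n::finite) proj set"
 assumes "finite S"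
 obtains a where "!!s. s \<in> S ==> peval (lin a) s ~= 0"
proof -
 have "\<exists>a\<in>UNIV. peval (lin a) s ~= 0" for s :: "('k, 'n) proj"
 proof -
  obtain j where j: "rep_proj s $ j ~= 0" using rep_proj_nonzero[of s] by (auto simp: vec_eq_iff)
  have "peval (lin (axis j 1)) s = rep_proj s $ j"
   by (simp add: peval_def axis_def if_distrib[of "%x. x * _"] sum.delta cong: if_cong)
  then show ?thesis using j by (intro bexI[of _ "axis j 1"]) auto
 qed
 from avoid_finite[OF assms, of UNIV] this show ?thesis using that by blast
qed

lemma form_through_avoiding:
 fixes S :: "('k::alg_closed_field, 'n::finite) proj set"
 assumes "finite S" "R \<notin> S"
 obtains a where "peval (lin a) R = 0" "!!s. s \<in> S ==> peval (lin a) s ~= 0"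
proof -
 let ?V = "{a. peval (lin a) R = 0}"
 have "\<exists>a\<in>?V. peval (lin a) s ~= 0" if "s \<in> S" for s
 proof -
  have "s ~= R" using that assms(2) by blast
  from separating_form[OF this] show ?thesis by blast
 qed
 moreover have "a + c *s b \<in> ?V" if "a \<in> ?V" "b \<in> ?V" for a b c
 proof -
  have "peval (lin (a + c *s b)) R = peval (lin a) R + c * peval (lin b) R"
   by (simp add: peval_def sum.distrib sum_distrib_left algebra_simps)
  then show ?thesis using that by simp
 qed
 moreover have "0 \<in> ?V" by (simp add: peval_def)
 ultimately show ?thesis using avoid_finite[OF assms(1), of ?V] that by blast
qed

section \<open>Automorphisms induced by field automorphisms\<close>

context curve
begin

text \<open>The images under \<open>T\<close> of the coordinate ratios are the affine coordinates of
  a generically defined map. It satisfies the equations of \<open>C\<close> because \<open>T\<close>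
  is a homomorphism fixing the constants; it extends to every point by \<open>extend_map\<close>,
  and it stays in \<open>C\<close> because \<open>C\<close> is closed. Injectivity of
  \<open>T\<close> makes it dominant.\<close>

lemma induced_map:
 assumes closed: "closedin zariski C" and T: "T \<in> ring_hom (FF C) (FF C)"
  and Tc: "!!c. T (cls C (%_. c)) = cls C (%_. c)"
  and T0: "!!x. x \<in> carrier (FF C) ==> T x = \<zero>\<^bsub>FF C\<^esub> ==> x = \<zero>\<^bsub>FF C\<^esub>"
 obtains sg where "morphism C C sg" "dominant C C sg" "!!h. ratl C h ==> T (cls C h) = cls C (%R. h (sg R))"
proof -
 obtain P0 where P0: "P0 \<in> C" using irrC unfolding irr_def by blast
 obtain j0 :: 'n where j0: "peval (coordv j0) P0 ~= 0" using ex_var_nonzero by blast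
 have gj: "aeg C (%R. R \<in> C & peval (coordv j0) R ~= 0)" by (rule gen_basic[OF irrC homogeneous_coordv P0 j0])
 define x where "x j R = peval (coordv j) R / peval (coordv j0) R" for j :: 'n and R :: "('k, 'n) proj"
 have rx: "ratl C (x j)" for j unfolding x_def[abs_def] by (rule ratl_form[OF irrC homogeneous_coordv homogeneous_coordv])
 \<comment> \<open>\<open>T\<close> in terms of functions: being compatible with sums and products,
   \<open>rep\<close> carries \<open>T\<close> through the evaluation of forms.\<close>
 define rep where "rep f g \<longleftrightarrow> ratl C f & ratl C g & T (cls C f) = cls C g" for f g
 have rep_ex: "EX g. rep f g" if f: "ratl C f" for f
 proof -
  have "T (cls C f) \<in> carrier (FF C)" by (rule ring_hom_closed[OF T cls_in_carrier[OF irrC f]])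
  then obtain g where "ratl C g" "T (cls C f) = cls C g" by (rule FF_cases[OF irrC])
  then show ?thesis using f unfolding rep_def by blast
 qed
 have rep_add: "rep (%R. f R + f' R) (%R. g R + g' R)" if "rep f g" "rep f' g'" for f g f' g'
  using that ring_hom_add[OF T, of "cls C f" "cls C f'"] unfolding rep_def
  by (simp add: FF_add[OF irrC] ratl_add[OF irrC] cls_in_carrier[OF irrC])
 have rep_mult: "rep (%R. f R * f' R) (%R. g R * g' R)" if "rep f g" "rep f' g'" for f g f' g'
  using that ring_hom_mult[OF T, of "cls C f" "cls C f'"] unfolding rep_def
  by (simp add: FF_mult[OF irrC] ratl_mult[OF irrC] cls_in_carrier[OF irrC])
 have rep_const: "rep (%_. c) (%_. c)" for c unfolding rep_def using Tc ratl_const[OF irrC] by blast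
 have rep_sum: "rep (%R. \<Sum>i\<in>I. f i R) (%R. \<Sum>i\<in>I. g i R)" if "!!i. i \<in> I ==> rep (f i) (g i)"
  for I :: "('n \<Rightarrow>\<^sub>0 nat) set" and f g
  using that by (induction I rule: infinite_finite_induct) (auto intro: rep_add rep_const)
 have rep_prod: "rep (%R. \<Prod>i\<in>I. f i R) (%R. \<Prod>i\<in>I. g i R)" if "!!i. i \<in> I ==> rep (f i) (g i)"
  for I :: "'n set" and f g
  using that by (induction I rule: infinite_finite_induct) (auto intro: rep_mult rep_const)
 have rep_power: "rep (%R. f R ^ k) (%R. g R ^ k)" if "rep f g" for f g and k :: nat
  using that by (induction k) (auto intro: rep_mult rep_const)
 have rep_zero: "aeg C (%R. g R = 0)" if r: "rep f g" and f: "aeg C (%R. f R = 0)" for f g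
 proof -
  have "cls C g = cls C (%_. 0)" using r cls_cong[OF f] Tc[of 0] unfolding rep_def by simp
  then show ?thesis using r unfolding rep_def FF_zero[OF irrC, symmetric] by (simp add: cls_eq_zero_iff[OF irrC])
 qed
 have rep_nz: "aeg C (%R. g R ~= 0)" if r: "rep f g" and f: "aeg C (%R. f R ~= 0)" for f g
 proof (rule ccontr)
  assume "\<not> ?thesis"
  then have "aeg C (%R. g R = 0)" using ratl_dich[OF irrC] r unfolding rep_def by blast
  then have "T (cls C f) = \<zero>\<^bsub>FF C\<^esub>" using r unfolding rep_def by (simp add: cls_eq_zero_iff[OF irrC])
  then have "cls C f = \<zero>\<^bsub>FF C\<^esub>" using T0 r cls_in_carrier[OF irrC] unfolding rep_def by blast
  then have "aeg C (%R. f R = 0)" using r unfolding rep_def by (simp add: cls_eq_zero_iff[OF irrC])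
  from gen_False[OF irrC this] f show False by simp
 qed
 have "ALL j. EX g. rep (x j) g" using rep_ex[OF rx] by blast
 from choice[OF this] obtain v where v: "!!j. rep (x j) (v j)" by blast
 have rv: "ratl C (v j)" for j using v[of j] unfolding rep_def by blast
 let ?x = "%R. \<chi> j. x j R" and ?v = "%R. \<chi> j. v j R"
 have rep_eval: "rep (%R. evm F (?x R)) (%R. evm F (?v R))" for F
  unfolding eval_mpoly_def vec_lambda_beta by (intro rep_sum rep_mult rep_const rep_prod rep_power v)
 have ex: "evm F (?x R) = (1 / peval (coordv j0) R) ^ d * peval F R" if F: "hmg d F" for F d R
 proof -
  have "?x R = (1 / peval (coordv j0) R) *s rep_proj R" by (simp add: vec_eq_iff x_def peval_def)
  then show ?thesis by (simp add: eval_mpoly_scale[OF F] peval_def)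
 qed
 have v0: "aeg C (%R. v j0 R ~= 0)"
  by (rule rep_nz[OF v]) (use gj in eventually_elim, simp add: x_def)
 have vz: "aeg C (%R. ?v R ~= 0)"
  using v0 by eventually_elim (auto simp: vec_eq_iff)
 define sg0 where "sg0 R = abs_proj (?v R)" for R
 have Fnz: "aeg C (%R. peval F (sg0 R) ~= 0)" if F: "hmg d F" "P \<in> C" "peval F P ~= 0" for F d P
 proof -
  have "aeg C (%R. evm F (?x R) ~= 0)"
   using gj gen_basic[OF irrC F] by eventually_elim (simp add: ex[OF F(1)])
  from rep_nz[OF rep_eval this] vz show ?thesis
   by eventually_elim (simp add: sg0_def peval_abs_eq_0_iff[OF F(1)])
 qed
 have Fz: "aeg C (%R. peval F (sg0 R) = 0)" if F: "hmg d F" "!!P. P \<in> C ==> peval F P = 0" for F d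
 proof -
  have "aeg C (%R. evm F (?x R) = 0)"
   using gj by eventually_elim (simp add: ex[OF F(1)] F(2))
  from rep_zero[OF rep_eval this] vz show ?thesis
   by eventually_elim (simp add: sg0_def peval_abs_eq_0_iff[OF F(1)])
 qed
 have m0: "EX y. mor_at C P sg0 y" if P: "P \<in> C" for P
  by (rule extend_map[where v = v and l = j0, OF P rv v0]) (auto simp: sg0_def[abs_def])
 define sg where "sg P = (SOME y. mor_at C P sg0 y)" for P
 have m: "mor_at C P sg0 (sg P)" if P: "P \<in> C" for P unfolding sg_def by (rule someI_ex[OF m0[OF P]])
 have sC: "sg P \<in> C" if P: "P \<in> C" for P
 proof (rule ccontr)
  assume "sg P \<notin> C"
  moreover have "openin (subtopology zariski UNIV) (- C)"
   using closed by (simp add: closedin_def Compl_eq_Diff_UNIV)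
  ultimately obtain F d where F: "hmg d F" "peval F (sg P) ~= 0" "\<forall>R\<in>UNIV. peval F R ~= 0 --> R \<in> - C"
   unfolding openin_zariski_sub by blast
  have "!!R. R \<in> C ==> peval F R = 0" using F(3) by blast
  from gen_False[OF irrC Fz[OF F(1) this]] mor_at_form[OF irrC P m[OF P] F(1,2)] show False by simp
 qed
 have mor: "morphism C C sg" by (rule morphismI[OF irrC m]) (use sC in auto)
 have eq: "aeg C (%R. sg R = sg0 R)"
 proof -
  have "aeg C (%R. \<forall>j\<in>UNIV. R \<in> C & reg C R (v j) (v j R))"
   by (intro eventually_ball_finite ballI ratl_reg[OF irrC rv]) simp
  then show ?thesis using vz gen_in[OF irrC]
  proof eventually_elim
   case (elim R)
   have "mor_at C R sg0 (sg0 R)" unfolding sg0_def[abs_def]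
   by (rule mor_at_of_reg[where h = "%_. 1", OF irrC elim(3)]) (use elim in auto)
   from mor_at_unique[OF irrC elim(3) m[OF elim(3)] this] show ?case by simp
  qed
 qed
 have dom: "dominant C C sg" unfolding filterlim_iff
 proof (intro allI impI)
  fix Q assume "eventually Q (gen C)"
  then obtain F d P where F: "hmg d F" "P \<in> C" "peval F P ~= 0" "\<forall>R\<in>C. peval F R ~= 0 --> Q R"
   unfolding eventually_gen[OF irrC] by blast
  show "aeg C (%R. Q (sg R))"
   using Fnz[OF F(1-3)] eq gen_in[OF irrC]
  proof eventually_elim
   case (elim R)
   then have "peval F (sg R) ~= 0" by simp
   then show ?case using F(4) sC[OF elim(3)] by blast
  qed
 qed
 have "T (cls C h) = cls C (%R. h (sg R))" if h: "ratl C h" for h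
 proof -
  obtain F G d P where FG: "hmg d F" "hmg d G" "P \<in> C" "peval G P ~= 0"
   "aeg C (%R. h R = peval F R / peval G R)" using h unfolding ratl_def by blast
  obtain w where w: "rep h w" using rep_ex[OF h] ..
  let ?d = "%R. h R * evm G (?x R) + - 1 * evm F (?x R)"
  have "aeg C (%R. ?d R = 0)"
   using FG(5) gen_basic[OF irrC FG(2-4)] by eventually_elim (simp add: ex[OF FG(1)] ex[OF FG(2)])
  from rep_zero[OF rep_add[OF rep_mult[OF w rep_eval] rep_mult[OF rep_const rep_eval]] this]
  have "aeg C (%R. w R * evm G (?v R) + - 1 * evm F (?v R) = 0)" .
  then have "aeg C (%R. h (sg R) = w R)"
   using vz Fnz[OF FG(2-4)] eq dominantD[OF dom FG(5)]
  proof eventually_elim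
   case (elim R)
   have "evm G (?v R) ~= 0" using elim(2,3) by (simp add: sg0_def peval_abs_eq_0_iff[OF FG(2)])
   moreover have "h (sg R) = evm F (?v R) / evm G (?v R)"
   using elim(4,5) peval_abs_ratio[OF FG(1,2) elim(2)] by (simp add: sg0_def)
   ultimately show ?case using elim(1) by (simp add: divide_eq_eq)
  qed
  from cls_cong[OF this] show ?thesis using w unfolding rep_def by simp
 qed
 with mor dom show ?thesis using that by blast
qed

lemma induced_automorphism:
 assumes closed: "closedin zariski C"
  and T: "T \<in> ring_hom (FF C) (FF C)" "T' \<in> ring_hom (FF C) (FF C)"
  and TT': "!!x. x \<in> carrier (FF C) ==> T' (T x) = x" "!!x. x \<in> carrier (FF C) ==> T (T' x) = x"
  and Tc: "!!c. T (cls C (%_. c)) = cls C (%_. c)"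
 obtains sg where "sg \<in> automorphisms C" "!!h. ratl C h ==> T (cls C h) = cls C (%R. h (sg R))"
proof -
 interpret FFC: field "FF C" by (rule field_FF[OF irrC])
 have Tc': "T' (cls C (%_. c)) = cls C (%_. c)" for c
  using TT'(1)[of "cls C (%_. c)"] Tc cls_in_carrier[OF irrC ratl_const[OF irrC]] by metis
 have z: "T \<zero>\<^bsub>FF C\<^esub> = \<zero>\<^bsub>FF C\<^esub>" "T' \<zero>\<^bsub>FF C\<^esub> = \<zero>\<^bsub>FF C\<^esub>" unfolding FF_zero[OF irrC] by (rule Tc Tc')+
 obtain sg where s: "morphism C C sg" "dominant C C sg" "!!h. ratl C h ==> T (cls C h) = cls C (%R. h (sg R))"
  by (rule induced_map[OF closed T(1) Tc]) (use TT'(1) z in metis)+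
 obtain rh where r: "morphism C C rh" "dominant C C rh" "!!h. ratl C h ==> T' (cls C h) = cls C (%R. h (rh R))"
  by (rule induced_map[OF closed T(2) Tc']) (use TT'(2) z in metis)+
 obtain P0 where P0: "P0 \<in> C" using irrC unfolding irr_def by blast
 obtain j0 :: 'n where j0: "peval (coordv j0) P0 ~= 0" using ex_var_nonzero by blast
 have gj: "aeg C (%R. R \<in> C & peval (coordv j0) R ~= 0)" by (rule gen_basic[OF irrC homogeneous_coordv P0 j0])
 have inverse: "\<alpha> (\<beta> P) = P" if a: "morphism C C \<alpha>" "dominant C C \<alpha>" and b: "morphism C C \<beta>" "dominant C C \<beta>"
  and ab: "!!h. ratl C h ==> cls C (%R. h (\<alpha> (\<beta> R))) = cls C h" and P: "P \<in> C" for \<alpha> \<beta> P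
 proof -
  have inC: "\<beta> R \<in> C" if "R \<in> C" for R using b(1) that unfolding morphism_def by blast
  have m: "mor_at C R (%R. \<alpha> (\<beta> R)) (\<alpha> (\<beta> R))" if "R \<in> C" for R
   by (rule mor_at_comp[OF irrC that irrC inC[OF that] morphism_mor_at[OF irrC b(1) that] b(2) morphism_mor_at[OF irrC a(1) inC[OF that]]])
  let ?x = "%j R. peval (coordv j) R / peval (coordv j0) R"
  have rx: "ratl C (?x j)" for j by (rule ratl_form[OF irrC homogeneous_coordv homogeneous_coordv])
  have rxab: "ratl C (%R. ?x j (\<alpha> (\<beta> R)))" for j
   by (rule morphism_ratl_pull[OF irrC irrC b morphism_ratl_pull[OF irrC irrC a rx]])
  have "aeg C (%R. \<forall>j\<in>UNIV. ?x j (\<alpha> (\<beta> R)) = ?x j R)"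
  proof (intro eventually_ball_finite ballI)
   show "aeg C (%R. ?x j (\<alpha> (\<beta> R)) = ?x j R)" for j
   using ab[OF rx[of j]] cls_eq_iff[OF irrC rxab rx] by blast
  qed simp
  then have "aeg C (%R. \<alpha> (\<beta> R) = R)"
   using gj dominantD[OF b(2) dominantD[OF a(2) gj]]
  proof eventually_elim
   case (elim R)
   have v: "(1 / peval (coordv j0) S) *s rep_proj S = (\<chi> j. ?x j S)" for S by (simp add: vec_eq_iff peval_def)
   have "abs_proj (\<chi> j. ?x j S) = S" if "peval (coordv j0) S ~= 0" for S
   unfolding v[symmetric] using abs_proj_scale[OF _ rep_proj_nonzero, of "1 / peval (coordv j0) S" S] that by simp
   moreover have "(\<chi> j. ?x j (\<alpha> (\<beta> R))) = (\<chi> j. ?x j R)" using elim(1) by simp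
   ultimately show ?case using elim(2,3) by metis
  qed
  from mor_at_unique[OF irrC P m[OF P] mor_at_self this] show ?thesis .
 qed
 have sr: "sg (rh P) = P" if "P \<in> C" for P
 proof (rule inverse[OF s(1,2) r(1,2) _ that])
  fix h assume h: "ratl C h"
  have "T' (T (cls C h)) = cls C (%R. h (sg (rh R)))"
   unfolding s(3)[OF h] by (rule r(3)[OF morphism_ratl_pull[OF irrC irrC s(1,2) h]])
  then show "cls C (%R. h (sg (rh R))) = cls C h" using TT'(1)[OF cls_in_carrier[OF irrC h]] by simp
 qed
 have rs: "rh (sg P) = P" if "P \<in> C" for P
 proof (rule inverse[OF r(1,2) s(1,2) _ that])
  fix h assume h: "ratl C h"
  have "T (T' (cls C h)) = cls C (%R. h (rh (sg R)))"
   unfolding r(3)[OF h] by (rule s(3)[OF morphism_ratl_pull[OF irrC irrC r(1,2) h]])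
  then show "cls C (%R. h (rh (sg R))) = cls C h" using TT'(2)[OF cls_in_carrier[OF irrC h]] by simp
 qed
 have im: "sg ` C \<subseteq> C" "rh ` C \<subseteq> C" using s(1) r(1) unfolding morphism_def by blast+
 \<comment> \<open>Elements of \<open>automorphisms\<close> are extensional, so the map is cut down
   to \<open>C\<close>.\<close>
 let ?s = "restrict sg C"
 have bij: "bij_betw ?s C C"
  by (rule bij_betwI[where g = rh]) (use im sr rs in auto)
 have inv: "inv_into C ?s P = rh P" if "P \<in> C" for P
  by (rule inv_into_f_eq) (use bij im that sr in \<open>auto simp: bij_betw_def\<close>)
 have "morphism C C ?s" by (rule morphismI[OF irrC, of sg]) (use im morphism_mor_at[OF irrC s(1)] in auto)
 moreover have "morphism C C (restrict (inv_into C ?s) C)"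
  by (rule morphismI[OF irrC, of rh]) (use im inv morphism_mor_at[OF irrC r(1)] in auto)
 ultimately have "?s \<in> automorphisms C" using bij unfolding automorphisms_def Bij_def by simp
 moreover have "T (cls C h) = cls C (%R. h (?s R))" if "ratl C h" for h
  unfolding s(3)[OF that] by (rule cls_cong) (use gen_in[OF irrC] in eventually_elim, simp)
 ultimately show ?thesis using that by blast
qed

end

section \<open>Projection from an outer Galois point\<close>

text \<open>A third row that is nonzero on \<open>rep_proj P\<close> completes \<open>Mx P\<close>
  to an invertible matrix.\<close>

lemma Mx_surj:
 fixes b :: "'k::field ^ 2"
 obtains x where "Mx P *v x = b"
proof -
 obtain k where k: "rep_proj P $ k ~= 0" using rep_proj_nonzero[of P] by (auto simp: vec_eq_iff)
 define T :: "'k ^ 3 ^ 3" where "T = (\<chi> i. if i = 1 then Mx P $ 1 else if i = 2 then Mx P $ 2 else axis k 1)"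
 have T12: "(T *v x) $ 1 = (Mx P *v x) $ 1" "(T *v x) $ 2 = (Mx P *v x) $ 2" for x
  by (simp_all add: T_def matrix_vector_mult_def)
 have T3: "(T *v x) $ 3 = x $ k" for x
  by (simp add: T_def matrix_vector_mult_def axis_def if_distrib[of "%c. c * _"] sum.delta cong: if_cong)
 have z: "x = 0" if "T *v x = 0" for x
 proof (rule ccontr)
  assume x: "x ~= 0"
  have "Mx P *v x = 0" using that T12[of x] by (simp add: vec_eq_iff forall_2)
  then have "abs_proj x = P" using x Mx_ker by blast
  then have "abs_proj (rep_proj P) = abs_proj x" by simp
  then obtain c where "x = c *s rep_proj P" "c ~= 0"
   using abs_proj_eq_iff[OF rep_proj_nonzero x] unfolding proportional_def by blast
  moreover have "x $ k = 0" using T3[of x] that by simp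
  ultimately show False using k by simp
 qed
 have "inj ((*v) T)"
 proof (rule injI)
  fix x y assume "T *v x = T *v y"
  then have "T *v (x - y) = 0" by (simp add: matrix_vector_mult_diff_distrib)
  then show "x = y" using z by (metis right_minus_eq)
 qed
 then obtain T' where "T' ** T = mat 1" using matrix_left_invertible_injective by blast
 then have T': "T ** T' = mat 1" using matrix_left_right_inverse by blast
 let ?w = "vector [b $ 1, b $ 2, 0] :: 'k ^ 3"
 have "T *v (T' *v ?w) = ?w" unfolding matrix_vector_mul_assoc T' by simp
 then have "Mx P *v (T' *v ?w) = b" using T12[of "T' *v ?w"] by (simp add: vec_eq_iff forall_2)
 then show ?thesis by (rule that)
qed

lemma pr_abs:
 assumes "Mx P *v v ~= 0" shows "pr P (abs_proj v) = abs_proj (Mx P *v v)"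
proof -
 have v: "v ~= 0" using assms by (auto simp: matrix_vector_mult_0_right)
 obtain c where "c ~= 0" "rep_proj (abs_proj v) = c *s v" by (rule rep_abs_proj[OF v])
 then show ?thesis using assms by (simp add: pr_def vector_scalar_commute abs_proj_scale)
qed

text \<open>If the restriction to the line has no root, it is a constant \<open>c\<close>. By
  homogeneity \<open>F (p + s x)\<close> equals \<open>c s^n\<close> for all nonzero
  \<open>s\<close>, hence as a polynomial, and \<open>s = 0\<close> contradicts the value at
  \<open>p\<close>.\<close>

lemma form_root_on_line:
 fixes F :: "('k::alg_closed_field, 'n::finite) mpoly"
 assumes F: "hmg n F" "0 < n" and p: "evm F p ~= 0"
 obtains t where "evm F (x + t *s p) = 0"
proof -
 let ?f = "psubst F (%j. [:x $ j, p $ j:])" and ?g = "psubst F (%j. [:p $ j, x $ j:])"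
 have f: "poly ?f t = evm F (x + t *s p)" for t
  unfolding poly_psubst by (rule arg_cong[where f = "evm F"]) (simp add: vec_eq_iff)
 have g: "poly ?g t = evm F (p + t *s x)" for t
  unfolding poly_psubst by (rule arg_cong[where f = "evm F"]) (simp add: vec_eq_iff)
 have "EX t. poly ?f t = 0"
 proof (cases "Polynomial.degree ?f > 0")
  case True then show ?thesis by (rule alg_closed_imp_poly_has_root)
 next
  case False
  then obtain c where c: "?f = [:c:]" using degree_eq_zeroE by blast
  have gc: "poly ?g s = c * s ^ n" if s: "s ~= 0" for s
  proof -
   have "p + s *s x = s *s (x + inverse s *s p)" using s by (simp add: vec_eq_iff distrib_left mult.assoc[symmetric])
   then have "poly ?g s = s ^ n * poly ?f (inverse s)" unfolding g f by (simp add: eval_mpoly_scale[OF F(1)])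
   then show ?thesis by (simp add: c)
  qed
  let ?d = "?g - Polynomial.smult c ([:0, 1:] ^ n)"
  have "?d = 0"
  proof (rule ccontr)
   assume d: "?d ~= 0"
   have "- {0} \<subseteq> {s. poly ?d s = 0}" using gc by (auto simp: poly_power)
   then have "finite (- {0 :: 'k})" using poly_roots_finite[OF d] finite_subset by blast
   then have "finite (UNIV :: 'k set)" by (metis Compl_eq_Diff_UNIV finite.emptyI finite_Diff2 finite_insert)
   then show False using infinite_alg_closed by blast
  qed
  then have "poly ?d 0 = 0" by simp
  then have "poly ?g 0 = 0" using F(2) by (simp add: poly_power)
  then show ?thesis using p unfolding g by simp
 qed
 then obtain t where "poly ?f t = 0" ..
 then show ?thesis using that f by metis
qed

text \<open>Reads a coefficient list of \<open>HOL-Algebra\<close>, leading coefficient in front, as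
  a polynomial of the type-based library.\<close>

fun hpoly :: "'a::comm_ring_1 list => 'a poly" where
 "hpoly [] = 0"
| "hpoly (a # as) = monom a (length as) + hpoly as"

lemma coeff_hpoly: "length as \<le> j ==> coeff (hpoly as) j = 0"
 by (induction as) auto

lemma hpoly_nonzero: "a ~= 0 ==> hpoly (a # as) ~= 0"
proof
 assume "a ~= 0" "hpoly (a # as) = 0"
 then have "coeff (hpoly (a # as)) (length as) = 0" by simp
 then show False using \<open>a ~= 0\<close> by (simp add: coeff_hpoly)
qed

lemma poly_hpoly: "poly (poly (hpoly as) [:y:]) x = horner_list (map (%a _. poly a x) as) (%_. y) z"
 by (induction as) (simp_all add: poly_monom)

lemma horner_list_scale:
 "length fs = length as ==> (!!i. i < length as ==> (gs ! i) R = c * (fs ! i) S) ==> length gs = length as ==> x R = y S ==>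
  horner_list gs x R = c * horner_list fs y S"
proof (induction as arbitrary: fs gs)
 case (Cons a as)
 obtain f fs' g gs' where l: "fs = f # fs'" "gs = g # gs'" using Cons.prems(1,3) by (metis length_Suc_conv)
 have "g R = c * f S" using Cons.prems(2)[of 0] l by simp
 moreover have "horner_list gs' x R = c * horner_list fs' y S"
 proof (rule Cons.IH)
  show "(gs' ! i) R = c * (fs' ! i) S" if "i < length as" for i using Cons.prems(2)[of "Suc i"] that l by simp
 qed (use Cons.prems l in auto)
 ultimately show ?case using Cons.prems(1,3,4) l by (simp add: distrib_left mult.assoc)
qed simp

text \<open>The situation of a given outer Galois point. The equation \<open>F\<close> makes every
  line through \<open>P\<close> meet the curve; that the fibres of the projection are the orbits of
  \<open>G\<close> is not assumed and is the goal of the locale.\<close>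

locale plane_outer = plane_map C ph
 for C :: "('k::alg_closed_field, 'n::finite) proj set" and ph +
 fixes F :: "('k, 3) mpoly" and n :: nat and P :: "('k, 3) proj" and G
 assumes closedC: "closedin zariski C" and uexC: "!!R. R \<in> C ==> EX t. unif C R t"
  and F: "hmg n F" "0 < n" and image: "ph ` C = zero_locus {F}"
  and outer: "P \<notin> ph ` C" and galext: "galois_extension (FF (ph ` C)) (projection_field (ph ` C) P)"
  and grp: "aut_group C G" and gal: "galois_group_at C ph P = G"
begin

abbreviation Y where "Y \<equiv> ph ` C"
abbreviation q where "q \<equiv> %R. pr P (ph R)"
abbreviation K0 where "K0 \<equiv> projection_field Y P"

lemma point_on_line:
 assumes M: "Mx P *v x ~= 0"
 obtains R t where "R \<in> C" "ph R = abs_proj (x + t *s rep_proj P)" "Mx P *v (x + t *s rep_proj P) = Mx P *v x"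
proof -
 have "peval F P ~= 0" using outer unfolding image zero_locus_def by simp
 then obtain t where t: "evm F (x + t *s rep_proj P) = 0"
  unfolding peval_def by (rule form_root_on_line[OF F])
 have "Mx P *v rep_proj P = 0" unfolding Mx_ker by simp
 then have Mt: "Mx P *v (x + t *s rep_proj P) = Mx P *v x"
  by (simp add: matrix_vector_right_distrib vector_scalar_commute)
 then have "x + t *s rep_proj P ~= 0" using M by (metis matrix_vector_mult_0_right)
 then have "abs_proj (x + t *s rep_proj P) \<in> zero_locus {F}"
  using t by (simp add: zero_locus_def peval_abs_eq_0_iff[OF F(1)])
 then obtain R where "R \<in> C" "ph R = abs_proj (x + t *s rep_proj P)" unfolding image[symmetric] by auto
 then show ?thesis using that Mt by blast
qed

lemma surj: "q ` C = UNIV"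
proof (intro subset_antisym subsetI UNIV_I)
 fix y
 obtain x where x: "Mx P *v x = rep_proj y" by (rule Mx_surj)
 then obtain R t where R: "R \<in> C" "ph R = abs_proj (x + t *s rep_proj P)" "Mx P *v (x + t *s rep_proj P) = Mx P *v x"
  using point_on_line[of x] rep_proj_nonzero by metis
 have "q R = y" unfolding R(2) using pr_abs[of P "x + t *s rep_proj P"] R(3) x rep_proj_nonzero[of y] by simp
 then show "y \<in> q ` C" using R(1) by blast
qed

lemmas q_dominant = proj_dominant[OF outer surj]
lemmas K0_eq = projection_field_eq(1)[OF outer surj]
lemmas K0_ratl = projection_field_eq(2)[OF outer surj]
lemmas q_pull = morphism_reg_pull[OF irrC proj_morphism[OF outer] q_dominant(1)]

text \<open>A Galois extension is algebraic, so every function satisfies a polynomial with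
  coefficients pulled back from the line. A common denominator makes these polynomials in
  \<open>sp y\<close>.\<close>

lemma relation:
 assumes h: "ratl C h"
 shows "EX A. A ~= 0 & (\<forall>\<^sub>F R in gen C. poly (poly A [:h R:]) (sp y (q R)) = 0)"
proof -
 interpret field "FF Y" by (rule field_FF[OF irrY])
 obtain g where g: "ratl Y g" "aeg C (%R. h R = g (ph R))" using phi_surj_ratl[OF h] by blast
 have K: "subfield K0 (FF Y)" and "\<not> (ring.transcendental (FF Y) over K0) (cls Y g)"
  using galext cls_in_carrier[OF irrY g(1)] unfolding galois_extension_def by blast+
 then have alg: "(algebraic over K0) (cls Y g)" by (simp add: over_def)
 from algebraicE[OF subfieldE(1)[OF K] cls_in_carrier[OF irrY g(1)] alg]
 obtain p where p: "p \<in> carrier (K0[X]\<^bsub>FF Y\<^esub>)" "p ~= []" "eval p (cls Y g) = \<zero>\<^bsub>FF Y\<^esub>" by blast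
 then have pK: "set p \<subseteq> K0" "hd p ~= \<zero>\<^bsub>FF Y\<^esub>"
  unfolding univ_poly_carrier[symmetric] polynomial_def by auto
 have "\<forall>c\<in>K0. EX f. ratl PL f & c = cls Y (%R. f (pr P R))" unfolding K0_eq by blast
 then obtain r where r: "!!c. c \<in> K0 ==> ratl PL (r c) & c = cls Y (%R. r c (pr P R))" by metis
 have rr: "ratl PL (r c)" if "c \<in> set p" for c using r pK(1) that by blast
 obtain a b where ab: "b ~= 0" "!!c. c \<in> set p ==> \<forall>\<^sub>F R in gen PL. r c R = poly (a c) (sp y R) / poly b (sp y R)"
  by (rule common_denominator[OF finite_set rr, where y = y]) blast+
 let ?gs = "map (%c R. r c (pr P R)) p"
 have rg: "\<forall>g\<in>set ?gs. ratl Y g" using K0_ratl rr by auto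
 note ev = FF_eval[OF irrY g(1) rg]
 have "map (cls Y) ?gs = p" unfolding map_map by (rule map_idI) (use r pK(1) in auto)
 then have "cls Y (horner_list ?gs g) = \<zero>\<^bsub>FF Y\<^esub>" using conjunct2[OF ev] p(3) by simp
 then have "aeg Y (%R. horner_list ?gs g R = 0)" unfolding cls_eq_zero_iff[OF irrY conjunct1[OF ev]] .
 from dominantD[OF dphi this] have h0: "aeg C (%R. horner_list ?gs g (ph R) = 0)" .
 have "aeg C (%R. \<forall>c\<in>set p. r c (q R) = poly (a c) (sp y (q R)) / poly b (sp y (q R)))"
  by (intro eventually_ball_finite ballI dominantD[OF q_dominant(1) ab(2)]) auto
 then have "aeg C (%R. poly (poly (hpoly (map a p)) [:h R:]) (sp y (q R)) = 0)"
  using h0 g(2) dominantD[OF q_dominant(1) ae_poly_sp[OF ab(1), of y]]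
 proof eventually_elim
  case (elim R)
  let ?s = "sp y (q R)"
  have "horner_list (map (%a _. poly a ?s) (map a p)) (%_. h R) R = poly b ?s * horner_list ?gs g (ph R)"
  proof (rule horner_list_scale[where as = p])
   fix i assume i: "i < length p"
   then have "p ! i \<in> set p" by simp
   then show "(map (%a _. poly a ?s) (map a p) ! i) R = poly b ?s * (?gs ! i) (ph R)"
   using elim(1,4) i by simp
  qed (use elim(3) in auto)
  then show ?case unfolding poly_hpoly[where z = R] elim(2) by simp
 qed
 moreover have "hpoly (map a p) ~= 0"
 proof -
  obtain c cs where c: "p = c # cs" using p(2) by (cases p) auto
  have "a c ~= 0"
  proof
   assume "a c = 0"
   then have "aeg PL (%R. r c R = 0)" using ab(2)[of c] c by simp
   from dominantD[OF q_dominant(2) this] have "cls Y (%R. r c (pr P R)) = cls Y (%_. 0)" by (rule cls_cong)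
   then have "c = \<zero>\<^bsub>FF Y\<^esub>" using r[of c] pK(1) c by (simp add: FF_zero[OF irrY])
   then show False using pK(2) c by simp
  qed
  then show ?thesis unfolding c by (simp add: hpoly_nonzero del: hpoly.simps)
 qed
 ultimately show ?thesis by blast
qed

sublocale cov: cover C q
 by unfold_locales (use irrC uexC q_pull q_dominant(1) relation in auto)

abbreviation Ph where "Ph \<equiv> pullback C (Some \<circ> ph)"

text \<open>An automorphism of the function field of the image transfers to that of \<open>C\<close>
  and is there induced by an automorphism of the smooth curve, which lies in \<open>G\<close> by the
  definition of \<open>galois_group_at\<close>. So \<open>G\<close> accounts for the whole Galois
  group.\<close>

lemma galois_automorphism:
 assumes t: "ta \<in> galois_group (FF Y) K0"
 obtains sg where "sg \<in> G" "!!g. ratl Y g ==> Ph (ta (cls Y g)) = cls C (%R. g (ph (sg R)))"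
proof -
 interpret FY: field "FF Y" by (rule field_FF[OF irrY])
 interpret FC: field "FF C" by (rule field_FF[OF irrC])
 let ?Ps = "inv_into (carrier (FF Y)) Ph" and ?ta' = "inv_into (carrier (FF Y)) ta"
 have ti: "ta \<in> ring_iso (FF Y) (FF Y)" and tK: "!!x. x \<in> K0 ==> ta x = x"
  using t unfolding galois_group_def by auto
 have bP: "bij_betw Ph (carrier (FF Y)) (carrier (FF C))" and bt: "bij_betw ta (carrier (FF Y)) (carrier (FF Y))"
  using Phi_iso ti unfolding ring_iso_def by auto
 have Pi: "?Ps \<in> ring_iso (FF C) (FF Y)" by (rule ring_iso_set_sym[OF FY.ring_axioms Phi_iso])
 have ti': "?ta' \<in> ring_iso (FF Y) (FF Y)" by (rule ring_iso_set_sym[OF FY.ring_axioms ti])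
 define T where "T = Ph \<circ> (ta \<circ> ?Ps)"
 define T' where "T' = Ph \<circ> (?ta' \<circ> ?Ps)"
 have T: "T \<in> ring_hom (FF C) (FF C)" "T' \<in> ring_hom (FF C) (FF C)"
  using ring_iso_set_trans[OF ring_iso_set_trans[OF Pi ti] Phi_iso] ring_iso_set_trans[OF ring_iso_set_trans[OF Pi ti'] Phi_iso]
  unfolding T_def T'_def ring_iso_def by auto
 have PP: "?Ps (Ph x) = x" if "x \<in> carrier (FF Y)" for x using bP that by (simp add: bij_betw_inv_into_left)
 have PP': "Ph (?Ps x) = x" "?Ps x \<in> carrier (FF Y)" if "x \<in> carrier (FF C)" for x
  using bP that by (simp_all add: bij_betw_inv_into_right bij_betwE[OF bij_betw_inv_into])
 have tt: "?ta' (ta x) = x" "ta (?ta' x) = x" "ta x \<in> carrier (FF Y)" "?ta' x \<in> carrier (FF Y)" if "x \<in> carrier (FF Y)" for x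
  using bt that by (simp_all add: bij_betw_inv_into_left bij_betw_inv_into_right bij_betwE[OF bij_betw_inv_into] bij_betwE)
 have Tg: "T (cls C (%R. g (ph R))) = Ph (ta (cls Y g))" if "ratl Y g" for g
  unfolding T_def using PP[OF cls_in_carrier[OF irrY that]] by (simp add: Phi_cls[OF that])
 have Tc: "T (cls C (%_. c)) = cls C (%_. c)" for c
  using Tg[OF ratl_const[OF irrY], of c] Phi_cls[OF ratl_const[OF irrY], of c] tK[OF projection_field_const[OF outer surj, of c]] by simp
 obtain sg where s: "sg \<in> automorphisms C" "!!h. ratl C h ==> T (cls C h) = cls C (%R. h (sg R))"
 proof (rule cov.induced_automorphism[OF closedC T _ _ Tc])
  show "T' (T x) = x" "T (T' x) = x" if "x \<in> carrier (FF C)" for x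
   unfolding T_def T'_def using that by (simp_all add: PP PP' tt)
 qed blast
 have st: "Ph (ta (cls Y g)) = cls C (%R. g (ph (sg R)))" if g: "ratl Y g" for g
  unfolding Tg[OF g, symmetric] by (rule s(2)[OF ratl_phi[OF g]])
 have "sg \<in> galois_group_at C ph P" unfolding galois_group_at_def
 proof (intro CollectI conjI s(1) bexI[OF _ t] ballI)
  fix f assume "f \<in> rational_funs Y"
  then have "f \<in> carrier (FF Y)" by (simp add: function_field_def)
  then obtain g where g: "ratl Y g" "f = cls Y g" by (rule FF_cases[OF irrY])
  note S = automorphism_simps[OF irrC s(1)]
  have "pullback C (Some \<circ> sg) (cls C (%R. g (ph R))) = cls C (%R. g (ph (sg R)))"
   by (rule pullback_cls[OF irrC irrC morphism_reg_pull[OF irrC S(2,5)] S(5) ratl_phi[OF g(1)]]) simp_all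
  then show "pullback C (Some \<circ> sg) (Ph f) = Ph (ta f)" unfolding g(2) Phi_cls[OF g(1)] st[OF g(1)] .
 qed
 then have "sg \<in> G" unfolding gal .
 then show ?thesis using st that by blast
qed

lemma q_inv: "sg \<in> G ==> R \<in> C ==> q (sg R) = q R"
 using induced_fixes_projection[OF outer surj] gal by blast

text \<open>Invariance under \<open>G\<close> is invariance under the Galois group, whose fixed
  field consists of the functions of the line.\<close>

lemma descend:
 assumes h: "ratl C h" and inv: "!!sg. sg \<in> G ==> \<forall>\<^sub>F R in gen C. h (sg R) = h R"
 shows "EX f. ratl PL f & (\<forall>\<^sub>F R in gen C. f (q R) = h R)"
proof -
 interpret aut_group C G by (rule grp)
 obtain g where g: "ratl Y g" "aeg C (%R. h R = g (ph R))" using phi_surj_ratl[OF h] by blast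
 have gY: "cls Y g \<in> carrier (FF Y)" by (rule cls_in_carrier[OF irrY g(1)])
 have "ta (cls Y g) = cls Y g" if t: "ta \<in> galois_group (FF Y) K0" for ta
 proof -
  obtain sg where s: "sg \<in> G" "!!g. ratl Y g ==> Ph (ta (cls Y g)) = cls C (%R. g (ph (sg R)))"
   by (rule galois_automorphism[OF t]) blast
  have "aeg C (%R. g (ph (sg R)) = g (ph R))"
   using inv[OF s(1)] g(2) dominantD[OF domi[OF s(1)] g(2)] by eventually_elim simp
  from cls_cong[OF this] have e: "Ph (ta (cls Y g)) = Ph (cls Y g)" using s(2)[OF g(1)] Phi_cls[OF g(1)] by simp
  have "bij_betw ta (carrier (FF Y)) (carrier (FF Y))" using t unfolding galois_group_def ring_iso_def by blast
  then have tY: "ta (cls Y g) \<in> carrier (FF Y)" using gY by (rule bij_betw_apply)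
  have "inj_on Ph (carrier (FF Y))" using Phi_iso unfolding ring_iso_def bij_betw_def by blast
  from inj_onD[OF this e tY gY] show ?thesis .
 qed
 then have "cls Y g \<in> K0" using galext gY unfolding galois_extension_def by blast
 then obtain f where f: "ratl PL f" "cls Y g = cls Y (%R. f (pr P R))" unfolding K0_eq by blast
 then have "aeg Y (%R. g R = f (pr P R))" using cls_eq_iff[OF irrY g(1) K0_ratl[OF f(1)]] by blast
 from dominantD[OF dphi this] g(2) have "aeg C (%R. f (q R) = h R)" by eventually_elim simp
 with f(1) show ?thesis by blast
qed

text \<open>If \<open>R\<close> were not in the orbit of \<open>S\<close>, the norm of a function vanishing at \<open>R\<close> but not on the
 orbit of \<open>S\<close> would come from a function on the line with two values at \<open>q R = q S\<close>.\<close>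

lemma fibres:
 assumes S: "S \<in> C" and R: "R \<in> C" and e: "q S = q R" shows "\<exists>sg\<in>G. R = sg S"
proof (rule ccontr)
 assume no: "\<not> ?thesis"
 interpret aut_group C G by (rule grp)
 let ?O = "(%sg. sg S) ` G" and ?O' = "(%sg. sg R) ` G"
 have RO: "R \<notin> ?O" using no by blast
 have fO: "finite ?O" "finite (?O \<union> ?O')" using fin by auto
 obtain a where a: "peval (lin a) R = 0" "!!s. s \<in> ?O ==> peval (lin a) s ~= 0" using form_through_avoiding[OF fO(1) RO] by blast
 obtain l where l: "!!s. s \<in> ?O \<union> ?O' ==> peval (lin l) s ~= 0" using form_avoiding[OF fO(2)] by blast
 let ?h = "%R. peval (lin a) R / peval (lin l) R" and ?N = "%R. \<Prod>sg\<in>G. peval (lin a) (sg R) / peval (lin l) (sg R)"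
 have rh: "reg C T ?h (?h T)" if "T \<in> ?O \<union> ?O'" for T
  by (rule reg_form[OF homogeneous_lin homogeneous_lin l[OF that]])
 have rN: "reg C T ?N (?N T)" if T: "T \<in> {S, R}" for T
 proof -
  have TC: "T \<in> C" using T S R by blast
  have "reg C T (%R. ?h (sg R)) (?h (sg T))" if s: "sg \<in> G" for sg
   by (rule reg_trans[OF s TC rh]) (use T s in auto)
  then show ?thesis by (rule reg_prod[OF irrC TC])
 qed
 have ratN: "ratl C ?N" using reg_imp_ratl[OF rN S] by blast
 have NR: "?N R = 0" using fin one a(1) R by (intro prod_zero bexI[of _ "\<lambda>x\<in>C. x"]) auto
 have "peval (lin a) (sg S) / peval (lin l) (sg S) ~= 0" if "sg \<in> G" for sg using a(2) l that by simp
 then have NS: "?N S ~= 0" by (simp only: prod_zero_iff[OF fin] bex_simps simp_thms) blast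
 have "EX f. ratl PL f & (\<forall>\<^sub>F R in gen C. f (q R) = ?N R)"
 proof (rule descend[OF ratN])
  fix ta assume t: "ta \<in> G"
  show "aeg C (%R. ?N (ta R) = ?N R)"
   using gen_in[OF irrC] by eventually_elim (rule prod_translate[OF t])
 qed
 then obtain f where "ratl PL f & (\<forall>\<^sub>F R in gen C. f (q R) = ?N R)" ..
 note f = this[THEN conjunct1] this[THEN conjunct2]
 have "reg PL (q T) f (?N T)" if T: "T \<in> {S, R}" for T
  by (rule cov.reg_q_converse[OF _ f(1) reg_cong[OF rN[OF T] f(2)]]) (use T S R in auto)
 from this[of R] have 1: "reg PL (q S) f (?N R)" unfolding e by simp
 have 2: "reg PL (q S) f (?N S)" by (rule \<open>!!T. T \<in> {S, R} ==> reg PL (q T) f (?N T)\<close>) simp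
 have "?N S = ?N R" by (rule reg_unique[OF irr_PL UNIV_I 2 1])
 then show False using NR NS by simp
qed

lemma gal_cover: "gal_cover C G q"
proof -
 interpret aut_group C G by (rule grp)
 show ?thesis
 proof
  show "q S = q R \<longleftrightarrow> (\<exists>sg\<in>G. R = sg S)" if "S \<in> C" "R \<in> C" for S R
   using fibres[OF that] q_inv[OF _ that(1)] by metis
 qed (use uexC surj q_pull q_dominant(1) descend in auto)
qed

end

section \<open>Ramification indices\<close>

context curve
begin

lemma ordge_step:
 assumes P: "P \<in> C" and f: "ratl C f" and r: "reg C P (%R. tt P R powi (- m) * f R) 0"
 shows "ordge P f (m + 1)"
proof -
 have "ordge P f m" unfolding ordge_def using r by blast
 then consider "aeg C (%R. f R = 0)" | n where "m \<le> n" "hord P f n"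
  unfolding ordge_iff[OF P f] by blast
 then show ?thesis
 proof cases
  case 1 then show ?thesis by (rule ordge_zero_fun)
 next
  case 2
  have "hord P (%R. tt P R powi (- m) * f R) (- m + n)" by (rule hord_mult[OF P hord_tt_powi[OF P] 2(2)])
  from hord_reg(2)[OF P this r] have "m + 1 \<le> n" by simp
  then show ?thesis unfolding ordge_hord[OF P 2(2)] .
 qed
qed

text \<open>Compare leading coefficients at \<open>P0\<close>: subtracting multiples of one function
  with a nonzero coefficient raises the order of all others. If all coefficients are zero, the
  orders already are high enough and every \<open>b i\<close> is 0.\<close>

lemma elimination_step:
 assumes fin: "finite I" and f: "!!i. i \<in> I ==> ratl C (f i)" and S: "P0 \<in> C"
  and o: "!!i. i \<in> I ==> ordge P0 (f i) m"
 shows "EX i0 b. (\<forall>i\<in>I - {i0}. ordge P0 (%R. f i R - b i * f i0 R) (m + 1)) & (i0 \<in> I \<or> (ALL i. b i = 0))"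
proof -
 have "\<forall>i\<in>I. EX a. reg C P0 (%R. tt P0 R powi (- m) * f i R) a" using o unfolding ordge_def by blast
 then obtain a where a: "!!i. i \<in> I ==> reg C P0 (%R. tt P0 R powi (- m) * f i R) (a i)" by metis
 have key: "ordge P0 (%R. f i R - b * f j R) (m + 1)" if i: "i \<in> I" "j \<in> I" and b: "a i = b * a j" for i j b
 proof (rule ordge_step[OF S])
  show "ratl C (%R. f i R - b * f j R)"
   by (intro ratl_diff ratl_mult[OF _ ratl_const] irrC f i)
  have "reg C P0 (%R. tt P0 R powi (- m) * f i R - b * (tt P0 R powi (- m) * f j R)) (a i - b * a j)"
   by (intro reg_diff reg_cmult irrC S a i)
  then show "reg C P0 (%R. tt P0 R powi (- m) * (f i R - b * f j R)) 0"
   by (simp add: b right_diff_distrib mult.left_commute)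
 qed
 show ?thesis
 proof (cases "\<exists>i\<in>I. a i ~= 0")
  case True
  then obtain i0 where i0: "i0 \<in> I" "a i0 ~= 0" by blast
  have "ordge P0 (%R. f i R - a i / a i0 * f i0 R) (m + 1)" if "i \<in> I - {i0}" for i
   by (rule key) (use that i0 in auto)
  then show ?thesis using i0(1) by (intro exI[of _ i0] exI[of _ "%i. a i / a i0"]) blast
 next
  case False
  have "ordge P0 (%R. f i R - 0 * f j R) (m + 1)" if "i \<in> I" for i j
   using key[OF that that, of 0] False that by simp
  then show ?thesis by (intro exI[of _ undefined] exI[of _ "%_. 0"]) simp
 qed
qed

text \<open>Raising the required order by one at one point costs at most one function. More
  functions than units to be gained therefore leave a nontrivial combination; the induction is on
  the number of missing units.\<close>

lemma elimination:
 assumes "finite I" and "!!i. i \<in> I ==> ratl C (f i)" and S: "finite S" "S \<subseteq> C"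
  and "!!i P. i \<in> I ==> P \<in> S ==> ordge P (f i) (m P)" and "!!P. P \<in> S ==> m P \<le> c P"
  and "(\<Sum>P\<in>S. nat (c P - m P)) < card I"
 shows "EX a. (\<exists>i\<in>I. a i ~= 0) & (\<forall>P\<in>S. ordge P (%R. \<Sum>i\<in>I. a i * f i R) (c P))"
 using assms(1,2,5,6,7)
proof (induction "\<Sum>P\<in>S. nat (c P - m P)" arbitrary: I f m)
 case 0
 then have "I ~= {}" by auto
 then obtain i where i: "i \<in> I" by blast
 have z: "nat (c P - m P) = 0" if "P \<in> S" for P using 0(1) S(1) that by (simp add: sum_eq_0_iff)
 have "ordge P (%R. \<Sum>k\<in>I. (if k = i then 1 else 0) * f k R) (c P)" if P: "P \<in> S" for P
 proof -
  have "m P = c P" using z[OF P] 0(5)[OF P] by simp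
  then have "ordge P (f i) (c P)" using 0(4)[OF i P] by simp
  moreover have "(\<Sum>k\<in>I. (if k = i then 1 else 0) * f k R) = f i R" for R
   using 0(2) i by (simp add: if_distrib[of "%x. x * _"] sum.delta cong: if_cong)
  ultimately show ?thesis by simp
 qed
 then show ?case using i by (intro exI[of _ "%k. if k = i then 1 else 0"]) auto
next
 case (Suc k)
 have "\<exists>P\<in>S. nat (c P - m P) ~= 0"
 proof (rule ccontr)
  assume "\<not> ?thesis"
  then have "(\<Sum>P\<in>S. nat (c P - m P)) = 0" by (intro sum.neutral) blast
  then show False using Suc.hyps(2) by simp
 qed
 then obtain P0 where P0: "P0 \<in> S" "m P0 < c P0" by (auto simp: not_le)
 then have P0C: "P0 \<in> C" using S by blast
 define m' where "m' = m(P0 := m P0 + 1)"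
 have sm: "(\<Sum>P\<in>S. nat (c P - m' P)) = k"
 proof -
  have "(\<Sum>P\<in>S. nat (c P - m P)) = nat (c P0 - m P0) + (\<Sum>P\<in>S - {P0}. nat (c P - m P))"
   by (rule sum.remove[OF S(1) P0(1)])
  moreover have "(\<Sum>P\<in>S. nat (c P - m' P)) = nat (c P0 - m' P0) + (\<Sum>P\<in>S - {P0}. nat (c P - m' P))"
   by (rule sum.remove[OF S(1) P0(1)])
  moreover have "(\<Sum>P\<in>S - {P0}. nat (c P - m' P)) = (\<Sum>P\<in>S - {P0}. nat (c P - m P))"
   by (rule sum.cong) (auto simp: m'_def)
  moreover have "nat (c P0 - m P0) = Suc (nat (c P0 - m' P0))" using P0(2) by (simp add: m'_def)
  ultimately show ?thesis using Suc.hyps(2) by linarith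
 qed
 have "EX i0 b. (\<forall>i\<in>I - {i0}. ordge P0 (%R. f i R - b i * f i0 R) (m P0 + 1)) & (i0 \<in> I \<or> (ALL i. b i = 0))"
  by (rule elimination_step[OF Suc.prems(1) _ P0C]) (auto intro: Suc.prems(2) Suc.prems(3)[OF _ P0(1)])
 then obtain i0 b where "(\<forall>i\<in>I - {i0}. ordge P0 (%R. f i R - b i * f i0 R) (m P0 + 1)) & (i0 \<in> I \<or> (ALL i. b i = 0))"
  by (elim exE)
 note ib = this[THEN conjunct1, rule_format] this[THEN conjunct2]
 let ?g = "%i R. f i R - b i * f i0 R"
 have rg: "ratl C (?g i)" "P \<in> S ==> ordge P (?g i) (m P)" if i: "i \<in> I - {i0}" for i P
 proof -
  have 1: "ratl C (%R. - b i * f i0 R) & (P \<in> S --> ordge P (%R. - b i * f i0 R) (m P))"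
  proof (cases "i0 \<in> I")
   case True
   then show ?thesis using ratl_mult[OF irrC ratl_const[OF irrC] Suc.prems(2)] ordge_cmult[OF _ Suc.prems(3)] S(2) by blast
  next
   case False
   then have "b i = 0" using ib(2) by blast
   then show ?thesis using ratl_const[OF irrC] ordge_0 by simp
  qed
  then show "ratl C (?g i)" using ratl_add[OF irrC, of "f i" "%R. - b i * f i0 R"] Suc.prems(2) i by simp
  show "ordge P (?g i) (m P)" if "P \<in> S"
   using ordge_add[of P "f i" "m P" "%R. - b i * f i0 R"] 1 that Suc.prems(3) i S(2) by auto
 qed
 have "EX a. (\<exists>i\<in>I - {i0}. a i ~= 0) & (\<forall>P\<in>S. ordge P (%R. \<Sum>i\<in>I - {i0}. a i * ?g i R) (c P))"
 proof (rule Suc.hyps(1)[OF sm[symmetric]])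
  show "finite (I - {i0})" using Suc.prems(1) by simp
  show "ratl C (?g i)" if "i \<in> I - {i0}" for i by (rule rg(1)[OF that])
  show "ordge P (?g i) (m' P)" if "i \<in> I - {i0}" "P \<in> S" for i P
   using ib(1)[OF that(1)] rg(2)[OF that] by (simp add: m'_def)
  show "m' P \<le> c P" if "P \<in> S" for P using Suc.prems(4)[OF that] P0(2) by (simp add: m'_def)
  have "card I \<le> Suc (card (I - {i0}))"
   using card_Suc_Diff1[OF Suc.prems(1), of i0] by (cases "i0 \<in> I") simp_all
  then show "(\<Sum>P\<in>S. nat (c P - m' P)) < card (I - {i0})" unfolding sm using Suc.prems(5) Suc.hyps(2) by linarith
 qed
 then obtain a where a: "\<exists>i\<in>I - {i0}. a i ~= 0" "!!P. P \<in> S ==> ordge P (%R. \<Sum>i\<in>I - {i0}. a i * ?g i R) (c P)" by blast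
 define a' where "a' i = (if i = i0 then - (\<Sum>i\<in>I - {i0}. a i * b i) else a i)" for i
 have "(\<Sum>i\<in>I. a' i * f i R) = (\<Sum>i\<in>I - {i0}. a i * ?g i R)" for R
 proof -
  have e: "(\<Sum>i\<in>I - {i0}. a i * ?g i R) = (\<Sum>i\<in>I - {i0}. a i * f i R) - (\<Sum>i\<in>I - {i0}. a i * b i) * f i0 R"
   by (simp add: right_diff_distrib sum_subtractf sum_distrib_right mult.assoc)
  have e': "(\<Sum>i\<in>I - {i0}. a' i * f i R) = (\<Sum>i\<in>I - {i0}. a i * f i R)" by (rule sum.cong) (auto simp: a'_def)
  show ?thesis
  proof (cases "i0 \<in> I")
   case True
   show ?thesis unfolding sum.remove[OF Suc.prems(1) True, of "%i. a' i * f i R"] e e' by (simp add: a'_def)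
  next
   case False
   then have "ALL i. b i = 0" "I - {i0} = I" using ib(2) by auto
   then show ?thesis using e e' by simp
  qed
 qed
 then have "\<forall>P\<in>S. ordge P (%R. \<Sum>i\<in>I. a' i * f i R) (c P)" using a(2) by simp
 moreover have "\<exists>i\<in>I. a' i ~= 0" using a(1) by (auto simp: a'_def)
 ultimately show ?case by blast
qed

end

context gal_cover
begin

lemma eq_quotient_if_sum_zero:
 fixes x y z :: "'a::field"
 assumes y: "y ~= 0" and s: "x + z * y\<^sup>2 = 0"
 shows "z = - x / y\<^sup>2"
proof -
 have "z * y\<^sup>2 = - x" using s by (simp add: eq_neg_iff_add_eq_0 add.commute)
 then have "z * y\<^sup>2 / y\<^sup>2 = - x / y\<^sup>2" by simp
 moreover have "z * y\<^sup>2 / y\<^sup>2 = z" using y by simp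
 ultimately show ?thesis by simp
qed

text \<open>The numerator of a uniformizer over a power of a linear form has a simple zero at
  \<open>Q\<close> but may vanish on \<open>S\<close>. Adding \<open>c\<close> times the square of a
  function that vanishes at \<open>Q\<close> and not on \<open>S\<close> leaves the zero simple, and
  each point of \<open>S\<close> excludes one value of \<open>c\<close>.\<close>

lemma simple_zero:
 assumes Q: "Q \<in> C" and S: "finite S" "S \<subseteq> C" "Q \<notin> S"
 obtains h where "ratl C h" "hord Q h 1" "!!R. R \<in> S ==> hord R h 0"
proof -
 obtain F G d where FG: "hmg d F" "hmg d G" "peval G Q ~= 0" "0 = peval F Q / peval G Q"
  "aeg C (%R. tt Q R = peval F R / peval G R)" using reg_tt[OF Q] unfolding reg_def by blast
 obtain l where l: "!!s. s \<in> insert Q S ==> peval (lin l) s ~= 0" using form_avoiding[of "insert Q S"] S(1) by blast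
 obtain b where b: "peval (lin b) Q = 0" "!!s. s \<in> S ==> peval (lin b) s ~= 0" using form_through_avoiding[OF S(1,3)] by blast
 let ?L = "lin l" and ?B = "lin b"
 have hL: "hmg d (?L ^ d)" using homogeneous_power[OF homogeneous_lin, of d l] by simp
 let ?f = "%R. peval F R / peval (?L ^ d) R" and ?g = "%R. peval ?B R / peval ?L R"
 have rf: "reg C R ?f (?f R)" "reg C R ?g (?g R)" if "R \<in> insert Q S" for R
  using reg_form[OF FG(1) hL, of R C] reg_form[OF homogeneous_lin homogeneous_lin, of l R C b] l[OF that] by (simp_all add: peval_simps)
 obtain c where c: "c \<notin> (%R. - ?f R / ?g R ^ 2) ` S"
  by (rule exE[OF ex_new_if_finite[OF infinite_alg_closed finite_imageI[OF S(1)]]])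
 let ?h = "%R. ?f R + c * ?g R ^ 2"
 have rh: "reg C R ?h (?h R)" if "R \<in> insert Q S" for R
  by (intro reg_add reg_cmult reg_power irrC rf that) (use that Q S(2) in auto)
 have rQ: "ratl C ?f" "ratl C (%R. c * ?g R ^ 2)" "ratl C ?h"
 proof -
  show 1: "ratl C ?f" using reg_imp_ratl[OF rf(1)] Q by blast
  have 2: "ratl C ?g" using reg_imp_ratl[OF rf(2)] Q by blast
  show 3: "ratl C (%R. c * ?g R ^ 2)" by (rule ratl_mult[OF irrC ratl_const[OF irrC] ratl_power[OF irrC 2]])
  show "ratl C ?h" by (rule ratl_add[OF irrC 1 3])
 qed
 have "hord R ?h 0" if R: "R \<in> S" for R
 proof (rule hord_unit[OF rh])
  have g0: "?g R ~= 0" using b(2)[OF R] l[of R] R by simp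
  show "?h R ~= 0"
  proof
   assume "?h R = 0"
   from eq_quotient_if_sum_zero[OF g0 this] have "c = - ?f R / ?g R ^ 2" .
   then show False using c R by blast
  qed
 qed (use R in auto)
 moreover have "hord Q ?h 1"
 proof -
  have u: "hord Q (%R. peval G R / peval (?L ^ d) R) 0"
   by (rule hord_unit[OF reg_form[OF FG(2) hL]]) (use FG(3) l[of Q] in \<open>simp_all add: peval_simps\<close>)
  have ae: "aeg C (%R. ?f R = tt Q R * (peval G R / peval (?L ^ d) R))"
   using FG(5) gen_basic[OF irrC FG(2) Q FG(3)] by eventually_elim simp
  have f1: "hord Q ?f 1" using hord_cong[OF hord_mult[OF Q hord_tt[OF Q] u] ae] by simp
  have g1: "ordge Q ?g 1"
  proof -
   have rg: "ratl C ?g" using reg_imp_ratl[OF rf(2)] Q by blast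
   have "ordge Q ?g (0 + 1)" by (rule ordge_step[OF Q rg]) (use rf(2)[of Q] b(1) in simp)
   then show ?thesis by simp
  qed
  have g2: "ordge Q (%R. c * ?g R ^ 2) 2"
  proof -
   have rg: "ratl C ?g" using reg_imp_ratl[OF rf(2)] Q by blast
   consider "aeg C (%R. ?g R = 0)" | n where "1 \<le> n" "hord Q ?g n" using g1 unfolding ordge_iff[OF Q rg] by blast
   then show ?thesis
   proof cases
   case 1
   show ?thesis by (rule ordge_zero_fun) (use 1 in eventually_elim, simp)
   next
   case 2
   have "hord Q (%R. ?g R ^ 2) (n + n)" using hord_mult[OF Q 2(2) 2(2)] by (simp add: power2_eq_square)
   then have "ordge Q (%R. ?g R ^ 2) 2" using ordge_hord[OF Q, of "%R. ?g R ^ 2" "n + n" 2] 2(1) by simp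
   then show ?thesis by (rule ordge_cmult[OF Q])
   qed
  qed
  have "ordge Q ?f 1" using ordge_hord[OF Q f1] by simp
  moreover have "ordge Q (%R. c * ?g R ^ 2) 1" by (rule ordge_mono[OF Q rQ(2) g2]) simp
  ultimately have h1: "ordge Q ?h 1" by (rule ordge_add[OF Q])
  have h2: "\<not> ordge Q ?h 2"
  proof
   assume "ordge Q ?h 2"
   from ordge_add[OF Q this ordge_cmult[OF Q g2, of "- 1"]] have "ordge Q ?f 2" by simp
   then show False using ordge_hord[OF Q f1] by simp
  qed
  from iffD1[OF ordge_iff[OF Q rQ(3)] h1] have "\<exists>n\<ge>1. hord Q ?h n"
  proof
   assume "aeg C (%R. ?h R = 0)"
   from ordge_zero_fun[OF this] h2 show ?thesis by (rule notE[rotated])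
  next
   assume "\<exists>n\<ge>1. hord Q ?h n" then show ?thesis .
  qed
  then obtain n where n: "1 \<le> n & hord Q ?h n" ..
  have "\<not> 2 \<le> n" using h2 ordge_hord[OF Q n[THEN conjunct2]] by simp
  then have "n = 1" using n by linarith
  then show ?thesis using n by simp
 qed
 ultimately show ?thesis by (intro that[OF rQ(3)])
qed

text \<open>Take a function with a simple zero at \<open>Q\<close> and order 0 at the rest of the
  orbit. Its norm vanishes at \<open>Q\<close> to the order of the stabilizer, and descends to a
  function vanishing at \<open>q Q\<close>. That function is a multiple of the local parameter,
  whose pullback has order \<open>ram Q\<close>.\<close>

lemma ram_le:
 assumes Q: "Q \<in> C" shows "ram Q \<le> int (card {sg\<in>G. sg Q = Q})"
proof -
 let ?S = "(%sg. sg Q) ` G - {Q}"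
 obtain h where h: "ratl C h" "hord Q h 1" "!!R. R \<in> ?S ==> hord R h 0"
  by (rule simple_zero[OF Q, of ?S]) (use fin Q in auto)
 let ?N = "%R. \<Prod>sg\<in>G. h (sg R)" and ?c = "int (card {sg\<in>G. sg Q = Q})"
 have "hord Q ?N (\<Sum>sg\<in>G. if sg Q = Q then 1 else 0)"
 proof (rule hord_prod[OF Q])
  fix sg assume s: "sg \<in> G"
  show "hord Q (%R. h (sg R)) (if sg Q = Q then 1 else 0)"
   by (rule hord_trans[OF s Q]) (use h(2,3) s in auto)
 qed
 then have hN: "hord Q ?N ?c" using fin by (simp add: sum.If_cases Int_def)
 have "(\<lambda>x\<in>C. x) \<in> {sg\<in>G. sg Q = Q}" using one Q by simp
 then have "{sg\<in>G. sg Q = Q} ~= {}" by blast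
 moreover have "finite {sg\<in>G. sg Q = Q}" using fin by simp
 ultimately have c0: "0 < ?c" by (simp only: card_gt_0_iff of_nat_0_less_iff simp_thms)
 have rN: "ratl C ?N" by (rule ratl_prod[OF irrC ratl_trans[OF _ h(1)]])
 have "EX f. ratl PL f & (\<forall>\<^sub>F R in gen C. f (q R) = ?N R)"
 proof (rule descend_exact[where h = ?N, OF rN])
  show "?N (ta R) = ?N R" if "ta \<in> G" "R \<in> C" for ta R by (rule prod_translate[OF that])
 qed
 then obtain f where "ratl PL f & (\<forall>\<^sub>F R in gen C. f (q R) = ?N R)" ..
 note f = this[THEN conjunct1] this[THEN conjunct2]
 have "reg C Q ?N 0"
 proof -
  obtain a where a: "reg C Q ?N a & (a = 0 \<longleftrightarrow> 0 < ?c)" using hord_nonneg[OF Q hN less_imp_le[OF c0]] ..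
  then have "a = 0" using c0 by simp
  with a show ?thesis by simp
 qed
 from reg_cong[OF this f(2)] have "reg C Q (%R. f (q R)) 0" .
 from reg_q_converse[OF Q f(1) this] obtain g b where g: "reg PL (q Q) g b" "aeg PL (%R. f R = sp (q Q) R * g R)"
  using unif_sp[of "q Q"] unfolding unif_def by blast
 have rg: "reg C Q (%R. g (q R)) b" by (rule pull[OF Q g(1)])
 have "aeg C (%R. g (q R) = ?N R / sp (q Q) (q R))"
  using dominantD[OF domin g(2)] f(2) s_neq[of "q Q" 0] by eventually_elim (simp add: eq_divide_eq mult.commute)
 from hord_cong[OF hord_divide[OF Q hN hord_ram[OF Q]] this] have "hord Q (%R. g (q R)) (?c - ram Q)" .
 from hord_reg(1)[OF Q this rg] show ?thesis by simp
qed

end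

context plane_build
begin

lemma ordge_power_mult:
 assumes P: "P \<in> C" and qP: "q P = y0" and ij: "i \<le> N" "j \<le> N'"
 shows "ordge P (%R. u R ^ i * v R ^ j) (- (int (N + N') * ram P))"
proof -
 have hs: "hord P (dl P) (ram P)" using hord_ram[OF P] qP by (simp add: dl_def[abs_def])
 have r: "reg C P (%R. dl P R ^ (N - i + (N' - j)) * ((dl P R * u R) ^ i * (dl P R * v R) ^ j))
  (a1 P ^ (N - i + (N' - j)) * (a2 P ^ i * a3 P ^ j))"
  by (intro reg_mult reg_power irrC P reg_dl reg_dlu reg_dlv)
 have e: "dl P R ^ (N - i + (N' - j)) * ((dl P R * u R) ^ i * (dl P R * v R) ^ j) = dl P R ^ (N + N') * (u R ^ i * v R ^ j)" for R
 proof -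
  have "dl P R ^ (N + N') = dl P R ^ (N - i + (N' - j)) * (dl P R ^ i * dl P R ^ j)"
   unfolding power_add[symmetric] using ij by simp
  then show ?thesis by (simp add: power_mult_distrib)
 qed
 have o: "ordge P (%R. dl P R ^ (N + N') * (u R ^ i * v R ^ j)) 0"
  unfolding ordge_reg using r unfolding e by blast
 have ruv: "ratl C (%R. u R ^ i * v R ^ j)" by (intro ratl_mult ratl_power irrC ru rv)
 have hp: "hord P (%R. dl P R ^ k) (int k * ram P)" for k
  using hord_power_int[OF P hs, of "int k"] by simp
 have "ratl C (%R. dl P R ^ (N + N') * (u R ^ i * v R ^ j))" by (intro ratl_mult ratl_power irrC ruv reg_imp_ratl[OF reg_dl] P)
 from ordge_iff[OF P this] o consider "aeg C (%R. dl P R ^ (N + N') * (u R ^ i * v R ^ j) = 0)"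
  | k where "0 \<le> k" "hord P (%R. dl P R ^ (N + N') * (u R ^ i * v R ^ j)) k" by blast
 then show ?thesis
 proof cases
  case 1
  show ?thesis by (rule ordge_zero_fun) (use 1 dl_nz[of P] in eventually_elim, simp)
 next
  case 2
  have "aeg C (%R. u R ^ i * v R ^ j = dl P R ^ (N + N') * (u R ^ i * v R ^ j) / dl P R ^ (N + N'))"
   using dl_nz[of P] by eventually_elim simp
  from hord_cong[OF hord_divide[OF P 2(2) hp] this]
  have h: "hord P (%R. u R ^ i * v R ^ j) (k - int (N + N') * ram P)" .
  show ?thesis unfolding ordge_hord[OF P h] using 2(1) by simp
 qed
qed

text \<open>Otherwise Riemann-Roch style counting yields a nontrivial combination of the \<open>u\<^sup>i v\<^sup>j\<close> with
 \<open>j < n\<close> that is regular everywhere and vanishes at a point.\<close>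

lemma fibre_degree_ge: "int n \<le> (\<Sum>P\<in>{P\<in>C. q P = y0}. ram P)"
proof (rule ccontr)
 let ?S = "{P\<in>C. q P = y0}"
 assume "\<not> ?thesis"
 then have small: "(\<Sum>P\<in>?S. ram P) \<le> int n - 1" by simp
 obtain Q0 where Q0: "Q0 \<in> C" "q Q0 = y0" using surj by (metis UNIV_I imageE)
 \<comment> \<open>The \<open>(N + 1) n\<close> products have to outnumber the conditions, of which
   there are at most \<open>1 + (N + n) (n - 1)\<close>; with \<open>N\<close> the square of
   \<open>n\<close> the difference is at least \<open>2 n - 1\<close>.\<close>
 define N where "N = n\<^sup>2"
 let ?I = "{..N} \<times> {..<n}" and ?f = "%(i, j) R. u R ^ i * v R ^ j"
 \<comment> \<open>The additional zero demanded at \<open>Q0\<close> forces the resulting constant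
   to be 0.\<close>
 let ?m = "%P. - (int (N + n) * ram P)" and ?c = "%P. if P = Q0 then 1 else (0 :: int)"
 have rf: "ratl C (?f x)" for x by (cases x) (auto intro!: ratl_mult ratl_power irrC ru rv)
 have "EX a. (\<exists>x\<in>?I. a x ~= 0) & (\<forall>P\<in>?S. ordge P (%R. \<Sum>x\<in>?I. a x * ?f x R) (?c P))"
 proof (rule elimination[OF _ rf finite_fibre])
  show "ordge P (?f x) (?m P)" if "x \<in> ?I" "P \<in> ?S" for x P
   using ordge_power_mult[of P "fst x" N "snd x" n] that by (auto simp: split_beta)
  have rp: "0 < ram P" if "P \<in> ?S" for P using ram_pos that by simp
  show "?m P \<le> ?c P" if "P \<in> ?S" for P
  proof -
   have "0 \<le> int (N + n) * ram P" using rp[OF that] by (intro mult_nonneg_nonneg) auto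
   then have "?m P \<le> 0" by simp
   moreover have "0 \<le> ?c P" by simp
   ultimately show ?thesis by (rule order_trans)
  qed
  have "int (\<Sum>P\<in>?S. nat (?c P - ?m P)) = (\<Sum>P\<in>?S. ?c P + int (N + n) * ram P)"
   unfolding of_nat_sum
  proof (rule sum.cong[OF refl])
   fix P assume "P \<in> ?S"
   from rp[OF this] have "0 \<le> int (N + n) * ram P" by (intro mult_nonneg_nonneg) auto
   then show "int (nat (?c P - ?m P)) = ?c P + int (N + n) * ram P" by simp
  qed
  also have "\<dots> = 1 + int (N + n) * (\<Sum>P\<in>?S. ram P)"
   using finite_fibre[of y0] Q0 by (simp add: sum.distrib sum_distrib_left sum.delta)
  also have "\<dots> \<le> 1 + int (N + n) * (int n - 1)" by (intro add_left_mono mult_left_mono small) simp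
  also have "\<dots> < int (card ?I)"
  proof -
   have "int (card ?I) = (int N + 1) * int n" by (simp add: card_cartesian_product algebra_simps)
   moreover have "int N = int n * int n" by (simp add: N_def power2_eq_square)
   ultimately show ?thesis using n_pos by (simp add: algebra_simps)
  qed
  finally show "(\<Sum>P\<in>?S. nat (?c P - ?m P)) < card ?I" by (simp only: of_nat_less_iff)
 qed auto
 then obtain a where a: "\<exists>x\<in>?I. a x ~= 0" "!!P. P \<in> ?S ==> ordge P (%R. \<Sum>x\<in>?I. a x * ?f x R) (?c P)" by blast
 let ?h = "%R. \<Sum>x\<in>?I. a x * ?f x R"
 have rh: "ratl C ?h" by (intro ratl_sum irrC ratl_mult[OF irrC ratl_const[OF irrC] rf])
 have "EX b. reg C P ?h b" if P: "P \<in> C" for P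
 proof (cases "q P = y0")
  case True
  have "ordge P ?h 0" by (rule ordge_mono[OF P rh a(2)]) (use True P in auto)
  then show ?thesis unfolding ordge_reg .
 next
  case False
  then have "reg C P u (a2 P)" "reg C P v (a3 P)"
   using reg_dlu[OF P] reg_dlv[OF P] by (simp_all add: dl_def)
  then have "reg C P (?f x) (case x of (i, j) => a2 P ^ i * a3 P ^ j)" for x
   by (cases x) (auto intro!: reg_mult reg_power irrC P)
  then have "reg C P ?h (\<Sum>x\<in>?I. a x * (case x of (i, j) => a2 P ^ i * a3 P ^ j))"
   by (intro reg_sum reg_cmult irrC P)
  then show ?thesis by blast
 qed
 from global_const[OF this] obtain c where c: "aeg C (%R. ?h R = c)" by blast
 have "c = 0"
 proof (rule ccontr)
  assume "c ~= 0"
  from hord_cong[OF hord_const[OF this] c] have "hord Q0 ?h 0" .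
  from ordge_hord[OF Q0(1) this, of 1] a(2)[of Q0] Q0 show False by simp
 qed
 define A :: "'k poly poly" where "A = (\<Sum>j<n. monom (\<Sum>i\<le>N. monom (a (i, j)) i) j)"
 have cA: "coeff (coeff A j) i = (if j < n & i \<le> N then a (i, j) else 0)" for i j
  by (simp add: A_def coeff_sum sum.delta if_distrib[of "%p. coeff p i"] cong: if_cong)
 have dA: "Polynomial.degree A < n"
 proof -
  have "Polynomial.degree A \<le> n - 1"
   by (rule degree_le) (auto simp: poly_eq_iff cA)
  then show ?thesis using n_pos by simp
 qed
 have pA: "poly (poly A [:z:]) x = (\<Sum>(i, j)\<in>?I. a (i, j) * (x ^ i * z ^ j))" for x z
 proof -
  have "poly (poly A [:z:]) x = (\<Sum>j<n. \<Sum>i\<le>N. a (i, j) * (x ^ i * z ^ j))"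
   by (simp add: A_def poly_sum poly_monom sum_distrib_right sum_distrib_left mult_ac)
  also have "\<dots> = (\<Sum>i\<le>N. \<Sum>j<n. a (i, j) * (x ^ i * z ^ j))" by (rule sum.swap)
  also have "\<dots> = (\<Sum>(i, j)\<in>?I. a (i, j) * (x ^ i * z ^ j))" by (rule sum.cartesian_product)
  finally show ?thesis .
 qed
 have "A = 0"
  by (rule relation_degree[OF dA]) (use c \<open>c = 0\<close> in \<open>simp add: pA split_beta\<close>)
 then show False using a(1) cA by (metis (no_types, lifting) SigmaE atMost_iff coeff_0 lessThan_iff)
qed

text \<open>Both divisors are constant along the fibre. The orbit sum has degree \<open>n\<close>,
  and the fibre at least that, so the stabilizer is at most \<open>ram Q\<close>; the norm argument
  gives the other inequality.\<close>

lemma orbit_eq_fibre: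
 assumes Q: "Q \<in> C" "q Q = y0" shows "(\<Sum>sg\<in>G. Poly_Mapping.single (sg Q) 1) = fibd y0"
proof (rule divisor_eqI[OF is_divisor_orbit[OF Q(1)] is_divisor_fibd])
 let ?S = "{P\<in>C. q P = y0}" and ?st = "int (card {sg\<in>G. sg Q = Q})"
 let ?O = "\<Sum>sg\<in>G. Poly_Mapping.single (sg Q) (1 :: int)"
 have lO: "lkp ?O P = ?st" if "P \<in> ?S" for P using orbit_divisor[OF Q(1), of P] that Q by simp
 have rm: "ram P = ram Q" if P: "P \<in> ?S" for P
 proof -
  obtain sg where "sg \<in> G" "P = sg Q" using fib[OF Q(1), of P] P Q(2) by auto
  then show ?thesis using ram_trans Q(1) by simp
 qed
 have "(\<Sum>P\<in>?S. lkp ?O P) = (\<Sum>P\<in>?S. \<Sum>sg\<in>G. (if P = sg Q then 1 else 0))"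
  by (simp add: lookup_sum lookup_single when_def eq_commute)
 also have "\<dots> = (\<Sum>sg\<in>G. \<Sum>P\<in>?S. (if P = sg Q then 1 else 0))" by (rule sum.swap)
 also have "\<dots> = (\<Sum>sg\<in>G. 1)"
  using finite_fibre[of y0] Q by (intro sum.cong) (simp_all add: sum.delta q_inv)
 also have "\<dots> \<le> (\<Sum>P\<in>?S. ram P)" using fibre_degree_ge by simp
 finally have "int (card ?S) * ?st \<le> int (card ?S) * ram Q" using lO rm by simp
 moreover have "0 < int (card ?S)" using Q finite_fibre[of y0] by (auto simp: card_gt_0_iff)
 ultimately have "?st \<le> ram Q" by (simp add: mult_le_cancel_left)
 then have e: "ram Q = ?st" using ram_le[OF Q(1)] by simp
 show "lkp ?O P = lkp (fibd y0) P" if P: "P \<in> C" for P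
  unfolding lookup_fibd orbit_divisor[OF Q(1)] using rm[of P] e Q by auto
qed

end

section \<open>From collinear Galois points back to the quotients\<close>

lemma plane_map_of_birational:
 fixes C :: "('k::alg_closed_field, 'n::finite) proj set" and ph :: "('k, 'n) proj => ('k, 3) proj"
 assumes i: "irr C" and b: "birational_embedding C ph"
 shows "plane_map C ph"
proof -
 obtain U V ps where U: "openin (subtopology zariski C) U" "U ~= {}"
  and V: "openin (subtopology zariski (ph ` C)) V" "V ~= {}"
  and m: "morphism C UNIV ph" "morphism V U ps" "!!P. P \<in> U ==> ps (ph P) = P"
  using b unfolding birational_embedding_def by blast
 obtain T where T: "T \<in> V" using V(2) by blast
 obtain W d Ps where "T \<in> W & openin (subtopology zariski V) W & (ALL j. hmg d (Ps j)) &
   (\<forall>R\<in>W. (EX j. peval (Ps j) R ~= 0) & ps R = abs_proj (\<chi> j. peval (Ps j) R))"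
  using m(2)[unfolded morphism_def, THEN conjunct2, rule_format, OF T] by (elim exE)
 then have W: "T \<in> W" "openin (subtopology zariski V) W" "ALL j. hmg d (Ps j)"
  "!!R. R \<in> W ==> (EX j. peval (Ps j) R ~= 0) & ps R = abs_proj (\<chi> j. peval (Ps j) R)"
  by simp_all
 have "V \<subseteq> ph ` C" using V(1) unfolding openin_zariski_sub by blast
 then have "subtopology zariski V = subtopology (subtopology zariski (ph ` C)) V"
  by (simp add: subtopology_subtopology inf.absorb2)
 then have oW: "openin (subtopology zariski (ph ` C)) W"
  using openin_trans_full[OF _ V(1)] W(2) by metis
 have "W ~= {}" using W(1) by blast
 from dominantD[OF dominant_image[OF i m(1)] gen_open[OF irr_image[OF i m(1)] oW this]]
 have "aeg C (%R. (EX j. peval (Ps j) (ph R) ~= 0) & R = abs_proj (\<chi> j. peval (Ps j) (ph R)))"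
  using gen_open[OF i U]
 proof eventually_elim
  case (elim R)
  show ?case using W(4)[OF elim(1)] m(3)[OF elim(2)] by simp
 qed
 then have "EX Ps d. (ALL j. hmg d (Ps j)) &
   (\<forall>\<^sub>F R in gen C. (EX j. peval (Ps j) (ph R) ~= 0) & R = abs_proj (\<chi> j. peval (Ps j) (ph R)))"
  using W(3) by (intro exI[of _ Ps] exI[of _ d] conjI)
 then show ?thesis using i m(1) by unfold_locales
qed

lemma same_projection:
 fixes P :: "('k::field, 3) proj"
 assumes e: "pr P T = pr P S" and T: "T ~= P" and S: "S ~= P"
 obtains c d where "rep_proj T = c *s rep_proj S + d *s rep_proj P"
proof -
 have nz: "Mx P *v rep_proj R ~= 0" if "R ~= P" for R using that rep_proj_nonzero[of R] unfolding Mx_ker by simp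
 have "abs_proj (Mx P *v rep_proj S) = abs_proj (Mx P *v rep_proj T)" using e unfolding pr_def by simp
 then obtain c where c: "Mx P *v rep_proj T = c *s (Mx P *v rep_proj S)"
  using abs_proj_eq_iff[OF nz[OF S] nz[OF T]] unfolding proportional_def by blast
 let ?x = "rep_proj T - c *s rep_proj S"
 have "Mx P *v ?x = 0" using c by (simp add: matrix_vector_mult_diff_distrib vector_scalar_commute)
 then consider "?x = 0" | "?x ~= 0" "abs_proj ?x = P" unfolding Mx_ker by blast
 then obtain d where "?x = d *s rep_proj P"
 proof cases
  case 1 then show ?thesis using that[of 0] by simp
 next
  case 2
  then have "abs_proj (rep_proj P) = abs_proj ?x" by simp
  then show ?thesis using abs_proj_eq_iff[OF rep_proj_nonzero 2(1)] that unfolding proportional_def by blast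
 qed
 then have "rep_proj T = c *s rep_proj S + d *s rep_proj P" by (simp add: algebra_simps)
 then show ?thesis by (rule that)
qed

lemma eval_lin_add: "evm (lin a) (x + y) = evm (lin a) x + evm (lin a) y"
 "evm (lin a) (c *s x) = c * evm (lin a) x"
 by (simp_all add: sum.distrib distrib_left sum_distrib_left mult.left_commute)

text \<open>A linear form on the projective line composed with the projection matrix; its zeros form
  a line through \<open>P\<close> when \<open>c\<close> is nonzero.\<close>

definition pull_lin :: "('k::field, 3) proj => 'k ^ 2 => 'k ^ 3" where
 "pull_lin P c = (\<chi> j. \<Sum>i\<in>UNIV. c $ i * Mx P $ i $ j)"

lemma eval_pull_lin: "evm (lin (pull_lin P c)) x = evm (lin c) (Mx P *v x)"
proof -
 have "(\<Sum>j\<in>UNIV. (\<Sum>i\<in>UNIV. c $ i * Mx P $ i $ j) * x $ j) = (\<Sum>j\<in>UNIV. \<Sum>i\<in>UNIV. c $ i * (Mx P $ i $ j * x $ j))"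
  by (simp add: sum_distrib_right mult.assoc)
 also have "\<dots> = (\<Sum>i\<in>UNIV. \<Sum>j\<in>UNIV. c $ i * (Mx P $ i $ j * x $ j))" by (rule sum.swap)
 finally show ?thesis by (simp add: pull_lin_def matrix_vector_mult_def sum_distrib_left)
qed

context plane_outer
begin

lemma M_nz: "R \<in> C ==> Mx P *v rep_proj (ph R) ~= 0"
 unfolding Mx_ker using outer rep_proj_nonzero by auto

text \<open>Every line through \<open>P\<close> meets the curve away from \<open>P\<close>. Applied
  to a line through \<open>P\<close> other than the given one, this yields a curve point off the
  given line.\<close>

lemma off_line:
 assumes a: "a ~= 0" "peval (lin a) P = 0"
 shows "aeg C (%R. peval (lin a) (ph R) ~= 0)"
proof -
 obtain k where k: "a $ k ~= 0" using a(1) by (auto simp: vec_eq_iff)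
 let ?x = "axis k 1 :: 'k ^ 3"
 have ax: "evm (lin a) ?x ~= 0"
  using k by (simp add: axis_def if_distrib[of "%c. _ * c"] sum.delta cong: if_cong)
 have "Mx P *v ?x ~= 0"
 proof
  assume "Mx P *v ?x = 0"
  then have "abs_proj ?x = P" unfolding Mx_ker by (auto simp: axis_eq_0_iff)
  moreover have "?x ~= 0" by (simp add: axis_eq_0_iff)
  ultimately have "evm (lin a) ?x = 0" using a(2) peval_abs_eq_0_iff[OF homogeneous_lin] by metis
  then show False using ax by simp
 qed
 then obtain R t where R: "R \<in> C" "ph R = abs_proj (?x + t *s rep_proj P)" "Mx P *v (?x + t *s rep_proj P) = Mx P *v ?x"
  by (rule point_on_line)
 have z: "?x + t *s rep_proj P ~= 0" using R(3) \<open>Mx P *v ?x ~= 0\<close> by (metis matrix_vector_mult_0_right)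
 have "evm (lin a) (?x + t *s rep_proj P) ~= 0"
  unfolding eval_lin_add using ax a(2) by (simp add: peval_def)
 then have "peval (lin a) (ph R) ~= 0" unfolding R(2) peval_abs_eq_0_iff[OF homogeneous_lin z] .
 from mor_at_form[OF irrC R(1) mphi[OF R(1)] homogeneous_lin this] show ?thesis .
qed

text \<open>The forms \<open>lam y\<close> and \<open>mu y\<close> for \<open>y = q Q\<close>, pulled back to the plane, are a multiple of the line
 through \<open>P\<close> and \<open>ph Q\<close> and a further line \<open>m\<close> through \<open>P\<close>.\<close>

lemma coordinate_forms:
 assumes a: "a ~= 0" "peval (lin a) P = 0" and Q: "Q \<in> C" "peval (lin a) (ph Q) = 0"
 shows "EX c m. c ~= 0 & peval (lin m) P = 0 & (ALL T. T ~= P --> peval (lin a) T = 0 --> peval (lin m) T ~= 0) &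
  (\<forall>R\<in>C. sp (q Q) (q R) = c * peval (lin a) (ph R) / peval (lin m) (ph R)) &
  (\<forall>R\<in>C. q R = q Q \<longleftrightarrow> peval (lin a) (ph R) = 0)"
proof -
 define y where "y = q Q"
 obtain l0 where l0: "lam y = lin l0" using homogeneous_one_lin[of "lam y"] homogeneous_lam by (metis One_nat_def)
 obtain m0 where m0: "mu y = lin m0" using homogeneous_one_lin[of "mu y"] homogeneous_mu by (metis One_nat_def)
 let ?b = "pull_lin P l0" and ?m = "pull_lin P m0"
 have eb: "evm (lin ?b) x = evm (lam y) (Mx P *v x)" for x unfolding eval_pull_lin l0 ..
 have em: "evm (lin ?m) x = evm (mu y) (Mx P *v x)" for x unfolding eval_pull_lin m0 ..
 have pp: "Mx P *v rep_proj P = 0" unfolding Mx_ker by simp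
 have "peval (lin ?b) P = 0" unfolding peval_def eb pp l0 by simp
 moreover have "peval (lin ?b) (ph Q) = 0"
  unfolding peval_def eb using peval_abs_eq_0_iff[OF homogeneous_lam M_nz[OF Q(1)], of y] by (simp add: y_def pr_def)
 moreover have "P ~= ph Q" using outer Q(1) by blast
 ultimately obtain c where c: "?b = c *s a" using line_coeffs_unique[of P "ph Q" a ?b] a Q(2) by blast
 have ec: "evm (lin ?b) x = c * evm (lin a) x" for x unfolding c by (simp add: sum_distrib_left mult.assoc)
 have "c ~= 0"
 proof
  assume "c = 0"
  obtain z where z: "z ~= y" using ex_other by blast
  obtain x where "Mx P *v x = rep_proj z" by (rule Mx_surj)
  then have "peval (lam y) z = 0" unfolding peval_def using eb[of x] ec[of x] \<open>c = 0\<close> by simp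
  then show False using z by (simp add: peval_lam)
 qed
 have qy: "q R = y \<longleftrightarrow> peval (lin a) (ph R) = 0" if R: "R \<in> C" for R
 proof -
  have "q R = y \<longleftrightarrow> peval (lam y) (abs_proj (Mx P *v rep_proj (ph R))) = 0" unfolding peval_lam pr_def ..
  also have "\<dots> \<longleftrightarrow> evm (lam y) (Mx P *v rep_proj (ph R)) = 0"
   by (rule peval_abs_eq_0_iff[OF homogeneous_lam M_nz[OF R]])
  also have "evm (lam y) (Mx P *v rep_proj (ph R)) = c * peval (lin a) (ph R)"
   unfolding eb[symmetric] ec peval_def ..
  finally show ?thesis using \<open>c ~= 0\<close> by simp
 qed
 have sp: "sp y (q R) = c * peval (lin a) (ph R) / peval (lin ?m) (ph R)" if R: "R \<in> C" for R
  unfolding sp_def pr_def peval_abs_ratio[OF homogeneous_lam homogeneous_mu M_nz[OF R]]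
  unfolding eb[symmetric] em[symmetric] ec peval_def ..
 have mP: "peval (lin ?m) P = 0" unfolding peval_def em pp m0 by simp
 have mT: "peval (lin ?m) T ~= 0" if T: "T ~= P" "peval (lin a) T = 0" for T
 proof -
  have nz: "Mx P *v rep_proj T ~= 0" unfolding Mx_ker using T(1) rep_proj_nonzero[of T] by simp
  have "evm (lam y) (Mx P *v rep_proj T) = 0" using T(2) ec[of "rep_proj T"] eb[of "rep_proj T"] by (simp add: peval_def)
  then have "abs_proj (Mx P *v rep_proj T) = y" using peval_abs_eq_0_iff[OF homogeneous_lam nz, of y] by (simp add: peval_lam)
  then show ?thesis unfolding peval_def em using peval_abs_eq_0_iff[OF homogeneous_mu nz, of y] peval_mu[of y] by simp
 qed
 show ?thesis
  by (intro exI[of _ c] exI[of _ ?m] conjI ballI allI impI) (rule \<open>c ~= 0\<close> mP mT sp[unfolded y_def] qy[unfolded y_def]; assumption)+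
qed

text \<open>The left hand function does not involve \<open>P\<close>. Hence for all centres on the
  line \<open>a\<close> the fibres through \<open>Q\<close> are the same divisor, the one cut out by
  \<open>a\<close>.\<close>

lemma fibre_order:
 assumes a: "a ~= 0" "peval (lin a) P = 0" and Q: "Q \<in> C" "peval (lin a) (ph Q) = 0"
  and S: "S \<in> C" and l: "peval (lin l) (ph S) ~= 0"
 shows "cov.hord S (%R. peval (lin a) (ph R) / peval (lin l) (ph R)) (lkp (gal_cover.fibd C q (q Q)) S)"
proof -
 interpret gc: gal_cover C G q by (rule gal_cover)
 obtain c m where "c ~= 0 & peval (lin m) P = 0 & (ALL T. T ~= P --> peval (lin a) T = 0 --> peval (lin m) T ~= 0) &
  (\<forall>R\<in>C. sp (q Q) (q R) = c * peval (lin a) (ph R) / peval (lin m) (ph R)) &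
  (\<forall>R\<in>C. q R = q Q \<longleftrightarrow> peval (lin a) (ph R) = 0)"
  using coordinate_forms[OF a Q] by (elim exE)
 then have cm: "c ~= 0" "!!T. T ~= P ==> peval (lin a) T = 0 ==> peval (lin m) T ~= 0"
  "!!R. R \<in> C ==> sp (q Q) (q R) = c * peval (lin a) (ph R) / peval (lin m) (ph R)"
  "!!R. R \<in> C ==> q R = q Q \<longleftrightarrow> peval (lin a) (ph R) = 0"
  by simp_all
 have SP: "ph S ~= P" using outer S by blast
 have rl: "reg C S (%R. peval (lin b) (ph R) / peval (lin l) (ph R)) (peval (lin b) (ph S) / peval (lin l) (ph S))" for b
  by (rule reg_phi[OF S reg_form[OF homogeneous_lin homogeneous_lin l]])
 show ?thesis
 proof (cases "q S = q Q")
  case True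
  then have mS: "peval (lin m) (ph S) ~= 0" using cm(2)[OF SP] cm(4)[OF S] by blast
  have u: "cov.hord S (%R. peval (lin m) (ph R) / peval (lin l) (ph R)) 0"
   by (rule cov.hord_unit[OF rl]) (use mS l in simp)
  have s: "cov.hord S (%R. sp (q Q) (q R)) (gc.ram S)" using gc.hord_ram[OF S] True by simp
  have ae: "aeg C (%R. peval (lin a) (ph R) / peval (lin l) (ph R) = inverse c * (sp (q Q) (q R) * (peval (lin m) (ph R) / peval (lin l) (ph R))))"
   using gen_in[OF irrC] mor_at_form[OF irrC S mphi[OF S] homogeneous_lin mS]
  proof eventually_elim
   case (elim R)
   show ?case unfolding cm(3)[OF elim(1)] using cm(1) elim(2) by simp
  qed
  have h: "cov.hord S (%R. inverse c * (sp (q Q) (q R) * (peval (lin m) (ph R) / peval (lin l) (ph R)))) (0 + (gc.ram S + 0))"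
   by (rule cov.hord_mult[OF S cov.hord_const cov.hord_mult[OF S s u]]) (use cm(1) in simp)
  from cov.hord_cong[OF h ae] have "cov.hord S (%R. peval (lin a) (ph R) / peval (lin l) (ph R)) (0 + (gc.ram S + 0))" .
  then show ?thesis using True S by (simp add: gc.lookup_fibd)
 next
  case False
  then have "peval (lin a) (ph S) ~= 0" using cm(4)[OF S] by blast
  then have "peval (lin a) (ph S) / peval (lin l) (ph S) ~= 0" using l by simp
  from cov.hord_unit[OF rl this] have "cov.hord S (%R. peval (lin a) (ph R) / peval (lin l) (ph R)) 0" .
  then show ?thesis using False by (simp add: gc.lookup_fibd)
 qed
qed

end

text \<open>For \<open>sg\<close> in both groups, \<open>ph (sg R)\<close> lies on the lines from
  \<open>ph R\<close> to \<open>P1\<close> and to \<open>P2\<close>. Generically \<open>ph R\<close>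
  is off the line through \<open>P1\<close> and \<open>P2\<close>, so these lines meet only in
  \<open>ph R\<close>, and birationality gives \<open>sg R = R\<close>.\<close>

lemma trivial_intersection:
 assumes p1: "plane_outer C ph F n P1 G1" and p2: "plane_outer C ph F n P2 G2" and ne: "P1 ~= P2"
  and a: "a ~= 0" "peval (lin a) P1 = 0" "peval (lin a) P2 = 0"
 shows "G1 \<inter> G2 = {\<lambda>x\<in>C. x}"
proof -
 interpret p1: plane_outer C ph F n P1 G1 by (rule p1)
 interpret p2: plane_outer C ph F n P2 G2 by (rule p2)
 interpret g1: aut_group C G1 by (rule p1.grp)
 interpret g2: aut_group C G2 by (rule p2.grp)
 have "sg = (\<lambda>x\<in>C. x)" if s: "sg \<in> G1" "sg \<in> G2" for sg
 proof -
  obtain Ps d where "(ALL j. hmg d (Ps j)) &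
   (\<forall>\<^sub>F R in gen C. (EX j. peval (Ps j) (ph R) ~= 0) & R = abs_proj (\<chi> j. peval (Ps j) (ph R)))"
   using p1.phi_inverse by (elim exE)
  note inv = this[THEN conjunct2]
  have "aeg C (%R. sg R = R)"
   using p1.off_line[OF a(1,2)] gen_in[OF p1.irrC] inv dominantD[OF g1.domi[OF s(1)] inv]
  proof eventually_elim
   case (elim R)
   have T: "ph (sg R) ~= P1" "ph R ~= P1" "ph (sg R) ~= P2" "ph R ~= P2"
   using p1.outer p2.outer elim(2) g1.in_C[OF s(1)] by blast+
   obtain c d where 1: "rep_proj (ph (sg R)) = c *s rep_proj (ph R) + d *s rep_proj P1"
   by (rule same_projection[OF p1.q_inv[OF s(1) elim(2)] T(1,2)])
   obtain c' d' where 2: "rep_proj (ph (sg R)) = c' *s rep_proj (ph R) + d' *s rep_proj P2"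
   by (rule same_projection[OF p2.q_inv[OF s(2) elim(2)] T(3,4)])
   have "c * peval (lin a) (ph R) = c' * peval (lin a) (ph R)"
   using arg_cong[OF 1, of "evm (lin a)"] arg_cong[OF 2, of "evm (lin a)"] a(2,3)
   unfolding eval_lin_add peval_def by simp
   then have cc: "c = c'" using elim(1) by simp
   have dd: "d *s rep_proj P1 = d' *s rep_proj P2" using 1 2 cc by simp
   have "d = 0"
   proof (rule ccontr)
   assume d: "d ~= 0"
   then have d': "d' ~= 0" using dd rep_proj_nonzero[of P1] by auto
   have "abs_proj (d *s rep_proj P1) = P1" using abs_proj_scale[OF d rep_proj_nonzero[of P1]] by simp
   moreover have "abs_proj (d' *s rep_proj P2) = P2" using abs_proj_scale[OF d' rep_proj_nonzero[of P2]] by simp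
   ultimately show False using ne unfolding dd by simp
   qed
   then have 3: "rep_proj (ph (sg R)) = c *s rep_proj (ph R)" using 1 by simp
   then have "c ~= 0" using rep_proj_nonzero[of "ph (sg R)"] by auto
   from abs_proj_scale[OF this rep_proj_nonzero] have "ph (sg R) = ph R" using 3 by (metis abs_rep_proj)
   then show ?case using elim(3,4) by metis
  qed
  then have "aeg C (%R. sg R = (\<lambda>x\<in>C. x) R)" using gen_in[OF p1.irrC] by eventually_elim simp
  from morphism_eq[OF p1.irrC g1.morph[OF s(1)] g1.morph[OF g1.one] this]
  show ?thesis by (intro g1.ext_eq s(1) g1.one)
 qed
 then show ?thesis using g1.one g2.one by blast
qed

section \<open>Spans of finitely many functions, and the smallest linear subsystem\<close>

lemma combination_mem:
 assumes i: "irr C" and V: "subalgebra (constants C) V (FF C)"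
 shows "(!!f. f \<in> set fs ==> ratl C f & cls C f \<in> V) ==> cls C (combination cs fs) \<in> V"
proof (induction cs fs rule: list_induct2')
 case (4 c cs f fs)
 have e: "combination (c # cs) (f # fs) = (%R. c * f R + combination cs fs R)" by (rule ext) simp
 have f: "ratl C f" "cls C f \<in> V" using 4(2) by auto
 have "\<forall>f\<in>set fs. ratl C f" using 4(2) by auto
 then have r: "ratl C (combination cs fs)" using combine_cls[OF i] by blast
 have "cls C (combination cs fs) \<in> V" using 4 by auto
 then show ?case unfolding e
  by (rule cls_add_closed[OF i V ratl_mult[OF i ratl_const[OF i] f(1)] cls_smult_closed[OF i V f] r])
next
 case 1
 have "combination [] [] = (%R :: ('a, 'b) proj. 0 :: 'a)" by (rule ext) simp
 then show ?case using subgroup.one_closed[OF subalgebra.axioms(1)[OF V]] by (simp add: FF_zero[OF i])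
next
 case (2 c cs)
 have "combination (c # cs) [] = (%R :: ('a, 'b) proj. 0 :: 'a)" by (rule ext) simp
 then show ?case using subgroup.one_closed[OF subalgebra.axioms(1)[OF V]] by (simp add: FF_zero[OF i])
next
 case (3 f fs)
 have "combination [] (f # fs) = (%R :: ('a, 'b) proj. 0 :: 'a)" by (rule ext) simp
 then show ?case using subgroup.one_closed[OF subalgebra.axioms(1)[OF V]] by (simp add: FF_zero[OF i])
qed

lemma (in curve) combination_ordge:
 assumes P: "P \<in> C"
 shows "(!!f. f \<in> set fs ==> ordge P f m) ==> ordge P (combination cs fs) m"
proof (induction cs fs rule: list_induct2')
 case (4 c cs f fs)
 have e: "combination (c # cs) (f # fs) = (%R. c * f R + combination cs fs R)" by (rule ext) simp
 show ?case unfolding e by (rule ordge_add[OF P ordge_cmult[OF P]]) (use 4 in auto)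
qed (auto intro: ordge_zero_fun)

definition span_set :: "('k::field, 'n::finite) proj set => (('k, 'n) proj => 'k) list => (('k, 'n) proj \<rightharpoonup> 'k) set" where
 "span_set C fs = {cls C (combination cs fs) | cs. True}"

lemma span_set_props:
 assumes i: "irr C" and r: "\<forall>f\<in>set fs. ratl C f"
 shows "subalgebra (constants C) (span_set C fs) (FF C)"
  "\<exists>m\<le>length fs. ring.dimension (FF C) m (constants C) (span_set C fs)"
  "set (map (cls C) fs) \<subseteq> span_set C fs"
proof -
 interpret field "FF C" by (rule field_FF[OF i])
 note K = subfield_constants[OF i]
 let ?Us = "map (cls C) fs"
 have U: "set ?Us \<subseteq> carrier (FF C)" using r cls_in_carrier[OF i] by auto
 have S: "span_set C fs = Span (constants C) ?Us"
 proof (intro subset_antisym subsetI)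
  fix x assume "x \<in> span_set C fs"
  then obtain cs where "x = cls C (combination cs fs)" unfolding span_set_def by blast
  then have "x = combine (map (const_fun C) cs) ?Us" using combine_cls[OF i r, of cs] by simp
  moreover have "set (map (const_fun C) cs) \<subseteq> constants C" unfolding constants_def by auto
  ultimately show "x \<in> Span (constants C) ?Us" unfolding Span_eq_combine_set[OF K U] by blast
 next
  fix x assume "x \<in> Span (constants C) ?Us"
  then obtain Ks where Ks: "set Ks \<subseteq> constants C" "x = combine Ks ?Us" unfolding Span_eq_combine_set[OF K U] by blast
  obtain cs where "Ks = map (const_fun C) cs" using Ks(1) unfolding constants_def by (metis ex_map_conv subset_iff rangeE)
  then show "x \<in> span_set C fs" using combine_cls[OF i r, of cs] Ks(2) unfolding span_set_def by auto
 qed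
 show "subalgebra (constants C) (span_set C fs) (FF C)" unfolding S
  by (intro subalgebra.intro subalgebra_axioms.intro Span_is_add_subgroup[OF K U] Span_smult_closed[OF K U])
 show "set ?Us \<subseteq> span_set C fs" unfolding S by (rule Span_base_incl[OF K U])
 have "\<exists>m\<le>length us. dimension m (constants C) (Span (constants C) us)" if "set us \<subseteq> carrier (FF C)" for us
  using that
 proof (induction us)
  case Nil
  then show ?case by (intro exI[of _ 0]) auto
 next
  case (Cons u us)
  then obtain m where m: "m \<le> length us" "dimension m (constants C) (Span (constants C) us)" by auto
  have uc: "u \<in> carrier (FF C)" "set us \<subseteq> carrier (FF C)" using Cons.prems by auto
  show ?case
  proof (cases "u \<in> Span (constants C) us")
   case True
   have "Span (constants C) (u # us) = Span (constants C) us"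
   proof (intro subset_antisym subsetI)
   fix x assume "x \<in> Span (constants C) (u # us)"
   then obtain k v where "k \<in> constants C" "v \<in> Span (constants C) us" "x = k \<otimes>\<^bsub>FF C\<^esub> u \<oplus>\<^bsub>FF C\<^esub> v"
   using line_extension_mem_iff by auto
   then show "x \<in> Span (constants C) us"
   using Span_subgroup_props(3)[OF K uc(2)] Span_smult_closed[OF K uc(2)] True by simp
   next
   fix x assume "x \<in> Span (constants C) us"
   then show "x \<in> Span (constants C) (u # us)" using mono_Span[OF K uc(2,1)] by blast
   qed
   then show ?thesis using m by (intro exI[of _ m]) simp
  next
   case False
   show ?thesis using Suc_dim[OF uc(1) False m(2)] m(1) by (intro exI[of _ "Suc m"]) simp
  qed
 qed
 from this[OF U] show "\<exists>m\<le>length fs. dimension m (constants C) (span_set C fs)" unfolding S by simp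
qed

theorem quotients_of_galois_points:
 fixes C :: "('k::alg_closed_field, 'n::finite) proj set"
  and G :: "nat => (('k, 'n) proj => ('k, 'n) proj) set"
 assumes irrC: "irr C" and closedC: "closedin zariski C" and uexC: "!!R. R \<in> C ==> EX t. unif C R t"
  and ag: "!!i. i \<in> {1, 2, 3} ==> aut_group C (G i)" and Q: "Q \<in> C"
  and bir: "birational_embedding C ph" and deg: "has_degree (ph ` C) (card (G 1))"
  and inj: "inj_on P {1, 2, 3}" and coll: "collinear_points (P ` {1, 2, 3})"
  and gp: "!!i. i \<in> {1, 2, 3} ==> outer_galois_point (ph ` C) (P i)"
  and gg: "!!i. i \<in> {1, 2, 3} ==> galois_group_at C ph (P i) = G i"
  and line: "ph Q \<in> line_through (P 1) (P 2)"
 shows "(\<forall>i\<in>{1, 2, 3}. rational_quotient C (G i)) &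
  (\<forall>i\<in>{1, 2, 3}. \<forall>j\<in>{1, 2, 3}. i ~= j --> G i \<inter> G j = {\<lambda>x\<in>C. x}) &
  (EX D. is_divisor C D &
   (\<forall>i\<in>{1, 2, 3}. D = (\<Sum>sg\<in>G i. Poly_Mapping.single (sg Q) 1)) &
   (\<exists>\<Lambda> m. smallest_linear_subsystem C D (\<Union>i\<in>{1, 2, 3}. quotient_system C (G i)) \<Lambda> &
   has_projective_dim C D \<Lambda> m & m \<le> 2))"
proof -
 let ?I = "{1, 2, 3} :: nat set"
 interpret pm: plane_map C ph by (rule plane_map_of_birational[OF irrC bir])
 obtain F where F: "hmg (card (G 1)) F" "ph ` C = zero_locus {F}" using deg unfolding has_degree_def by blast
 have n: "0 < card (G 1)" using aut_group.fin[OF ag[of 1]] aut_group.one[OF ag[of 1]] by (auto simp: card_gt_0_iff)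
 have po: "plane_outer C ph F (card (G 1)) (P i) (G i)" if i: "i \<in> ?I" for i
 proof (intro plane_outer.intro pm.plane_map_axioms plane_outer_axioms.intro)
  show "EX t. unif C R t" if "R \<in> C" for R by (rule uexC[OF that])
  show "P i \<notin> ph ` C" "galois_extension (FF (ph ` C)) (projection_field (ph ` C) (P i))"
   using gp[OF i] unfolding outer_galois_point_def galois_point_def by blast+
 qed (use closedC F n ag[OF i] gg[OF i] in simp_all)
 obtain a where a: "a ~= 0" "P ` ?I \<subseteq> {R. peval (lin a) R = 0}"
  using coll unfolding collinear_points_def is_line_lin by blast
 have aP: "peval (lin a) (P i) = 0" if "i \<in> ?I" for i using a(2) that by blast
 have neq: "P i ~= P j" if "i \<in> ?I" "j \<in> ?I" "i ~= j" for i j using inj_onD[OF inj _ that(1,2)] that(3) by blast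
 have "line_through (P 1) (P 2) = {T. peval (lin a) T = 0}" by (rule line_through_eq[OF neq a(1) aP aP]) auto
 then have aQ: "peval (lin a) (ph Q) = 0" using line by simp
 define q where "q i = (%R. pr (P i) (ph R))" for i
 define y where "y i = q i Q" for i
 define x where "x i R = xc (y i) (q i R)" for i R
 have gc: "gal_cover C (G i) (q i)" if "i \<in> ?I" for i unfolding q_def by (rule plane_outer.gal_cover[OF po[OF that]])
 interpret g1: gal_cover C "G 1" "q 1" by (rule gc) simp
 define D where "D = g1.fibd (y 1)"
 \<comment> \<open>All three fibres through \<open>Q\<close> are the divisor cut out by the common
   line; \<open>l\<close> is a linear form nonzero at the point in question, used as
   denominator.\<close>
 have fd: "gal_cover.fibd C (q i) (y i) = D" if i: "i \<in> ?I" for i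
 proof -
  interpret gi: gal_cover C "G i" "q i" by (rule gc[OF i])
  have one: "1 \<in> ?I" by simp
  show ?thesis unfolding D_def
  proof (rule g1.divisor_eqI[OF gi.is_divisor_fibd g1.is_divisor_fibd])
   fix S assume S: "S \<in> C"
   obtain l where "!!s. s \<in> {ph S} ==> peval (lin l) s ~= 0" using form_avoiding[of "{ph S}"] by blast
   then have l: "peval (lin l) (ph S) ~= 0" by simp
   show "lkp (gi.fibd (y i)) S = lkp (g1.fibd (y 1)) S"
   using g1.hord_unique[OF S plane_outer.fibre_order[OF po[OF i] a(1) aP[OF i] Q aQ S l]
   plane_outer.fibre_order[OF po[OF one] a(1) aP[OF one] Q aQ S l]]
   unfolding y_def q_def .
  qed
 qed
 have triv: "G i \<inter> G j = {\<lambda>x\<in>C. x}" if "i \<in> ?I" "j \<in> ?I" "i ~= j" for i j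
  by (rule trivial_intersection[OF po[OF that(1)] po[OF that(2)] neq[OF that] a(1) aP[OF that(1)] aP[OF that(2)]])
 have rx: "ratl C (x i)" if i: "i \<in> ?I" for i
 proof -
  interpret gi: gal_cover C "G i" "q i" by (rule gc[OF i])
  show ?thesis unfolding x_def[abs_def] by (rule gi.ratl_pull_q[OF ratl_xc])
 qed
 have pole: "g1.ordge S (x i) (- lkp D S)" if i: "i \<in> ?I" and S: "S \<in> C" for i S
  using gal_cover.xc_order[OF gc[OF i] S, of "y i"] fd[OF i] by (simp add: x_def[abs_def])
 have orbit: "D = (\<Sum>sg\<in>G i. Poly_Mapping.single (sg Q) 1)" if i: "i \<in> ?I" for i
 proof -
  obtain j where j: "j \<in> ?I" "i ~= j" using i by force
  interpret gi: gal_cover C "G i" "q i" by (rule gc[OF i])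
  \<comment> \<open>The coordinate of any other quotient serves as \<open>v\<close>: its poles are
    bounded by the same fibre, and triviality of the intersection leaves only the identity fixing
    it.\<close>
  interpret plane_build C "G i" "q i" "y i" "x j"
  proof
   show "ratl C (x j)" by (rule rx[OF j(1)])
   show "g1.ordge S (x j) (- lkp (gi.fibd (y i)) S)" if "S \<in> C" for S
   using pole[OF j(1) that] fd[OF i] by simp
   show "sg = (\<lambda>x\<in>C. x)" if s: "sg \<in> G i" "aeg C (%R. x j (sg R) = x j R)" for sg
   proof -
   have "sg \<in> automorphisms C" using gi.aut s(1) by blast
   then have "sg \<in> G j" by (rule gal_cover.xc_mem[OF gc[OF j(1)]]) (use s(2) in \<open>simp add: x_def\<close>)
   then show ?thesis using triv[OF i j] s(1) by blast
   qed
  qed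
  show ?thesis using orbit_eq_fibre[OF Q y_def[of i, symmetric]] fd[OF i] by simp
 qed
 have D0: "0 \<le> lkp D S" if "S \<in> C" for S
  unfolding D_def g1.lookup_fibd using g1.ram_pos[OF that] by simp
 let ?fs = "[%_. 1, x 1, x 2]"
 have rfs: "\<forall>f\<in>set ?fs. ratl C f" using rx ratl_const[OF irrC] by simp
 define V where "V = span_set C ?fs"
 note Vp = span_set_props[OF irrC rfs, folded V_def]
 have Vm: "cls C (%_. 1) \<in> V" "cls C (x 1) \<in> V" "cls C (x 2) \<in> V" using Vp(3) by simp_all
 have VR: "V \<subseteq> riemann_roch_space C D"
 proof
  fix f assume "f \<in> V"
  then obtain cs where f: "f = cls C (combination cs ?fs)" unfolding V_def span_set_def by blast
  have r: "ratl C (combination cs ?fs)" using combine_cls[OF irrC rfs] by blast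
  have "g1.ordge S (combination cs ?fs) (- lkp D S)" if S: "S \<in> C" for S
  proof (rule g1.combination_ordge[OF S])
   fix f assume "f \<in> set ?fs"
   then consider "f = (%_. 1)" | i where "i \<in> ?I" "f = x i" by auto
   then show "g1.ordge S f (- lkp D S)"
   proof cases
   case 1
   show ?thesis unfolding 1 using g1.ordge_hord[OF S g1.hord_const[of 1]] D0[OF S] by simp
   next
   case 2
   show ?thesis unfolding 2(2) by (rule pole[OF 2(1) S])
   qed
  qed
  then show "f \<in> riemann_roch_space C D" unfolding f g1.riemann_roch_cls[OF r] by blast
 qed
 \<comment> \<open>Each \<open>x i\<close> is a constant times \<open>m / a\<close> for a linear
   form \<open>m\<close> vanishing at \<open>P i\<close>. Subtracting from \<open>m3\<close> the
   multiples of \<open>m1\<close> and \<open>m2\<close> that match its values at \<open>P 2\<close>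
   and \<open>P 1\<close> leaves a form vanishing at both points, hence a multiple of
   \<open>a\<close>; division by \<open>a\<close> gives the relation.\<close>
 have x3: "cls C (x 3) \<in> V"
 proof -
  have form: "EX c m. c ~= 0 & peval (lin m) (P i) = 0 & (ALL T. T ~= P i --> peval (lin a) T = 0 --> peval (lin m) T ~= 0) &
   (\<forall>R\<in>C. x i R = inverse c * (peval (lin m) (ph R) / peval (lin a) (ph R)))" if i: "i \<in> ?I" for i
  proof -
   obtain c m where "c ~= 0 & peval (lin m) (P i) = 0 & (ALL T. T ~= P i --> peval (lin a) T = 0 --> peval (lin m) T ~= 0) &
   (\<forall>R\<in>C. sp (pr (P i) (ph Q)) (pr (P i) (ph R)) = c * peval (lin a) (ph R) / peval (lin m) (ph R)) &
   (\<forall>R\<in>C. pr (P i) (ph R) = pr (P i) (ph Q) \<longleftrightarrow> peval (lin a) (ph R) = 0)"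
   using plane_outer.coordinate_forms[OF po[OF i] a(1) aP[OF i] Q aQ] by (elim exE)
   then show ?thesis by (intro exI[of _ c] exI[of _ m]) (simp add: x_def xc_inverse y_def q_def field_simps)
  qed
  obtain c1 m1 where 1: "c1 ~= 0 & peval (lin m1) (P 1) = 0 & (ALL T. T ~= P 1 --> peval (lin a) T = 0 --> peval (lin m1) T ~= 0) &
   (\<forall>R\<in>C. x 1 R = inverse c1 * (peval (lin m1) (ph R) / peval (lin a) (ph R)))" using form[of 1] by auto
  obtain c2 m2 where 2: "c2 ~= 0 & peval (lin m2) (P 2) = 0 & (ALL T. T ~= P 2 --> peval (lin a) T = 0 --> peval (lin m2) T ~= 0) &
   (\<forall>R\<in>C. x 2 R = inverse c2 * (peval (lin m2) (ph R) / peval (lin a) (ph R)))" using form[of 2] by auto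
  obtain c3 m3 where 3: "c3 ~= 0 & peval (lin m3) (P 3) = 0 & (ALL T. T ~= P 3 --> peval (lin a) T = 0 --> peval (lin m3) T ~= 0) &
   (\<forall>R\<in>C. x 3 R = inverse c3 * (peval (lin m3) (ph R) / peval (lin a) (ph R)))" using form[of 3] by auto
  have nz: "peval (lin m1) (P 2) ~= 0" "peval (lin m2) (P 1) ~= 0" using 1 2 neq[of 1 2] aP[of 1] aP[of 2] by auto
  define \<beta> gm where "\<beta> = peval (lin m3) (P 2) / peval (lin m1) (P 2)" and "gm = peval (lin m3) (P 1) / peval (lin m2) (P 1)"
  let ?b = "m3 + (- \<beta>) *s m1 + (- gm) *s m2"
  have eb: "peval (lin ?b) T = peval (lin m3) T - \<beta> * peval (lin m1) T - gm * peval (lin m2) T" for T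
   by (simp add: peval_def sum_3 algebra_simps)
  have "P 1 ~= P 2" by (rule neq) auto
  moreover have "peval (lin ?b) (P 1) = 0" "peval (lin ?b) (P 2) = 0" unfolding eb using 1 2 nz by (simp_all add: \<beta>_def gm_def)
  ultimately obtain \<alpha> where "?b = \<alpha> *s a" using line_coeffs_unique[of "P 1" "P 2" a ?b] a(1) aP[of 1] aP[of 2] by auto
  then have ab: "peval (lin ?b) T = \<alpha> * peval (lin a) T" for T by (simp add: peval_def sum_distrib_left mult.assoc)
  have m3: "peval (lin m3) T = \<alpha> * peval (lin a) T + \<beta> * peval (lin m1) T + gm * peval (lin m2) T" for T
   using ab[of T] unfolding eb by (simp add: algebra_simps)
  have 11: "(1 :: nat) \<in> ?I" by simp
  have "aeg C (%R. x 3 R = combination [\<alpha> / c3, \<beta> * c1 / c3, gm * c2 / c3] ?fs R)"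
   using plane_outer.off_line[OF po[OF 11] a(1) aP[OF 11]] gen_in[OF irrC]
  proof eventually_elim
   case (elim R)
   let ?a = "peval (lin a) (ph R)" and ?m1 = "peval (lin m1) (ph R)" and ?m2 = "peval (lin m2) (ph R)"
   have "x 3 R = inverse c3 * ((\<alpha> * ?a + \<beta> * ?m1 + gm * ?m2) / ?a)" using 3 elim(2) unfolding m3 by blast
   also have "\<dots> = \<alpha> / c3 + \<beta> * c1 / c3 * (inverse c1 * (?m1 / ?a)) + gm * c2 / c3 * (inverse c2 * (?m2 / ?a))"
   proof -
   have "(\<alpha> * ?a + \<beta> * ?m1 + gm * ?m2) / ?a = \<alpha> + \<beta> * (?m1 / ?a) + gm * (?m2 / ?a)"
   using elim(1) by (simp add: add_divide_distrib)
   moreover have "\<beta> * c1 / c3 * (inverse c1 * (?m1 / ?a)) = inverse c3 * (\<beta> * (?m1 / ?a))"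
   "gm * c2 / c3 * (inverse c2 * (?m2 / ?a)) = inverse c3 * (gm * (?m2 / ?a))"
   using 1 2 by (simp_all add: divide_inverse)
   ultimately show ?thesis by (simp only: distrib_left divide_inverse mult.commute[of \<alpha>])
   qed
   also have "\<dots> = \<alpha> / c3 + \<beta> * c1 / c3 * x 1 R + gm * c2 / c3 * x 2 R" using 1 2 elim(2) by simp
   finally show ?case by simp
  qed
  from cls_cong[OF this] show ?thesis unfolding V_def span_set_def by blast
 qed
 have xV: "cls C (x i) \<in> V" if "i \<in> ?I" for i using that Vm x3 by auto
 have sub: "quotient_system C (G i) \<subseteq> linear_system C D V" if i: "i \<in> ?I" for i
  using gal_cover.system_subset[OF gc[OF i] Vp(1) Vm(1), of "y i"] xV[OF i] fd[OF i] by (simp add: x_def[abs_def])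
 have small: "linear_system C D V \<subseteq> \<Lambda>'" if L: "linear_subsystem C D \<Lambda>'" "(\<Union>i\<in>?I. quotient_system C (G i)) \<subseteq> \<Lambda>'" for \<Lambda>'
 proof -
  obtain V' where V': "subalgebra (constants C) V' (FF C)" "\<Lambda>' = linear_system C D V'"
   using L(1) unfolding linear_subsystem_def by blast
  have c: "cls C (%_. 1) \<in> V'" "cls C (x i) \<in> V'" if i: "i \<in> ?I" for i
  proof -
   have "quotient_system C (G i) \<subseteq> linear_system C (gal_cover.fibd C (q i) (y i)) V'"
   using L(2) i unfolding fd[OF i] V'(2) by blast
   from gal_cover.system_contains[OF gc[OF i] V'(1) this]
   show "cls C (%_. 1) \<in> V'" "cls C (x i) \<in> V'" by (simp_all add: x_def[abs_def])
  qed
  have "V \<subseteq> V'"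
  proof
   fix f assume "f \<in> V"
   then obtain cs where f: "f = cls C (combination cs ?fs)" unfolding V_def span_set_def by blast
   show "f \<in> V'" unfolding f
   by (rule combination_mem[OF irrC V'(1)]) (use rfs c[of 1] c[of 2] in auto)
  qed
  then show ?thesis unfolding V'(2) linear_system_def by blast
 qed
 have "length ?fs = 3" by simp
 with Vp(2) have "\<exists>m\<le>3. ring.dimension (FF C) m (constants C) V" by (simp only:)
 then obtain m where "m \<le> 3 & ring.dimension (FF C) m (constants C) V" ..
 note m = this[THEN conjunct1] this[THEN conjunct2]
 \<comment> \<open>The projective dimension is one less than \<open>m\<close>; \<open>V\<close>
   contains the constants, so the subtraction is legitimate.\<close>
 have "m ~= 0"
 proof
  assume "m = 0"
  let ?o = "[%_. 1] :: (('k, 'n) proj => 'k) list"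
  show False
  proof (rule dependent_functions[OF irrC m(2), of ?o])
   show "ratl C f & cls C f \<in> V" if "f \<in> set ?o" for f using that Vm(1) ratl_const[OF irrC] by auto
   show "m < length ?o" using \<open>m = 0\<close> by simp
   fix cs :: "'k list"
   assume cs: "length cs = length ?o" "\<exists>c\<in>set cs. c ~= 0" "aeg C (%R. combination cs ?o R = 0)"
   obtain c where "cs = [c]" using cs(1) by (auto simp: length_Suc_conv)
   with cs(2,3) show False by (simp add: gen_const[OF irrC])
  qed
 qed
 then obtain m' where m': "m = Suc m'" using not0_implies_Suc by blast
 have dim: "has_projective_dim C D (linear_system C D V) m'"
  unfolding has_projective_dim_def by (intro exI[of _ V] conjI Vp(1) VR refl m(2)[unfolded m'])
 have smallest: "smallest_linear_subsystem C D (\<Union>i\<in>?I. quotient_system C (G i)) (linear_system C D V)"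
  unfolding smallest_linear_subsystem_def
 proof (intro conjI allI impI)
  show "linear_subsystem C D (linear_system C D V)"
   unfolding linear_subsystem_def by (intro exI[of _ V] conjI Vp(1) VR refl)
  show "(\<Union>i\<in>?I. quotient_system C (G i)) \<subseteq> linear_system C D V" by (rule UN_least[OF sub])
  show "linear_system C D V \<subseteq> \<Lambda>'" if "linear_subsystem C D \<Lambda>' & (\<Union>i\<in>?I. quotient_system C (G i)) \<subseteq> \<Lambda>'" for \<Lambda>'
   by (rule small[OF that[THEN conjunct1] that[THEN conjunct2]])
 qed
 have m2: "m' \<le> 2" using m(1) m' by simp
 have dD: "is_divisor C D" unfolding D_def by (rule g1.is_divisor_fibd)
 have rq: "rational_quotient C (G i)" if i: "i \<in> ?I" for i
  unfolding rational_quotient_def by (rule exI[of _ "q i"]) (rule gal_cover.geometric_quotient[OF gc[OF i]])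
 have "\<exists>\<Lambda> m. smallest_linear_subsystem C D (\<Union>i\<in>?I. quotient_system C (G i)) \<Lambda> & has_projective_dim C D \<Lambda> m & m \<le> 2"
  by (intro exI[of _ "linear_system C D V"] exI[of _ m'] conjI smallest dim m2)
 then have DD: "is_divisor C D & (\<forall>i\<in>?I. D = (\<Sum>sg\<in>G i. Poly_Mapping.single (sg Q) 1)) &
   (\<exists>\<Lambda> m. smallest_linear_subsystem C D (\<Union>i\<in>?I. quotient_system C (G i)) \<Lambda> & has_projective_dim C D \<Lambda> m & m \<le> 2)"
  by (intro conjI dD ballI orbit)
 have R: "\<forall>i\<in>?I. rational_quotient C (G i)" by (rule ballI[OF rq])
 have T: "\<forall>i\<in>?I. \<forall>j\<in>?I. i ~= j --> G i \<inter> G j = {\<lambda>x\<in>C. x}" by (intro ballI impI triv)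
 show ?thesis by (intro conjI R T exI[of _ D] DD)
qed

theorem theorem2:
  fixes C :: "('k::alg_closed_field, 'n::finite) proj set"
    and G :: "nat \<Rightarrow> (('k, 'n) proj \<Rightarrow> ('k, 'n) proj) set"
    and Q :: "('k, 'n) proj"
  assumes "smooth_projective_curve C"
    and "\<And>i. i \<in> {1, 2, 3} \<Longrightarrow> subgroup (G i) (Aut C)"
    and "\<And>i. i \<in> {1, 2, 3} \<Longrightarrow> finite (G i)"
    and "Q \<in> C"
  shows
    "(\<forall>i\<in>{1, 2, 3}. rational_quotient C (G i)) \<and>
     (\<forall>i\<in>{1, 2, 3}. \<forall>j\<in>{1, 2, 3}. i \<noteq> j \<longrightarrow> G i \<inter> G j = {\<one>\<^bsub>Aut C\<^esub>}) \<and>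
     (\<exists>D. is_divisor C D \<and>
        (\<forall>i\<in>{1, 2, 3}. D = (\<Sum>\<sigma>\<in>G i. Poly_Mapping.single (\<sigma> Q) 1)) \<and>
        (\<exists>\<Lambda> m. smallest_linear_subsystem C D (\<Union>i\<in>{1, 2, 3}. quotient_system C (G i)) \<Lambda> \<and>
           has_projective_dim C D \<Lambda> m \<and> m \<le> 2))
     \<longleftrightarrow>
     (\<exists>(\<phi> :: ('k, 'n) proj \<Rightarrow> ('k, 3) proj) (P :: nat \<Rightarrow> ('k, 3) proj).
        birational_embedding C \<phi> \<and> has_degree (\<phi> ` C) (card (G 1)) \<and>
        inj_on P {1, 2, 3} \<and> collinear_points (P ` {1, 2, 3}) \<and>
        (\<forall>i\<in>{1, 2, 3}. outer_galois_point (\<phi> ` C) (P i) \<and> galois_group_at C \<phi> (P i) = G i) \<and>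
        \<phi> Q \<in> line_through (P 1) (P 2))"
proof -
  let ?I = "{1, 2, 3} :: nat set"
  have irrC: "irr C" and closedC: "closedin zariski C"
    using assms(1) unfolding smooth_projective_curve_def by (auto intro: irreducible_imp_irr)
  have uexC: "\<exists>t. unif C R t" if R: "R \<in> C" for R
  proof -
    obtain T where "uniformizer C R T" using assms(1) R unfolding smooth_projective_curve_def by blast
    then obtain t where "unif C R t" by (rule uniformizerE[OF irrC R])
    then show ?thesis by (intro exI[of _ t])
  qed
  have ag: "aut_group C (G i)" if "i \<in> ?I" for i by (rule aut_groupI[OF irrC assms(2,3)[OF that]])
  show ?thesis
  proof (rule iffI, goal_cases)
    case 1
    have rq: "rational_quotient C (G i)" if "i \<in> ?I" for i using 1[THEN conjunct1] that by (rule bspec)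
    have "\<forall>i\<in>?I. \<exists>q. gal_cover C (G i) q"
    proof
      fix i assume i: "i \<in> ?I"
      obtain q where "geometric_quotient C (G i) (UNIV :: ('k, 2) proj set) q" using rq[OF i] unfolding rational_quotient_def ..
      from geometric_quotient_gal_cover[OF ag[OF i] uexC this] show "\<exists>q. gal_cover C (G i) q" by (intro exI[of _ q])
    qed
    from bchoice[OF this] obtain q where q: "\<forall>i\<in>?I. gal_cover C (G i) (q i)" ..
    have triv: "G i \<inter> G j = {\<lambda>x\<in>C. x}" if "i \<in> ?I" "j \<in> ?I" "i \<noteq> j" for i j
      using 1[THEN conjunct2, THEN conjunct1] that unfolding Aut_one by blast
    obtain D \<Lambda> m where D: "\<forall>i\<in>?I. D = (\<Sum>\<sigma>\<in>G i. Poly_Mapping.single (\<sigma> Q) 1)"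
      and L: "smallest_linear_subsystem C D (\<Union>i\<in>?I. quotient_system C (G i)) \<Lambda>" "has_projective_dim C D \<Lambda> m" "m \<le> 2"
      using 1[THEN conjunct2, THEN conjunct2] by blast
    have sub: "quotient_system C (G i) \<subseteq> \<Lambda>" if "i \<in> ?I" for i
      using L(1) that unfolding smallest_linear_subsystem_def by blast
    show ?case
      by (rule galois_points_of_quotients[OF irrC q[rule_format] assms(4) triv D[rule_format] sub L(2,3)])
  next
    case 2
    then obtain \<phi> :: "('k, 'n) proj \<Rightarrow> ('k, 3) proj" and P :: "nat \<Rightarrow> ('k, 3) proj"
      where b: "birational_embedding C \<phi>" "has_degree (\<phi> ` C) (card (G 1))"
        "inj_on P ?I" "collinear_points (P ` ?I)"
        and g: "\<forall>i\<in>?I. outer_galois_point (\<phi> ` C) (P i) \<and> galois_group_at C \<phi> (P i) = G i"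
        and l: "\<phi> Q \<in> line_through (P 1) (P 2)" by (elim exE conjE)
    show ?case unfolding Aut_one
      by (rule quotients_of_galois_points[where G = G and P = P and Q = Q and C = C and ph = \<phi>, OF irrC closedC uexC ag assms(4) b _ _ l]) (use g in blast)+
  qed
qed

end
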